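(* Let $V$ and $W$ be Banach spaces, let $T>0$, let $\alpha\in(\frac13,\frac12]$, and let $\mathbf{X}=(X,\mathbb{X})\in\mathscr{C}^{\alpha}([0,T],V)$ be a rough path. Let $f_0:W\to W$ be Lipschitz continuous and let $f:W\to L(V,W)$ be of class $C_b^3$. Let $\mathcal{M}$ be a finite dimensional $C^3$-submanifold of $W$. Assume that $X$ is truly rough and that there is a symmetric element $x\in V\otimes V$ with $[\mathbf{X}]_t=x\,t$ for all $t\in[0,T]$. Then the following statements are equivalent: (i) $\mathcal{M}$ is locally invariant for the rough differential equation $dY_t=f_0(Y_t)\,dt+f(Y_t)\,d\mathbf{X}_t$, $Y_0=\xi$. (ii) For each $y\in\mathcal{M}$ we have $$f_0(y)-\tfrac12\,Df(y)f(y)\,x\in T_y\mathcal{M},\qquad\text{and}\qquad f(y)v\in T_y\mathcal{M}\ \text{ for all } v\in V.$$ Moreover, if the equivalent statements (i) and (ii) are fulfilled and $\mathcal{M}$ is closed as a subset of $W$, then $\mathcal{M}$ is globally invariant for this rough differential equation.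
   Context: Notation: $L(V,W)$ is the space of bounded linear operators. For a path $X$ write $X_{s,t}=X_t-X_s$. $C_b^k$ denotes $k$ times continuously Fréchet differentiable mappings which are bounded together with their derivatives up to order $k$. $\mathcal{C}^{\alpha}([0,T],W)$ is the space of $\alpha$-Hölder continuous paths. $V\otimes V$ is a completed tensor product with a symmetric cross-norm for which the canonical injection $L(V,L(V,W))\hookrightarrow L(V\otimes V,W)$, $A\mapsto(v\otimes w\mapsto (Av)w)$, holds (e.g. the projective tensor product). Rough paths: $\mathscr{C}^{\alpha}([0,T],V)$ is the set of pairs $(X,\mathbb{X})$ with $X\in\mathcal{C}^{\alpha}([0,T],V)$ and $\mathbb{X}:[0,T]^2\to V\otimes V$ satisfying $\sup_{s\ne t}|\mathbb{X}_{s,t}|/|t-s|^{2\alpha}<\infty$ and Chen's relation $\mathbb{X}_{s,t}-\mathbb{X}_{s,u}-\mathbb{X}_{u,t}=X_{s,u}\otimes X_{u,t}$. The bracket is $[\mathbf{X}]_{s,t}:=X_{s,t}\otimes X_{s,t}-2\,\mathrm{Sym}(\mathbb{X}_{s,t})$, and $[\mathbf{X}]_t:=[\mathbf{X}]_{0,t}$. Truly rough: $X\in\mathcal{C}^{\alpha}([0,T],V)$ is truly rough if there is a dense subset $D\subset[0,T)$ such that $\limsup_{t\downarrow s}|\langle v,X_{s,t}\rangle|/|t-s|^{2\alpha}=\infty$ for all $s\in D$ and all $v\in V^*\setminus\{0\}$. Controlled rough paths: $\mathscr{D}_X^{2\alpha}([0,T],W)$ is the space of pairs $(Y,Y')$ with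 $Y\in\mathcal{C}^{\alpha}([0,T],W)$, $Y'\in\mathcal{C}^{\alpha}([0,T],L(V,W))$ and $\sup_{s\neq t}|Y_{s,t}-Y'_sX_{s,t}|/|t-s|^{2\alpha}<\infty$. For $(Y,Y')\in\mathscr{D}_X^{2\alpha}([0,T],L(V,W))$ the rough integral over $[0,t]$ is $\int_0^tY_s\,d\mathbf{X}_s=\lim_{|\Pi|\to0}\sum_{[u,v]\in\Pi}(Y_uX_{u,v}+Y'_u\mathbb{X}_{u,v})$, the limit being over partitions $\Pi$ of $[0,t]$ with mesh tending to $0$. For $(Y,Y')\in\mathscr{D}_X^{2\alpha}([0,T],W)$ the path $f(Y)$ is controlled with Gubinelli derivative $f(Y)'_t=Df(Y_t)Y'_t$. Solutions: a solution of the equation with $Y_0=\xi$ is $(Y,Y')\in\mathscr{D}_X^{2\alpha}([0,T],W)$ with $Y'=f(Y)$ and $Y_t=\xi+\int_0^tf_0(Y_s)\,ds+\int_0^tf(Y_s)\,d\mathbf{X}_s$ for $t\in[0,T]$. Under the stated assumptions on $f_0,f$ it is known that for every $\xi\in W$ there is a unique solution on $[0,T]$. Invariance: $\mathcal{M}$ is locally invariant if for each $\xi\in\mathcal{M}$ there is $T_0\in(0,T]$ such that the solution $Y$ with $Y_0=\xi$ satisfies $Y_t\in\mathcal{M}$ for all $t\in[0,T_0]$; it is globally invariant if for each $\xi\in\mathcal{M}$ this holds for all $t\in[0,T]$. Submanifolds: $\mathcal{M}\subset W$ is an $m$-dimensional $C^k$-submanifold ($m,k\ge1$) if for every $y\in\mathcal{M}$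 there are an open neighborhood $U\subset W$ of $y$, an open set $O\subset\mathbb{R}^m$ and $\phi\in C^k(O,W)$ such that $\phi:O\to U\cap\mathcal{M}$ is a homeomorphism and $D\phi(z)\in L(\mathbb{R}^m,W)$ is one-to-one for all $z\in O$. The tangent space is $T_y\mathcal{M}:=D\phi(z)\mathbb{R}^m$ with $z=\phi^{-1}(y)$ (independent of the choice of $\phi$). The term $Df(y)f(y)$: $Df(y)f(y)\in L(V,L(V,W))\hookrightarrow L(V\otimes V,W)$ is determined by $Df(y)f(y)(v\otimes w)=\big(Df(y)[f(y)v]\big)w$, and $Df(y)f(y)x\in W$ is its value at $x$. *)

theory Defs
  imports "HOL-Analysis.Analysis"
begin

section \<open>Completed tensor products\<close>

text \<open>
  A Banach space \<open>'t\<close> is a completed tensor product of \<open>'v\<close> with itself if it contains the algebraic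
  tensor product as a dense subspace and its norm is a symmetric cross-norm.
  Assumption \<open>alg\<close> is the universal property of the algebraic tensor product: since
  the linear functional need only exist, and any linear functional on the span of the elementary
  tensors extends linearly to \<open>'t\<close>, it says that the canonical linear map from the algebraic tensor
  product to \<open>'t\<close> is injective. The form \<open>b\<close> there is not required to be bounded.
\<close>

locale completed_tensor_product =
  fixes tensor :: "'v::banach \<Rightarrow> 'v \<Rightarrow> 't::banach"
  assumes bilin: "bilinear tensor"
    and alg: "\<And>b :: 'v \<Rightarrow> 'v \<Rightarrow> real. bilinear b \<Longrightarrow>
      \<exists>l :: 't \<Rightarrow> real. linear l \<and> (\<forall>v w. l (tensor v w) = b v w)"
    and dense: "closure (span (range (\<lambda>(v, w). tensor v w))) = UNIV"
    and cross_norm: "\<And>v w. norm (tensor v w) = norm v * norm w"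
    and symmetric_norm: "\<exists>F :: 't \<Rightarrow> 't. bounded_linear F \<and>
      (\<forall>v w. F (tensor v w) = tensor w v) \<and> (\<forall>x. norm (F x) = norm x)"

definition tensor_flip :: "('v::banach \<Rightarrow> 'v \<Rightarrow> 't::banach) \<Rightarrow> 't \<Rightarrow> 't" where
  "tensor_flip tensor =
     (THE F. bounded_linear F \<and> (\<forall>v w. F (tensor v w) = tensor w v))"

definition tensor_Sym :: "('v::banach \<Rightarrow> 'v \<Rightarrow> 't::banach) \<Rightarrow> 't \<Rightarrow> 't" where
  "tensor_Sym tensor x = (1/2) *\<^sub>R (x + tensor_flip tensor x)"

definition symmetric_tensor :: "('v::banach \<Rightarrow> 'v \<Rightarrow> 't::banach) \<Rightarrow> 't \<Rightarrow> bool" where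
  "symmetric_tensor tensor x \<longleftrightarrow> tensor_flip tensor x = x"

text \<open>
  The canonical injection of \<open>L(V, L(V, W))\<close> into \<open>L(V \<otimes> V, W)\<close>. The image of \<open>A\<close> is unique by density
  of the elementary tensors, and the resulting linear map is bounded by the closed graph theorem.
\<close>

definition has_canonical_injection ::
    "('v::banach \<Rightarrow> 'v \<Rightarrow> 't::banach) \<Rightarrow> 'w::banach itself \<Rightarrow> bool" where
  "has_canonical_injection tensor (_ :: 'w itself) \<longleftrightarrow>
     (\<forall>A :: 'v \<Rightarrow>\<^sub>L 'v \<Rightarrow>\<^sub>L 'w. \<exists>B :: 't \<Rightarrow>\<^sub>L 'w.
        \<forall>v w. blinfun_apply B (tensor v w) = blinfun_apply (blinfun_apply A v) w)"

definition tensor_lift ::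
    "('v::banach \<Rightarrow> 'v \<Rightarrow> 't::banach) \<Rightarrow> ('v \<Rightarrow>\<^sub>L 'v \<Rightarrow>\<^sub>L 'w::banach) \<Rightarrow> 't \<Rightarrow>\<^sub>L 'w" where
  "tensor_lift tensor A =
     (THE B. \<forall>v w. blinfun_apply B (tensor v w) = blinfun_apply (blinfun_apply A v) w)"

context completed_tensor_product
begin

lemma bounded_linear_eq_on_tensors:
  fixes F G :: "'t \<Rightarrow> 'b::real_normed_vector"
  assumes F: "bounded_linear F" and G: "bounded_linear G"
    and eq: "\<And>v w. F (tensor v w) = G (tensor v w)"
  shows "F = G"
proof
  fix x
  have span: "F y = G y" if "y \<in> span (range (\<lambda>(v, w). tensor v w))" for y
  proof (rule linear_eq_on_span[OF bounded_linear.linear[OF F] bounded_linear.linear[OF G] _ that])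
    fix z assume "z \<in> range (\<lambda>(v, w). tensor v w)"
    then show "F z = G z" by (auto simp: eq)
  qed
  have "closed {y. F y = G y}"
    by (intro closed_Collect_eq linear_continuous_on F G)
  then have "closure (span (range (\<lambda>(v, w). tensor v w))) \<subseteq> {y. F y = G y}"
    by (intro closure_minimal) (auto simp: span)
  then show "F x = G x" using dense by auto
qed

lemma tensor_flip_unique:
  assumes "bounded_linear F" "\<And>v w. F (tensor v w) = tensor w v"
  shows "tensor_flip tensor = F"
  unfolding tensor_flip_def
proof (rule the_equality)
  show "bounded_linear F \<and> (\<forall>v w. F (tensor v w) = tensor w v)"
    using assms by simp
next
  fix G assume "bounded_linear G \<and> (\<forall>v w. G (tensor v w) = tensor w v)"
  then show "G = F"
    using assms by (intro bounded_linear_eq_on_tensors) simp_all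
qed

lemma tensor_flip:
  "bounded_linear (tensor_flip tensor)"
  "tensor_flip tensor (tensor v w) = tensor w v"
  "norm (tensor_flip tensor x) = norm x"
proof -
  obtain F where F: "bounded_linear F" "\<And>v w. F (tensor v w) = tensor w v" "\<And>x. norm (F x) = norm x"
    using symmetric_norm by blast
  have "tensor_flip tensor = F"
    by (rule tensor_flip_unique[OF F(1,2)])
  then show "bounded_linear (tensor_flip tensor)"
    "tensor_flip tensor (tensor v w) = tensor w v"
    "norm (tensor_flip tensor x) = norm x"
    by (simp_all add: F)
qed

lemma tensor_lift:
  fixes A :: "'v \<Rightarrow>\<^sub>L 'v \<Rightarrow>\<^sub>L 'w::banach"
  assumes "has_canonical_injection tensor TYPE('w)"
  shows "blinfun_apply (tensor_lift tensor A) (tensor v w) = blinfun_apply (blinfun_apply A v) w"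
proof -
  let ?P = "\<lambda>B :: 't \<Rightarrow>\<^sub>L 'w.
    \<forall>v w. blinfun_apply B (tensor v w) = blinfun_apply (blinfun_apply A v) w"
  obtain B where B: "?P B"
    using assms unfolding has_canonical_injection_def by blast
  have uniq: "C = B" if C: "?P C" for C
  proof -
    have "blinfun_apply C = blinfun_apply B"
      by (rule bounded_linear_eq_on_tensors[OF blinfun.bounded_linear_right blinfun.bounded_linear_right])
        (simp only: C B)
    then show ?thesis by (simp only: blinfun_apply_inject)
  qed
  have "tensor_lift tensor A = B"
    unfolding tensor_lift_def by (rule the_equality[of ?P, OF B uniq])
  then show ?thesis using B by simp
qed

end


section \<open>Differentiability\<close>

text \<open>The higher derivatives are iterated derivatives, with values in nested operator spaces.\<close>

definition C3_on ::
    "'a::real_normed_vector set \<Rightarrow> ('a \<Rightarrow> 'b::real_normed_vector) \<Rightarrow> bool" where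
  "C3_on S g \<longleftrightarrow>
     (\<exists>(g1 :: 'a \<Rightarrow> 'a \<Rightarrow>\<^sub>L 'b) (g2 :: 'a \<Rightarrow> 'a \<Rightarrow>\<^sub>L 'a \<Rightarrow>\<^sub>L 'b) (g3 :: 'a \<Rightarrow> 'a \<Rightarrow>\<^sub>L 'a \<Rightarrow>\<^sub>L 'a \<Rightarrow>\<^sub>L 'b).
        (\<forall>x\<in>S. (g has_derivative blinfun_apply (g1 x)) (at x) \<and>
                (g1 has_derivative blinfun_apply (g2 x)) (at x) \<and>
                (g2 has_derivative blinfun_apply (g3 x)) (at x)) \<and>
        continuous_on S g3)"

definition Cb3 :: "('a::real_normed_vector \<Rightarrow> 'b::real_normed_vector) \<Rightarrow> bool" where
  "Cb3 g \<longleftrightarrow>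
     (\<exists>(g1 :: 'a \<Rightarrow> 'a \<Rightarrow>\<^sub>L 'b) (g2 :: 'a \<Rightarrow> 'a \<Rightarrow>\<^sub>L 'a \<Rightarrow>\<^sub>L 'b) (g3 :: 'a \<Rightarrow> 'a \<Rightarrow>\<^sub>L 'a \<Rightarrow>\<^sub>L 'a \<Rightarrow>\<^sub>L 'b).
        (\<forall>x. (g has_derivative blinfun_apply (g1 x)) (at x) \<and>
              (g1 has_derivative blinfun_apply (g2 x)) (at x) \<and>
              (g2 has_derivative blinfun_apply (g3 x)) (at x)) \<and>
        continuous_on UNIV g3 \<and>
        bounded (range g) \<and> bounded (range g1) \<and> bounded (range g2) \<and> bounded (range g3))"

definition Frechet_D ::
    "('a::real_normed_vector \<Rightarrow> 'b::real_normed_vector) \<Rightarrow> 'a \<Rightarrow> 'a \<Rightarrow>\<^sub>L 'b" where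
  "Frechet_D g x = Blinfun (frechet_derivative g (at x))"

lemma Frechet_D_eq:
  assumes "(g has_derivative blinfun_apply A) (at x)"
  shows "Frechet_D g x = A"
  unfolding Frechet_D_def using frechet_derivative_at[OF assms]
  by (metis blinfun_apply_inverse)


section \<open>Rough paths and controlled paths\<close>

text \<open>Paths are total functions on the reals of which only the values on \<open>[0,T]\<close> are used.\<close>

definition holder_path :: "real \<Rightarrow> real \<Rightarrow> (real \<Rightarrow> 'a::real_normed_vector) \<Rightarrow> bool" where
  "holder_path \<alpha> T X \<longleftrightarrow>
     (\<exists>C. \<forall>s\<in>{0..T}. \<forall>t\<in>{0..T}. s \<noteq> t \<longrightarrow> norm (X t - X s) / \<bar>t - s\<bar> powr \<alpha> \<le> C)"

definition rough_path ::
    "('v::banach \<Rightarrow> 'v \<Rightarrow> 't::banach) \<Rightarrow> real \<Rightarrow> real \<Rightarrow> (real \<Rightarrow> 'v) \<Rightarrow> (real \<Rightarrow> real \<Rightarrow> 't) \<Rightarrow> bool"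
  where
  "rough_path tensor \<alpha> T X XX \<longleftrightarrow>
     holder_path \<alpha> T X \<and>
     (\<exists>C. \<forall>s\<in>{0..T}. \<forall>t\<in>{0..T}. s \<noteq> t \<longrightarrow> norm (XX s t) / \<bar>t - s\<bar> powr (2 * \<alpha>) \<le> C) \<and>
     (\<forall>s\<in>{0..T}. \<forall>u\<in>{0..T}. \<forall>t\<in>{0..T}.
        XX s t - XX s u - XX u t = tensor (X u - X s) (X t - X u))"

definition rough_bracket ::
    "('v::banach \<Rightarrow> 'v \<Rightarrow> 't::banach) \<Rightarrow> (real \<Rightarrow> 'v) \<Rightarrow> (real \<Rightarrow> real \<Rightarrow> 't) \<Rightarrow> real \<Rightarrow> real \<Rightarrow> 't"
  where
  "rough_bracket tensor X XX s t =
     tensor (X t - X s) (X t - X s) - 2 *\<^sub>R tensor_Sym tensor (XX s t)"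

definition truly_rough :: "real \<Rightarrow> real \<Rightarrow> (real \<Rightarrow> 'v::real_normed_vector) \<Rightarrow> bool" where
  "truly_rough \<alpha> T X \<longleftrightarrow>
     holder_path \<alpha> T X \<and>
     (\<exists>D. D \<subseteq> {0..<T} \<and> {0..<T} \<subseteq> closure D \<and>
        (\<forall>s\<in>D. \<forall>v :: 'v \<Rightarrow>\<^sub>L real. v \<noteq> 0 \<longrightarrow>
           Limsup (at_right s)
             (\<lambda>t. ereal (\<bar>blinfun_apply v (X t - X s)\<bar> / \<bar>t - s\<bar> powr (2 * \<alpha>))) = \<infinity>))"

definition controlled_path ::
    "real \<Rightarrow> real \<Rightarrow> (real \<Rightarrow> 'v::banach) \<Rightarrow> (real \<Rightarrow> 'w::banach) \<Rightarrow> (real \<Rightarrow> 'v \<Rightarrow>\<^sub>L 'w) \<Rightarrow> bool" where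
  "controlled_path \<alpha> T X Y Y' \<longleftrightarrow>
     holder_path \<alpha> T Y \<and> holder_path \<alpha> T Y' \<and>
     (\<exists>C. \<forall>s\<in>{0..T}. \<forall>t\<in>{0..T}. s \<noteq> t \<longrightarrow>
        norm (Y t - Y s - blinfun_apply (Y' s) (X t - X s)) / \<bar>t - s\<bar> powr (2 * \<alpha>) \<le> C)"


section \<open>Rough integrals and rough differential equations\<close>

text \<open>
  A partition of \<open>[0,t]\<close> is a strictly increasing finite sequence \<open>p 0, \<dots>, p n\<close> from \<open>0\<close> to \<open>t\<close>
  (so \<open>n = 0\<close>, and the sum is empty, if \<open>t = 0\<close>).
\<close>

definition has_rough_integral ::
    "('v::banach \<Rightarrow> 'v \<Rightarrow> 't::banach) \<Rightarrow> (real \<Rightarrow> 'v) \<Rightarrow> (real \<Rightarrow> real \<Rightarrow> 't) \<Rightarrow>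
     (real \<Rightarrow> 'v \<Rightarrow>\<^sub>L 'w::banach) \<Rightarrow> (real \<Rightarrow> 'v \<Rightarrow>\<^sub>L 'v \<Rightarrow>\<^sub>L 'w) \<Rightarrow> real \<Rightarrow> 'w \<Rightarrow> bool" where
  "has_rough_integral tensor X XX Y Y' t I \<longleftrightarrow>
     (\<forall>\<epsilon>>0. \<exists>\<delta>>0. \<forall>(n::nat) (p :: nat \<Rightarrow> real).
        p 0 = 0 \<and> p n = t \<and> (\<forall>i<n. p i < p (Suc i) \<and> p (Suc i) - p i < \<delta>) \<longrightarrow>
        norm ((\<Sum>i<n. blinfun_apply (Y (p i)) (X (p (Suc i)) - X (p i)) +
                      blinfun_apply (tensor_lift tensor (Y' (p i))) (XX (p i) (p (Suc i)))) - I)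
          < \<epsilon>)"

text \<open>The Gubinelli derivative of \<open>f(Y)\<close> is the composition \<open>Df(Y) Y'\<close>.\<close>

definition rde_solution ::
    "('v::banach \<Rightarrow> 'v \<Rightarrow> 't::banach) \<Rightarrow> real \<Rightarrow> real \<Rightarrow> (real \<Rightarrow> 'v) \<Rightarrow> (real \<Rightarrow> real \<Rightarrow> 't) \<Rightarrow>
     ('w::banach \<Rightarrow> 'w) \<Rightarrow> ('w \<Rightarrow> 'v \<Rightarrow>\<^sub>L 'w) \<Rightarrow> 'w \<Rightarrow> (real \<Rightarrow> 'w) \<Rightarrow> (real \<Rightarrow> 'v \<Rightarrow>\<^sub>L 'w) \<Rightarrow> bool" where
  "rde_solution tensor \<alpha> T X XX f0 f \<xi> Y Y' \<longleftrightarrow>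
     controlled_path \<alpha> T X Y Y' \<and>
     (\<forall>t\<in>{0..T}. Y' t = f (Y t)) \<and>
     (\<forall>t\<in>{0..T}. \<exists>I.
        has_rough_integral tensor X XX
          (\<lambda>s. f (Y s)) (\<lambda>s. Frechet_D f (Y s) o\<^sub>L Y' s) t I \<and>
        Y t = \<xi> + integral {0..t} (\<lambda>s. f0 (Y s)) + I)"

text \<open>
  Under the standing assumptions the solution started at \<open>\<xi>\<close> exists and is unique on \<open>[0,T]\<close>.
  A property of ``the solution'' is rendered as: a solution exists, and every solution has the
  property.
\<close>

definition locally_invariant ::
    "('v::banach \<Rightarrow> 'v \<Rightarrow> 't::banach) \<Rightarrow> real \<Rightarrow> real \<Rightarrow> (real \<Rightarrow> 'v) \<Rightarrow> (real \<Rightarrow> real \<Rightarrow> 't) \<Rightarrow>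
     ('w::banach \<Rightarrow> 'w) \<Rightarrow> ('w \<Rightarrow> 'v \<Rightarrow>\<^sub>L 'w) \<Rightarrow> 'w set \<Rightarrow> bool" where
  "locally_invariant tensor \<alpha> T X XX f0 f M \<longleftrightarrow>
     (\<forall>\<xi>\<in>M. \<exists>T0\<in>{0<..T}.
        (\<exists>Y Y'. rde_solution tensor \<alpha> T X XX f0 f \<xi> Y Y') \<and>
        (\<forall>Y Y'. rde_solution tensor \<alpha> T X XX f0 f \<xi> Y Y' \<longrightarrow> (\<forall>t\<in>{0..T0}. Y t \<in> M)))"

definition globally_invariant ::
    "('v::banach \<Rightarrow> 'v \<Rightarrow> 't::banach) \<Rightarrow> real \<Rightarrow> real \<Rightarrow> (real \<Rightarrow> 'v) \<Rightarrow> (real \<Rightarrow> real \<Rightarrow> 't) \<Rightarrow>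
     ('w::banach \<Rightarrow> 'w) \<Rightarrow> ('w \<Rightarrow> 'v \<Rightarrow>\<^sub>L 'w) \<Rightarrow> 'w set \<Rightarrow> bool" where
  "globally_invariant tensor \<alpha> T X XX f0 f M \<longleftrightarrow>
     (\<forall>\<xi>\<in>M.
        (\<exists>Y Y'. rde_solution tensor \<alpha> T X XX f0 f \<xi> Y Y') \<and>
        (\<forall>Y Y'. rde_solution tensor \<alpha> T X XX f0 f \<xi> Y Y' \<longrightarrow> (\<forall>t\<in>{0..T}. Y t \<in> M)))"


section \<open>Finite dimensional submanifolds\<close>

text \<open>The dimension is \<open>m = CARD('m)\<close>, which is at least one since types are nonempty.\<close>

definition local_parametrization ::
    "'w::banach set \<Rightarrow> 'w \<Rightarrow> 'w set \<Rightarrow> (real ^ 'm::finite) set \<Rightarrow> (real ^ 'm \<Rightarrow> 'w) \<Rightarrow> bool" where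
  "local_parametrization M y U S \<phi> \<longleftrightarrow>
     open U \<and> y \<in> U \<and> open S \<and> C3_on S \<phi> \<and>
     (\<exists>\<psi>. homeomorphism S (U \<inter> M) \<phi> \<psi>) \<and>
     (\<forall>z\<in>S. inj (frechet_derivative \<phi> (at z)))"

definition C3_submanifold :: "'m::finite itself \<Rightarrow> 'w::banach set \<Rightarrow> bool" where
  "C3_submanifold (_ :: 'm itself) M \<longleftrightarrow>
     (\<forall>y\<in>M. \<exists>U S (\<phi> :: real ^ 'm \<Rightarrow> 'w). local_parametrization M y U S \<phi>)"

text \<open>
  The space \<open>D\<phi>(z) \<real>\<^sup>m\<close> with \<open>\<phi> z = y\<close> does not depend on the local parametrization \<open>\<phi>\<close> around \<open>y\<close>,
  so the union over all of them is this common space.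
\<close>

definition tangent_space :: "'m::finite itself \<Rightarrow> 'w::banach set \<Rightarrow> 'w \<Rightarrow> 'w set" where
  "tangent_space (_ :: 'm itself) M y =
     {frechet_derivative \<phi> (at z) h | U S (\<phi> :: real ^ 'm \<Rightarrow> 'w) z h.
        local_parametrization M y U S \<phi> \<and> z \<in> S \<and> \<phi> z = y}"

end

theory Submission
  imports Defs
begin

text \<open>
  The Euler step of second order,
  \<open>E s t y = y + f(y) X\<^bsub>s,t\<^esub> + (Df(y) f(y)) XX\<^bsub>s,t\<^esub> + (t - s) f0(y)\<close>,
  governs everything. A path solves the equation if and only if \<open>Y t - E s t (Y s)\<close> is of order
  \<open>(t - s) powr (3 * \<alpha>)\<close> (\<open>davie_solution_if_rde_solution\<close>, \<open>rde_solution_if_davie_solution\<close>), and because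
  \<open>3 * \<alpha> > 1\<close> such local statements determine the path: two discrete paths that follow \<open>E\<close> on a grid of
  mesh \<open>h\<close> up to an error of order \<open>h powr (3 * \<alpha>)\<close> per step, and that start at the same point, stay
  within a positive power of \<open>h\<close> of each other (\<open>grid_path_stability\<close>). This one estimate yields
  uniqueness, existence (the Euler schemes on dyadic grids form a Cauchy sequence), and the
  convergence of every consistent scheme, in particular of a scheme that never leaves \<open>M\<close>.
  
  The geometry enters as follows. Let \<open>\<phi>\<close> parametrise \<open>M\<close> near \<open>y = \<phi> z\<close>, and let \<open>n\<close> be a bounded projection
  whose kernel is the tangent space at \<open>y\<close>. If \<open>f\<close> is tangent to \<open>M\<close>, write \<open>f(y) v = D\<phi>(z) (a v)\<close>.
  Differentiating this relation along \<open>M\<close> in the direction \<open>f(y) u\<close> gives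
  \<open>n ((Df(y) f(y) u) v) = n (D\<^sup>2\<phi>(z) (a u) (a v))\<close> (\<open>second_order_tangency\<close>). The right hand side is
  symmetric in \<open>u\<close> and \<open>v\<close>, so \<open>n\<close> sees only the symmetric part of \<open>XX\<close>, and the bracket condition
  says that this part is half of \<open>X \<otimes> X - (t - s) x\<close>. Therefore the normal part of the
  Euler increment (\<open>normal_euler_increment\<close>) is
  \<open>1/2 n (D\<^sup>2\<phi>(z) (a X) (a X)) + (t - s) n (f0(y) - 1/2 (Df(y) f(y)) x)\<close>.
  The first summand is what the curvature of \<open>M\<close> imposes on any path in \<open>M\<close> with tangential increment
  \<open>a X\<close>, so staying in \<open>M\<close> up to \<open>(t - s) powr (3 * \<alpha>)\<close> means precisely that the second one vanishes.
  
  In the direction from (i) to (ii), the tangency of \<open>f\<close> comes first. Normal increments of a path in \<open>M\<close>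
  are quadratic, hence \<open>n (f(Y\<^sub>s) X\<^bsub>s,t\<^esub>)\<close> is of order \<open>(t - s) powr (2 * \<alpha>)\<close>; at a time at which \<open>X\<close> is truly
  rough, a functional that detects \<open>n (f(Y\<^sub>s) v) \<noteq> 0\<close> would contradict this. Such times accumulate at \<open>0\<close>,
  and tangency passes to the limit. Then the expansion above at time \<open>0\<close> gives the drift
  condition. In the other direction, the Euler increment is corrected in the chart so that the scheme
  stays in \<open>M\<close> with an error of order \<open>h powr (3 * \<alpha>)\<close> per step; stability shows that the scheme converges
  to the solution (\<open>local_invariance_in_chart\<close>). If \<open>M\<close> is closed, the first exit time is itself a time in
  \<open>M\<close>, from which the solution can be continued in \<open>M\<close>.
\<close>

section \<open>Hahn-Banach, left inverses and uniform boundedness\<close>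

definition sublinear :: "('a::real_vector \<Rightarrow> real) \<Rightarrow> bool" where
  "sublinear p \<longleftrightarrow> (\<forall>x y. p (x + y) \<le> p x + p y) \<and> (\<forall>c>0. \<forall>x. p (c *\<^sub>R x) \<le> c * p x)"

lemma sublinear_zero:
  assumes "sublinear p"
  shows "p 0 = 0"
proof -
  have "p (2 *\<^sub>R 0) \<le> 2 * p 0" "p ((1/2) *\<^sub>R 0) \<le> (1/2) * p 0"
    using assms unfolding sublinear_def by (metis zero_less_numeral, metis half_gt_zero zero_less_one)
  then show ?thesis by simp
qed

lemma sublinear_minus:
  assumes "sublinear p"
  shows "- p (- x) \<le> p x"
proof -
  have "p (x + - x) \<le> p x + p (- x)" using assms unfolding sublinear_def by blast
  then show ?thesis using sublinear_zero[OF assms] by simp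
qed

text \<open>
  Lowering a sublinear functional as far as a linear one on a cone permits. With a subspace for \<open>C\<close>
  this forces every linear minorant to extend \<open>l\<close>; with a ray it shows that minimal sublinear functionals
  are additive. Both uses together make up the Hahn-Banach theorem.
\<close>

lemma sublinear_inf_convolution:
  fixes D :: "'b::real_vector \<Rightarrow> 'a::real_vector"
  assumes p: "sublinear p" and D: "linear D" and l: "linear l"
    and C0: "0 \<in> C" and Cadd: "\<And>h k. h \<in> C \<Longrightarrow> k \<in> C \<Longrightarrow> h + k \<in> C"
    and Cscale: "\<And>c h. 0 < c \<Longrightarrow> h \<in> C \<Longrightarrow> c *\<^sub>R h \<in> C"
    and dom: "\<And>h. h \<in> C \<Longrightarrow> l h \<le> p (D h)"
  obtains q where "sublinear q" "\<And>x. q x \<le> p x" "\<And>x h. h \<in> C \<Longrightarrow> q x \<le> p (x + D h) - l h"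
proof -
  define q where "q x = (INF h\<in>C. p (x + D h) - l h)" for x
  have lower: "- p (- x) \<le> p (x + D h) - l h" if "h \<in> C" for x h
  proof -
    have "p (- x + (x + D h)) \<le> p (- x) + p (x + D h)" using p unfolding sublinear_def by blast
    then show ?thesis using dom[OF that] by simp
  qed
  then have bdd: "bdd_below ((\<lambda>h. p (x + D h) - l h) ` C)" for x by (auto intro!: bdd_belowI2)
  have le: "q x \<le> p (x + D h) - l h" if "h \<in> C" for x h
    unfolding q_def by (rule cINF_lower[OF bdd that])
  have ne: "C \<noteq> {}" using C0 by auto
  have "q (x + y) \<le> q x + q y" for x y
  proof -
    have *: "q (x + y) \<le> (p (x + D h) - l h) + (p (y + D k) - l k)" if "h \<in> C" "k \<in> C" for h k
    proof -
      have "q (x + y) \<le> p ((x + D h) + (y + D k)) - l (h + k)"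
        using le[OF Cadd[OF that], of "x + y"] by (simp add: linear_add[OF D] algebra_simps)
      also have "\<dots> \<le> (p (x + D h) - l h) + (p (y + D k) - l k)"
        using p unfolding sublinear_def by (smt (verit) linear_add[OF l])
      finally show ?thesis .
    qed
    have "q (x + y) - (p (y + D k) - l k) \<le> q x" if "k \<in> C" for k
      unfolding q_def[of x] using *[OF _ that] by (intro cINF_greatest[OF ne]) (simp add: algebra_simps)
    then have "q (x + y) - q x \<le> q y"
      unfolding q_def[of y] by (intro cINF_greatest[OF ne]) (simp add: algebra_simps)
    then show ?thesis by simp
  qed
  moreover have "q (c *\<^sub>R x) \<le> c * q x" if c: "0 < c" for c x
  proof -
    have "q (c *\<^sub>R x) / c \<le> q x"
      unfolding q_def[of x]
    proof (rule cINF_greatest[OF ne])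
      fix h assume h: "h \<in> C"
      have "q (c *\<^sub>R x) \<le> p (c *\<^sub>R (x + D h)) - l (c *\<^sub>R h)"
        using le[OF Cscale[OF c h], of "c *\<^sub>R x"] by (simp add: linear_scale[OF D] algebra_simps)
      also have "\<dots> \<le> c * (p (x + D h) - l h)"
        using p c unfolding sublinear_def by (simp add: linear_scale[OF l] right_diff_distrib)
      finally show "q (c *\<^sub>R x) / c \<le> p (x + D h) - l h" using c by (simp add: field_simps)
    qed
    then show ?thesis using c by (simp add: field_simps)
  qed
  ultimately have "sublinear q" unfolding sublinear_def by blast
  moreover have "q x \<le> p x" for x
    using le[OF C0, of x] by (simp add: linear_0[OF D] linear_0[OF l])
  ultimately show ?thesis using le that by blast
qed

text \<open>
  By Zorn's lemma there is a minimal sublinear functional below \<open>p\<close>, and a minimal one is linear. Working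
  with functionals on the whole space avoids partially defined extensions.
\<close>

lemma sublinear_dominates_linear:
  fixes p :: "'a::real_vector \<Rightarrow> real"
  assumes p: "sublinear p"
  obtains l where "linear l" "\<And>x. l x \<le> p x"
proof -
  let ?A = "{q. sublinear q \<and> q \<le> p}" and ?P = "\<lambda>q r :: 'a \<Rightarrow> real. r \<le> q"
  have "\<exists>m\<in>?A. \<forall>q\<in>?A. q \<le> m \<longrightarrow> q = m"
  proof (rule predicate_Zorn[of ?A ?P])
    show "partial_order_on ?A (relation_of ?P ?A)"
      by (rule partial_order_on_relation_ofI) auto
  next
    fix C assume "C \<in> Chains (relation_of ?P ?A)"
    then have CA: "\<And>q. q \<in> C \<Longrightarrow> sublinear q \<and> q \<le> p"
      and tot: "\<And>q r. q \<in> C \<Longrightarrow> r \<in> C \<Longrightarrow> q \<le> r \<or> r \<le> q"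
      unfolding Chains_def relation_of_def by auto
    show "\<exists>u\<in>?A. \<forall>q\<in>C. u \<le> q"
    proof (cases "C = {}")
      case True
      then show ?thesis using p by auto
    next
      case False
      define u where "u x = (INF q\<in>C. q x)" for x
      have bdd: "bdd_below ((\<lambda>q. q x) ` C)" for x
      proof (rule bdd_belowI2[of _ "- p (- x)"])
        fix q assume "q \<in> C"
        then show "- p (- x) \<le> q x"
          using CA[of q] sublinear_minus[of q x] le_funD[of q p "- x"] by linarith
      qed
      have le: "u x \<le> q x" if "q \<in> C" for q x
        unfolding u_def by (rule cINF_lower[OF bdd that])
      have "u (x + y) \<le> u x + u y" for x y
      proof -
        have *: "u (x + y) \<le> q x + r y" if qr: "q \<in> C" "r \<in> C" for q r
        proof -
          obtain m where m: "m \<in> C" "m x \<le> q x" "m y \<le> r y"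
            using tot[OF qr] qr by (metis le_funD order_refl)
          have "m (x + y) \<le> m x + m y" using CA[OF m(1)] unfolding sublinear_def by blast
          then show ?thesis using le[OF m(1), of "x + y"] m by linarith
        qed
        have "u (x + y) - r y \<le> u x" if "r \<in> C" for r
          unfolding u_def[of x] using *[OF _ that] by (intro cINF_greatest[OF False]) (simp add: algebra_simps)
        then have "u (x + y) - u x \<le> u y"
          unfolding u_def[of y] by (intro cINF_greatest[OF False]) (simp add: algebra_simps)
        then show ?thesis by simp
      qed
      moreover have "u (c *\<^sub>R x) \<le> c * u x" if c: "0 < c" for c x
      proof -
        have "u (c *\<^sub>R x) / c \<le> u x"
          unfolding u_def[of x]
        proof (rule cINF_greatest[OF False])
          fix q assume q: "q \<in> C"
          have "u (c *\<^sub>R x) \<le> q (c *\<^sub>R x)" by (rule le[OF q])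
          also have "\<dots> \<le> c * q x" using CA[OF q] c unfolding sublinear_def by blast
          finally show "u (c *\<^sub>R x) / c \<le> q x" using c by (simp add: field_simps)
        qed
        then show ?thesis using c by (simp add: field_simps)
      qed
      moreover have "u \<le> p" using False CA le by (meson ex_in_conv le_funD le_funI order_trans)
      ultimately have "u \<in> ?A" unfolding sublinear_def by blast
      then show ?thesis using le by (intro bexI[of _ u]) (auto simp: le_fun_def)
    qed
  qed
  then obtain m where m: "sublinear m" "m \<le> p"
    and min: "\<And>q. sublinear q \<Longrightarrow> q \<le> m \<Longrightarrow> q = m" by (auto intro: order_trans)
  have add: "m (x + y) = m x + m y" for x y
  proof (rule antisym)
    show "m (x + y) \<le> m x + m y" using m(1) unfolding sublinear_def by blast
    \<comment> \<open>Pushing \<open>m\<close> down along the ray through \<open>y\<close> gives a sublinear functional below \<open>m\<close>.\<close>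
    have "m y * t \<le> m (t *\<^sub>R y)" if "0 \<le> t" for t
    proof (cases "t = 0")
      case False
      then have t: "0 < t" using that by simp
      have "m ((1/t) *\<^sub>R (t *\<^sub>R y)) \<le> (1/t) * m (t *\<^sub>R y)"
        using m(1) t unfolding sublinear_def by (meson zero_less_divide_1_iff)
      then show ?thesis using t by (simp add: field_simps)
    qed (simp add: sublinear_zero[OF m(1)])
    then obtain q where q: "sublinear q" "\<And>x. q x \<le> m x" "\<And>x t. t \<in> {0..} \<Longrightarrow> q x \<le> m (x + t *\<^sub>R y) - m y * t"
      using sublinear_inf_convolution[OF m(1), of "\<lambda>t. t *\<^sub>R y" "\<lambda>t. m y * t" "{0..}"]
      by (auto simp: linear_iff algebra_simps)
    have "q = m" using min[OF q(1)] q(2) by (auto simp: le_fun_def)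
    then show "m x + m y \<le> m (x + y)" using q(3)[of 1 x] by simp
  qed
  have neg: "m (- x) = - m x" for x using add[of x "- x"] sublinear_zero[OF m(1)] by simp
  have pos: "m (c *\<^sub>R x) = c * m x" if "0 < c" for c x
  proof (rule antisym)
    show 1: "m (c *\<^sub>R x) \<le> c * m x" using m(1) that unfolding sublinear_def by blast
    show "c * m x \<le> m (c *\<^sub>R x)"
      using m(1) that neg unfolding sublinear_def by (metis minus_mult_right neg_le_iff_le scaleR_minus_right)
  qed
  have "m (c *\<^sub>R x) = c * m x" for c x
  proof -
    consider "c > 0" | "c = 0" | "- c > 0" by linarith
    then show ?thesis
    proof cases
      case 3
      then have "m ((- c) *\<^sub>R (- x)) = (- c) * m (- x)" by (rule pos)
      then show ?thesis by (simp add: neg)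
    qed (auto simp: pos sublinear_zero[OF m(1)])
  qed
  then have "linear m" using add by (auto simp: linear_iff)
  then show ?thesis using m(2) that by (auto simp: le_fun_def)
qed

theorem hahn_banach_extension:
  fixes D :: "'b::real_vector \<Rightarrow> 'a::real_normed_vector"
  assumes D: "linear D" and l: "linear l" and C: "0 \<le> C" and dom: "\<And>h. l h \<le> C * norm (D h)"
  obtains L :: "'a \<Rightarrow>\<^sub>L real" where "\<And>h. blinfun_apply L (D h) = l h" "\<And>x. \<bar>blinfun_apply L x\<bar> \<le> C * norm x"
proof -
  let ?p = "\<lambda>x. C * norm x"
  have "sublinear ?p"
    unfolding sublinear_def using C
    by (auto simp: norm_triangle_ineq mult_left_mono simp flip: distrib_left)
  then obtain q where q: "sublinear q" "\<And>x. q x \<le> ?p x" "\<And>x h. q x \<le> ?p (x + D h) - l h"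
    using sublinear_inf_convolution[of ?p D l UNIV] D l dom by auto
  obtain m where m: "linear m" "\<And>x. m x \<le> q x" using sublinear_dominates_linear[OF q(1)] by blast
  have bound: "\<bar>m x\<bar> \<le> C * norm x" for x
    using m(2)[of x] q(2)[of x] m(2)[of "- x"] q(2)[of "- x"] linear_neg[OF m(1), of x] by (simp add: abs_le_iff)
  then have "bounded_linear m"
    using m(1) by (intro bounded_linear_intro[of _ C]) (auto simp: linear_iff mult.commute)
  then have ap: "blinfun_apply (Blinfun m) = m" by (rule bounded_linear_Blinfun_apply)
  have ge: "l h \<le> m (D h)" for h
    using q(3)[of "- D h" h] m(2)[of "- D h"] by (simp add: linear_neg[OF m(1)])
  have "m (D h) = l h" for h
    using ge[of h] ge[of "- h"] by (simp add: linear_neg[OF m(1)] linear_neg[OF D] linear_neg[OF l])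
  then show ?thesis using bound that[of "Blinfun m"] by (simp add: ap)
qed

corollary functional_separating_from_zero:
  fixes w :: "'a::real_normed_vector"
  assumes "w \<noteq> 0"
  obtains L :: "'a \<Rightarrow>\<^sub>L real" where "blinfun_apply L w \<noteq> 0"
proof -
  have "linear (\<lambda>t. t *\<^sub>R w)" "linear (\<lambda>t::real. t * norm w)" by (auto simp: linear_iff algebra_simps)
  moreover have "t * norm w \<le> 1 * norm (t *\<^sub>R w)" for t by (simp add: mult_right_mono)
  ultimately obtain L :: "'a \<Rightarrow>\<^sub>L real" where "\<And>t. blinfun_apply L (t *\<^sub>R w) = t * norm w"
    using hahn_banach_extension[of "\<lambda>t. t *\<^sub>R w" "\<lambda>t. t * norm w" 1] zero_le_one by metis
  from this[of 1] show ?thesis using assms that[of L] by simp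
qed

text \<open>
  The coordinates of \<open>h\<close> are functionals of \<open>D h\<close> bounded by \<open>1/c\<close>, and Hahn-Banach extends each of them.
  The bound on the norm is uniform in \<open>D\<close>; this replaces a continuous choice of complements of the
  tangent spaces.
\<close>

corollary bounded_left_inverse:
  fixes D :: "'e::euclidean_space \<Rightarrow> 'a::real_normed_vector"
  assumes D: "linear D" and c: "0 < c" and below: "\<And>h. c * norm h \<le> norm (D h)"
  obtains P :: "'a \<Rightarrow>\<^sub>L 'e" where "\<And>h. blinfun_apply P (D h) = h" "norm P \<le> real DIM('e) / c"
proof -
  have "\<exists>L :: 'a \<Rightarrow>\<^sub>L real. (\<forall>h. blinfun_apply L (D h) = h \<bullet> b) \<and> (\<forall>x. \<bar>blinfun_apply L x\<bar> \<le> (1/c) * norm x)"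
    if b: "b \<in> Basis" for b :: 'e
  proof -
    have "h \<bullet> b \<le> (1/c) * norm (D h)" for h
    proof -
      have "h \<bullet> b \<le> norm h" using Basis_le_norm[OF b, of h] by simp
      also have "\<dots> \<le> (1/c) * norm (D h)" using below[of h] c by (simp add: field_simps)
      finally show ?thesis .
    qed
    then show ?thesis
      using hahn_banach_extension[OF D, of "\<lambda>h. h \<bullet> b" "1/c"] c
      by (metis bounded_linear.linear bounded_linear_inner_left less_eq_real_def zero_less_divide_1_iff)
  qed
  then obtain L :: "'e \<Rightarrow> 'a \<Rightarrow>\<^sub>L real"
    where L: "\<And>b h. b \<in> Basis \<Longrightarrow> blinfun_apply (L b) (D h) = h \<bullet> b"
      "\<And>b x. b \<in> Basis \<Longrightarrow> \<bar>blinfun_apply (L b) x\<bar> \<le> (1/c) * norm x"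
    by metis
  define P where "P x = (\<Sum>b\<in>Basis. blinfun_apply (L b) x *\<^sub>R b)" for x
  have bound: "norm (P x) \<le> real DIM('e) / c * norm x" for x
  proof -
    have "norm (P x) \<le> (\<Sum>b\<in>(Basis::'e set). (1/c) * norm x)"
      unfolding P_def by (rule order_trans[OF norm_sum]) (intro sum_mono, simp add: L(2) del: times_divide_eq_left)
    then show ?thesis by simp
  qed
  have "bounded_linear P"
    unfolding P_def by (intro bounded_linear_sum bounded_linear_scaleR_left bounded_linear_compose[OF bounded_linear_scaleR_left] blinfun.bounded_linear_right)
  then have ap: "blinfun_apply (Blinfun P) = P" by (rule bounded_linear_Blinfun_apply)
  have "P (D h) = h" for h unfolding P_def by (simp add: L(1) euclidean_representation)
  moreover have "norm (Blinfun P) \<le> real DIM('e) / c"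
    by (rule norm_blinfun_bound) (use c bound in \<open>simp_all add: ap\<close>)
  ultimately show ?thesis using that[of "Blinfun P"] by (simp add: ap)
qed

text \<open>
  The points at which the whole family is bounded by \<open>n\<close> form a closed set, and by Baire one of these
  sets contains a ball.
\<close>

theorem banach_steinhaus:
  fixes G :: "('a::banach \<Rightarrow>\<^sub>L 'b::real_normed_vector) set"
  assumes pt: "\<And>x. \<exists>c. \<forall>g\<in>G. norm (blinfun_apply g x) \<le> c"
  obtains K where "\<And>g. g \<in> G \<Longrightarrow> norm g \<le> K"
proof -
  define S where "S n = {x. \<forall>g\<in>G. norm (blinfun_apply g x) \<le> real n}" for n :: nat
  have cl: "closed (S n)" for n
  proof -
    have "S n = (\<Inter>g\<in>G. {x. norm (blinfun_apply g x) \<le> real n})" unfolding S_def by auto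
    then show ?thesis by (auto intro!: closed_INT closed_Collect_le continuous_intros)
  qed
  have "\<exists>n. x \<in> S n" for x
  proof -
    obtain c where "\<forall>g\<in>G. norm (blinfun_apply g x) \<le> c" using pt by blast
    then have "x \<in> S (nat \<lceil>c\<rceil>)" unfolding S_def by (auto intro: order_trans real_nat_ceiling_ge)
    then show ?thesis by blast
  qed
  then have "\<Union> (range S) = UNIV" by blast
  have "\<exists>n. interior (S n) \<noteq> {}"
  proof (rule ccontr)
    assume "\<not> ?thesis"
    then have "(euclidean::'a topology) interior_of \<Union> (range S) = {}"
      using cl by (intro Baire_category_alt disjI1 completely_metrizable_space_euclidean) auto
    then show False using \<open>\<Union> (range S) = UNIV\<close> by simp
  qed
  then obtain n a r where r: "0 < r" "cball a r \<subseteq> S n"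
    by (metis ex_in_conv mem_interior_cball)
  have "norm g \<le> 2 * real n / r" if g: "g \<in> G" for g
  proof (rule norm_blinfun_bound)
    fix x
    show "norm (blinfun_apply g x) \<le> 2 * real n / r * norm x"
    proof (cases "x = 0")
      case False
      define u where "u = (r / norm x) *\<^sub>R x"
      have "a \<in> S n" "a + u \<in> S n" using r False by (auto simp: u_def dist_norm intro!: subsetD[OF r(2)])
      then have "norm (blinfun_apply g a) \<le> n" "norm (blinfun_apply g (a + u)) \<le> n" using g by (auto simp: S_def)
      moreover have "blinfun_apply g u = blinfun_apply g (a + u) - blinfun_apply g a" by (simp add: blinfun.add_right)
      ultimately have "norm (blinfun_apply g u) \<le> 2 * real n"
        using norm_triangle_ineq4[of "blinfun_apply g (a + u)" "blinfun_apply g a"] by simp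
      then show ?thesis using r False by (simp add: u_def blinfun.scaleR_right field_simps)
    qed (simp add: blinfun.zero_right)
  qed (use r in simp)
  then show ?thesis using that by blast
qed

context completed_tensor_product
begin

lemma tensor_lift_unique:
  fixes B :: "'t \<Rightarrow>\<^sub>L 'w::banach"
  assumes inj: "has_canonical_injection tensor TYPE('w)"
    and B: "\<And>v w. blinfun_apply B (tensor v w) = blinfun_apply (blinfun_apply A v) w"
  shows "tensor_lift tensor A = B"
proof -
  have "blinfun_apply (tensor_lift tensor A) = blinfun_apply B"
    by (rule bounded_linear_eq_on_tensors[OF blinfun.bounded_linear_right blinfun.bounded_linear_right])
      (simp only: tensor_lift[OF inj] B)
  then show ?thesis by (simp only: blinfun_apply_inject)
qed

text \<open>
  Boundedness of the canonical injection is the uniform boundedness principle for the evaluations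
  \<open>A \<mapsto> tensor_lift tensor A x\<close> at algebraic tensors \<open>x\<close> of norm at most one: each of them is bounded, since
  \<open>x\<close> is a finite sum of elementary tensors, and they are pointwise bounded by the norm of \<open>tensor_lift tensor A\<close>.
\<close>

theorem bounded_linear_tensor_lift:
  assumes inj: "has_canonical_injection tensor TYPE('w::banach)"
  shows "bounded_linear (tensor_lift tensor :: ('v \<Rightarrow>\<^sub>L 'v \<Rightarrow>\<^sub>L 'w) \<Rightarrow> 't \<Rightarrow>\<^sub>L 'w)"
proof -
  let ?l = "tensor_lift tensor :: ('v \<Rightarrow>\<^sub>L 'v \<Rightarrow>\<^sub>L 'w) \<Rightarrow> 't \<Rightarrow>\<^sub>L 'w" and ?E = "span (range (\<lambda>(v, w). tensor v w))"
  have add: "?l (A + B) = ?l A + ?l B" for A B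
    by (rule tensor_lift_unique[OF inj]) (simp add: blinfun.add_left tensor_lift[OF inj])
  have scale: "?l (c *\<^sub>R A) = c *\<^sub>R ?l A" for c A
    by (rule tensor_lift_unique[OF inj]) (simp add: blinfun.scaleR_left tensor_lift[OF inj])
  have bl: "bounded_linear (\<lambda>A. blinfun_apply (?l A) x)" if "x \<in> ?E" for x
    using that
  proof (induction rule: span_induct)
    case base
    show ?case
      by (simp add: subspace_def blinfun.add_right blinfun.scaleR_right blinfun.zero_right
          bounded_linear_add bounded_linear_const_scaleR)
  next
    case (step x)
    then obtain v w where x: "x = tensor v w" by auto
    have "bounded_linear (\<lambda>A :: 'v \<Rightarrow>\<^sub>L 'v \<Rightarrow>\<^sub>L 'w. blinfun_apply (blinfun_apply A v) w)"
      by (intro bounded_linear_compose[OF blinfun.bounded_linear_left] blinfun.bounded_linear_left)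
    then show ?case by (simp add: x tensor_lift[OF inj])
  qed
  define G where "G = {Blinfun (\<lambda>A. blinfun_apply (?l A) x) | x. x \<in> ?E \<and> norm x \<le> 1}"
  have "\<exists>c. \<forall>g\<in>G. norm (blinfun_apply g A) \<le> c" for A
  proof (intro exI ballI)
    fix g assume "g \<in> G"
    then obtain x where x: "x \<in> ?E" "norm x \<le> 1" "g = Blinfun (\<lambda>A. blinfun_apply (?l A) x)" by (auto simp: G_def)
    have "norm (blinfun_apply (?l A) x) \<le> norm (?l A) * norm x" by (rule norm_blinfun)
    also have "\<dots> \<le> norm (?l A) * 1" using x by (intro mult_left_mono) auto
    finally show "norm (blinfun_apply g A) \<le> norm (?l A)"
      by (simp add: x(3) bounded_linear_Blinfun_apply[OF bl[OF x(1)]])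
  qed
  then obtain K where K: "\<And>g. g \<in> G \<Longrightarrow> norm g \<le> K" using banach_steinhaus by blast
  have unit: "norm (blinfun_apply (?l A) x) \<le> K * norm A" if "x \<in> ?E" "norm x \<le> 1" for A x
  proof -
    have "Blinfun (\<lambda>A. blinfun_apply (?l A) x) \<in> G" using that by (auto simp: G_def)
    from K[OF this] norm_blinfun[of "Blinfun (\<lambda>A. blinfun_apply (?l A) x)" A] show ?thesis
      by (simp add: bounded_linear_Blinfun_apply[OF bl[OF that(1)]]) (meson mult_right_mono norm_ge_zero order_trans)
  qed
  have E: "norm (blinfun_apply (?l A) x) \<le> K * norm A * norm x" if "x \<in> ?E" for A x
  proof (cases "x = 0")
    case False
    have "norm (blinfun_apply (?l A) ((1 / norm x) *\<^sub>R x)) \<le> K * norm A"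
      using that False by (intro unit span_scale) auto
    then show ?thesis using False by (simp add: blinfun.scaleR_right field_simps)
  qed (simp add: blinfun.zero_right)
  have all: "norm (blinfun_apply (?l A) x) \<le> K * norm A * norm x" for A x
  proof -
    have "closure ?E \<subseteq> {x. norm (blinfun_apply (?l A) x) \<le> K * norm A * norm x}"
      using E by (intro closure_minimal closed_Collect_le continuous_intros) auto
    then show ?thesis using dense by auto
  qed
  have "0 \<le> K" using K[of 0] unfolding G_def
    by (smt (verit, best) K mem_Collect_eq norm_ge_zero norm_zero span_zero G_def)
  then have "norm (?l A) \<le> norm A * K" for A
    using all by (intro norm_blinfun_bound) (auto simp: mult.commute)
  then show ?thesis using add scale by (intro bounded_linear_intro)
qed

end

section \<open>Difference estimates and Taylor expansions\<close>

lemma norm_increment_le_derivative_bound: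
  fixes u :: "real \<Rightarrow> 'a::real_normed_vector"
  assumes d: "\<And>s. s \<in> {0..1} \<Longrightarrow> (u has_vector_derivative u' s) (at s within {0..1})"
    and B: "\<And>s. s \<in> {0..1} \<Longrightarrow> norm (u' s) \<le> B"
  shows "norm (u 1 - u 0) \<le> B"
proof -
  have "onorm (\<lambda>h::real. h *\<^sub>R u' s) \<le> B" if "s \<in> {0..1}" for s
    using mult_left_mono[OF B[OF that]] by (intro onorm_le) (simp add: mult.commute[of B])
  then have "norm (u 1 - u 0) \<le> B * norm (1 - 0 :: real)"
    by (intro differentiable_bound[of "{0..1}" u "\<lambda>s h. h *\<^sub>R u' s"])
      (use d in \<open>auto simp: has_vector_derivative_def\<close>)
  then show ?thesis by simp
qed

lemma has_vector_derivative_along_segment: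
  assumes "(g has_derivative blinfun_apply (g' (y + s *\<^sub>R d))) (at (y + s *\<^sub>R d))"
  shows "((\<lambda>s. g (y + s *\<^sub>R d)) has_vector_derivative blinfun_apply (g' (y + s *\<^sub>R d)) d) (at s within S)"
proof -
  have "((\<lambda>s. y + s *\<^sub>R d) has_derivative (\<lambda>h. h *\<^sub>R d)) (at s within S)"
    by (auto intro!: derivative_eq_intros)
  from has_derivative_compose[OF this assms] show ?thesis
    by (simp add: has_vector_derivative_def blinfun.scaleR_right)
qed

lemma blinfun_Lipschitz:
  fixes g :: "'a::real_normed_vector \<Rightarrow> 'b::real_normed_vector"
  assumes U: "convex U" and d: "\<And>y. y \<in> U \<Longrightarrow> (g has_derivative blinfun_apply (g' y)) (at y)"
    and B: "\<And>y. y \<in> U \<Longrightarrow> norm (g' y) \<le> B" and "y \<in> U" "z \<in> U"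
  shows "norm (g y - g z) \<le> B * norm (y - z)"
  by (rule differentiable_bound[OF U _ _ assms(4,5), of g "\<lambda>y. blinfun_apply (g' y)"])
    (use d B in \<open>auto simp: has_derivative_at_withinI simp flip: norm_blinfun.rep_eq\<close>)

text \<open>
  Bounded maps with bounded Lipschitz derivative, expressed without the derivative. The last
  inequality is the form in which smoothness enters the stability estimate: it is linear in the two
  differences \<open>p - q\<close> and \<open>e - d\<close>, with the first increment \<open>e\<close> as the only factor, so that
  a bound on the increments of one of two compared paths suffices. The condition is stable under products.
\<close>

definition C11 :: "real \<Rightarrow> ('a::real_normed_vector \<Rightarrow> 'b::real_normed_vector) \<Rightarrow> bool" where
  "C11 K g \<longleftrightarrow> 0 \<le> K \<and> (\<forall>y. norm (g y) \<le> K) \<and> (\<forall>y z. norm (g y - g z) \<le> K * norm (y - z)) \<and>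
     (\<forall>p e q d. norm (g (p + e) - g p - (g (q + d) - g q)) \<le> K * (norm (p - q) * norm e + norm (e - d)))"

lemma C11D:
  assumes "C11 K g"
  shows "0 \<le> K" "norm (g y) \<le> K" "norm (g y - g z) \<le> K * norm (y - z)"
    "norm (g (p + e) - g p - (g (q + d) - g q)) \<le> K * (norm (p - q) * norm e + norm (e - d))"
  using assms unfolding C11_def by auto

lemma C11_mono: "C11 K g \<Longrightarrow> K \<le> L \<Longrightarrow> C11 L g"
  unfolding C11_def by (meson mult_right_mono add_nonneg_nonneg mult_nonneg_nonneg norm_ge_zero order_trans)

lemma C11_if_derivative_Lipschitz:
  fixes g :: "'a::real_normed_vector \<Rightarrow> 'b::real_normed_vector"
  assumes d: "\<And>y. (g has_derivative blinfun_apply (g' y)) (at y)"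
    and b: "\<And>y. norm (g y) \<le> K" "\<And>y. norm (g' y) \<le> K"
    and lip: "\<And>y z. norm (g' y - g' z) \<le> K * norm (y - z)"
  shows "C11 K g"
  unfolding C11_def
proof (intro conjI allI)
  show K0: "0 \<le> K" using b(1) norm_ge_zero order_trans by blast
  show L: "norm (g y - g z) \<le> K * norm (y - z)" for y z
    by (rule blinfun_Lipschitz[of UNIV g g']) (use d b in auto)
  show "norm (g (p + e) - g p - (g (q + d') - g q)) \<le> K * (norm (p - q) * norm e + norm (e - d'))" for p e q d'
  proof -
    define u where "u s = g (p + s *\<^sub>R e) - g (q + s *\<^sub>R e)" for s
    have "norm (u 1 - u 0) \<le> K * (norm (p - q) * norm e)"
    proof (rule norm_increment_le_derivative_bound)
      fix s :: real
      show "(u has_vector_derivative blinfun_apply (g' (p + s *\<^sub>R e)) e - blinfun_apply (g' (q + s *\<^sub>R e)) e) (at s within {0..1})"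
        unfolding u_def by (intro has_vector_derivative_diff has_vector_derivative_along_segment d)
      have "norm (blinfun_apply (g' (p + s *\<^sub>R e) - g' (q + s *\<^sub>R e)) e) \<le> norm (g' (p + s *\<^sub>R e) - g' (q + s *\<^sub>R e)) * norm e"
        by (rule norm_blinfun)
      also have "\<dots> \<le> (K * norm ((p + s *\<^sub>R e) - (q + s *\<^sub>R e))) * norm e" by (intro mult_right_mono lip) simp
      finally show "norm (blinfun_apply (g' (p + s *\<^sub>R e)) e - blinfun_apply (g' (q + s *\<^sub>R e)) e) \<le> K * (norm (p - q) * norm e)"
        by (simp add: blinfun.diff_left algebra_simps)
    qed
    moreover have "norm (g (q + e) - g (q + d')) \<le> K * norm (e - d')"
      using L[of "q + e" "q + d'"] by simp
    moreover have "g (p + e) - g p - (g (q + d') - g q) = (u 1 - u 0) + (g (q + e) - g (q + d'))"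
      by (simp add: u_def)
    ultimately show ?thesis by (simp only: distrib_left norm_triangle_mono)
  qed
qed (use b in auto)

lemma C11_bounded_linear:
  assumes L: "bounded_linear L" and g: "C11 K g"
  shows "\<exists>K'. C11 K' (\<lambda>y. L (g y))"
proof -
  obtain N where N: "0 < N" "\<And>x. norm (L x) \<le> N * norm x"
    using bounded_linear.pos_bounded[OF L] by (auto simp: mult.commute)
  have N': "norm (L x) \<le> N * c" if "norm x \<le> c" for x c
    using N(2)[of x] mult_left_mono[OF that, of N] N(1) by linarith
  have "C11 (N * K) (\<lambda>y. L (g y))"
    unfolding C11_def mult.assoc linear_diff[OF bounded_linear.linear[OF L], symmetric]
    using N(1) by (intro conjI allI N' C11D[OF g]) (simp add: C11D(1)[OF g])
  then show ?thesis by blast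
qed

lemma C11_bounded_bilinear:
  fixes a :: "'d::real_normed_vector \<Rightarrow> 'a::real_normed_vector" and b :: "'d \<Rightarrow> 'b::real_normed_vector"
    and \<beta> :: "'a \<Rightarrow> 'b \<Rightarrow> 'c::real_normed_vector"
  assumes \<beta>: "bounded_bilinear \<beta>" and a: "C11 K a" and b: "C11 K b"
  shows "\<exists>K'. C11 K' (\<lambda>y. \<beta> (a y) (b y))"
proof -
  interpret bounded_bilinear \<beta> by (rule \<beta>)
  obtain N where N: "0 < N" "\<And>x y. norm (\<beta> x y) \<le> norm x * norm y * N" using pos_bounded by blast
  have bd: "norm (\<beta> x y) \<le> c * d * N" if "norm x \<le> c" "norm y \<le> d" for x y c d
  proof -
    have "norm x * norm y * N \<le> c * d * N"
      using that N(1) order_trans[OF norm_ge_zero that(1)] by (intro mult_right_mono mult_mono) auto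
    then show ?thesis using N(2)[of x y] by linarith
  qed
  note K0 = C11D(1)[OF a]
  have "C11 (6 * K * K * N) (\<lambda>y. \<beta> (a y) (b y))"
    unfolding C11_def
  proof (intro conjI allI)
    show "0 \<le> 6 * K * K * N" using K0 N by simp
    show "norm (\<beta> (a y) (b y)) \<le> 6 * K * K * N" for y
    proof -
      have "norm (\<beta> (a y) (b y)) \<le> K * K * N" by (intro bd C11D(2)[OF a] C11D(2)[OF b])
      moreover have "0 \<le> K * K * N" using K0 N(1) by simp
      ultimately show ?thesis by linarith
    qed
    show "norm (\<beta> (a y) (b y) - \<beta> (a z) (b z)) \<le> 6 * K * K * N * norm (y - z)" for y z
    proof -
      have "\<beta> (a y) (b y) - \<beta> (a z) (b z) = \<beta> (a y - a z) (b y) + \<beta> (a z) (b y - b z)"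
        by (simp add: diff_left diff_right)
      moreover have "norm (\<beta> (a y - a z) (b y)) \<le> (K * norm (y - z)) * K * N"
        by (intro bd C11D(3)[OF a] C11D(2)[OF b])
      moreover have "norm (\<beta> (a z) (b y - b z)) \<le> K * (K * norm (y - z)) * N"
        by (intro bd C11D(3)[OF b] C11D(2)[OF a])
      moreover have "0 \<le> K * K * N * norm (y - z)" using K0 N(1) by simp
      ultimately show ?thesis
        using norm_triangle_ineq[of "\<beta> (a y - a z) (b y)" "\<beta> (a z) (b y - b z)"] by (simp add: algebra_simps)
    qed
    fix p e q d :: 'd
    let ?pq = "norm (p - q) * norm e" and ?ed = "norm (e - d)"
    define a1 a2 a3 a4 where "a1 = a (p + e)" and "a2 = a p" and "a3 = a (q + d)" and "a4 = a q"
    define b1 b2 b3 b4 where "b1 = b (p + e)" and "b2 = b p" and "b3 = b (q + d)" and "b4 = b q"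
    have ab4: "norm (a1 - a2 - (a3 - a4)) \<le> K * (?pq + ?ed)" "norm (b1 - b2 - (b3 - b4)) \<le> K * (?pq + ?ed)"
      unfolding a1_def a2_def a3_def a4_def b1_def b2_def b3_def b4_def by (intro C11D(4)[OF a] C11D(4)[OF b])+
    have a12: "norm (a1 - a2) \<le> K * norm e" "norm (b1 - b2) \<le> K * norm e"
      using C11D(3)[OF a, of "p + e" p] C11D(3)[OF b, of "p + e" p] by (simp_all add: a1_def a2_def b1_def b2_def)
    have a24: "norm (a2 - a4) \<le> K * norm (p - q)" by (simp add: a2_def a4_def C11D(3)[OF a])
    have ab: "norm b1 \<le> K" "norm b3 \<le> K" "norm a1 \<le> K" "norm a2 \<le> K" "norm a4 \<le> K"
      by (simp_all add: a1_def a2_def a4_def b1_def b3_def C11D(2)[OF a] C11D(2)[OF b])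
    have b13: "norm (b1 - b3) \<le> K * norm (p - q) + K * ?ed"
    proof -
      have "norm (b1 - b3) \<le> K * norm ((p - q) + (e - d))"
        using C11D(3)[OF b, of "p + e" "q + d"] by (simp add: b1_def b3_def algebra_simps)
      also have "\<dots> \<le> K * (norm (p - q) + ?ed)" by (intro mult_left_mono norm_triangle_ineq K0)
      finally show ?thesis by (simp add: distrib_left)
    qed
    have t1: "norm (\<beta> (a1 - a2 - (a3 - a4)) b3) \<le> (K * (?pq + ?ed)) * K * N" by (intro bd ab ab4)
    have t2: "norm (\<beta> a4 (b1 - b2 - (b3 - b4))) \<le> K * (K * (?pq + ?ed)) * N" by (intro bd ab ab4)
    have t3: "norm (\<beta> (a2 - a4) (b1 - b2)) \<le> (K * norm (p - q)) * (K * norm e) * N" by (intro bd a24 a12)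
    have t4: "norm (\<beta> (a1 - a2) (b1 - b3)) \<le> (K * ?pq + 2 * K * ?ed) * K * N"
    proof -
      have m: "norm (a1 - a2) \<le> 2 * K" using ab norm_triangle_ineq4[of a1 a2] by linarith
      have "norm (a1 - a2) * norm (b1 - b3) \<le> norm (a1 - a2) * (K * norm (p - q) + K * ?ed)"
        by (intro mult_left_mono b13) simp
      also have "\<dots> = norm (a1 - a2) * (K * norm (p - q)) + norm (a1 - a2) * (K * ?ed)" by (rule distrib_left)
      also have "\<dots> \<le> (K * norm e) * (K * norm (p - q)) + (2 * K) * (K * ?ed)"
        using K0 by (intro add_mono mult_right_mono a12 m) auto
      finally have "norm (a1 - a2) * norm (b1 - b3) * N \<le> ((K * norm e) * (K * norm (p - q)) + (2 * K) * (K * ?ed)) * N"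
        using N(1) by (intro mult_right_mono) auto
      then show ?thesis using N(2)[of "a1 - a2" "b1 - b3"] by (simp add: algebra_simps)
    qed
    have "\<beta> a1 b1 - \<beta> a2 b2 - (\<beta> a3 b3 - \<beta> a4 b4)
        = \<beta> (a1 - a2 - (a3 - a4)) b3 + \<beta> a4 (b1 - b2 - (b3 - b4)) + \<beta> (a2 - a4) (b1 - b2) + \<beta> (a1 - a2) (b1 - b3)"
      by (simp add: diff_left diff_right add_left add_right algebra_simps)
    also have "norm \<dots> \<le> (K * (?pq + ?ed)) * K * N + K * (K * (?pq + ?ed)) * N
        + (K * norm (p - q)) * (K * norm e) * N + (K * ?pq + 2 * K * ?ed) * K * N"
      by (intro norm_triangle_le add_mono t1 t2 t3 t4)
    also have "\<dots> = K * K * N * (4 * ?pq + 4 * ?ed)" by (simp add: algebra_simps)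
    also have "\<dots> \<le> K * K * N * (6 * (?pq + ?ed))" using K0 N(1) by (intro mult_left_mono) auto
    finally show "norm (\<beta> (a (p + e)) (b (p + e)) - \<beta> (a p) (b p) - (\<beta> (a (q + d)) (b (q + d)) - \<beta> (a q) (b q)))
        \<le> 6 * K * K * N * (?pq + ?ed)"
      by (simp add: a1_def a2_def a3_def a4_def b1_def b2_def b3_def b4_def mult.assoc mult.left_commute)
  qed
  then show ?thesis by blast
qed

definition taylor_rem :: "('a::real_normed_vector \<Rightarrow> 'b::real_normed_vector) \<Rightarrow> ('a \<Rightarrow> 'a \<Rightarrow>\<^sub>L 'b) \<Rightarrow> 'a \<Rightarrow> 'a \<Rightarrow> 'b" where
  "taylor_rem f f1 y d = f (y + d) - f y - blinfun_apply (f1 y) d"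

lemma taylor_rem_difference_increment:
  assumes d: "\<And>y. (f has_derivative blinfun_apply (f1 y)) (at y)" and f1: "C11 K f1"
  shows "norm (taylor_rem f f1 z d - taylor_rem f f1 z d') \<le> K * (norm d + norm d') * norm (d - d')"
proof -
  define u where "u s = f ((z + d') + s *\<^sub>R (d - d')) - s *\<^sub>R blinfun_apply (f1 z) (d - d')" for s
  have "norm (u 1 - u 0) \<le> K * (norm d + norm d') * norm (d - d')"
  proof (rule norm_increment_le_derivative_bound)
    fix s :: real assume s: "s \<in> {0..1}"
    let ?w = "(z + d') + s *\<^sub>R (d - d')"
    show "(u has_vector_derivative blinfun_apply (f1 ?w) (d - d') - blinfun_apply (f1 z) (d - d')) (at s within {0..1})"
      unfolding u_def
      by (intro has_vector_derivative_diff has_vector_derivative_along_segment d)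
        (auto intro!: derivative_eq_intros simp: has_vector_derivative_def)
    have "norm (?w - z) = norm ((1 - s) *\<^sub>R d' + s *\<^sub>R d)" by (simp add: algebra_simps)
    also have "\<dots> \<le> 1 * norm d' + 1 * norm d"
      using s by (intro norm_triangle_le add_mono) (auto intro!: mult_right_mono mult_left_le_one_le)
    finally have "K * norm (?w - z) \<le> K * (norm d + norm d')" using C11D(1)[OF f1] by (intro mult_left_mono) auto
    then have "norm (f1 ?w - f1 z) \<le> K * (norm d + norm d')" using C11D(3)[OF f1, of ?w z] by linarith
    then have "norm (f1 ?w - f1 z) * norm (d - d') \<le> K * (norm d + norm d') * norm (d - d')"
      by (intro mult_right_mono) auto
    then show "norm (blinfun_apply (f1 ?w) (d - d') - blinfun_apply (f1 z) (d - d')) \<le> K * (norm d + norm d') * norm (d - d')"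
      using norm_blinfun[of "f1 ?w - f1 z" "d - d'"] by (simp add: blinfun.diff_left)
  qed
  moreover have "u 1 - u 0 = taylor_rem f f1 z d - taylor_rem f f1 z d'"
    by (simp add: u_def taylor_rem_def blinfun.diff_right algebra_simps)
  ultimately show ?thesis by simp
qed

text \<open>
  The derivative of \<open>s \<mapsto> f (y + s d) - f (z + s d)\<close>, compared with its value at \<open>0\<close>, is a second difference
  of \<open>f1\<close>; this gives the two powers of \<open>d\<close>.
\<close>

lemma taylor_rem_difference_base:
  assumes d: "\<And>y. (f has_derivative blinfun_apply (f1 y)) (at y)" and f1: "C11 K f1"
  shows "norm (taylor_rem f f1 y d - taylor_rem f f1 z d) \<le> K * norm (y - z) * norm d ^ 2"
proof -
  define u where "u s = f (y + s *\<^sub>R d) - f (z + s *\<^sub>R d) - s *\<^sub>R (blinfun_apply (f1 y) d - blinfun_apply (f1 z) d)" for s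
  have "norm (u 1 - u 0) \<le> K * norm (y - z) * norm d ^ 2"
  proof (rule norm_increment_le_derivative_bound)
    fix s :: real assume s: "s \<in> {0..1}"
    let ?b = "f1 (y + s *\<^sub>R d) - f1 y - (f1 (z + s *\<^sub>R d) - f1 z)"
    have "(u has_vector_derivative blinfun_apply (f1 (y + s *\<^sub>R d)) d - blinfun_apply (f1 (z + s *\<^sub>R d)) d - (blinfun_apply (f1 y) d - blinfun_apply (f1 z) d)) (at s within {0..1})"
      unfolding u_def
      by (intro has_vector_derivative_diff has_vector_derivative_along_segment d)
        (auto intro!: derivative_eq_intros simp: has_vector_derivative_def)
    also have "blinfun_apply (f1 (y + s *\<^sub>R d)) d - blinfun_apply (f1 (z + s *\<^sub>R d)) d - (blinfun_apply (f1 y) d - blinfun_apply (f1 z) d) = blinfun_apply ?b d"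
      by (simp add: blinfun.diff_left)
    finally show "(u has_vector_derivative blinfun_apply ?b d) (at s within {0..1})" .
    have "norm ?b \<le> K * (norm (y - z) * norm (s *\<^sub>R d) + norm (s *\<^sub>R d - s *\<^sub>R d))" by (rule C11D(4)[OF f1])
    also have "\<dots> \<le> K * (norm (y - z) * norm d)"
      using s C11D(1)[OF f1] by (auto intro!: mult_left_mono mult_left_le_one_le)
    finally have "norm ?b * norm d \<le> K * (norm (y - z) * norm d) * norm d" by (rule mult_right_mono) simp
    then show "norm (blinfun_apply ?b d) \<le> K * norm (y - z) * norm d ^ 2"
      using norm_blinfun[of ?b d] by (simp add: power2_eq_square mult.assoc)
  qed
  moreover have "u 1 - u 0 = taylor_rem f f1 y d - taylor_rem f f1 z d"
    by (simp add: u_def taylor_rem_def algebra_simps)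
  ultimately show ?thesis by simp
qed

lemma taylor_rem_bound:
  assumes d: "\<And>y. (f has_derivative blinfun_apply (f1 y)) (at y)" and f1: "C11 K f1"
  shows "norm (taylor_rem f f1 y d) \<le> K * norm d ^ 2"
  using taylor_rem_difference_increment[OF d f1, of y d 0]
  by (simp add: taylor_rem_def power2_eq_square blinfun.zero_right mult.assoc)

text \<open>
  The error of expanding the coefficient along its own first order increment \<open>f y v\<close>.
\<close>

definition euler_rem :: "('w::real_normed_vector \<Rightarrow> 'v::real_normed_vector \<Rightarrow>\<^sub>L 'w) \<Rightarrow> ('w \<Rightarrow> 'w \<Rightarrow>\<^sub>L 'v \<Rightarrow>\<^sub>L 'w) \<Rightarrow> 'w \<Rightarrow> 'v \<Rightarrow> 'v \<Rightarrow>\<^sub>L 'w" where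
  "euler_rem f f1 y v = taylor_rem f f1 y (blinfun_apply (f y) v)"

lemma euler_rem_bounds:
  assumes d: "\<And>y. (f has_derivative blinfun_apply (f1 y)) (at y)" and f: "C11 K f" and f1: "C11 K f1"
  shows "norm (euler_rem f f1 y v) \<le> K ^ 3 * norm v ^ 2"
    and "norm (euler_rem f f1 y v - euler_rem f f1 z v) \<le> 3 * K ^ 3 * norm (y - z) * norm v ^ 2"
proof -
  note K0 = C11D(1)[OF f]
  have fv: "norm (blinfun_apply (f y) v) \<le> K * norm v" for y
    using norm_blinfun[of "f y" v] mult_right_mono[OF C11D(2)[OF f, of y], of "norm v"] by (meson norm_ge_zero order_trans)
  have fd: "norm (blinfun_apply (f y) v - blinfun_apply (f z) v) \<le> K * norm (y - z) * norm v"
    using norm_blinfun[of "f y - f z" v] mult_right_mono[OF C11D(3)[OF f, of y z], of "norm v"]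
    by (simp add: blinfun.diff_left)
  have sq: "norm (blinfun_apply (f y) v) ^ 2 \<le> K ^ 2 * norm v ^ 2" for y
    using power_mono[OF fv, where n = 2] by (simp add: power_mult_distrib)
  have "norm (euler_rem f f1 y v) \<le> K * norm (blinfun_apply (f y) v) ^ 2"
    unfolding euler_rem_def by (rule taylor_rem_bound[OF d f1])
  also have "\<dots> \<le> K * (K ^ 2 * norm v ^ 2)" by (intro mult_left_mono sq K0)
  finally show "norm (euler_rem f f1 y v) \<le> K ^ 3 * norm v ^ 2" by (simp add: power2_eq_square power3_eq_cube mult.assoc)
  let ?y = "blinfun_apply (f y) v" and ?z = "blinfun_apply (f z) v"
  have "norm (taylor_rem f f1 y ?y - taylor_rem f f1 z ?y) \<le> K * norm (y - z) * norm ?y ^ 2"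
    by (rule taylor_rem_difference_base[OF d f1])
  also have "\<dots> \<le> K * norm (y - z) * (K ^ 2 * norm v ^ 2)" using K0 by (intro mult_left_mono sq) auto
  finally have 1: "norm (taylor_rem f f1 y ?y - taylor_rem f f1 z ?y) \<le> K ^ 3 * norm (y - z) * norm v ^ 2"
    by (simp add: power2_eq_square power3_eq_cube algebra_simps)
  have "norm (taylor_rem f f1 z ?y - taylor_rem f f1 z ?z) \<le> K * (norm ?y + norm ?z) * norm (?y - ?z)"
    by (rule taylor_rem_difference_increment[OF d f1])
  also have "\<dots> \<le> K * (K * norm v + K * norm v) * (K * norm (y - z) * norm v)"
    using K0 by (intro mult_mono mult_left_mono add_mono fv fd) auto
  finally have 2: "norm (taylor_rem f f1 z ?y - taylor_rem f f1 z ?z) \<le> 2 * K ^ 3 * norm (y - z) * norm v ^ 2"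
    by (simp add: power2_eq_square power3_eq_cube algebra_simps)
  show "norm (euler_rem f f1 y v - euler_rem f f1 z v) \<le> 3 * K ^ 3 * norm (y - z) * norm v ^ 2"
    using 1 2 norm_triangle_ineq[of "taylor_rem f f1 y ?y - taylor_rem f f1 z ?y" "taylor_rem f f1 z ?y - taylor_rem f f1 z ?z"]
    unfolding euler_rem_def by simp
qed

lemma Cb3_imp_C11:
  assumes "Cb3 f"
  obtains f1 K where "\<And>y. (f has_derivative blinfun_apply (f1 y)) (at y)" "C11 K f" "C11 K f1"
proof -
  obtain f1 f2 f3 where d: "\<And>y. (f has_derivative blinfun_apply (f1 y)) (at y)"
      "\<And>y. (f1 has_derivative blinfun_apply (f2 y)) (at y)" "\<And>y. (f2 has_derivative blinfun_apply (f3 y)) (at y)"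
    and b: "bounded (range f)" "bounded (range f1)" "bounded (range f2)" "bounded (range f3)"
    using assms unfolding Cb3_def by blast
  obtain b0 b1 b2 b3 where "\<And>y. norm (f y) \<le> b0" "\<And>y. norm (f1 y) \<le> b1" "\<And>y. norm (f2 y) \<le> b2" "\<And>y. norm (f3 y) \<le> b3"
    using b unfolding bounded_iff by blast
  then have "\<exists>K. \<forall>y. norm (f y) \<le> K \<and> norm (f1 y) \<le> K \<and> norm (f2 y) \<le> K \<and> norm (f3 y) \<le> K"
    by (intro exI[of _ "max (max b0 b1) (max b2 b3)"]) (auto simp: le_max_iff_disj)
  then obtain K where K: "\<And>y. norm (f y) \<le> K" "\<And>y. norm (f1 y) \<le> K" "\<And>y. norm (f2 y) \<le> K" "\<And>y. norm (f3 y) \<le> K"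
    by blast
  have "C11 K f" by (rule C11_if_derivative_Lipschitz[OF d(1) K(1,2)], rule blinfun_Lipschitz[of UNIV f1 f2]) (use d K in auto)
  moreover have "C11 K f1" by (rule C11_if_derivative_Lipschitz[OF d(2) K(2,3)], rule blinfun_Lipschitz[of UNIV f2 f3]) (use d K in auto)
  ultimately show ?thesis using that d by blast
qed

text \<open>
  The setting of a local parametrisation of class \<open>C\<^sup>3\<close>. The third derivative enters
  through the Lipschitz constant of the second one.
\<close>

locale twice_differentiable_on_ball =
  fixes z0 :: "'a::real_normed_vector" and r K :: real and \<phi> :: "'a \<Rightarrow> 'b::real_normed_vector"
    and \<phi>1 :: "'a \<Rightarrow> 'a \<Rightarrow>\<^sub>L 'b" and \<phi>2 :: "'a \<Rightarrow> 'a \<Rightarrow>\<^sub>L 'a \<Rightarrow>\<^sub>L 'b"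
  assumes r: "0 < r"
    and D1: "\<And>z. z \<in> ball z0 r \<Longrightarrow> (\<phi> has_derivative blinfun_apply (\<phi>1 z)) (at z)"
    and D2: "\<And>z. z \<in> ball z0 r \<Longrightarrow> (\<phi>1 has_derivative blinfun_apply (\<phi>2 z)) (at z)"
    and bound1: "\<And>z. z \<in> ball z0 r \<Longrightarrow> norm (\<phi>1 z) \<le> K"
    and bound2: "\<And>z. z \<in> ball z0 r \<Longrightarrow> norm (\<phi>2 z) \<le> K"
    and Lip2: "\<And>z w. z \<in> ball z0 r \<Longrightarrow> w \<in> ball z0 r \<Longrightarrow> norm (\<phi>2 z - \<phi>2 w) \<le> K * norm (z - w)"
begin

lemma K0: "0 \<le> K"
  using bound1[of z0] r norm_ge_zero order_trans by (metis centre_in_ball)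

lemma Lip0: "z \<in> ball z0 r \<Longrightarrow> w \<in> ball z0 r \<Longrightarrow> norm (\<phi> z - \<phi> w) \<le> K * norm (z - w)"
  by (rule blinfun_Lipschitz[OF convex_ball D1 bound1])

lemma Lip1: "z \<in> ball z0 r \<Longrightarrow> w \<in> ball z0 r \<Longrightarrow> norm (\<phi>1 z - \<phi>1 w) \<le> K * norm (z - w)"
  by (rule blinfun_Lipschitz[OF convex_ball D2 bound2])

lemma segment: "z \<in> ball z0 r \<Longrightarrow> z + q \<in> ball z0 r \<Longrightarrow> s \<in> {0..1} \<Longrightarrow> z + s *\<^sub>R q \<in> ball z0 r"
  using convexD_alt[OF convex_ball, of z z0 r "z + q" s] by (simp add: algebra_simps)

lemma taylor1:
  assumes z: "z \<in> ball z0 r" and q: "z + q \<in> ball z0 r"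
  shows "norm (\<phi> (z + q) - \<phi> z - blinfun_apply (\<phi>1 z) q) \<le> K * norm q ^ 2"
proof -
  define u where "u s = \<phi> (z + s *\<^sub>R q) - s *\<^sub>R blinfun_apply (\<phi>1 z) q" for s
  have "norm (u 1 - u 0) \<le> K * norm q ^ 2"
  proof (rule norm_increment_le_derivative_bound)
    fix s :: real assume s: "s \<in> {0..1}"
    note zs = segment[OF z q s]
    show "(u has_vector_derivative blinfun_apply (\<phi>1 (z + s *\<^sub>R q)) q - blinfun_apply (\<phi>1 z) q) (at s within {0..1})"
      unfolding u_def
      by (intro has_vector_derivative_diff has_vector_derivative_along_segment D1 zs)
        (auto intro!: derivative_eq_intros simp: has_vector_derivative_def)
    have "norm (\<phi>1 (z + s *\<^sub>R q) - \<phi>1 z) \<le> K * norm q"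
      using Lip1[OF zs z] mult_left_mono[OF mult_left_le_one_le[of "norm q" s] K0] s by auto
    then have "norm (\<phi>1 (z + s *\<^sub>R q) - \<phi>1 z) * norm q \<le> K * norm q * norm q" by (rule mult_right_mono) simp
    then show "norm (blinfun_apply (\<phi>1 (z + s *\<^sub>R q)) q - blinfun_apply (\<phi>1 z) q) \<le> K * norm q ^ 2"
      using norm_blinfun[of "\<phi>1 (z + s *\<^sub>R q) - \<phi>1 z" q] by (simp add: blinfun.diff_left power2_eq_square mult.assoc)
  qed
  then show ?thesis by (simp add: u_def algebra_simps)
qed

lemma taylor1_derivative:
  assumes z: "z \<in> ball z0 r" and q: "z + q \<in> ball z0 r"
  shows "norm (\<phi>1 (z + q) - \<phi>1 z - blinfun_apply (\<phi>2 z) q) \<le> K * norm q ^ 2"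
proof -
  define u where "u s = \<phi>1 (z + s *\<^sub>R q) - s *\<^sub>R blinfun_apply (\<phi>2 z) q" for s
  have "norm (u 1 - u 0) \<le> K * norm q ^ 2"
  proof (rule norm_increment_le_derivative_bound)
    fix s :: real assume s: "s \<in> {0..1}"
    note zs = segment[OF z q s]
    show "(u has_vector_derivative blinfun_apply (\<phi>2 (z + s *\<^sub>R q)) q - blinfun_apply (\<phi>2 z) q) (at s within {0..1})"
      unfolding u_def
      by (intro has_vector_derivative_diff has_vector_derivative_along_segment D2 zs)
        (auto intro!: derivative_eq_intros simp: has_vector_derivative_def)
    have "norm (\<phi>2 (z + s *\<^sub>R q) - \<phi>2 z) \<le> K * norm q"
      using Lip2[OF zs z] mult_left_mono[OF mult_left_le_one_le[of "norm q" s] K0] s by auto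
    then have "norm (\<phi>2 (z + s *\<^sub>R q) - \<phi>2 z) * norm q \<le> K * norm q * norm q" by (rule mult_right_mono) simp
    then show "norm (blinfun_apply (\<phi>2 (z + s *\<^sub>R q)) q - blinfun_apply (\<phi>2 z) q) \<le> K * norm q ^ 2"
      using norm_blinfun[of "\<phi>2 (z + s *\<^sub>R q) - \<phi>2 z" q] by (simp add: blinfun.diff_left power2_eq_square mult.assoc)
  qed
  then show ?thesis by (simp add: u_def algebra_simps)
qed

lemma taylor2:
  assumes z: "z \<in> ball z0 r" and q: "z + q \<in> ball z0 r"
  shows "norm (\<phi> (z + q) - \<phi> z - blinfun_apply (\<phi>1 z) q - (1/2) *\<^sub>R blinfun_apply (blinfun_apply (\<phi>2 z) q) q) \<le> K * norm q ^ 3"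
proof -
  define u where "u s = \<phi> (z + s *\<^sub>R q) - s *\<^sub>R blinfun_apply (\<phi>1 z) q - (s\<^sup>2 / 2) *\<^sub>R blinfun_apply (blinfun_apply (\<phi>2 z) q) q" for s
  have "norm (u 1 - u 0) \<le> K * norm q ^ 3"
  proof (rule norm_increment_le_derivative_bound)
    fix s :: real assume s: "s \<in> {0..1}"
    note zs = segment[OF z q s]
    let ?b = "\<phi>1 (z + s *\<^sub>R q) - \<phi>1 z - blinfun_apply (\<phi>2 z) (s *\<^sub>R q)"
    have "(u has_vector_derivative blinfun_apply (\<phi>1 (z + s *\<^sub>R q)) q - blinfun_apply (\<phi>1 z) q - s *\<^sub>R blinfun_apply (blinfun_apply (\<phi>2 z) q) q) (at s within {0..1})"
      unfolding u_def
      by (intro has_vector_derivative_diff has_vector_derivative_along_segment D1 zs)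
        (auto intro!: derivative_eq_intros simp: has_vector_derivative_def)
    then show "(u has_vector_derivative blinfun_apply ?b q) (at s within {0..1})"
      by (simp add: blinfun.diff_left blinfun.scaleR_right blinfun.scaleR_left)
    have "norm ?b \<le> K * norm (s *\<^sub>R q) ^ 2" by (rule taylor1_derivative[OF z zs])
    also have "\<dots> \<le> K * norm q ^ 2"
      using s K0 by (intro mult_left_mono power_mono) (auto intro: mult_left_le_one_le)
    finally have "norm ?b * norm q \<le> K * norm q ^ 2 * norm q" by (rule mult_right_mono) simp
    then show "norm (blinfun_apply ?b q) \<le> K * norm q ^ 3"
      using norm_blinfun[of ?b q] by (simp add: power2_eq_square power3_eq_cube mult.assoc)
  qed
  then show ?thesis by (simp add: u_def algebra_simps)
qed

lemma second_difference:
  assumes z: "z \<in> ball z0 r" and ab: "norm a + norm b < r - dist z0 z"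
  shows "norm (\<phi> (z + a + b) - \<phi> (z + a) - \<phi> (z + b) + \<phi> z - blinfun_apply (blinfun_apply (\<phi>2 z) a) b)
    \<le> 2 * K * (norm a + norm b) ^ 3"
proof -
  have inb: "z + x \<in> ball z0 r" if "norm x \<le> norm a + norm b" for x
    using ab that dist_triangle[of z0 "z + x" z] by (simp add: dist_norm)
  define u where "u s = \<phi> ((z + a) + s *\<^sub>R b) - \<phi> (z + s *\<^sub>R b) - s *\<^sub>R blinfun_apply (blinfun_apply (\<phi>2 z) a) b" for s
  have "norm (u 1 - u 0) \<le> 2 * K * (norm a + norm b) ^ 3"
  proof (rule norm_increment_le_derivative_bound)
    fix s :: real assume s: "s \<in> {0..1}"
    have sb: "norm (s *\<^sub>R b) \<le> norm b" using s by (auto intro: mult_left_le_one_le)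
    have i: "norm (a + s *\<^sub>R b) \<le> norm a + norm b" "norm (s *\<^sub>R b) \<le> norm a + norm b"
      using sb norm_triangle_ineq[of a "s *\<^sub>R b"] norm_ge_zero[of a] by linarith+
    let ?b1 = "\<phi>1 (z + (a + s *\<^sub>R b)) - \<phi>1 z - blinfun_apply (\<phi>2 z) (a + s *\<^sub>R b)"
    let ?b2 = "\<phi>1 (z + s *\<^sub>R b) - \<phi>1 z - blinfun_apply (\<phi>2 z) (s *\<^sub>R b)"
    have "(u has_vector_derivative blinfun_apply (\<phi>1 ((z + a) + s *\<^sub>R b)) b - blinfun_apply (\<phi>1 (z + s *\<^sub>R b)) b - blinfun_apply (blinfun_apply (\<phi>2 z) a) b) (at s within {0..1})"
      unfolding u_def using inb[OF i(1)] inb[OF i(2)]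
      by (intro has_vector_derivative_diff has_vector_derivative_along_segment D1)
        (auto intro!: derivative_eq_intros simp: has_vector_derivative_def add.assoc)
    then show "(u has_vector_derivative blinfun_apply (?b1 - ?b2) b) (at s within {0..1})"
      by (simp add: blinfun.diff_left blinfun.add_left blinfun.add_right algebra_simps)
    have "norm ?b1 \<le> K * norm (a + s *\<^sub>R b) ^ 2" "norm ?b2 \<le> K * norm (s *\<^sub>R b) ^ 2"
      using taylor1_derivative[OF z inb[OF i(1)]] taylor1_derivative[OF z inb[OF i(2)]] by auto
    moreover have "K * norm (a + s *\<^sub>R b) ^ 2 \<le> K * (norm a + norm b) ^ 2" "K * norm (s *\<^sub>R b) ^ 2 \<le> K * (norm a + norm b) ^ 2"
      using K0 i by (intro mult_left_mono power_mono; simp)+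
    ultimately have "norm (?b1 - ?b2) \<le> 2 * K * (norm a + norm b) ^ 2"
      using norm_triangle_ineq4[of ?b1 ?b2] by linarith
    then have "norm (?b1 - ?b2) * norm b \<le> 2 * K * (norm a + norm b) ^ 2 * (norm a + norm b)"
      using K0 by (intro mult_mono) auto
    then show "norm (blinfun_apply (?b1 - ?b2) b) \<le> 2 * K * (norm a + norm b) ^ 3"
      using norm_blinfun[of "?b1 - ?b2" b] by (simp add: power2_eq_square power3_eq_cube mult.assoc)
  qed
  then show ?thesis by (simp add: u_def algebra_simps)
qed

text \<open>
  The second difference \<open>\<phi> (z + a + b) - \<phi> (z + a) - \<phi> (z + b) + \<phi> z\<close> is symmetric in \<open>a\<close> and \<open>b\<close>, and the second
  derivative is its leading term.
\<close>

lemma second_derivative_symmetric: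
  assumes z: "z \<in> ball z0 r"
  shows "blinfun_apply (blinfun_apply (\<phi>2 z) a) b = blinfun_apply (blinfun_apply (\<phi>2 z) b) a"
proof -
  let ?N = "norm a + norm b" and ?x = "blinfun_apply (blinfun_apply (\<phi>2 z) a) b - blinfun_apply (blinfun_apply (\<phi>2 z) b) a"
  define \<rho> where "\<rho> = r - dist z0 z"
  have \<rho>: "0 < \<rho>" using z by (simp add: \<rho>_def)
  have ev: "norm ?x \<le> 4 * K * ?N ^ 3 * e" if e: "0 < e" "e * ?N < \<rho>" for e
  proof -
    let ?a = "e *\<^sub>R a" and ?b = "e *\<^sub>R b"
    have ab: "norm ?a + norm ?b < r - dist z0 z" "norm ?b + norm ?a < r - dist z0 z"
      using e by (simp_all add: \<rho>_def algebra_simps)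
    have "norm (blinfun_apply (blinfun_apply (\<phi>2 z) ?a) ?b - blinfun_apply (blinfun_apply (\<phi>2 z) ?b) ?a)
        \<le> 2 * K * (norm ?a + norm ?b) ^ 3 + 2 * K * (norm ?b + norm ?a) ^ 3"
      using norm_triangle_le_diff[OF add_mono[OF second_difference[OF z ab(2)] second_difference[OF z ab(1)]]]
      by (simp add: algebra_simps)
    also have "\<dots> = 4 * K * (e * ?N) ^ 3" using e by (simp add: algebra_simps)
    also have "\<dots> = e\<^sup>2 * (4 * K * ?N ^ 3 * e)" by (simp add: power_mult_distrib power2_eq_square power3_eq_cube)
    also have "blinfun_apply (blinfun_apply (\<phi>2 z) ?a) ?b - blinfun_apply (blinfun_apply (\<phi>2 z) ?b) ?a = e\<^sup>2 *\<^sub>R ?x"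
      by (simp add: blinfun.scaleR_right blinfun.scaleR_left power2_eq_square scaleR_diff_right)
    finally have "e\<^sup>2 * norm ?x \<le> e\<^sup>2 * (4 * K * ?N ^ 3 * e)" using e by simp
    then show ?thesis using e by simp
  qed
  have "norm ?x \<le> 0"
  proof (rule tendsto_lowerbound[of "\<lambda>e. 4 * K * ?N ^ 3 * e" _ "at_right 0"])
    show "((\<lambda>e. 4 * K * ?N ^ 3 * e) \<longlongrightarrow> 0) (at_right 0)" by (auto intro!: tendsto_eq_intros)
    have "((\<lambda>e. e * ?N) \<longlongrightarrow> 0) (at_right 0)" by (auto intro!: tendsto_eq_intros)
    then have "eventually (\<lambda>e. e * ?N < \<rho>) (at_right 0)" using \<rho> by (rule order_tendstoD)
    moreover have "eventually (\<lambda>e::real. 0 < e) (at_right 0)" by (simp add: eventually_at_right_less)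
    ultimately show "eventually (\<lambda>e. norm ?x \<le> 4 * K * ?N ^ 3 * e) (at_right 0)"
      by eventually_elim (rule ev)
  qed simp
  then show ?thesis by simp
qed

end

lemma C3_on_imp_twice_differentiable_on_ball:
  fixes \<phi> :: "'a::real_normed_vector \<Rightarrow> 'b::real_normed_vector"
  assumes "C3_on S \<phi>" "open S" "z0 \<in> S"
  obtains r K \<phi>1 \<phi>2 where "ball z0 r \<subseteq> S" "twice_differentiable_on_ball z0 r K \<phi> \<phi>1 \<phi>2"
proof -
  obtain g1 g2 g3 where d: "\<And>x. x \<in> S \<Longrightarrow> (\<phi> has_derivative blinfun_apply (g1 x)) (at x)"
      "\<And>x. x \<in> S \<Longrightarrow> (g1 has_derivative blinfun_apply (g2 x)) (at x)"
      "\<And>x. x \<in> S \<Longrightarrow> (g2 has_derivative blinfun_apply (g3 x)) (at x)"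
    and c: "continuous_on S g3"
    using assms(1) unfolding C3_on_def by blast
  have near: "\<exists>e>0. \<forall>y. dist y z0 < e \<longrightarrow> norm (g y) \<le> norm (g z0) + 1"
    if "isCont g z0" for g :: "'a \<Rightarrow> 'c::real_normed_vector"
  proof -
    have "eventually (\<lambda>y. dist (g y) (g z0) < 1) (nhds z0)"
      using that by (simp add: continuous_at tendsto_iff eventually_nhds_conv_at isCont_def)
    then obtain e where e: "e > 0" "\<And>y. dist y z0 < e \<Longrightarrow> dist (g y) (g z0) < 1"
      by (auto simp: eventually_nhds_metric)
    have "norm (g y) \<le> norm (g z0) + 1" if "dist y z0 < e" for y
      using e(2)[OF that] norm_triangle_ineq2[of "g y" "g z0"] by (simp add: dist_norm)
    then show ?thesis using e by blast
  qed
  have "isCont g1 z0" "isCont g2 z0" using d(2,3)[OF assms(3)] has_derivative_continuous by blast+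
  moreover have "isCont g3 z0" using c assms by (simp add: continuous_on_eq_continuous_at)
  ultimately obtain e1 e2 e3 where e: "e1 > 0" "e2 > 0" "e3 > 0"
    and b: "\<And>y. dist y z0 < e1 \<Longrightarrow> norm (g1 y) \<le> norm (g1 z0) + 1"
      "\<And>y. dist y z0 < e2 \<Longrightarrow> norm (g2 y) \<le> norm (g2 z0) + 1"
      "\<And>y. dist y z0 < e3 \<Longrightarrow> norm (g3 y) \<le> norm (g3 z0) + 1"
    using near by metis
  obtain e0 where e0: "e0 > 0" "ball z0 e0 \<subseteq> S" using assms open_contains_ball by blast
  define r where "r = min (min e0 e1) (min e2 e3)"
  define K where "K = (norm (g1 z0) + 1) + (norm (g2 z0) + 1) + (norm (g3 z0) + 1)"
  have sub: "ball z0 r \<subseteq> S" using e0 by (auto simp: r_def)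
  have bb: "norm (g1 z) \<le> K" "norm (g2 z) \<le> K" "norm (g3 z) \<le> K" if "z \<in> ball z0 r" for z
  proof -
    have "dist z z0 < e1" "dist z z0 < e2" "dist z z0 < e3" using that by (auto simp: r_def dist_commute)
    then show "norm (g1 z) \<le> K" "norm (g2 z) \<le> K" "norm (g3 z) \<le> K"
      using b[of z] norm_ge_zero[of "g1 z0"] norm_ge_zero[of "g2 z0"] norm_ge_zero[of "g3 z0"]
      unfolding K_def by linarith+
  qed
  have "twice_differentiable_on_ball z0 r K \<phi> g1 g2"
  proof
    show "0 < r" using e e0 by (simp add: r_def)
    show "norm (g2 z - g2 w) \<le> K * norm (z - w)" if "z \<in> ball z0 r" "w \<in> ball z0 r" for z w
      by (rule blinfun_Lipschitz[OF convex_ball _ _ that, of g2 g3]) (use sub d bb in auto)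
  qed (use sub d bb in auto)
  then show ?thesis using that sub by blast
qed

section \<open>Discrete sewing\<close>

text \<open>
  For \<open>\<theta> > 1\<close>, halving an interval gains a factor below one. The bound \<open>2/3\<close> is the worst ratio in a
  division of \<open>n \<ge> 2\<close> steps into two nearly equal parts; it occurs for \<open>n = 3\<close>.
\<close>

lemma split_powr_le:
  fixes x y :: real
  assumes \<theta>: "1 < \<theta>" and x: "0 \<le> x" "x \<le> 2/3 * (x + y)" and y: "0 \<le> y" "y \<le> 2/3 * (x + y)"
  shows "x powr \<theta> + y powr \<theta> \<le> (2/3) powr (\<theta> - 1) * (x + y) powr \<theta>"
proof -
  have le: "u powr \<theta> \<le> u * (2/3 * (x + y)) powr (\<theta> - 1)" if "0 \<le> u" "u \<le> 2/3 * (x + y)" for u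
  proof (cases "u = 0")
    case False
    then have "u powr \<theta> = u * u powr (\<theta> - 1)" using that powr_mult_base[of u "\<theta> - 1"] by simp
    also have "\<dots> \<le> u * (2/3 * (x + y)) powr (\<theta> - 1)"
      using that \<theta> by (intro mult_left_mono powr_mono2) auto
    finally show ?thesis .
  qed (use \<theta> in simp)
  have "x powr \<theta> + y powr \<theta> \<le> (x + y) * (2/3 * (x + y)) powr (\<theta> - 1)"
    using add_mono[OF le[OF x] le[OF y]] by (simp add: distrib_right)
  also have "\<dots> = (2/3) powr (\<theta> - 1) * (x + y) powr \<theta>"
  proof (cases "x + y = 0")
    case False
    then have "0 < x + y" using x y by linarith
    moreover have "(2/3 * (x + y)) powr (\<theta> - 1) = (2/3) powr (\<theta> - 1) * (x + y) powr (\<theta> - 1)"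
      by (rule powr_mult)
    ultimately show ?thesis using powr_mult_base[of "x + y" "\<theta> - 1"] by (simp add: ac_simps)
  qed (use \<theta> in simp)
  finally show ?thesis .
qed

text \<open>
  Induction on the number of steps, by division at the midpoint. The defect may contain a small multiple
  of the remainder over the left subinterval, because that subinterval is already covered by
  the induction hypothesis. So an implicit estimate for \<open>R\<close> closes without a fixed point argument.
\<close>

theorem discrete_sewing:
  fixes R :: "nat \<Rightarrow> nat \<Rightarrow> 'a::real_normed_vector"
  assumes \<theta>: "1 < \<theta>" and h: "0 < h" and nn: "0 \<le> B" "0 \<le> \<epsilon>" "0 \<le> b"
    and c: "c = (2/3) powr (\<theta> - 1)" and b: "(1 + b) * c \<le> (1 + c) / 2"
    and one: "\<And>i. p \<le> i \<Longrightarrow> i < q \<Longrightarrow> norm (R i (Suc i)) \<le> \<epsilon> * h powr \<theta>"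
    and defect: "\<And>i j k. p \<le> i \<Longrightarrow> i < j \<Longrightarrow> j < k \<Longrightarrow> k \<le> q \<Longrightarrow>
      norm (R i k - R i j - R j k) \<le> B * (real (k - i) * h) powr \<theta> + b * norm (R i j)"
  shows "p \<le> i \<Longrightarrow> i < k \<Longrightarrow> k \<le> q \<Longrightarrow> norm (R i k) \<le> (\<epsilon> + 2 * B / (1 - c)) * (real (k - i) * h) powr \<theta>"
proof (induction "k - i" arbitrary: i k rule: less_induct)
  case less
  have "(2/3) powr (\<theta> - 1) < (1::real) powr (\<theta> - 1)" using \<theta> by (intro powr_less_mono2) auto
  then have c1: "0 < c" "c < 1" using c by auto
  define M where "M = \<epsilon> + 2 * B / (1 - c)"
  have M0: "0 \<le> M" "\<epsilon> \<le> M" using nn c1 by (auto simp: M_def)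
  show ?case
  proof (cases "k = Suc i")
    case True
    have "norm (R i (Suc i)) \<le> \<epsilon> * h powr \<theta>" using less.prems True by (intro one) auto
    also have "\<dots> \<le> M * h powr \<theta>" using M0 by (intro mult_right_mono) auto
    finally show ?thesis using True by (simp add: M_def)
  next
    case False
    define j where "j = i + (k - i) div 2"
    have j: "i < j" "j < k" using False less.prems by (auto simp: j_def)
    let ?x = "real (j - i) * h" and ?y = "real (k - j) * h"
    have xy: "?x + ?y = real (k - i) * h" using j by (simp add: of_nat_diff flip: distrib_right) 
    have "3 * (j - i) \<le> 2 * (k - i)" "3 * (k - j) \<le> 2 * (k - i)" using False less.prems by (auto simp: j_def)
    then have "3 * real (j - i) \<le> 2 * real (k - i)" "3 * real (k - j) \<le> 2 * real (k - i)" by linarith+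
    then have "real (j - i) * h \<le> (2/3 * real (k - i)) * h" "real (k - j) * h \<le> (2/3 * real (k - i)) * h"
      using h by (intro mult_right_mono; simp)+
    then have xy23: "?x \<le> 2/3 * (?x + ?y)" "?y \<le> 2/3 * (?x + ?y)" unfolding xy by simp_all
    have IH: "norm (R i j) \<le> M * ?x powr \<theta>" "norm (R j k) \<le> M * ?y powr \<theta>"
      unfolding M_def using less.prems j by (intro less.hyps; linarith)+
    let ?W = "(real (k - i) * h) powr \<theta>"
    have sp: "?x powr \<theta> + ?y powr \<theta> \<le> c * ?W"
      using split_powr_le[OF \<theta> _ xy23(1) _ xy23(2)] h unfolding c xy by simp
    have "norm (R i k) \<le> norm (R i k - R i j - R j k) + norm (R i j) + norm (R j k)"
      using norm_triangle_ineq[of "R i k - R i j - R j k" "R i j + R j k"] norm_triangle_ineq[of "R i j" "R j k"] by simp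
    also have "\<dots> \<le> B * ?W + (1 + b) * (norm (R i j) + norm (R j k))"
      using defect[OF less.prems(1) j less.prems(3)] mult_nonneg_nonneg[OF nn(3) norm_ge_zero[of "R j k"]]
      by (simp add: algebra_simps)
    also have "\<dots> \<le> B * ?W + (1 + b) * (M * (?x powr \<theta> + ?y powr \<theta>))"
      using IH nn by (intro add_left_mono mult_left_mono) (auto simp: distrib_left)
    also have "\<dots> \<le> B * ?W + (1 + b) * (M * (c * ?W))"
      using sp nn M0 by (intro add_left_mono mult_left_mono) auto
    also have "\<dots> = B * ?W + ((1 + b) * c) * (M * ?W)" by (simp add: algebra_simps)
    also have "\<dots> \<le> B * ?W + ((1 + c) / 2) * (M * ?W)"
      using b M0 by (intro add_left_mono mult_right_mono) auto
    also have "\<dots> = (B + (1 + c) / 2 * M) * ?W" by (simp add: algebra_simps)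
    also have "\<dots> \<le> M * ?W"
    proof (rule mult_right_mono)
      have "B = (1 - c) / 2 * (2 * B / (1 - c))" using c1 by simp
      also have "\<dots> \<le> (1 - c) / 2 * M" using c1 nn by (intro mult_left_mono) (auto simp: M_def)
      finally show "B + (1 + c) / 2 * M \<le> M" by (simp add: field_simps)
    qed simp
    finally show ?thesis by (simp add: M_def)
  qed
qed

text \<open>
  An estimate that at most doubles a quantity over a window of fixed length, plus a constant, extends to the
  whole interval. The mesh is at most half a window, so that each window advances by at least
  \<open>\<tau> / 2\<close>.
\<close>

lemma iterate_over_windows:
  fixes u :: "nat \<Rightarrow> real"
  assumes h: "0 < h" "h \<le> \<tau> / 2" and c: "0 \<le> c" and u0: "0 \<le> u 0" and N: "real N * h \<le> T"
    and win: "\<And>p k. p \<le> k \<Longrightarrow> k \<le> N \<Longrightarrow> real (k - p) * h \<le> \<tau> \<Longrightarrow> u k \<le> 2 * u p + c"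
    and k: "k \<le> N"
  shows "u k \<le> 2 ^ nat \<lceil>2 * T / \<tau>\<rceil> * (u 0 + c)"
proof -
  have \<tau>: "0 < \<tau>" using h by linarith
  have *: "u k + c \<le> 2 ^ j * (u 0 + c)" if "k \<le> N" "real k * h \<le> real j * (\<tau> / 2)" for j k
    using that
  proof (induction j arbitrary: k)
    case 0
    then have "k = 0" using h by (simp add: mult_le_0_iff)
    then show ?case by simp
  next
    case (Suc j)
    show ?case
    proof (cases "real k * h \<le> real j * (\<tau> / 2)")
      case True
      then have "u k + c \<le> 2 ^ j * (u 0 + c)" using Suc by simp
      also have "\<dots> \<le> 2 ^ Suc j * (u 0 + c)" using u0 c by (intro mult_right_mono) auto
      finally show ?thesis .
    next
      case False
      define p where "p = nat \<lfloor>real j * (\<tau> / 2) / h\<rfloor>"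
      have x0: "0 \<le> real j * (\<tau> / 2) / h" using h \<tau> by simp
      have "real p \<le> real j * (\<tau> / 2) / h" "real j * (\<tau> / 2) / h < real p + 1"
        using x0 by (simp_all add: p_def)
      then have p: "real p * h \<le> real j * (\<tau> / 2)" "real j * (\<tau> / 2) < real p * h + h"
        using h by (simp_all add: field_simps)
      have "real p * h < real k * h" using p False by linarith
      then have pk: "p \<le> k" using h by simp
      have "real (k - p) * h = real k * h - real p * h" using pk by (simp add: of_nat_diff left_diff_distrib)
      also have "\<dots> \<le> \<tau>" using p Suc.prems h by (simp add: algebra_simps)
      finally have "u k \<le> 2 * u p + c" using win pk Suc.prems by blast
      moreover have "u p + c \<le> 2 ^ j * (u 0 + c)" using Suc.IH[of p] p pk Suc.prems by simp
      ultimately show ?thesis by simp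
    qed
  qed
  have "real N * h \<le> real (nat \<lceil>2 * T / \<tau>\<rceil>) * (\<tau> / 2)"
  proof -
    have "2 * T / \<tau> \<le> real (nat \<lceil>2 * T / \<tau>\<rceil>)" by linarith
    then have "2 * T / \<tau> * (\<tau> / 2) \<le> real (nat \<lceil>2 * T / \<tau>\<rceil>) * (\<tau> / 2)" using \<tau> by (intro mult_right_mono) auto
    then show ?thesis using N \<tau> by simp
  qed
  moreover have "real k * h \<le> real N * h" using k h by simp
  ultimately have "u k + c \<le> 2 ^ nat \<lceil>2 * T / \<tau>\<rceil> * (u 0 + c)" by (intro *) (use k in auto)
  then show ?thesis using c by linarith
qed

lemma eventually_powr_small:
  assumes "0 < a" "0 < e"
  shows "eventually (\<lambda>x. C * x powr a \<le> (e::real)) (at_right 0)"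
proof -
  have "((\<lambda>x::real. x powr a) \<longlongrightarrow> 0) (at_right 0)"
    using assms by (intro tendsto_eq_intros tendsto_powr'[where b = a and g = "\<lambda>_. a"]) (auto intro!: tendsto_eq_intros eventually_at_rightI[of 0 1])
  then have "((\<lambda>x. C * x powr a) \<longlongrightarrow> C * 0) (at_right 0)" by (intro tendsto_mult_left)
  then have "eventually (\<lambda>x. C * x powr a < e) (at_right 0)" using assms by (intro order_tendstoD(2)) auto
  then show ?thesis by (rule eventually_mono) simp
qed

section \<open>The defect of the Euler step\<close>

text \<open>
  The analytic content of the rough differential equation. The tensor product has disappeared: \<open>F\<close> stands for
  the lift of \<open>Df(y) f(y)\<close>, and Chen's relation is stated after application of \<open>F\<close>. One constant \<open>K \<ge> 1\<close>
  serves for all bounds.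
\<close>

locale rough_equation =
  fixes \<alpha> T K :: real and X :: "real \<Rightarrow> 'v::banach" and XX :: "real \<Rightarrow> real \<Rightarrow> 't::banach"
    and f0 :: "'w::banach \<Rightarrow> 'w" and f :: "'w \<Rightarrow> 'v \<Rightarrow>\<^sub>L 'w" and f1 :: "'w \<Rightarrow> 'w \<Rightarrow>\<^sub>L 'v \<Rightarrow>\<^sub>L 'w"
    and F :: "'w \<Rightarrow> 't \<Rightarrow>\<^sub>L 'w"
  assumes T: "0 < T" and \<alpha>: "1/3 < \<alpha>" "\<alpha> \<le> 1/2" and K: "1 \<le> K"
    and X_Holder: "\<And>s t. s \<in> {0..T} \<Longrightarrow> t \<in> {0..T} \<Longrightarrow> norm (X t - X s) \<le> K * \<bar>t - s\<bar> powr \<alpha>"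
    and XX_Holder: "\<And>s t. s \<in> {0..T} \<Longrightarrow> t \<in> {0..T} \<Longrightarrow> norm (XX s t) \<le> K * \<bar>t - s\<bar> powr (2 * \<alpha>)"
    and Chen: "\<And>y s u t. s \<in> {0..T} \<Longrightarrow> u \<in> {0..T} \<Longrightarrow> t \<in> {0..T} \<Longrightarrow>
      blinfun_apply (F y) (XX s t - XX s u - XX u t)
      = blinfun_apply (blinfun_apply (f1 y) (blinfun_apply (f y) (X u - X s))) (X t - X u)"
    and XX_continuous: "continuous_on ({0..T} \<times> {0..T}) (\<lambda>(s, t). XX s t)"
    and f_derivative: "\<And>y. (f has_derivative blinfun_apply (f1 y)) (at y)"
    and C11_f: "C11 K f" and C11_f1: "C11 K f1" and C11_F: "C11 K F"
    and f0_Lipschitz: "\<And>y z. norm (f0 y - f0 z) \<le> K * norm (y - z)"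
begin

definition rough_step :: "'w \<Rightarrow> real \<Rightarrow> real \<Rightarrow> 'w" where
  "rough_step y s t = blinfun_apply (f y) (X t - X s) + blinfun_apply (F y) (XX s t)"

definition davie_rem :: "(real \<Rightarrow> 'w) \<Rightarrow> real \<Rightarrow> real \<Rightarrow> 'w" where
  "davie_rem Y s t = Y t - Y s - rough_step (Y s) s t - (t - s) *\<^sub>R f0 (Y s)"

text \<open>
  The part of an increment that is not of first order in the driver; it is of order \<open>2 * \<alpha>\<close>.
\<close>

definition offset :: "'w \<Rightarrow> 'w \<Rightarrow> 'v \<Rightarrow> 'w" where
  "offset y y' v = y' - y - blinfun_apply (f y) v"

lemma mult_norm_le: "norm (blinfun_apply L x) \<le> a * b" if "norm L \<le> a" "norm x \<le> b"
  using norm_blinfun[of L x] that mult_mono[OF that order_trans[OF norm_ge_zero that(1)] norm_ge_zero]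
  by linarith

text \<open>
  Chen's relation cancels the terms of order \<open>\<alpha>\<close> and \<open>2 * \<alpha>\<close>.
\<close>

lemma rough_step_defect:
  assumes "s \<in> {0..T}" "u \<in> {0..T}" "t \<in> {0..T}"
  shows "rough_step y s u + rough_step y' u t - rough_step y s t
    = blinfun_apply (f y' - f (y + blinfun_apply (f y) (X u - X s)) + euler_rem f f1 y (X u - X s)) (X t - X u)
      + blinfun_apply (F y' - F y) (XX u t)"
proof -
  have "blinfun_apply (F y) (XX s t) = blinfun_apply (F y) (XX s u) + blinfun_apply (F y) (XX u t)
      + blinfun_apply (blinfun_apply (f1 y) (blinfun_apply (f y) (X u - X s))) (X t - X u)"
    using Chen[OF assms, of y] by (simp add: blinfun.diff_right blinfun.add_right algebra_simps)
  then show ?thesis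
    by (simp add: rough_step_def euler_rem_def taylor_rem_def blinfun.diff_right blinfun.diff_left blinfun.add_left algebra_simps)
qed

text \<open>
  Here and below \<open>a\<close> stands for \<open>(t - s) powr \<alpha>\<close>, so that all estimates are polynomial in \<open>a\<close>. The offset enters
  linearly, which later makes the a priori bounds linear in the size of the drift.
\<close>

lemma rough_step_defect_bound:
  assumes m: "s \<in> {0..T}" "u \<in> {0..T}" "t \<in> {0..T}" and a: "0 \<le> a" "a \<le> 1"
    and su: "norm (X u - X s) \<le> K * a" and ut: "norm (X t - X u) \<le> K * a" "norm (XX u t) \<le> K * a\<^sup>2"
  shows "norm (rough_step y s u + rough_step y' u t - rough_step y s t)
    \<le> 2 * K\<^sup>2 * a * norm (offset y y' (X u - X s)) + 2 * K ^ 6 * a ^ 3"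
proof -
  let ?e = "offset y y' (X u - X s)" and ?p = "y + blinfun_apply (f y) (X u - X s)"
  have e: "y' = ?p + ?e" by (simp add: offset_def)
  have K0: "0 \<le> K" using K by simp
  have "norm (f y' - f ?p) \<le> K * norm (y' - ?p)" by (rule C11D(3)[OF C11_f])
  also have "y' - ?p = ?e" by (simp add: offset_def)
  finally have 1: "norm (f y' - f ?p) \<le> K * norm ?e" .
  have "norm (euler_rem f f1 y (X u - X s)) \<le> K ^ 3 * norm (X u - X s) ^ 2"
    by (rule euler_rem_bounds[OF f_derivative C11_f C11_f1])
  also have "\<dots> \<le> K ^ 3 * (K * a) ^ 2" using K0 su by (intro mult_left_mono power_mono) auto
  finally have 2: "norm (euler_rem f f1 y (X u - X s)) \<le> K ^ 3 * (K * a) ^ 2" .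
  have fx: "norm (blinfun_apply (f y) (X u - X s)) \<le> K * (K * a)"
    by (rule mult_norm_le[OF C11D(2)[OF C11_f] su])
  have "norm (F y' - F y) \<le> K * norm (y' - y)" by (rule C11D(3)[OF C11_F])
  also have "y' - y = blinfun_apply (f y) (X u - X s) + ?e" by (simp add: offset_def)
  also have "K * norm (blinfun_apply (f y) (X u - X s) + ?e) \<le> K * (K * (K * a) + norm ?e)"
    using fx by (intro mult_left_mono K0 norm_triangle_mono) auto
  finally have 3: "norm (F y' - F y) \<le> K * (K * (K * a) + norm ?e)" .
  have "norm (rough_step y s u + rough_step y' u t - rough_step y s t)
    \<le> (K * norm ?e + K ^ 3 * (K * a) ^ 2) * (K * a) + (K * (K * (K * a) + norm ?e)) * (K * a\<^sup>2)"
    unfolding rough_step_defect[OF m] by (intro norm_triangle_mono mult_norm_le 1 2 3 ut)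
  also have "\<dots> = K\<^sup>2 * a * norm ?e + K\<^sup>2 * norm ?e * (a * a) + (K ^ 6 * a ^ 3 + K ^ 4 * a ^ 3)"
    by (simp add: algebra_simps power2_eq_square eval_nat_numeral)
  also have "\<dots> \<le> K\<^sup>2 * a * norm ?e + K\<^sup>2 * norm ?e * (a * 1) + (K ^ 6 * a ^ 3 + K ^ 6 * a ^ 3)"
    using a K by (intro add_mono mult_left_mono mult_right_mono power_increasing) auto
  finally show ?thesis by (simp add: algebra_simps)
qed

text \<open>
  The estimate behind stability: the defects of two paths differ by a multiple of the distance \<open>\<zeta>\<close> of
  the paths, apart from the difference of the offsets. The bound \<open>E\<close> concerns the first path alone,
  so that an unknown path can be compared with a known one.
\<close>

lemma rough_step_defect_difference:
  assumes m: "s \<in> {0..T}" "u \<in> {0..T}" "t \<in> {0..T}" and a: "0 \<le> a" "a \<le> 1"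
    and su: "norm (X u - X s) \<le> K * a" and ut: "norm (X t - X u) \<le> K * a" "norm (XX u t) \<le> K * a\<^sup>2"
    and \<zeta>: "norm (y - z) \<le> \<zeta>" and E: "norm (offset y y' (X u - X s)) \<le> E * a\<^sup>2"
  shows "norm (rough_step y s u + rough_step y' u t - rough_step y s t - (rough_step z s u + rough_step z' u t - rough_step z s t))
    \<le> 2 * K\<^sup>2 * a * norm (offset y y' (X u - X s) - offset z z' (X u - X s)) + 5 * K ^ 6 * (E + 1) * \<zeta> * a ^ 3"
proof (cases "a = 0")
  case True
  then show ?thesis using su ut unfolding rough_step_defect[OF m] by (simp add: blinfun.zero_right)
next
  case False
  let ?v = "X u - X s"
  let ?e = "offset y y' ?v" and ?d = "offset z z' ?v" and ?p = "y + blinfun_apply (f y) ?v" and ?q = "z + blinfun_apply (f z) ?v"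
  have a0: "0 < a" using False a by simp
  have e: "y' = ?p + ?e" "z' = ?q + ?d" by (simp_all add: offset_def)
  have K0: "0 \<le> K" using K by simp
  have \<zeta>0: "0 \<le> \<zeta>" using \<zeta> norm_ge_zero order_trans by blast
  have "0 \<le> E * a\<^sup>2" using E norm_ge_zero order_trans by blast
  then have E0: "0 \<le> E" using a0 by (simp add: zero_le_mult_iff)
  let ?D = "norm (?e - ?d)"
  have fv: "norm (blinfun_apply (f y) ?v) \<le> K * (K * a)"
    by (rule mult_norm_le[OF C11D(2)[OF C11_f] su])
  have "norm (f y - f z) \<le> K * norm (y - z)" by (rule C11D(3)[OF C11_f])
  also have "\<dots> \<le> K * \<zeta>" by (intro mult_left_mono \<zeta> K0)
  finally have fdv: "norm (blinfun_apply (f y) ?v - blinfun_apply (f z) ?v) \<le> (K * \<zeta>) * (K * a)"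
    using mult_norm_le[of "f y - f z", OF _ su] by (simp add: blinfun.diff_left)
  have pq: "norm (?p - ?q) \<le> \<zeta> * (2 * K\<^sup>2)"
  proof -
    have "?p - ?q = (y - z) + (blinfun_apply (f y) ?v - blinfun_apply (f z) ?v)" by simp
    also have "norm \<dots> \<le> \<zeta> + (K * \<zeta>) * (K * a)" by (intro norm_triangle_mono \<zeta> fdv)
    also have "\<dots> = \<zeta> * (1 + K\<^sup>2 * a)" by (simp add: algebra_simps power2_eq_square)
    also have "\<dots> \<le> \<zeta> * (K\<^sup>2 + K\<^sup>2 * 1)" using \<zeta>0 a K by (intro mult_left_mono add_mono) auto
    finally show ?thesis by simp
  qed
  have "norm (f (?p + ?e) - f ?p - (f (?q + ?d) - f ?q)) \<le> K * (norm (?p - ?q) * norm ?e + ?D)"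
    by (rule C11D(4)[OF C11_f])
  also have "\<dots> \<le> K * (\<zeta> * (2 * K\<^sup>2) * (E * a\<^sup>2) + ?D)"
    using \<zeta>0 by (intro mult_left_mono add_right_mono mult_mono pq E K0) auto
  finally have 1: "norm (f y' - f ?p - (f z' - f ?q)) \<le> K * (\<zeta> * (2 * K\<^sup>2) * (E * a\<^sup>2) + ?D)"
    unfolding e[symmetric] .
  have "norm (euler_rem f f1 y ?v - euler_rem f f1 z ?v) \<le> 3 * K ^ 3 * norm (y - z) * norm ?v ^ 2"
    by (rule euler_rem_bounds[OF f_derivative C11_f C11_f1])
  also have "\<dots> \<le> 3 * K ^ 3 * \<zeta> * (K * a) ^ 2" using K0 su \<zeta> \<zeta>0 by (intro mult_mono power_mono) auto
  finally have 2: "norm (euler_rem f f1 y ?v - euler_rem f f1 z ?v) \<le> 3 * K ^ 3 * \<zeta> * (K * a) ^ 2" .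
  let ?y = "blinfun_apply (f y) ?v + ?e" and ?z = "blinfun_apply (f z) ?v + ?d"
  have yz: "y' = y + ?y" "z' = z + ?z" by (simp_all add: offset_def)
  have yn: "norm ?y \<le> K * (K * a) + E * a" 
  proof -
    have "E * a\<^sup>2 \<le> E * a" using E0 a by (intro mult_left_mono) (auto simp: power2_eq_square mult_left_le)
    then show ?thesis using fv E by (intro norm_triangle_mono) auto
  qed
  have yzn: "norm (?y - ?z) \<le> (K * \<zeta>) * (K * a) + ?D"
    using norm_triangle_mono[OF fdv order_refl[of ?D]] by (simp add: algebra_simps)
  have "norm (F (y + ?y) - F y - (F (z + ?z) - F z)) \<le> K * (norm (y - z) * norm ?y + norm (?y - ?z))"
    by (rule C11D(4)[OF C11_F])
  also have "\<dots> \<le> K * (\<zeta> * (K * (K * a) + E * a) + ((K * \<zeta>) * (K * a) + ?D))"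
    using \<zeta>0 by (intro mult_left_mono add_mono mult_mono yn yzn \<zeta> K0) auto
  finally have 3: "norm (F y' - F y - (F z' - F z)) \<le> K * (\<zeta> * (K * (K * a) + E * a) + ((K * \<zeta>) * (K * a) + ?D))"
    unfolding yz[symmetric] .
  have "rough_step y s u + rough_step y' u t - rough_step y s t - (rough_step z s u + rough_step z' u t - rough_step z s t)
    = blinfun_apply ((f y' - f ?p - (f z' - f ?q)) + (euler_rem f f1 y ?v - euler_rem f f1 z ?v)) (X t - X u)
      + blinfun_apply (F y' - F y - (F z' - F z)) (XX u t)"
    unfolding rough_step_defect[OF m] by (simp add: blinfun.diff_left blinfun.add_left)
  also have "norm \<dots> \<le> (K * (\<zeta> * (2 * K\<^sup>2) * (E * a\<^sup>2) + ?D) + 3 * K ^ 3 * \<zeta> * (K * a) ^ 2) * (K * a)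
      + (K * (\<zeta> * (K * (K * a) + E * a) + ((K * \<zeta>) * (K * a) + ?D))) * (K * a\<^sup>2)"
    by (intro norm_triangle_mono mult_norm_le 1 2 3 ut)
  also have "\<dots> = (K\<^sup>2 * a * ?D + K\<^sup>2 * ?D * (a * a))
      + (2 * (K ^ 4 * E) + 3 * K ^ 6 + 2 * K ^ 4 + K ^ 2 * E) * (\<zeta> * a ^ 3)"
    by (simp add: algebra_simps power2_eq_square eval_nat_numeral)
  also have "\<dots> \<le> (K\<^sup>2 * a * ?D + K\<^sup>2 * ?D * (a * 1))
      + (2 * (K ^ 6 * E) + 3 * K ^ 6 + 2 * K ^ 6 + K ^ 6 * E) * (\<zeta> * a ^ 3)"
    using a K E0 \<zeta>0 by (intro add_mono mult_left_mono mult_right_mono power_increasing) auto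
  also have "\<dots> \<le> 2 * K\<^sup>2 * a * ?D + 5 * K ^ 6 * (E + 1) * \<zeta> * a ^ 3"
    using mult_nonneg_nonneg[of "2 * (K ^ 6 * E)" "\<zeta> * a ^ 3"] a K E0 \<zeta>0 by (simp add: algebra_simps)
  finally show ?thesis .
qed

section \<open>A priori bounds on grids\<close>

text \<open>
  A discrete path that follows the Euler step up to an error of the order of the defect.
\<close>

definition grid_path :: "real \<Rightarrow> real \<Rightarrow> real \<Rightarrow> nat \<Rightarrow> (nat \<Rightarrow> 'w) \<Rightarrow> bool" where
  "grid_path C0 a h N y \<longleftrightarrow> 0 \<le> a \<and> 0 < h \<and> a + real N * h \<le> T \<and>
     (\<forall>k<N. norm (y (Suc k) - y k - rough_step (y k) (a + real k * h) (a + real (Suc k) * h) - h *\<^sub>R f0 (y k))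
        \<le> C0 * h powr (3 * \<alpha>))"

text \<open>
  The drift is subtracted as a Riemann sum, not as \<open>(t - s) f0(y)\<close>. The sum is additive, so it does not contribute to
  the defect. This is essential for stability: the drift is only Lipschitz, and a difference
  \<open>(f0(y j) - f0(y i)) - (f0(z j) - f0(z i))\<close> has no decay in time beyond that of \<open>y - z\<close> itself.
\<close>

definition grid_rem :: "real \<Rightarrow> real \<Rightarrow> (nat \<Rightarrow> 'w) \<Rightarrow> nat \<Rightarrow> nat \<Rightarrow> 'w" where
  "grid_rem a h y i j = y j - y i - rough_step (y i) (a + real i * h) (a + real j * h) - (\<Sum>k=i..<j. h *\<^sub>R f0 (y k))"

lemma grid_path_mono_const: "grid_path C0 a h N y \<Longrightarrow> C0 \<le> C \<Longrightarrow> grid_path C a h N y"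
  unfolding grid_path_def by (meson mult_right_mono order_trans powr_ge_zero)

lemma grid_times:
  assumes "grid_path C0 a h N y" "k \<le> N"
  shows "a + real k * h \<in> {0..T}"
proof -
  have "real k * h \<le> real N * h" using assms by (intro mult_right_mono) (auto simp: grid_path_def)
  moreover have "0 \<le> real k * h" "0 \<le> a" "a + real N * h \<le> T" using assms(1) by (auto simp: grid_path_def)
  ultimately show ?thesis by auto
qed

text \<open>
  The last condition is the smallness hypothesis of the sewing estimate, with the coefficient of the offset
  in the defect as \<open>b\<close>.
\<close>

definition small_window :: "real \<Rightarrow> real \<Rightarrow> bool" where
  "small_window \<theta> \<tau> \<longleftrightarrow> 0 < \<tau> \<and> \<tau> \<le> 1 \<and> (1 + 2 * K\<^sup>2 * \<tau> powr \<alpha>) * (2/3) powr (\<theta> - 1) \<le> (1 + (2/3) powr (\<theta> - 1)) / 2"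

definition sewing_const :: "real \<Rightarrow> real" where "sewing_const \<theta> = 2 / (1 - (2/3) powr (\<theta> - 1))"

lemma two_thirds_powr_less_1: "1 < \<theta> \<Longrightarrow> (2/3::real) powr (\<theta> - 1) < 1"
  using powr_less_mono2[of "\<theta> - 1" "2/3::real" 1] by simp

lemma sewing_const_pos: "1 < \<theta> \<Longrightarrow> 0 < sewing_const \<theta>"
  using two_thirds_powr_less_1[of \<theta>] by (simp add: sewing_const_def)

lemma eventually_small_window:
  assumes "1 < \<theta>"
  shows "eventually (small_window \<theta>) (at_right 0)"
proof -
  let ?c = "(2/3::real) powr (\<theta> - 1)"
  have c: "0 < ?c" "?c < 1" using two_thirds_powr_less_1[OF assms] by auto
  have "eventually (\<lambda>\<tau>. 2 * K\<^sup>2 * ?c * \<tau> powr \<alpha> \<le> (1 - ?c) / 2) (at_right 0)"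
    using \<alpha> c by (intro eventually_powr_small) auto
  moreover have "eventually (\<lambda>\<tau>::real. 0 < \<tau> \<and> \<tau> < 1) (at_right 0)" by (intro eventually_at_rightI[of 0 1]) auto
  ultimately show ?thesis
    unfolding small_window_def by eventually_elim (simp add: algebra_simps add_divide_distrib)
qed

lemma powr_multiples: "0 < w \<Longrightarrow> w powr (2 * \<alpha>) = (w powr \<alpha>)\<^sup>2" "0 < w \<Longrightarrow> w powr (3 * \<alpha>) = (w powr \<alpha>) ^ 3"
  by (simp_all add: powr_power mult.commute)

text \<open>
  All estimates over an interval of length at most \<open>w \<le> 1\<close> become polynomial in \<open>b = w powr \<alpha>\<close>; the
  length itself is at most \<open>b\<^sup>2\<close> because \<open>\<alpha> \<le> 1/2\<close>.
\<close>

lemma window_powers: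
  assumes w: "0 < w" "w \<le> 1" and b: "b = w powr \<alpha>"
  shows "0 \<le> b" "b \<le> 1" "w powr (2 * \<alpha>) = b\<^sup>2" "w powr (3 * \<alpha>) = b ^ 3" "w \<le> b\<^sup>2"
    and "s \<in> {0..T} \<Longrightarrow> t \<in> {0..T} \<Longrightarrow> \<bar>t - s\<bar> \<le> w \<Longrightarrow> norm (X t - X s) \<le> K * b"
    and "s \<in> {0..T} \<Longrightarrow> t \<in> {0..T} \<Longrightarrow> \<bar>t - s\<bar> \<le> w \<Longrightarrow> norm (XX s t) \<le> K * b\<^sup>2"
proof -
  have K0: "0 \<le> K" using K by simp
  show "0 \<le> b" "b \<le> 1" using w \<alpha> powr_mono2[of \<alpha> w 1] by (auto simp: b)
  show b2: "w powr (2 * \<alpha>) = b\<^sup>2" "w powr (3 * \<alpha>) = b ^ 3" using powr_multiples[OF w(1)] by (simp_all add: b)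
  have "w powr 1 \<le> w powr (2 * \<alpha>)" using w \<alpha> by (intro powr_mono') auto
  then show "w \<le> b\<^sup>2" using w b2 by simp
  assume m: "s \<in> {0..T}" "t \<in> {0..T}" and le: "\<bar>t - s\<bar> \<le> w"
  show "norm (X t - X s) \<le> K * b"
    using X_Holder[OF m] mult_left_mono[OF powr_mono2[OF _ _ le, of \<alpha>] K0] \<alpha> by (simp add: b)
  show "norm (XX s t) \<le> K * b\<^sup>2"
    using XX_Holder[OF m] mult_left_mono[OF powr_mono2[OF _ _ le, of "2 * \<alpha>"] K0] \<alpha> b2 by simp
qed

lemma grid_rem_defect:
  assumes "i \<le> j" "j \<le> k"
  shows "grid_rem a h y i k - grid_rem a h y i j - grid_rem a h y j k
    = rough_step (y i) (a + real i * h) (a + real j * h) + rough_step (y j) (a + real j * h) (a + real k * h)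
      - rough_step (y i) (a + real i * h) (a + real k * h)"
  using sum.atLeastLessThan_concat[OF assms, of "\<lambda>k. h *\<^sub>R f0 (y k)"]
  by (simp add: grid_rem_def algebra_simps)

lemma grid_offset:
  "offset (y i) (y j) (X (a + real j * h) - X (a + real i * h))
    = blinfun_apply (F (y i)) (XX (a + real i * h) (a + real j * h)) + (\<Sum>k=i..<j. h *\<^sub>R f0 (y k)) + grid_rem a h y i j"
  by (simp add: offset_def grid_rem_def rough_step_def)

lemma drift_bound:
  fixes g :: "nat \<Rightarrow> 'w"
  assumes "0 \<le> h" "i \<le> j" "\<And>k. i \<le> k \<Longrightarrow> k < j \<Longrightarrow> norm (g k) \<le> A"
  shows "norm (\<Sum>k=i..<j. h *\<^sub>R g k) \<le> A * (real (j - i) * h)"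
proof -
  have "norm (\<Sum>k=i..<j. h *\<^sub>R g k) \<le> (\<Sum>k=i..<j. h * A)"
    using assms by (intro order_trans[OF norm_sum] sum_mono) (auto intro!: mult_left_mono)
  then show ?thesis by (simp add: algebra_simps)
qed

lemma window_remainder_bound:
  assumes y: "grid_path C0 a h N y" and \<tau>: "small_window (3 * \<alpha>) \<tau>" and C0: "0 \<le> C0"
    and q: "q \<le> N" "real (q - p) * h \<le> \<tau>" and A: "0 \<le> A" "\<And>k. p \<le> k \<Longrightarrow> k < q \<Longrightarrow> norm (f0 (y k)) \<le> A"
    and ik: "p \<le> i" "i < k" "k \<le> q"
  shows "norm (grid_rem a h y i k) \<le> (C0 + 6 * K ^ 6 * (1 + A) * sewing_const (3 * \<alpha>)) * (real (k - i) * h) powr (3 * \<alpha>)"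
proof -
  let ?\<theta> = "3 * \<alpha>" and ?c = "(2/3) powr (3 * \<alpha> - 1)" and ?R = "grid_rem a h y"
  define B where "B = 6 * K ^ 6 * (1 + A)"
  have h: "0 < h" using y by (simp add: grid_path_def)
  have K0: "0 \<le> K" using K by simp
  have "norm (?R i k) \<le> (C0 + 2 * B / (1 - ?c)) * (real (k - i) * h) powr ?\<theta>"
  proof (rule discrete_sewing[where R = ?R and p = p and q = q and b = "2 * K\<^sup>2 * \<tau> powr \<alpha>" and c = ?c, OF _ h _ C0 _ refl _ _ _ ik])
    show "1 < ?\<theta>" using \<alpha> by simp
    show "0 \<le> B" using A K0 by (simp add: B_def)
    show "0 \<le> 2 * K\<^sup>2 * \<tau> powr \<alpha>" by simp
    show "(1 + 2 * K\<^sup>2 * \<tau> powr \<alpha>) * ?c \<le> (1 + ?c) / 2" using \<tau> by (simp add: small_window_def)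
  next
    fix i assume "p \<le> i" "i < q"
    then show "norm (?R i (Suc i)) \<le> C0 * h powr ?\<theta>"
      using y q by (simp add: grid_path_def grid_rem_def)
  next
    fix i j k assume ijk: "p \<le> i" "i < j" "j < k" "k \<le> q"
    let ?s = "a + real i * h" and ?u = "a + real j * h" and ?t = "a + real k * h" and ?w = "real (k - i) * h"
    have m: "?s \<in> {0..T}" "?u \<in> {0..T}" "?t \<in> {0..T}" using ijk q by (intro grid_times[OF y]; simp)+
    have w: "0 < ?w" "\<bar>?u - ?s\<bar> \<le> ?w" "\<bar>?t - ?u\<bar> \<le> ?w" "real (j - i) * h \<le> ?w"
      using h ijk by (auto simp: of_nat_diff simp flip: left_diff_distrib)
    have "real (k - i) * h \<le> real (q - p) * h" using ijk h by (intro mult_right_mono) auto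
    then have w\<tau>: "?w \<le> \<tau>" using q by linarith
    then have w1: "?w \<le> 1" using \<tau> by (simp add: small_window_def)
    define b where "b = ?w powr \<alpha>"
    note win = window_powers[OF w(1) w1 b_def]
    note b = win(1,2) and b2 = win(3,4) and X1 = win(6) and XX1 = win(7)
    have b\<tau>: "b \<le> \<tau> powr \<alpha>" using w w\<tau> \<alpha> unfolding b_def by (intro powr_mono2) auto
    note wb = win(5)
    have "norm (offset (y i) (y j) (X ?u - X ?s)) \<le> K * (K * b\<^sup>2) + A * b\<^sup>2 + norm (?R i j)"
      unfolding grid_offset
    proof (intro norm_triangle_mono order_refl mult_norm_le C11D(2)[OF C11_F] XX1 m w)
      have "norm (\<Sum>k=i..<j. h *\<^sub>R f0 (y k)) \<le> A * (real (j - i) * h)"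
        using ijk h by (intro drift_bound A(2)) auto
      also have "\<dots> \<le> A * b\<^sup>2" using w wb A by (intro mult_left_mono) auto
      finally show "norm (\<Sum>k=i..<j. h *\<^sub>R f0 (y k)) \<le> A * b\<^sup>2" .
    qed
    then have off: "2 * K\<^sup>2 * b * norm (offset (y i) (y j) (X ?u - X ?s)) \<le> 2 * K\<^sup>2 * b * (K * (K * b\<^sup>2) + A * b\<^sup>2 + norm (?R i j))"
      using b by (intro mult_left_mono) auto
    have "norm (?R i k - ?R i j - ?R j k) \<le> 2 * K\<^sup>2 * b * norm (offset (y i) (y j) (X ?u - X ?s)) + 2 * K ^ 6 * b ^ 3"
      using ijk unfolding grid_rem_defect[OF less_imp_le[OF ijk(2)] less_imp_le[OF ijk(3)]]
      by (intro rough_step_defect_bound m b X1 XX1 w)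
    also have "\<dots> \<le> 2 * K\<^sup>2 * b * (K * (K * b\<^sup>2) + A * b\<^sup>2 + norm (?R i j)) + 2 * K ^ 6 * b ^ 3" using off by simp
    also have "\<dots> = (2 * K ^ 4 + 2 * K\<^sup>2 * A + 2 * K ^ 6) * b ^ 3 + 2 * K\<^sup>2 * b * norm (?R i j)"
      by (simp add: algebra_simps eval_nat_numeral)
    also have "\<dots> \<le> (2 * K ^ 6 + 2 * K ^ 6 * A + 2 * K ^ 6) * b ^ 3 + 2 * K\<^sup>2 * (\<tau> powr \<alpha>) * norm (?R i j)"
      using b b\<tau> K A by (intro add_mono mult_right_mono mult_left_mono power_increasing) auto
    also have "\<dots> \<le> B * b ^ 3 + 2 * K\<^sup>2 * (\<tau> powr \<alpha>) * norm (?R i j)"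
      using b A K0 by (intro add_right_mono mult_right_mono) (auto simp: B_def algebra_simps)
    finally show "norm (?R i k - ?R i j - ?R j k) \<le> B * ?w powr ?\<theta> + 2 * K\<^sup>2 * \<tau> powr \<alpha> * norm (?R i j)"
      by (simp add: b2)
  qed
  then show ?thesis by (simp add: B_def sewing_const_def)
qed

lemma window_increment_bound:
  assumes y: "grid_path C0 a h N y" and \<tau>: "0 < \<tau>" "\<tau> \<le> 1"
    and k: "p \<le> k" "k \<le> N" "real (k - p) * h \<le> \<tau>" and A: "0 \<le> A" "\<And>j. p \<le> j \<Longrightarrow> j < k \<Longrightarrow> norm (f0 (y j)) \<le> A"
    and R: "p < k \<Longrightarrow> norm (grid_rem a h y p k) \<le> C * (real (k - p) * h) powr (3 * \<alpha>)" and C: "0 \<le> C"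
  shows "norm (y k - y p) \<le> (2 * K\<^sup>2 + A + C) * (real (k - p) * h) powr \<alpha>"
proof (cases "p = k")
  case False
  then have pk: "p < k" using k by simp
  have h: "0 < h" using y by (simp add: grid_path_def)
  have K0: "0 \<le> K" using K by simp
  let ?s = "a + real p * h" and ?t = "a + real k * h" and ?w = "real (k - p) * h"
  have m: "?s \<in> {0..T}" "?t \<in> {0..T}" using k by (intro grid_times[OF y]; simp)+
  have w: "0 < ?w" "\<bar>?t - ?s\<bar> = ?w" using h pk by (auto simp: of_nat_diff simp flip: left_diff_distrib)
  have w1: "?w \<le> 1" using k \<tau> by linarith
  have le: "?w powr b \<le> ?w powr \<alpha>" if "\<alpha> \<le> b" for b using w w1 that by (intro powr_mono') auto
  have "y k - y p = (blinfun_apply (f (y p)) (X ?t - X ?s) + blinfun_apply (F (y p)) (XX ?s ?t))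
      + (\<Sum>j=p..<k. h *\<^sub>R f0 (y j)) + grid_rem a h y p k"
    by (simp add: grid_rem_def rough_step_def)
  also have "norm \<dots> \<le> (K * (K * ?w powr \<alpha>) + K * (K * ?w powr (2 * \<alpha>))) + A * ?w + C * ?w powr (3 * \<alpha>)"
    by (intro norm_triangle_mono mult_norm_le C11D(2)[OF C11_f] C11D(2)[OF C11_F] drift_bound A(2) R pk)
      (use X_Holder[OF m] XX_Holder[OF m] w h k in auto)
  also have "\<dots> \<le> (K * (K * ?w powr \<alpha>) + K * (K * ?w powr \<alpha>)) + A * ?w powr \<alpha> + C * ?w powr \<alpha>"
    using K0 A C \<alpha> le[of 1] w by (intro add_mono mult_left_mono le) auto
  finally show ?thesis by (simp add: algebra_simps power2_eq_square)
qed simp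

text \<open>
  The length of the window depends neither on the starting value nor on the size of the drift there, because the bound on the
  remainder is linear in \<open>A\<close>. Hence a drift of linear growth cannot cause explosion.
\<close>

lemma window_drift_bound:
  assumes y: "grid_path C0 a h N y" and \<tau>: "small_window (3 * \<alpha>) \<tau>" and C0: "0 \<le> C0"
    and small: "K * (1 + 6 * K ^ 6 * sewing_const (3 * \<alpha>)) * \<tau> powr \<alpha> \<le> 1/2"
    and q: "p \<le> q" "q \<le> N" "real (q - p) * h \<le> \<tau>" and k: "p \<le> k" "k \<le> q"
  shows "norm (f0 (y k)) \<le> 2 * norm (f0 (y p)) + 2 * K * (2 * K\<^sup>2 + C0 + 6 * K ^ 6 * sewing_const (3 * \<alpha>))"
proof -
  have h: "0 < h" using y by (simp add: grid_path_def)
  have K0: "0 \<le> K" using K by simp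
  have s0: "0 < sewing_const (3 * \<alpha>)" using \<alpha> by (intro sewing_const_pos) simp
  have \<tau>': "0 < \<tau>" "\<tau> \<le> 1" using \<tau> by (auto simp: small_window_def)
  define S where "S = 6 * K ^ 6 * sewing_const (3 * \<alpha>)"
  have S0: "0 \<le> S" using K0 s0 by (simp add: S_def)
  define A where "A = Max ((\<lambda>k. norm (f0 (y k))) ` {p..q})"
  have A: "norm (f0 (y j)) \<le> A" if "p \<le> j" "j \<le> q" for j using that by (auto simp: A_def)
  have A0: "0 \<le> A" using A[of p] q norm_ge_zero order_trans by blast
  have le: "norm (f0 (y j)) \<le> norm (f0 (y p)) + K * (2 * K\<^sup>2 + C0 + S) + A / 2" if j: "p \<le> j" "j \<le> q" for j
  proof -
    have "real (j - p) * h \<le> real (q - p) * h" using h j by (intro mult_right_mono) auto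
    then have w: "real (j - p) * h \<le> \<tau>" using q by linarith
    have "norm (y j - y p) \<le> (2 * K\<^sup>2 + A + (C0 + 6 * K ^ 6 * (1 + A) * sewing_const (3 * \<alpha>))) * (real (j - p) * h) powr \<alpha>"
    proof (rule window_increment_bound[OF y \<tau>' j(1) _ w A0 A])
      show "norm (grid_rem a h y p j) \<le> (C0 + 6 * K ^ 6 * (1 + A) * sewing_const (3 * \<alpha>)) * (real (j - p) * h) powr (3 * \<alpha>)" if "p < j"
        using that q j by (intro window_remainder_bound[OF y \<tau> C0 q(2,3) A0 A]) auto
    qed (use j q A0 K0 C0 s0 in auto)
    also have "\<dots> \<le> (2 * K\<^sup>2 + A + (C0 + 6 * K ^ 6 * (1 + A) * sewing_const (3 * \<alpha>))) * \<tau> powr \<alpha>"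
      using w h \<alpha> A0 C0 s0 K0 by (intro mult_left_mono powr_mono2) auto
    also have "\<dots> = (2 * K\<^sup>2 + C0 + S) * \<tau> powr \<alpha> + A * ((1 + S) * \<tau> powr \<alpha>)"
      by (simp add: S_def algebra_simps)
    finally have "K * norm (y j - y p) \<le> K * ((2 * K\<^sup>2 + C0 + S) * \<tau> powr \<alpha>) + A * (K * (1 + S) * \<tau> powr \<alpha>)"
      using mult_left_mono[OF _ K0] by (fastforce simp: algebra_simps)
    also have "\<dots> \<le> K * ((2 * K\<^sup>2 + C0 + S) * 1) + A * (1/2)"
      using small K0 A0 C0 S0 \<tau>' \<alpha> powr_mono2[of \<alpha> \<tau> 1]
      by (intro add_mono mult_left_mono) (auto simp: S_def)
    finally show ?thesis
      using f0_Lipschitz[of "y j" "y p"] norm_triangle_ineq2[of "f0 (y j)" "f0 (y p)"] by simp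
  qed
  \<comment> \<open>The maximum A occurs on both sides, with the factor one half on the right.\<close>
  have "A \<le> norm (f0 (y p)) + K * (2 * K\<^sup>2 + C0 + S) + A / 2"
    unfolding A_def using le q by (subst Max_le_iff) (auto simp flip: A_def)
  then have "A \<le> 2 * norm (f0 (y p)) + 2 * K * (2 * K\<^sup>2 + C0 + S)" by (simp add: algebra_simps)
  then show ?thesis using A[OF k] by (simp add: S_def)
qed

definition apriori_bound :: "real \<Rightarrow> real \<Rightarrow> real \<Rightarrow> real \<Rightarrow> bool" where
  "apriori_bound \<tau> C0 A0 C \<longleftrightarrow> 0 \<le> C \<and>
     (\<forall>a h N y. grid_path C0 a h N y \<longrightarrow> h \<le> \<tau> / 2 \<longrightarrow> norm (f0 (y 0)) \<le> A0 \<longrightarrow>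
      (\<forall>k\<le>N. norm (f0 (y k)) \<le> C) \<and>
      (\<forall>i k. i < k \<longrightarrow> k \<le> N \<longrightarrow> real (k - i) * h \<le> \<tau> \<longrightarrow>
         norm (grid_rem a h y i k) \<le> C * (real (k - i) * h) powr (3 * \<alpha>) \<and>
         norm (y k - y i) \<le> C * (real (k - i) * h) powr \<alpha>))"

lemma apriori_boundD:
  assumes "apriori_bound \<tau> C0 A0 C"
  shows "0 \<le> C"
    and "grid_path C0 a h N y \<Longrightarrow> h \<le> \<tau> / 2 \<Longrightarrow> norm (f0 (y 0)) \<le> A0 \<Longrightarrow> k \<le> N \<Longrightarrow> norm (f0 (y k)) \<le> C"
    and "grid_path C0 a h N y \<Longrightarrow> h \<le> \<tau> / 2 \<Longrightarrow> norm (f0 (y 0)) \<le> A0 \<Longrightarrow> i < k \<Longrightarrow> k \<le> N \<Longrightarrow> real (k - i) * h \<le> \<tau> \<Longrightarrow>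
      norm (grid_rem a h y i k) \<le> C * (real (k - i) * h) powr (3 * \<alpha>)"
    and "grid_path C0 a h N y \<Longrightarrow> h \<le> \<tau> / 2 \<Longrightarrow> norm (f0 (y 0)) \<le> A0 \<Longrightarrow> i < k \<Longrightarrow> k \<le> N \<Longrightarrow> real (k - i) * h \<le> \<tau> \<Longrightarrow>
      norm (y k - y i) \<le> C * (real (k - i) * h) powr \<alpha>"
  using assms unfolding apriori_bound_def by simp_all

theorem grid_path_apriori:
  obtains \<tau> where "0 < \<tau>" "\<tau> \<le> 1" "\<And>C0 A0. 0 \<le> C0 \<Longrightarrow> 0 \<le> A0 \<Longrightarrow> \<exists>C. apriori_bound \<tau> C0 A0 C"
proof -
  have th: "1 < 3 * \<alpha>" using \<alpha> by simp
  have "eventually (\<lambda>\<tau>. K * (1 + 6 * K ^ 6 * sewing_const (3 * \<alpha>)) * \<tau> powr \<alpha> \<le> 1/2) (at_right 0)"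
    using \<alpha> by (intro eventually_powr_small) auto
  with eventually_small_window[OF th]
  have "eventually (\<lambda>\<tau>. small_window (3 * \<alpha>) \<tau> \<and> K * (1 + 6 * K ^ 6 * sewing_const (3 * \<alpha>)) * \<tau> powr \<alpha> \<le> 1/2) (at_right 0)"
    by eventually_elim simp
  then obtain \<tau> where \<tau>: "small_window (3 * \<alpha>) \<tau>" and small: "K * (1 + 6 * K ^ 6 * sewing_const (3 * \<alpha>)) * \<tau> powr \<alpha> \<le> 1/2"
    using eventually_happens'[OF trivial_limit_at_right_real] by blast
  have \<tau>': "0 < \<tau>" "\<tau> \<le> 1" using \<tau> by (auto simp: small_window_def)
  have K0: "0 \<le> K" using K by simp
  have s0: "0 < sewing_const (3 * \<alpha>)" using th by (rule sewing_const_pos)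
  show ?thesis
  proof (rule that[OF \<tau>'])
    fix C0 A0 :: real assume C0: "0 \<le> C0" and A0: "0 \<le> A0"
    define c where "c = 2 * K * (2 * K\<^sup>2 + C0 + 6 * K ^ 6 * sewing_const (3 * \<alpha>))"
    have c0: "0 \<le> c" using C0 K0 s0 by (simp add: c_def)
    define A where "A = 2 ^ nat \<lceil>2 * T / \<tau>\<rceil> * (A0 + c)"
    have A: "0 \<le> A" using A0 c0 by (simp add: A_def)
    define CR where "CR = C0 + 6 * K ^ 6 * (1 + A) * sewing_const (3 * \<alpha>)"
    have CR0: "0 \<le> CR" using C0 A K0 s0 by (simp add: CR_def)
    let ?C = "2 * K\<^sup>2 + A + CR"
    have C: "A \<le> ?C" "CR \<le> ?C" using A CR0 by auto
    show "\<exists>C. apriori_bound \<tau> C0 A0 C"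
      unfolding apriori_bound_def
    proof (intro exI[of _ ?C] conjI allI impI)
      show "0 \<le> ?C" using A CR0 by simp
      fix a h N y assume y: "grid_path C0 a h N y" and h\<tau>: "h \<le> \<tau> / 2" and y0: "norm (f0 (y 0)) \<le> A0"
      have h: "0 < h" "0 \<le> a" "a + real N * h \<le> T" using y by (auto simp: grid_path_def)
      have f0A: "norm (f0 (y k)) \<le> A" if "k \<le> N" for k
      proof -
        have "norm (f0 (y k)) \<le> 2 ^ nat \<lceil>2 * T / \<tau>\<rceil> * (norm (f0 (y 0)) + c)"
        proof (rule iterate_over_windows[OF h(1) h\<tau> c0 _ _ _ that])
          show "real N * h \<le> T" using h by linarith
          fix p k assume "p \<le> k" "k \<le> N" "real (k - p) * h \<le> \<tau>"
          then show "norm (f0 (y k)) \<le> 2 * norm (f0 (y p)) + c"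
            unfolding c_def by (intro window_drift_bound[OF y \<tau> C0 small, of p k]) auto
        qed simp
        also have "\<dots> \<le> A" using y0 by (simp add: A_def)
        finally show ?thesis .
      qed
      then show "norm (f0 (y k)) \<le> ?C" if "k \<le> N" for k using C(1) that order_trans by blast
      fix i k assume ik: "i < k" "k \<le> N" "real (k - i) * h \<le> \<tau>"
      have R: "norm (grid_rem a h y i k) \<le> CR * (real (k - i) * h) powr (3 * \<alpha>)"
        unfolding CR_def using ik by (intro window_remainder_bound[OF y \<tau> C0 ik(2,3) A f0A]) auto
      also have "\<dots> \<le> ?C * (real (k - i) * h) powr (3 * \<alpha>)" using C by (intro mult_right_mono) auto
      finally show "norm (grid_rem a h y i k) \<le> ?C * (real (k - i) * h) powr (3 * \<alpha>)" .
      show "norm (y k - y i) \<le> ?C * (real (k - i) * h) powr \<alpha>"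
        using ik by (intro window_increment_bound[OF y \<tau>' _ ik(2,3) A f0A R CR0]) auto
    qed
  qed
qed

section \<open>Stability of grid paths\<close>

text \<open>
  Sewing with the exponent \<open>\<theta>'\<close> between \<open>1\<close> and \<open>3 * \<alpha>\<close> turns the one-step errors of order \<open>3 * \<alpha>\<close> into the small
  factor \<open>h powr \<gamma>\<close>.
\<close>

definition \<theta>' :: real where "\<theta>' = (1 + 3 * \<alpha>) / 2"
definition \<gamma> :: real where "\<gamma> = (3 * \<alpha> - 1) / 2"

lemma \<theta>'_\<gamma>: "1 < \<theta>'" "\<theta>' \<le> 3 * \<alpha>" "0 < \<gamma>" "\<gamma> \<le> \<alpha>" "3 * \<alpha> = \<gamma> + \<theta>'"
  using \<alpha> by (auto simp: \<theta>'_def \<gamma>_def field_simps)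

lemma window_stability:
  assumes y: "grid_path C0 a h N y" and z: "grid_path C0 a h N z" and C0: "0 \<le> C0"
    and \<tau>: "small_window \<theta>' \<tau>"
    and s1: "2 * K\<^sup>2 * \<tau> powr \<alpha> \<le> 1/4" and s2: "(K + 9 * K ^ 6 * (E + 1) * sewing_const \<theta>') * \<tau> powr 1 \<le> 1/4"
    and q: "p \<le> q" "q \<le> N" "real (q - p) * h \<le> \<tau>"
    and A: "0 \<le> A" "\<And>k. p \<le> k \<Longrightarrow> k < q \<Longrightarrow> norm (f0 (y k)) \<le> A"
    and CR: "0 \<le> CR" "\<And>i k. p \<le> i \<Longrightarrow> i < k \<Longrightarrow> k \<le> q \<Longrightarrow> norm (grid_rem a h y i k) \<le> CR * (real (k - i) * h) powr (3 * \<alpha>)"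
    and E: "E = K\<^sup>2 + A + CR"
    and k: "p \<le> k" "k \<le> q"
  shows "norm (y k - z k) \<le> 2 * norm (y p - z p) + 4 * C0 * h powr \<gamma>"
proof -
  let ?c = "(2/3) powr (\<theta>' - 1)" and ?R = "\<lambda>i k. grid_rem a h y i k - grid_rem a h z i k"
  have h: "0 < h" using y by (simp add: grid_path_def)
  have K0: "0 \<le> K" using K by simp
  have \<tau>': "0 < \<tau>" "\<tau> \<le> 1" using \<tau> by (auto simp: small_window_def)
  have s0: "0 < sewing_const \<theta>'" using \<theta>'_\<gamma>(1) by (rule sewing_const_pos)
  define \<zeta> where "\<zeta> = Max ((\<lambda>k. norm (y k - z k)) ` {p..q})"
  have \<zeta>: "norm (y j - z j) \<le> \<zeta>" if "p \<le> j" "j \<le> q" for j using that by (auto simp: \<zeta>_def)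
  have \<zeta>0: "0 \<le> \<zeta>" using \<zeta>[of p] q norm_ge_zero order_trans by blast
  have E0: "0 \<le> E" using A CR by (simp add: E)
  have DD: "norm (\<Sum>k=i..<j. h *\<^sub>R (f0 (y k) - f0 (z k))) \<le> (K * \<zeta>) * (real (j - i) * h)" if "p \<le> i" "i \<le> j" "j \<le> q" for i j
  proof (rule drift_bound[OF less_imp_le[OF h] that(2)])
    fix k assume "i \<le> k" "k < j"
    then have "K * norm (y k - z k) \<le> K * \<zeta>" using that by (intro mult_left_mono \<zeta> K0) auto
    then show "norm (f0 (y k) - f0 (z k)) \<le> K * \<zeta>" using f0_Lipschitz[of "y k" "z k"] by linarith
  qed
  have "K ^ 4 * 1 \<le> K ^ 6 * (E + 1)" using K E0 by (intro mult_mono power_increasing) auto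
  then have K46: "K ^ 4 \<le> K ^ 6 * (E + 1)" by simp
  define B where "B = 9 * K ^ 6 * (E + 1) * \<zeta>"
  have B0: "0 \<le> B" using K0 E0 \<zeta>0 by (simp add: B_def)
  have RB: "norm (?R i k) \<le> (2 * C0 * h powr \<gamma> + B * sewing_const \<theta>') * (real (k - i) * h) powr \<theta>'" if ik: "p \<le> i" "i < k" "k \<le> q" for i k
  proof -
    have "norm (?R i k) \<le> (2 * C0 * h powr \<gamma> + 2 * B / (1 - ?c)) * (real (k - i) * h) powr \<theta>'"
    proof (rule discrete_sewing[where R = ?R and p = p and q = q and b = "2 * K\<^sup>2 * \<tau> powr \<alpha>" and c = ?c, OF \<theta>'_\<gamma>(1) h B0 _ _ refl _ _ _ ik])
      show "0 \<le> 2 * C0 * h powr \<gamma>" using C0 by simp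
      show "0 \<le> 2 * K\<^sup>2 * \<tau> powr \<alpha>" by simp
      show "(1 + 2 * K\<^sup>2 * \<tau> powr \<alpha>) * ?c \<le> (1 + ?c) / 2" using \<tau> by (simp add: small_window_def)
    next
      fix i assume "p \<le> i" "i < q"
      then have "norm (grid_rem a h y i (Suc i)) \<le> C0 * h powr (3 * \<alpha>)" "norm (grid_rem a h z i (Suc i)) \<le> C0 * h powr (3 * \<alpha>)"
        using y z q by (auto simp: grid_path_def grid_rem_def)
      then have "norm (?R i (Suc i)) \<le> 2 * C0 * h powr (3 * \<alpha>)"
        using norm_triangle_ineq4[of "grid_rem a h y i (Suc i)" "grid_rem a h z i (Suc i)"] by linarith
      then show "norm (?R i (Suc i)) \<le> 2 * C0 * h powr \<gamma> * h powr \<theta>'"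
        by (simp add: \<theta>'_\<gamma>(5) powr_add mult.assoc)
    next
      fix i j k assume ijk: "p \<le> i" "i < j" "j < k" "k \<le> q"
      let ?s = "a + real i * h" and ?u = "a + real j * h" and ?t = "a + real k * h" and ?w = "real (k - i) * h"
      have m: "?s \<in> {0..T}" "?u \<in> {0..T}" "?t \<in> {0..T}" using ijk q by (intro grid_times[OF y]; simp)+
      have w: "0 < ?w" "\<bar>?u - ?s\<bar> \<le> ?w" "\<bar>?t - ?u\<bar> \<le> ?w" "real (j - i) * h \<le> ?w"
        using h ijk by (auto simp: of_nat_diff simp flip: left_diff_distrib)
      have "real (k - i) * h \<le> real (q - p) * h" using ijk h by (intro mult_right_mono) auto
      then have w\<tau>: "?w \<le> \<tau>" using q by linarith
      then have w1: "?w \<le> 1" using \<tau>' by linarith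
      define b where "b = ?w powr \<alpha>"
      note win = window_powers[OF w(1) w1 b_def]
      note b = win(1,2) and b2 = win(3,4) and X1 = win(6) and XX1 = win(7)
      have b\<tau>: "b \<le> \<tau> powr \<alpha>" using w w\<tau> \<alpha> unfolding b_def by (intro powr_mono2) auto
      have wb: "real (j - i) * h \<le> b\<^sup>2" using win(5) w(4) by linarith
      have zi: "norm (y i - z i) \<le> \<zeta>" using ijk by (intro \<zeta>) auto
      let ?oy = "offset (y i) (y j) (X ?u - X ?s)" and ?oz = "offset (z i) (z j) (X ?u - X ?s)"
      have oy: "norm ?oy \<le> E * b\<^sup>2"
      proof -
        have "norm (\<Sum>k=i..<j. h *\<^sub>R f0 (y k)) \<le> A * (real (j - i) * h)"
          using ijk h by (intro drift_bound A(2)) auto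
        also have "\<dots> \<le> A * b\<^sup>2" using wb A(1) by (intro mult_left_mono) auto
        finally have d: "norm (\<Sum>k=i..<j. h *\<^sub>R f0 (y k)) \<le> A * b\<^sup>2" .
        have "norm (grid_rem a h y i j) \<le> CR * (real (j - i) * h) powr (3 * \<alpha>)" using ijk by (intro CR(2)) auto
        also have "\<dots> \<le> CR * ?w powr (3 * \<alpha>)" using w(4) h \<alpha> CR(1) by (intro mult_left_mono powr_mono2) auto
        also have "\<dots> \<le> CR * b\<^sup>2" unfolding b2 using b CR(1) by (intro mult_left_mono power_decreasing) auto
        finally have r: "norm (grid_rem a h y i j) \<le> CR * b\<^sup>2" .
        have "norm ?oy \<le> K * (K * b\<^sup>2) + A * b\<^sup>2 + CR * b\<^sup>2"
          unfolding grid_offset by (intro norm_triangle_mono mult_norm_le C11D(2)[OF C11_F] XX1 m w d r)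
        then show ?thesis by (simp add: E algebra_simps power2_eq_square)
      qed
      have oyz: "norm (?oy - ?oz) \<le> 2 * K\<^sup>2 * \<zeta> * b\<^sup>2 + norm (?R i j)"
      proof -
        have "norm (F (y i) - F (z i)) \<le> K * \<zeta>"
          using C11D(3)[OF C11_F, of "y i" "z i"] mult_left_mono[OF zi K0] by linarith
        then have f: "norm (blinfun_apply (F (y i) - F (z i)) (XX ?s ?u)) \<le> K * \<zeta> * (K * b\<^sup>2)"
          by (intro mult_norm_le XX1 m w)
        have "norm (\<Sum>k=i..<j. h *\<^sub>R (f0 (y k) - f0 (z k))) \<le> (K * \<zeta>) * (real (j - i) * h)"
          using ijk by (intro DD) auto
        also have "\<dots> \<le> (K * \<zeta>) * b\<^sup>2" using wb K0 \<zeta>0 by (intro mult_left_mono) auto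
        finally have d: "norm (\<Sum>k=i..<j. h *\<^sub>R (f0 (y k) - f0 (z k))) \<le> (K * \<zeta>) * b\<^sup>2" .
        have "(\<Sum>k=i..<j. h *\<^sub>R (f0 (y k) - f0 (z k))) = (\<Sum>k=i..<j. h *\<^sub>R f0 (y k)) - (\<Sum>k=i..<j. h *\<^sub>R f0 (z k))"
          by (simp add: scaleR_diff_right sum_subtractf)
        then have eq: "?oy - ?oz = blinfun_apply (F (y i) - F (z i)) (XX ?s ?u) + (\<Sum>k=i..<j. h *\<^sub>R (f0 (y k) - f0 (z k))) + ?R i j"
          by (simp add: grid_offset blinfun.diff_left)
        have "norm (?oy - ?oz) \<le> K * \<zeta> * (K * b\<^sup>2) + (K * \<zeta>) * b\<^sup>2 + norm (?R i j)"
          unfolding eq by (intro norm_triangle_mono f d order_refl)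
        also have "\<dots> \<le> K * \<zeta> * (K * b\<^sup>2) + (K * K * \<zeta>) * b\<^sup>2 + norm (?R i j)"
          using K \<zeta>0 by (intro add_mono order_refl mult_right_mono) auto
        finally show ?thesis by (simp add: algebra_simps power2_eq_square)
      qed
      have ij: "i \<le> j" "j \<le> k" using ijk by auto
      have "norm (?R i k - ?R i j - ?R j k) = norm ((grid_rem a h y i k - grid_rem a h y i j - grid_rem a h y j k) - (grid_rem a h z i k - grid_rem a h z i j - grid_rem a h z j k))"
        by (simp add: algebra_simps)
      also have "\<dots> \<le> 2 * K\<^sup>2 * b * norm (?oy - ?oz) + 5 * K ^ 6 * (E + 1) * \<zeta> * b ^ 3"
        unfolding grid_rem_defect[OF ij] by (intro rough_step_defect_difference m b X1 XX1 w zi oy)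
      also have "\<dots> \<le> 2 * K\<^sup>2 * b * (2 * K\<^sup>2 * \<zeta> * b\<^sup>2 + norm (?R i j)) + 5 * K ^ 6 * (E + 1) * \<zeta> * b ^ 3"
        using b by (intro add_right_mono mult_left_mono oyz) auto
      also have "\<dots> = K ^ 4 * (4 * (\<zeta> * b ^ 3)) + 5 * K ^ 6 * (E + 1) * \<zeta> * b ^ 3 + b * (2 * K\<^sup>2 * norm (?R i j))"
        by (simp add: algebra_simps eval_nat_numeral)
      also have "\<dots> \<le> K ^ 6 * (E + 1) * (4 * (\<zeta> * b ^ 3)) + 5 * K ^ 6 * (E + 1) * \<zeta> * b ^ 3 + \<tau> powr \<alpha> * (2 * K\<^sup>2 * norm (?R i j))"
        using b \<zeta>0 by (intro add_mono order_refl mult_right_mono K46 b\<tau>) auto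
      also have "\<dots> = B * b ^ 3 + 2 * K\<^sup>2 * \<tau> powr \<alpha> * norm (?R i j)" by (simp add: B_def algebra_simps)
      also have "\<dots> \<le> B * ?w powr \<theta>' + 2 * K\<^sup>2 * \<tau> powr \<alpha> * norm (?R i j)"
        unfolding b2(2)[symmetric] using w w1 \<theta>'_\<gamma> B0 by (intro add_right_mono mult_left_mono powr_mono') auto
      finally show "norm (?R i k - ?R i j - ?R j k) \<le> B * ?w powr \<theta>' + 2 * K\<^sup>2 * \<tau> powr \<alpha> * norm (?R i j)" .
    qed
    then show ?thesis by (simp add: sewing_const_def mult.commute[of B])
  qed
  let ?\<epsilon> = "2 * C0 * h powr \<gamma>"
  have \<epsilon>0: "0 \<le> ?\<epsilon>" using C0 by simp
  have le: "norm (y k - z k) \<le> norm (y p - z p) * (5/4) + \<zeta> / 4 + ?\<epsilon>" if k: "p \<le> k" "k \<le> q" for k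
  proof (cases "p = k")
    case True
    have "norm (y p - z p) \<le> norm (y p - z p) * (5/4) + \<zeta> / 4 + ?\<epsilon>"
      using \<zeta>0 \<epsilon>0 norm_ge_zero[of "y p - z p"] by linarith
    then show ?thesis unfolding True .
  next
    case False
    let ?s = "a + real p * h" and ?t = "a + real k * h" and ?w = "real (k - p) * h"
    have m: "?s \<in> {0..T}" "?t \<in> {0..T}" using k q by (intro grid_times[OF y]; simp)+
    have w: "0 < ?w" "\<bar>?t - ?s\<bar> = ?w" using h k False by (auto simp: of_nat_diff simp flip: left_diff_distrib)
    have "?w \<le> real (q - p) * h" using h k by (intro mult_right_mono) auto
    then have w\<tau>: "?w \<le> \<tau>" using q by linarith
    have wp: "?w powr b \<le> \<tau> powr \<alpha>" if "\<alpha> \<le> b" for b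
    proof -
      have "?w powr b \<le> ?w powr \<alpha>" using w w\<tau> \<tau>' that by (intro powr_mono') auto
      also have "\<dots> \<le> \<tau> powr \<alpha>" using w w\<tau> \<alpha> by (intro powr_mono2) auto
      finally show ?thesis .
    qed
    let ?Z = "norm (y p - z p)"
    have X1: "norm (X ?t - X ?s) \<le> K * \<tau> powr \<alpha>"
      using X_Holder[OF m] mult_left_mono[OF wp[of \<alpha>] K0] w by simp
    have X2: "norm (XX ?s ?t) \<le> K * \<tau> powr \<alpha>"
      using XX_Holder[OF m] mult_left_mono[OF wp[of "2 * \<alpha>"] K0] w \<alpha> by simp
    have "?w powr \<theta>' \<le> ?w powr 1" using w w\<tau> \<tau>' \<theta>'_\<gamma> by (intro powr_mono') auto
    then have wth: "?w powr \<theta>' \<le> \<tau>" using w w\<tau> by simp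
    have "norm (?R p k) \<le> (?\<epsilon> + B * sewing_const \<theta>') * ?w powr \<theta>'" using False k by (intro RB) auto
    also have "\<dots> \<le> (?\<epsilon> + B * sewing_const \<theta>') * \<tau>" using wth \<epsilon>0 B0 s0 by (intro mult_left_mono) auto
    also have "\<dots> \<le> ?\<epsilon> + B * sewing_const \<theta>' * \<tau>" using \<epsilon>0 \<tau>' by (simp add: distrib_right mult_left_le)
    finally have r: "norm (?R p k) \<le> ?\<epsilon> + B * sewing_const \<theta>' * \<tau>" .
    have "norm (\<Sum>k=p..<k. h *\<^sub>R (f0 (y k) - f0 (z k))) \<le> (K * \<zeta>) * ?w" using k by (intro DD) auto
    also have "\<dots> \<le> (K * \<zeta>) * \<tau>" using w\<tau> K0 \<zeta>0 by (intro mult_left_mono) auto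
    finally have d: "norm (\<Sum>k=p..<k. h *\<^sub>R (f0 (y k) - f0 (z k))) \<le> (K * \<zeta>) * \<tau>" .
    have "(\<Sum>k=p..<k. h *\<^sub>R (f0 (y k) - f0 (z k))) = (\<Sum>k=p..<k. h *\<^sub>R f0 (y k)) - (\<Sum>k=p..<k. h *\<^sub>R f0 (z k))"
      by (simp add: scaleR_diff_right sum_subtractf)
    then have eq: "y k - z k = (y p - z p) + blinfun_apply (f (y p) - f (z p)) (X ?t - X ?s) + blinfun_apply (F (y p) - F (z p)) (XX ?s ?t)
        + (\<Sum>k=p..<k. h *\<^sub>R (f0 (y k) - f0 (z k))) + ?R p k"
      by (simp add: grid_rem_def rough_step_def blinfun.diff_left)
    have "norm (y k - z k) \<le> ?Z + (K * ?Z) * (K * \<tau> powr \<alpha>) + (K * ?Z) * (K * \<tau> powr \<alpha>) + (K * \<zeta>) * \<tau> + (?\<epsilon> + B * sewing_const \<theta>' * \<tau>)"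
      unfolding eq by (intro norm_triangle_mono mult_norm_le C11D(3)[OF C11_f] C11D(3)[OF C11_F] X1 X2 d r order_refl)
    also have "\<dots> = ?Z + ?Z * (2 * K\<^sup>2 * \<tau> powr \<alpha>) + \<zeta> * ((K + 9 * K ^ 6 * (E + 1) * sewing_const \<theta>') * \<tau> powr 1) + ?\<epsilon>"
      using \<tau>' by (simp add: B_def algebra_simps power2_eq_square)
    also have "\<dots> \<le> ?Z + ?Z * (1/4) + \<zeta> * (1/4) + ?\<epsilon>"
      using s1 s2 \<zeta>0 by (intro add_mono mult_left_mono order_refl) auto
    finally show ?thesis by simp
  qed
  \<comment> \<open>The maximal distance \<open>\<zeta>\<close> is absorbed into the left hand side.\<close>
  have "\<zeta> \<le> norm (y p - z p) * (5/4) + \<zeta> / 4 + ?\<epsilon>"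
    unfolding \<zeta>_def using le q by (subst Max_le_iff) (auto simp flip: \<zeta>_def)
  moreover have "0 \<le> norm (y p - z p)" by simp
  ultimately have "\<zeta> \<le> 2 * norm (y p - z p) + 4 * C0 * h powr \<gamma>" using \<epsilon>0 by linarith
  then show ?thesis using \<zeta>[OF k] by linarith
qed

definition stability_bound :: "real \<Rightarrow> real \<Rightarrow> real \<Rightarrow> real \<Rightarrow> bool" where
  "stability_bound C0 A0 M h0 \<longleftrightarrow> 0 \<le> M \<and> 0 < h0 \<and>
     (\<forall>a h N y z k. grid_path C0 a h N y \<longrightarrow> grid_path C0 a h N z \<longrightarrow> h \<le> h0 \<longrightarrow> norm (f0 (y 0)) \<le> A0 \<longrightarrow> k \<le> N \<longrightarrow>
        norm (y k - z k) \<le> M * (norm (y 0 - z 0) + h powr \<gamma>))"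

lemma stability_boundD:
  assumes "stability_bound C0 A0 M h0"
  shows "0 \<le> M" "0 < h0"
    and "grid_path C0 a h N y \<Longrightarrow> grid_path C0 a h N z \<Longrightarrow> h \<le> h0 \<Longrightarrow> norm (f0 (y 0)) \<le> A0 \<Longrightarrow> k \<le> N \<Longrightarrow>
      norm (y k - z k) \<le> M * (norm (y 0 - z 0) + h powr \<gamma>)"
  using assms unfolding stability_bound_def by simp_all

text \<open>
  The bound on the initial drift concerns one of the two paths; the other one is controlled by comparison with it.
  So the theorem applies to any scheme whose one-step errors are known.
\<close>

theorem grid_path_stability:
  assumes C0: "0 \<le> C0" and A0: "0 \<le> A0"
  shows "\<exists>M h0. stability_bound C0 A0 M h0"
proof -
  obtain \<tau>1 where \<tau>1: "0 < \<tau>1" "\<tau>1 \<le> 1" and ap: "\<And>C0 A0. 0 \<le> C0 \<Longrightarrow> 0 \<le> A0 \<Longrightarrow> \<exists>C. apriori_bound \<tau>1 C0 A0 C"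
    using grid_path_apriori by metis
  obtain C where C: "apriori_bound \<tau>1 C0 A0 C" using ap[OF C0 A0] by blast
  note C0' = apriori_boundD(1)[OF C]
  define E where "E = K\<^sup>2 + C + C"
  have "eventually (\<lambda>\<tau>. 2 * K\<^sup>2 * \<tau> powr \<alpha> \<le> 1/4) (at_right 0)"
    using \<alpha> by (intro eventually_powr_small) auto
  moreover have "eventually (\<lambda>\<tau>. (K + 9 * K ^ 6 * (E + 1) * sewing_const \<theta>') * \<tau> powr 1 \<le> 1/4) (at_right 0)"
    by (intro eventually_powr_small) auto
  moreover have "eventually (\<lambda>\<tau>. \<tau> < \<tau>1) (at_right 0)"
    using \<tau>1 by (intro eventually_at_rightI[of 0 \<tau>1]) auto
  moreover note eventually_small_window[OF \<theta>'_\<gamma>(1)]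
  ultimately have "eventually (\<lambda>\<tau>. small_window \<theta>' \<tau> \<and> 2 * K\<^sup>2 * \<tau> powr \<alpha> \<le> 1/4 \<and> (K + 9 * K ^ 6 * (E + 1) * sewing_const \<theta>') * \<tau> powr 1 \<le> 1/4 \<and> \<tau> < \<tau>1) (at_right 0)"
    by eventually_elim blast
  then obtain \<tau> where \<tau>: "small_window \<theta>' \<tau>" "2 * K\<^sup>2 * \<tau> powr \<alpha> \<le> 1/4" "(K + 9 * K ^ 6 * (E + 1) * sewing_const \<theta>') * \<tau> powr 1 \<le> 1/4" "\<tau> < \<tau>1"
    using eventually_happens'[OF trivial_limit_at_right_real] by blast
  have \<tau>0: "0 < \<tau>" using \<tau>(1) by (simp add: small_window_def)
  define J where "J = nat \<lceil>2 * T / \<tau>\<rceil>"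
  have "stability_bound C0 A0 (2 ^ J * (1 + 4 * C0)) (\<tau> / 2)"
    unfolding stability_bound_def
  proof (intro conjI allI impI)
    show "0 \<le> 2 ^ J * (1 + 4 * C0)" using C0 by simp
    show "0 < \<tau> / 2" using \<tau>0 by simp
    fix a h N y z k
    assume y: "grid_path C0 a h N y" and z: "grid_path C0 a h N z" and h: "h \<le> \<tau> / 2" and y0: "norm (f0 (y 0)) \<le> A0" and k: "k \<le> N"
    have hh: "0 < h" "0 \<le> a" "a + real N * h \<le> T" using y by (auto simp: grid_path_def)
    have h1: "h \<le> \<tau>1 / 2" using h \<tau> by linarith
    have "norm (y k - z k) \<le> 2 ^ J * (norm (y 0 - z 0) + 4 * C0 * h powr \<gamma>)"
      unfolding J_def
    proof (rule iterate_over_windows[OF hh(1) h, where u = "\<lambda>k. norm (y k - z k)", OF _ _ _ _ k])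
      show "0 \<le> 4 * C0 * h powr \<gamma>" using C0 by simp
      show "real N * h \<le> T" using hh by linarith
      fix p k assume pk: "p \<le> k" "k \<le> N" "real (k - p) * h \<le> \<tau>"
      show "norm (y k - z k) \<le> 2 * norm (y p - z p) + 4 * C0 * h powr \<gamma>"
      proof (rule window_stability[OF y z C0 \<tau>(1-3) pk C0' _ C0' _ E_def pk(1) order_refl])
        show "norm (f0 (y j)) \<le> C" if "p \<le> j" "j < k" for j using apriori_boundD(2)[OF C y h1 y0] that pk by auto
        fix i j assume ij: "p \<le> i" "i < j" "j \<le> k"
        have "real (j - i) * h \<le> real (k - p) * h" using ij hh by (intro mult_right_mono) auto
        then have "real (j - i) * h \<le> \<tau>1" using pk \<tau> by linarith
        then show "norm (grid_rem a h y i j) \<le> C * (real (j - i) * h) powr (3 * \<alpha>)" using apriori_boundD(3)[OF C y h1 y0] ij pk by auto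
      qed
    qed simp
    also have "\<dots> \<le> 2 ^ J * ((1 + 4 * C0) * (norm (y 0 - z 0) + h powr \<gamma>))"
      using C0 by (intro mult_left_mono) (auto simp: algebra_simps)
    finally show "norm (y k - z k) \<le> 2 ^ J * (1 + 4 * C0) * (norm (y 0 - z 0) + h powr \<gamma>)" by (simp add: mult.assoc)
  qed
  then show ?thesis by blast
qed

end

section \<open>Solutions in the sense of Davie\<close>

lemma powr_le_powr_times:
  fixes w :: real
  assumes "0 \<le> w" "w \<le> T" "a \<le> b"
  shows "w powr b \<le> T powr (b - a) * w powr a"
proof (cases "w = 0")
  case False
  have "w powr b = w powr (b - a) * w powr a" using False assms by (simp flip: powr_add)
  also have "\<dots> \<le> T powr (b - a) * w powr a" using assms by (intro mult_right_mono powr_mono2) auto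
  finally show ?thesis .
qed simp

lemma nonpos_if_le_powr_inverse_nat:
  fixes x :: real
  assumes \<gamma>: "0 < \<gamma>" and c: "0 \<le> c" and le: "\<And>N. N0 \<le> N \<Longrightarrow> x \<le> M * (c / real N) powr \<gamma>"
  shows "x \<le> 0"
proof (rule tendsto_lowerbound)
  have "(\<lambda>N. c / real N) \<longlonglongrightarrow> 0" by (rule lim_const_over_n)
  then have "(\<lambda>N. (c / real N) powr \<gamma>) \<longlonglongrightarrow> 0"
    using \<gamma> c by (intro tendsto_eq_intros tendsto_powr'[where b = \<gamma> and g = "\<lambda>_. \<gamma>"]) auto
  then have "(\<lambda>N. M * (c / real N) powr \<gamma>) \<longlonglongrightarrow> M * 0" by (rule tendsto_mult_left)
  then show "(\<lambda>N. M * (c / real N) powr \<gamma>) \<longlonglongrightarrow> 0" by simp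
  show "eventually (\<lambda>N. x \<le> M * (c / real N) powr \<gamma>) sequentially"
    using le by (auto simp: eventually_sequentially)
qed simp

lemma summable_increments_imp_convergent:
  fixes y :: "nat \<Rightarrow> 'a::banach"
  assumes "summable (\<lambda>n. y (Suc n) - y n)"
  shows "convergent y"
proof -
  have "convergent (\<lambda>n. \<Sum>k<n. y (Suc k) - y k)" using assms by (simp add: summable_iff_convergent)
  then have "convergent (\<lambda>n. (y n - y 0) + y 0)"
    unfolding sum_lessThan_telescope by (intro convergent_add convergent_const)
  then show ?thesis by simp
qed

context rough_equation
begin

text \<open>
  Davie's notion of a solution. It contains no integral, and its restrictions to grids are grid paths.
\<close>

definition davie_solution :: "(real \<Rightarrow> 'w) \<Rightarrow> bool" where
  "davie_solution Y \<longleftrightarrow> (\<exists>C\<ge>0. \<forall>s t. 0 \<le> s \<longrightarrow> s \<le> t \<longrightarrow> t \<le> T \<longrightarrow> norm (davie_rem Y s t) \<le> C * (t - s) powr (3 * \<alpha>))"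

lemma rough_step_bound:
  assumes "s \<in> {0..T}" "t \<in> {0..T}"
  shows "norm (rough_step y s t) \<le> K * (K * \<bar>t - s\<bar> powr \<alpha>) + K * (K * \<bar>t - s\<bar> powr (2 * \<alpha>))"
  unfolding rough_step_def
  by (intro norm_triangle_mono mult_norm_le C11D(2)[OF C11_f] C11D(2)[OF C11_F] X_Holder XX_Holder assms)

lemma davie_solution_bounds:
  assumes "davie_solution Y"
  obtains L where "0 \<le> L" "\<And>s t. s \<in> {0..T} \<Longrightarrow> t \<in> {0..T} \<Longrightarrow> norm (Y t - Y s) \<le> L * \<bar>t - s\<bar> powr \<alpha>"
    "\<And>t. t \<in> {0..T} \<Longrightarrow> norm (f0 (Y t)) \<le> L"
proof -
  obtain C where C: "0 \<le> C" and dav: "\<And>s t. 0 \<le> s \<Longrightarrow> s \<le> t \<Longrightarrow> t \<le> T \<Longrightarrow> norm (davie_rem Y s t) \<le> C * (t - s) powr (3 * \<alpha>)"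
    using assms unfolding davie_solution_def by blast
  have K0: "0 \<le> K" using K by simp
  define c where "c = K * (K * 1) + K * (K * T powr (2 * \<alpha> - \<alpha>)) + C * T powr (3 * \<alpha> - \<alpha>)"
  have c: "0 \<le> c" using C K0 by (simp add: c_def)
  have inc: "norm (Y t - Y s) \<le> (c + T powr (1 - \<alpha>) * norm (f0 (Y s))) * (t - s) powr \<alpha>" if st: "0 \<le> s" "s \<le> t" "t \<le> T" for s t
  proof -
    have m: "s \<in> {0..T}" "t \<in> {0..T}" using st by auto
    have p: "(t - s) powr b \<le> T powr (b - \<alpha>) * (t - s) powr \<alpha>" if "\<alpha> \<le> b" for b
      using st that by (intro powr_le_powr_times) auto
    have eq: "Y t - Y s = rough_step (Y s) s t + (t - s) *\<^sub>R f0 (Y s) + davie_rem Y s t" by (simp add: davie_rem_def)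
    have "norm (Y t - Y s) \<le> norm (rough_step (Y s) s t) + norm ((t - s) *\<^sub>R f0 (Y s)) + norm (davie_rem Y s t)"
      unfolding eq by (intro norm_triangle_mono order_refl)
    also have "\<dots> \<le> (K * (K * (t - s) powr \<alpha>) + K * (K * (t - s) powr (2 * \<alpha>))) + (t - s) powr 1 * norm (f0 (Y s)) + C * (t - s) powr (3 * \<alpha>)"
      using rough_step_bound[OF m, of "Y s"] dav[OF st] st by (intro add_mono) auto
    also have "\<dots> \<le> (K * (K * (t - s) powr \<alpha>) + K * (K * (T powr (2 * \<alpha> - \<alpha>) * (t - s) powr \<alpha>)))
        + (T powr (1 - \<alpha>) * (t - s) powr \<alpha>) * norm (f0 (Y s)) + C * (T powr (3 * \<alpha> - \<alpha>) * (t - s) powr \<alpha>)"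
      using \<alpha> K0 C by (intro add_mono order_refl mult_left_mono mult_right_mono p) auto
    finally show ?thesis by (simp add: c_def algebra_simps)
  qed
  define A where "A = norm (f0 (Y 0)) + K * ((c + T powr (1 - \<alpha>) * norm (f0 (Y 0))) * T powr \<alpha>)"
  have A: "norm (f0 (Y t)) \<le> A" if t: "t \<in> {0..T}" for t
  proof -
    have "norm (Y t - Y 0) \<le> (c + T powr (1 - \<alpha>) * norm (f0 (Y 0))) * (t - 0) powr \<alpha>" using t by (intro inc) auto
    also have "\<dots> \<le> (c + T powr (1 - \<alpha>) * norm (f0 (Y 0))) * T powr \<alpha>"
      using t c \<alpha> by (intro mult_left_mono powr_mono2) auto
    finally have "K * norm (Y t - Y 0) \<le> K * ((c + T powr (1 - \<alpha>) * norm (f0 (Y 0))) * T powr \<alpha>)"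
      using K0 by (intro mult_left_mono)
    then show ?thesis
      using f0_Lipschitz[of "Y t" "Y 0"] norm_triangle_ineq2[of "f0 (Y t)" "f0 (Y 0)"] by (simp add: A_def)
  qed
  have "norm (f0 (Y 0)) \<le> A" using T by (intro A) auto
  then have A0: "0 \<le> A" by (rule order_trans[OF norm_ge_zero])
  define L where "L = c + T powr (1 - \<alpha>) * A + A"
  have H: "norm (Y t - Y s) \<le> L * (t - s) powr \<alpha>" if st: "0 \<le> s" "s \<le> t" "t \<le> T" for s t
  proof -
    have "T powr (1 - \<alpha>) * norm (f0 (Y s)) \<le> T powr (1 - \<alpha>) * A" using A st by (intro mult_left_mono) auto
    then have "c + T powr (1 - \<alpha>) * norm (f0 (Y s)) \<le> L" using A0 by (simp add: L_def)
    then have "(c + T powr (1 - \<alpha>) * norm (f0 (Y s))) * (t - s) powr \<alpha> \<le> L * (t - s) powr \<alpha>" by (rule mult_right_mono) simp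
    then show ?thesis using inc[OF st] by linarith
  qed
  show ?thesis
  proof (rule that)
    show "0 \<le> L" using c A0 by (simp add: L_def)
    show "norm (f0 (Y t)) \<le> L" if "t \<in> {0..T}" for t
    proof -
      have "0 \<le> T powr (1 - \<alpha>) * A" using A0 by simp
      then show ?thesis using A[OF that] c by (simp add: L_def)
    qed
    show "norm (Y t - Y s) \<le> L * \<bar>t - s\<bar> powr \<alpha>" if "s \<in> {0..T}" "t \<in> {0..T}" for s t
      using H[of s t] H[of t s] that by (cases "s \<le> t") (auto simp: norm_minus_commute)
  qed
qed

lemma continuous_on_if_Holder:
  fixes Y :: "real \<Rightarrow> 'a::real_normed_vector"
  assumes H: "\<And>s t. s \<in> S \<Longrightarrow> t \<in> S \<Longrightarrow> \<bar>t - s\<bar> \<le> \<tau> \<Longrightarrow> norm (Y t - Y s) \<le> L * \<bar>t - s\<bar> powr \<alpha>" and \<tau>: "0 < \<tau>"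
  shows "continuous_on S Y"
  unfolding continuous_on_def
proof
  fix s assume s: "s \<in> S"
  have "((\<lambda>t. \<bar>t - s\<bar>) \<longlongrightarrow> 0) (at s within S)" by (auto intro!: tendsto_eq_intros)
  then have "((\<lambda>t. \<bar>t - s\<bar> powr \<alpha>) \<longlongrightarrow> 0) (at s within S)"
    using \<alpha> by (intro tendsto_eq_intros tendsto_powr'[where b = \<alpha> and g = "\<lambda>_. \<alpha>"]) auto
  then have lim: "((\<lambda>t. L * \<bar>t - s\<bar> powr \<alpha>) \<longlongrightarrow> 0) (at s within S)"
    using tendsto_mult_left[of _ 0 _ L] by fastforce
  have "eventually (\<lambda>t. t \<in> S \<and> dist t s < \<tau>) (at s within S)"
    unfolding eventually_at using \<tau> by blast
  then have "eventually (\<lambda>t. norm (Y t - Y s) \<le> L * \<bar>t - s\<bar> powr \<alpha>) (at s within S)"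
    by eventually_elim (auto intro!: H s simp: dist_real_def)
  then have "((\<lambda>t. Y t - Y s) \<longlongrightarrow> 0) (at s within S)" using lim by (rule Lim_null_comparison)
  then show "(Y \<longlongrightarrow> Y s) (at s within S)" by (simp add: LIM_zero_iff)
qed

lemma X_continuous: "continuous_on {0..T} X"
  using X_Holder by (intro continuous_on_if_Holder[of _ 1 _ K]) auto

lemma continuous_if_Lipschitz:
  fixes g :: "'w \<Rightarrow> 'b::real_normed_vector"
  assumes "\<And>y z. norm (g y - g z) \<le> K * norm (y - z)"
  shows "isCont g y"
proof -
  have "K-lipschitz_on UNIV g" using assms K by (intro lipschitz_onI) (auto simp: dist_norm)
  then show ?thesis using lipschitz_on_continuous_on continuous_on_eq_continuous_at open_UNIV by blast
qed

lemma davie_solution_if_local: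
  assumes Y: "continuous_on {0..T} Y" and \<tau>: "0 < \<tau>" and C: "0 \<le> C"
    and loc: "\<And>s t. 0 \<le> s \<Longrightarrow> s \<le> t \<Longrightarrow> t \<le> T \<Longrightarrow> t - s \<le> \<tau> \<Longrightarrow> norm (davie_rem Y s t) \<le> C * (t - s) powr (3 * \<alpha>)"
  shows "davie_solution Y"
proof -
  have K0: "0 \<le> K" using K by simp
  have "bounded (Y ` {0..T})" using Y compact_Icc compact_continuous_image compact_imp_bounded by blast
  then obtain B where B: "0 < B" "\<And>t. t \<in> {0..T} \<Longrightarrow> norm (Y t) \<le> B" unfolding bounded_pos by blast
  define A where "A = norm (f0 0) + K * B"
  have A: "norm (f0 (Y t)) \<le> A" if "t \<in> {0..T}" for t
    using f0_Lipschitz[of "Y t" 0] norm_triangle_ineq2[of "f0 (Y t)" "f0 0"] mult_left_mono[OF B(2)[OF that] K0] by (simp add: A_def)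
  define R where "R = B + B + (K * (K * T powr \<alpha>) + K * (K * T powr (2 * \<alpha>))) + T * A"
  have A0: "0 \<le> A" using K0 B by (simp add: A_def)
  have R0: "0 \<le> R" using K0 B A0 T by (simp add: R_def)
  show ?thesis
    unfolding davie_solution_def
  proof (intro exI[of _ "C + R / \<tau> powr (3 * \<alpha>)"] conjI allI impI)
    show "0 \<le> C + R / \<tau> powr (3 * \<alpha>)" using C R0 by simp
    fix s t assume st: "0 \<le> s" "s \<le> t" "t \<le> T"
    have m: "s \<in> {0..T}" "t \<in> {0..T}" using st by auto
    let ?w = "(t - s) powr (3 * \<alpha>)"
    show "norm (davie_rem Y s t) \<le> (C + R / \<tau> powr (3 * \<alpha>)) * ?w"
    proof (cases "t - s \<le> \<tau>")
      case True
      have "norm (davie_rem Y s t) \<le> C * ?w" by (rule loc[OF st True])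
      also have "\<dots> \<le> (C + R / \<tau> powr (3 * \<alpha>)) * ?w" using R0 by (intro mult_right_mono) auto
      finally show ?thesis .
    next
      case False
      have "norm (davie_rem Y s t) \<le> norm (Y t) + norm (Y s) + norm (rough_step (Y s) s t) + norm ((t - s) *\<^sub>R f0 (Y s))"
        unfolding davie_rem_def by (intro order_trans[OF norm_triangle_ineq4] add_right_mono order_refl)
      also have "\<dots> \<le> R"
        unfolding R_def
      proof (intro add_mono B m)
        have "norm (rough_step (Y s) s t) \<le> K * (K * \<bar>t - s\<bar> powr \<alpha>) + K * (K * \<bar>t - s\<bar> powr (2 * \<alpha>))"
          by (rule rough_step_bound[OF m])
        also have "\<dots> \<le> K * (K * T powr \<alpha>) + K * (K * T powr (2 * \<alpha>))"
          using st \<alpha> K0 by (intro add_mono mult_left_mono powr_mono2) auto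
        finally show "norm (rough_step (Y s) s t) \<le> K * (K * T powr \<alpha>) + K * (K * T powr (2 * \<alpha>))" .
        show "norm ((t - s) *\<^sub>R f0 (Y s)) \<le> T * A" using st A[OF m(1)] A0 by (auto intro!: mult_mono)
      qed
      also have "\<dots> = R / \<tau> powr (3 * \<alpha>) * \<tau> powr (3 * \<alpha>)" using \<tau> by simp
      also have "\<dots> \<le> R / \<tau> powr (3 * \<alpha>) * ?w" using False \<tau> \<alpha> R0 by (intro mult_left_mono powr_mono2) auto
      also have "\<dots> \<le> (C + R / \<tau> powr (3 * \<alpha>)) * ?w" using C by (intro mult_right_mono) auto
      finally show ?thesis .
    qed
  qed
qed

lemma davie_solution_grid_path:
  assumes "davie_solution Y"
  shows "\<exists>C0\<ge>0. \<forall>a h N. 0 \<le> a \<longrightarrow> 0 < h \<longrightarrow> a + real N * h \<le> T \<longrightarrow> grid_path C0 a h N (\<lambda>k. Y (a + real k * h))"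
proof -
  obtain C where C: "0 \<le> C" and dav: "\<And>s t. 0 \<le> s \<Longrightarrow> s \<le> t \<Longrightarrow> t \<le> T \<Longrightarrow> norm (davie_rem Y s t) \<le> C * (t - s) powr (3 * \<alpha>)"
    using assms unfolding davie_solution_def by blast
  show ?thesis
  proof (intro exI[of _ C] conjI C allI impI)
    fix a h :: real and N :: nat assume a: "0 \<le> a" and h: "0 < h" and N: "a + real N * h \<le> T"
    have "norm (Y (a + real (Suc k) * h) - Y (a + real k * h) - rough_step (Y (a + real k * h)) (a + real k * h) (a + real (Suc k) * h) - h *\<^sub>R f0 (Y (a + real k * h)))
        \<le> C * h powr (3 * \<alpha>)" if "k < N" for k
    proof -
      have "real (Suc k) * h \<le> real N * h" using that h by (intro mult_right_mono) auto
      then have t: "a + real (Suc k) * h \<le> T" using N by linarith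
      have d: "a + real (Suc k) * h - (a + real k * h) = h" by (simp add: algebra_simps)
      show ?thesis using dav[of "a + real k * h" "a + real (Suc k) * h"] a h t unfolding davie_rem_def d
        by (simp add: mult_right_mono)
    qed
    then show "grid_path C a h N (\<lambda>k. Y (a + real k * h))" using a h N by (simp add: grid_path_def)
  qed
qed

text \<open>
  Both solutions are grid paths on every grid between \<open>s\<close> and \<open>t\<close>; the mesh tends to zero.
\<close>

theorem davie_solution_unique:
  assumes Y: "davie_solution Y" and Z: "davie_solution Z" and eq: "Y s = Z s" and st: "0 \<le> s" "s \<le> t" "t \<le> T"
  shows "Y t = Z t"
proof (cases "s = t")
  case False
  obtain C1 where C1: "0 \<le> C1" "\<And>a h N. 0 \<le> a \<Longrightarrow> 0 < h \<Longrightarrow> a + real N * h \<le> T \<Longrightarrow> grid_path C1 a h N (\<lambda>k. Y (a + real k * h))"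
    using davie_solution_grid_path[OF Y] by blast
  obtain C2 where C2: "0 \<le> C2" "\<And>a h N. 0 \<le> a \<Longrightarrow> 0 < h \<Longrightarrow> a + real N * h \<le> T \<Longrightarrow> grid_path C2 a h N (\<lambda>k. Z (a + real k * h))"
    using davie_solution_grid_path[OF Z] by blast
  define C0 where "C0 = max C1 C2"
  have C0: "0 \<le> C0" using C1 by (simp add: C0_def)
  obtain M h0 where stab: "stability_bound C0 (norm (f0 (Y s))) M h0"
    using grid_path_stability[OF C0 norm_ge_zero] by blast
  note h0 = stability_boundD(2)[OF stab]
  define N0 where "N0 = Suc (nat \<lceil>(t - s) / h0\<rceil>)"
  have "norm (Y t - Z t) \<le> M * ((t - s) / real N) powr \<gamma>" if N: "N0 \<le> N" for N
  proof -
    let ?h = "(t - s) / real N"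
    have N1: "0 < N" using N by (simp add: N0_def)
    have h: "0 < ?h" "s + real N * ?h = t" using N1 st False by auto
    have "(t - s) / h0 \<le> real N0" unfolding N0_def by linarith
    also have "\<dots> \<le> real N" using N by simp
    finally have "?h \<le> h0" using N1 h0 by (simp add: field_simps)
    moreover have "grid_path C0 s ?h N (\<lambda>k. Y (s + real k * ?h))" "grid_path C0 s ?h N (\<lambda>k. Z (s + real k * ?h))"
      using C1(2)[of s ?h N] C2(2)[of s ?h N] h st grid_path_mono_const by (auto simp: C0_def)
    ultimately show ?thesis
      using stability_boundD(3)[OF stab, of s ?h N "\<lambda>k. Y (s + real k * ?h)" "\<lambda>k. Z (s + real k * ?h)" N] h eq by simp
  qed
  then have "norm (Y t - Z t) \<le> 0"
    using st \<theta>'_\<gamma>(3) by (intro nonpos_if_le_powr_inverse_nat[of \<gamma> "t - s"]) auto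
  then show ?thesis by simp
qed (use eq in simp)

primrec euler :: "'w \<Rightarrow> real \<Rightarrow> nat \<Rightarrow> 'w" where
  "euler \<xi> h 0 = \<xi>"
| "euler \<xi> h (Suc k) = euler \<xi> h k + rough_step (euler \<xi> h k) (real k * h) (real (Suc k) * h) + h *\<^sub>R f0 (euler \<xi> h k)"

lemma euler_grid_path: "0 < h \<Longrightarrow> real N * h \<le> T \<Longrightarrow> 0 \<le> C0 \<Longrightarrow> grid_path C0 0 h N (euler \<xi> h)"
  by (simp add: grid_path_def)

text \<open>
  The Riemann sum of the drift is replaced by its value at the left end point, at the cost of a Hoelder increment.
\<close>

lemma grid_davie_bound:
  assumes C: "apriori_bound \<tau> C0 A0 C" and \<tau>: "\<tau> \<le> 1"
    and y: "grid_path C0 a h N y" "h \<le> \<tau> / 2" "norm (f0 (y 0)) \<le> A0"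
    and ik: "i \<le> k" "k \<le> N" "real (k - i) * h \<le> \<tau>"
  shows "norm (y k - y i - rough_step (y i) (a + real i * h) (a + real k * h) - (real (k - i) * h) *\<^sub>R f0 (y i))
    \<le> (C + K * C) * (real (k - i) * h) powr (3 * \<alpha>)"
proof (cases "i = k")
  case True
  have m: "a + real k * h \<in> {0..T}" using ik by (intro grid_times[OF y(1)])
  show ?thesis using rough_step_bound[OF m m, of "y k"] True by simp
next
  case False
  then have ik': "i < k" using ik by simp
  have h: "0 < h" using y(1) by (simp add: grid_path_def)
  have K0: "0 \<le> K" using K by simp
  note C0 = apriori_boundD(1)[OF C]
  let ?w = "real (k - i) * h"
  have w: "0 \<le> ?w" "?w \<le> 1" using h ik \<tau> by auto
  have R: "norm (grid_rem a h y i k) \<le> C * ?w powr (3 * \<alpha>)" by (rule apriori_boundD(3)[OF C y ik' ik(2,3)])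
  have "norm (\<Sum>j=i..<k. h *\<^sub>R (f0 (y j) - f0 (y i))) \<le> (K * (C * ?w powr \<alpha>)) * ?w"
  proof (rule drift_bound[OF less_imp_le[OF h] ik(1)])
    fix j assume j: "i \<le> j" "j < k"
    have "norm (y j - y i) \<le> C * ?w powr \<alpha>"
    proof (cases "i = j")
      case False
      have le: "real (j - i) * h \<le> ?w" using j h by (intro mult_right_mono) auto
      have "norm (y j - y i) \<le> C * (real (j - i) * h) powr \<alpha>"
        using False j ik le by (intro apriori_boundD(4)[OF C y]) auto
      also have "\<dots> \<le> C * ?w powr \<alpha>" using le h \<alpha> C0 by (intro mult_left_mono powr_mono2) auto
      finally show ?thesis .
    qed (use C0 in simp)
    then have "K * norm (y j - y i) \<le> K * (C * ?w powr \<alpha>)" using K0 by (rule mult_left_mono)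
    then show "norm (f0 (y j) - f0 (y i)) \<le> K * (C * ?w powr \<alpha>)" using f0_Lipschitz[of "y j" "y i"] by linarith
  qed
  also have "\<dots> = K * C * (?w * ?w powr \<alpha>)" by simp
  also have "?w * ?w powr \<alpha> = ?w powr (1 + \<alpha>)" using w by (simp add: powr_mult_base)
  also have "K * C * ?w powr (1 + \<alpha>) \<le> K * C * ?w powr (3 * \<alpha>)"
    using w \<alpha> K0 C0 by (intro mult_left_mono powr_mono') auto
  finally have D: "norm (\<Sum>j=i..<k. h *\<^sub>R (f0 (y j) - f0 (y i))) \<le> K * C * ?w powr (3 * \<alpha>)" .
  have "(\<Sum>j=i..<k. h *\<^sub>R f0 (y i)) = ?w *\<^sub>R f0 (y i)" by (simp add: sum_constant_scaleR)
  then have eq: "y k - y i - rough_step (y i) (a + real i * h) (a + real k * h) - ?w *\<^sub>R f0 (y i)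
      = grid_rem a h y i k + (\<Sum>j=i..<k. h *\<^sub>R (f0 (y j) - f0 (y i)))"
    by (simp add: grid_rem_def scaleR_diff_right sum_subtractf)
  show ?thesis unfolding eq distrib_right by (intro norm_triangle_mono R D)
qed

text \<open>
  Euler schemes on dyadic grids. Restricted to the coarser grid, the scheme of the next level is again a
  grid path, by the a priori bound over two steps, so stability bounds the difference of consecutive levels by a geometric
  sequence. Step functions through the grid points then converge at every time, and the
  expansion passes to the limit.
\<close>

theorem davie_solution_exists:
  obtains Y where "Y 0 = \<xi>" "davie_solution Y"
proof -
  obtain \<tau> where \<tau>: "0 < \<tau>" "\<tau> \<le> 1" and ap: "\<And>C0 A0. 0 \<le> C0 \<Longrightarrow> 0 \<le> A0 \<Longrightarrow> \<exists>C. apriori_bound \<tau> C0 A0 C"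
    using grid_path_apriori by metis
  define A0 where "A0 = norm (f0 \<xi>)"
  obtain C where C: "apriori_bound \<tau> 0 A0 C" using ap[of 0 A0] by (auto simp: A0_def)
  note C0 = apriori_boundD(1)[OF C]
  have K0: "0 \<le> K" using K by simp
  define C' where "C' = C + K * C"
  have C': "0 \<le> C'" using C0 K0 by (simp add: C'_def)
  obtain M h0 where stab: "stability_bound C' A0 M h0"
    using grid_path_stability[OF C', of A0] by (auto simp: A0_def)
  note M = stability_boundD(1)[OF stab] and h0 = stability_boundD(2)[OF stab]
  define h where "h n = T / 2 ^ n" for n :: nat
  have h: "0 < h n" "real (2 ^ n) * h n = T" "h (Suc n) * 2 = h n" for n using T by (auto simp: h_def)
  have hlim: "h \<longlonglongrightarrow> 0"
  proof -
    have "(\<lambda>n. T * (1/2) ^ n) \<longlonglongrightarrow> T * 0" by (intro tendsto_mult_left LIMSEQ_power_zero) simp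
    then show ?thesis by (simp add: h_def[abs_def] power_one_over field_simps)
  qed
  have "eventually (\<lambda>n. h n < min (\<tau> / 2) h0) sequentially"
    using \<tau> h0 by (intro order_tendstoD(2)[OF hlim]) auto
  then obtain n0 where n0: "\<And>n. n0 \<le> n \<Longrightarrow> h n < min (\<tau> / 2) h0" by (auto simp: eventually_sequentially)
  define y where "y n = euler \<xi> (h n)" for n
  have y0: "y n 0 = \<xi>" "norm (f0 (y n 0)) \<le> A0" for n by (simp_all add: y_def A0_def)
  have gp: "grid_path c 0 (h n) (2 ^ n) (y n)" if "0 \<le> c" for n c
    unfolding y_def using h(1,2)[of n] that by (intro euler_grid_path) auto
  have dav: "norm (y n k - y n i - rough_step (y n i) (real i * h n) (real k * h n) - (real (k - i) * h n) *\<^sub>R f0 (y n i))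
      \<le> C' * (real (k - i) * h n) powr (3 * \<alpha>)"
    if "n0 \<le> n" "i \<le> k" "k \<le> 2 ^ n" "real (k - i) * h n \<le> \<tau>" for n i k
    using grid_davie_bound[OF C \<tau>(2) gp _ y0(2), of n i k] n0[OF that(1)] that by (simp add: C'_def)
  have inc: "norm (y n k - y n i) \<le> C * (real (k - i) * h n) powr \<alpha>"
    if "n0 \<le> n" "i \<le> k" "k \<le> 2 ^ n" "real (k - i) * h n \<le> \<tau>" for n i k
    using apriori_boundD(4)[OF C gp _ y0(2), of n i k] n0[OF that(1)] that by (cases "i = k") auto
  \<comment> \<open>Every second point of one level is a grid path of the level before.\<close>
  have refine: "norm (y n k - y (Suc n) (2 * k)) \<le> M * h n powr \<gamma>" if n: "n0 \<le> n" and k: "k \<le> 2 ^ n" for n k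
  proof -
    have "norm (y (Suc n) (2 * Suc k) - y (Suc n) (2 * k) - rough_step (y (Suc n) (2 * k)) (real k * h n) (real (Suc k) * h n) - h n *\<^sub>R f0 (y (Suc n) (2 * k)))
        \<le> C' * h n powr (3 * \<alpha>)" if k: "k < 2 ^ n" for k
    proof -
      have eqs: "real (2 * k) * h (Suc n) = real k * h n" "real (2 * Suc k) * h (Suc n) = real (Suc k) * h n"
        "real (2 * Suc k - 2 * k) * h (Suc n) = h n"
        unfolding h(3)[of n, symmetric] by (simp_all add: algebra_simps)
      show ?thesis using dav[of "Suc n" "2 * k" "2 * Suc k", unfolded eqs] n k n0[OF n] \<tau> by simp
    qed
    then have "grid_path C' 0 (h n) (2 ^ n) (\<lambda>k. y (Suc n) (2 * k))"
      using h(1,2)[of n] by (simp add: grid_path_def)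
    then show ?thesis
      using stability_boundD(3)[OF stab gp[OF C'], of n "\<lambda>k. y (Suc n) (2 * k)" k] n0[OF n] y0 k by auto
  qed
  define \<kappa> where "\<kappa> n t = nat \<lfloor>t / h n\<rfloor>" for n t
  have \<kappa>: "real (\<kappa> n t) * h n \<le> t" "t < real (\<kappa> n t) * h n + h n" "\<kappa> n t \<le> 2 ^ n" if "t \<in> {0..T}" for n t
  proof -
    have x: "0 \<le> t / h n" using that h(1)[of n] by simp
    then have le: "real (\<kappa> n t) \<le> t / h n" "t / h n < real (\<kappa> n t) + 1" by (simp_all add: \<kappa>_def)
    then show "real (\<kappa> n t) * h n \<le> t" "t < real (\<kappa> n t) * h n + h n" using h(1)[of n] by (simp_all add: field_simps)
    have "t / h n \<le> 2 ^ n" using that T by (simp add: h_def field_simps)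
    then have "real (\<kappa> n t) \<le> 2 ^ n" using le by linarith
    then show "\<kappa> n t \<le> 2 ^ n" by simp
  qed
  have \<kappa>Suc: "\<kappa> (Suc n) t = 2 * \<kappa> n t \<or> \<kappa> (Suc n) t = Suc (2 * \<kappa> n t)" if t: "t \<in> {0..T}" for n t
  proof -
    let ?h = "h (Suc n)"
    have "real (\<kappa> n t) * (?h * 2) \<le> t" "t < real (\<kappa> n t) * (?h * 2) + ?h * 2"
      using \<kappa>(1,2)[OF t, of n] by (simp_all add: h(3))
    then have "real (\<kappa> (Suc n) t) * ?h < (real (2 * \<kappa> n t) + 2) * ?h" "real (2 * \<kappa> n t) * ?h < (real (\<kappa> (Suc n) t) + 1) * ?h"
      using \<kappa>(1,2)[OF t, of "Suc n"] by (simp_all add: algebra_simps)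
    then have "real (\<kappa> (Suc n) t) < real (2 * \<kappa> n t) + 2" "real (2 * \<kappa> n t) < real (\<kappa> (Suc n) t) + 1"
      using h(1)[of "Suc n"] mult_less_cancel_right_pos by blast+
    then show ?thesis by linarith
  qed
  have step: "norm (y (Suc n) (\<kappa> (Suc n) t) - y n (\<kappa> n t)) \<le> (C + M) * T powr \<gamma> * ((1/2) powr \<gamma>) ^ n"
    if n: "n0 \<le> n" and t: "t \<in> {0..T}" for n t
  proof -
    have "norm (y (Suc n) (\<kappa> (Suc n) t) - y (Suc n) (2 * \<kappa> n t)) \<le> C * h n powr \<gamma>"
    proof (cases "\<kappa> (Suc n) t = 2 * \<kappa> n t")
      case False
      then have \<kappa>': "\<kappa> (Suc n) t = Suc (2 * \<kappa> n t)" using \<kappa>Suc[OF t] by blast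
      have hs: "h (Suc n) \<le> h n" "h n \<le> 1" "h (Suc n) \<le> \<tau>" using h(1,3)[of n] h(1)[of "Suc n"] n0[OF n] \<tau> by auto
      have "norm (y (Suc n) (\<kappa> (Suc n) t) - y (Suc n) (2 * \<kappa> n t)) \<le> C * (real (\<kappa> (Suc n) t - 2 * \<kappa> n t) * h (Suc n)) powr \<alpha>"
        using n \<kappa>(3)[OF t, of "Suc n"] hs by (intro inc) (auto simp: \<kappa>')
      also have "\<dots> = C * h (Suc n) powr \<alpha>" by (simp add: \<kappa>')
      also have "\<dots> \<le> C * h n powr \<alpha>" using hs h(1)[of "Suc n"] \<alpha> C0 by (intro mult_left_mono powr_mono2) auto
      also have "\<dots> \<le> C * h n powr \<gamma>" using hs h(1)[of n] \<theta>'_\<gamma> C0 by (intro mult_left_mono powr_mono') auto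
      finally show ?thesis .
    qed (use C0 in simp)
    moreover have "norm (y n (\<kappa> n t) - y (Suc n) (2 * \<kappa> n t)) \<le> M * h n powr \<gamma>" using n \<kappa>(3)[OF t] by (intro refine)
    moreover have "norm (y (Suc n) (\<kappa> (Suc n) t) - y n (\<kappa> n t))
        \<le> norm (y (Suc n) (\<kappa> (Suc n) t) - y (Suc n) (2 * \<kappa> n t)) + norm (y n (\<kappa> n t) - y (Suc n) (2 * \<kappa> n t))"
      using norm_triangle_ineq4[of "y (Suc n) (\<kappa> (Suc n) t) - y (Suc n) (2 * \<kappa> n t)" "y n (\<kappa> n t) - y (Suc n) (2 * \<kappa> n t)"] by simp
    moreover have "h n powr \<gamma> = T powr \<gamma> * ((1/2) powr \<gamma>) ^ n"
    proof -
      have "h n = T * (1/2) ^ n" by (simp add: h_def power_one_over field_simps)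
      moreover have "((1/2::real) ^ n) powr \<gamma> = ((1/2) powr \<gamma>) ^ n"
        by (simp add: powr_power powr_powr mult.commute flip: powr_realpow)
      ultimately show ?thesis using T by (simp add: powr_mult)
    qed
    ultimately show ?thesis by (simp add: algebra_simps)
  qed
  define Y where "Y t = lim (\<lambda>n. y n (\<kappa> n t))" for t
  have lim: "(\<lambda>n. y n (\<kappa> n t)) \<longlonglongrightarrow> Y t" if t: "t \<in> {0..T}" for t
  proof -
    have "(1/2) powr \<gamma> < (1::real)" using \<theta>'_\<gamma>(3) powr_less_mono2[of \<gamma> "1/2::real" 1] by simp
    then have "summable (\<lambda>n. (C + M) * T powr \<gamma> * ((1/2) powr \<gamma>) ^ n)"
      by (intro summable_mult summable_geometric) simp
    then have "summable (\<lambda>n. y (Suc n) (\<kappa> (Suc n) t) - y n (\<kappa> n t))"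
      using step[OF _ t] by (rule summable_comparison_test'[where N = n0])
    then have "convergent (\<lambda>n. y n (\<kappa> n t))" by (rule summable_increments_imp_convergent)
    then show ?thesis by (simp add: Y_def convergent_LIMSEQ_iff)
  qed
  have tlim: "(\<lambda>n. real (\<kappa> n t) * h n) \<longlonglongrightarrow> t" if t: "t \<in> {0..T}" for t
  proof (rule tendsto_sandwich)
    have "(\<lambda>n. t - h n) \<longlonglongrightarrow> t - 0" by (intro tendsto_diff tendsto_const hlim)
    then show "(\<lambda>n. t - h n) \<longlonglongrightarrow> t" by simp
    show "eventually (\<lambda>n. t - h n \<le> real (\<kappa> n t) * h n) sequentially"
      using \<kappa>(2)[OF t] by (intro always_eventually allI) (simp add: algebra_simps less_imp_le)
  qed (use \<kappa>(1)[OF t] in auto)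
  have mono: "\<kappa> n s \<le> \<kappa> n t" if "s \<le> t" for n s t
    unfolding \<kappa>_def using that h(1)[of n] by (intro nat_mono floor_mono divide_right_mono) auto
  have \<kappa>T: "real (\<kappa> n t) * h n \<in> {0..T}" if "t \<in> {0..T}" for n t using \<kappa>(1)[OF that, of n] h(1)[of n] that by auto
  have window: "eventually (\<lambda>n. n0 \<le> n \<and> real (\<kappa> n t - \<kappa> n s) * h n \<le> \<tau>) sequentially"
    and wlim: "(\<lambda>n. real (\<kappa> n t - \<kappa> n s) * h n) \<longlonglongrightarrow> t - s"
    if st: "0 \<le> s" "s \<le> t" "t \<le> T" "t - s \<le> \<tau> / 2" for s t
  proof -
    have m: "s \<in> {0..T}" "t \<in> {0..T}" using st by auto
    have eq: "real (\<kappa> n t - \<kappa> n s) * h n = real (\<kappa> n t) * h n - real (\<kappa> n s) * h n" for n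
      using mono[OF st(2), of n] by (simp add: of_nat_diff algebra_simps)
    show wlim: "(\<lambda>n. real (\<kappa> n t - \<kappa> n s) * h n) \<longlonglongrightarrow> t - s"
      unfolding eq by (intro tendsto_diff tlim m)
    have "t - s < \<tau>" using st \<tau> by linarith
    then have "eventually (\<lambda>n. real (\<kappa> n t - \<kappa> n s) * h n < \<tau>) sequentially" by (rule order_tendstoD(2)[OF wlim])
    then show "eventually (\<lambda>n. n0 \<le> n \<and> real (\<kappa> n t - \<kappa> n s) * h n \<le> \<tau>) sequentially"
      using eventually_ge_at_top[of n0] by eventually_elim auto
  qed
  have H: "norm (Y t - Y s) \<le> C * \<bar>t - s\<bar> powr \<alpha>" if st: "0 \<le> s" "s \<le> t" "t \<le> T" "t - s \<le> \<tau> / 2" for s t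
  proof (rule tendsto_le[OF sequentially_bot])
    have m: "s \<in> {0..T}" "t \<in> {0..T}" using st by auto
    show "(\<lambda>n. norm (y n (\<kappa> n t) - y n (\<kappa> n s))) \<longlonglongrightarrow> norm (Y t - Y s)"
      by (intro tendsto_norm tendsto_diff lim m)
    have "(\<lambda>n. C * (real (\<kappa> n t - \<kappa> n s) * h n) powr \<alpha>) \<longlonglongrightarrow> C * (t - s) powr \<alpha>"
      using \<alpha> st less_imp_le[OF h(1)] by (intro tendsto_mult_left tendsto_powr' wlim st tendsto_const disjI2 conjI always_eventually) auto
    then show "(\<lambda>n. C * (real (\<kappa> n t - \<kappa> n s) * h n) powr \<alpha>) \<longlonglongrightarrow> C * \<bar>t - s\<bar> powr \<alpha>" using st by simp
    show "eventually (\<lambda>n. norm (y n (\<kappa> n t) - y n (\<kappa> n s)) \<le> C * (real (\<kappa> n t - \<kappa> n s) * h n) powr \<alpha>) sequentially"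
      using window[OF st] by eventually_elim (intro inc mono st \<kappa>(3) m, auto)
  qed
  have dist: "norm (davie_rem Y s t) \<le> C' * (t - s) powr (3 * \<alpha>)" if st: "0 \<le> s" "s \<le> t" "t \<le> T" "t - s \<le> \<tau> / 2" for s t
  proof (rule tendsto_le[OF sequentially_bot])
    have m: "s \<in> {0..T}" "t \<in> {0..T}" using st by auto
    have X: "(\<lambda>n. X (real (\<kappa> n u) * h n)) \<longlonglongrightarrow> X u" if "u \<in> {0..T}" for u
      using continuous_on_tendsto_compose[OF X_continuous tlim[OF that] that] \<kappa>T[OF that] by simp
    have "(\<lambda>n. case (real (\<kappa> n s) * h n, real (\<kappa> n t) * h n) of (s, t) \<Rightarrow> XX s t) \<longlonglongrightarrow> (case (s, t) of (s, t) \<Rightarrow> XX s t)"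
      using m \<kappa>T by (intro continuous_on_tendsto_compose[OF XX_continuous] tendsto_Pair tlim always_eventually) auto
    then have XX: "(\<lambda>n. XX (real (\<kappa> n s) * h n) (real (\<kappa> n t) * h n)) \<longlonglongrightarrow> XX s t" by simp
    have comp: "(\<lambda>n. g (y n (\<kappa> n s))) \<longlonglongrightarrow> g (Y s)"
      if "\<And>y z. norm (g y - g z) \<le> K * norm (y - z)" for g :: "'w \<Rightarrow> 'b::real_normed_vector"
      using continuous_if_Lipschitz[OF that] lim[OF m(1)] by (rule isCont_tendsto_compose)
    show "(\<lambda>n. norm (y n (\<kappa> n t) - y n (\<kappa> n s) - rough_step (y n (\<kappa> n s)) (real (\<kappa> n s) * h n) (real (\<kappa> n t) * h n)
        - (real (\<kappa> n t - \<kappa> n s) * h n) *\<^sub>R f0 (y n (\<kappa> n s)))) \<longlonglongrightarrow> norm (davie_rem Y s t)"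
      unfolding davie_rem_def rough_step_def
      by (intro tendsto_norm tendsto_diff tendsto_add tendsto_scaleR blinfun.tendsto lim m wlim st X XX comp
          C11D(3)[OF C11_f] C11D(3)[OF C11_F] f0_Lipschitz)
    show "(\<lambda>n. C' * (real (\<kappa> n t - \<kappa> n s) * h n) powr (3 * \<alpha>)) \<longlonglongrightarrow> C' * (t - s) powr (3 * \<alpha>)"
      using \<alpha> st less_imp_le[OF h(1)] by (intro tendsto_mult_left tendsto_powr' wlim st tendsto_const disjI2 conjI always_eventually) auto
    show "eventually (\<lambda>n. norm (y n (\<kappa> n t) - y n (\<kappa> n s) - rough_step (y n (\<kappa> n s)) (real (\<kappa> n s) * h n) (real (\<kappa> n t) * h n)
        - (real (\<kappa> n t - \<kappa> n s) * h n) *\<^sub>R f0 (y n (\<kappa> n s))) \<le> C' * (real (\<kappa> n t - \<kappa> n s) * h n) powr (3 * \<alpha>)) sequentially"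
      using window[OF st] by eventually_elim (intro dav mono st \<kappa>(3) m, auto)
  qed
  show ?thesis
  proof (rule that[of Y])
    have "\<kappa> n 0 = 0" for n by (simp add: \<kappa>_def)
    then show "Y 0 = \<xi>" by (simp add: Y_def y0)
    have "continuous_on {0..T} Y"
    proof (rule continuous_on_if_Holder)
      show "0 < \<tau> / 2" using \<tau> by simp
      show "norm (Y t - Y s) \<le> C * \<bar>t - s\<bar> powr \<alpha>" if "s \<in> {0..T}" "t \<in> {0..T}" "\<bar>t - s\<bar> \<le> \<tau> / 2" for s t
        using H[of s t] H[of t s] that by (cases "s \<le> t") (auto simp: norm_minus_commute abs_minus_commute)
    qed
    then show "davie_solution Y" using \<tau> by (intro davie_solution_if_local[where \<tau> = "\<tau> / 2", OF _ _ C' dist]) auto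
  qed
qed

end

section \<open>Rough integral equations and Davie expansions\<close>

definition fine_partition :: "(nat \<Rightarrow> real) \<Rightarrow> nat \<Rightarrow> real \<Rightarrow> real \<Rightarrow> bool" where
  "fine_partition p n t \<delta> \<longleftrightarrow> p 0 = 0 \<and> p n = t \<and> (\<forall>i<n. p i < p (Suc i) \<and> p (Suc i) - p i < \<delta>)"

lemma fine_partition_bounds:
  assumes "fine_partition p n t \<delta>" "i \<le> n"
  shows "0 \<le> p i" "p i \<le> t"
proof -
  have mono: "p i \<le> p j" if "i \<le> j" "j \<le> n" for i j
    using that
  proof (induction rule: dec_induct)
    case (step j)
    then have "p j < p (Suc j)" using assms by (auto simp: fine_partition_def)
    then show ?case using step by simp
  qed simp
  show "0 \<le> p i" "p i \<le> t" using mono[of 0 i] mono[of i n] assms by (auto simp: fine_partition_def)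
qed

lemma sum_lessThan_add: "(\<Sum>i<m + n. g i) = (\<Sum>i<m. g i) + (\<Sum>i<n. g (m + i))" for g :: "nat \<Rightarrow> 'a::comm_monoid_add"
  by (induction n) (simp_all add: add.assoc)

lemma fine_partition_concat:
  assumes p: "fine_partition p m s \<delta>" and st: "s < t" and N: "0 < N" "(t - s) / real N < \<delta>"
  shows "fine_partition (\<lambda>i. if i \<le> m then p i else s + real (i - m) * ((t - s) / real N)) (m + N) t \<delta>"
proof -
  have pos: "0 < (t - s) / real N" using st N by simp
  show ?thesis
    unfolding fine_partition_def
  proof (intro conjI allI impI)
    fix i assume i: "i < m + N"
    consider "Suc i \<le> m" | "i = m" | "m < i" by linarith
    then have "(if Suc i \<le> m then p (Suc i) else s + real (Suc i - m) * ((t - s) / real N)) - (if i \<le> m then p i else s + real (i - m) * ((t - s) / real N))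
      \<in> {0<..<\<delta>}"
    proof cases
      case 2
      then show ?thesis using p pos N by (auto simp: fine_partition_def)
    next
      case 3
      then have n: "\<not> Suc i \<le> m" "\<not> i \<le> m" by auto
      have "real (Suc i - m) = real (i - m) + 1" using 3 by linarith
      then have a: "real (Suc i - m) * ((t - s) / real N) = real (i - m) * ((t - s) / real N) + (t - s) / real N"
        by (simp only: distrib_right mult_1)
      show ?thesis unfolding if_not_P[OF n(1)] if_not_P[OF n(2)] a using pos N by simp
    qed (use p in \<open>auto simp: fine_partition_def\<close>)
    then show "(if i \<le> m then p i else s + real (i - m) * ((t - s) / real N)) < (if Suc i \<le> m then p (Suc i) else s + real (Suc i - m) * ((t - s) / real N))"
      "(if Suc i \<le> m then p (Suc i) else s + real (Suc i - m) * ((t - s) / real N)) - (if i \<le> m then p i else s + real (i - m) * ((t - s) / real N)) < \<delta>"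
      by auto
  qed (use p N in \<open>auto simp: fine_partition_def\<close>)
qed

lemma fine_partition_exists:
  assumes "0 \<le> s" "0 < \<delta>"
  obtains p m where "fine_partition p m s \<delta>"
proof (cases "s = 0")
  case True
  then have "fine_partition (\<lambda>_. 0) 0 s \<delta>" by (simp add: fine_partition_def)
  then show ?thesis by (rule that)
next
  case False
  obtain N :: nat where N: "s / \<delta> < real N" using reals_Archimedean2 by blast
  have "0 \<le> s / \<delta>" using assms by simp
  then have N0: "0 < real N" using N by linarith
  then have "s / real N < \<delta>" using N assms by (simp add: field_simps)
  moreover have "fine_partition (\<lambda>_. 0) 0 0 \<delta>" by (simp add: fine_partition_def)
  ultimately have "fine_partition (\<lambda>i. if i \<le> 0 then 0 else 0 + real (i - 0) * ((s - 0) / real N)) (0 + N) s \<delta>"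
    using assms False N0 by (intro fine_partition_concat) auto
  then show ?thesis by (rule that)
qed

context rough_equation
begin

lemma drift_increment:
  assumes L: "0 \<le> L" and H: "\<And>s t. s \<in> {0..T} \<Longrightarrow> t \<in> {0..T} \<Longrightarrow> norm (Y t - Y s) \<le> L * \<bar>t - s\<bar> powr \<alpha>"
    and st: "0 \<le> s" "s \<le> t" "t \<le> T"
  shows "norm (integral {0..t} (\<lambda>r. f0 (Y r)) - integral {0..s} (\<lambda>r. f0 (Y r)) - (t - s) *\<^sub>R f0 (Y s))
    \<le> K * L * T powr (1 + \<alpha> - 3 * \<alpha>) * (t - s) powr (3 * \<alpha>)"
proof -
  have K0: "0 \<le> K" using K by simp
  have Y: "continuous_on {0..T} Y" using H by (intro continuous_on_if_Holder[of _ 1 _ L]) auto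
  have "continuous_on UNIV f0"
    by (intro continuous_at_imp_continuous_on ballI continuous_if_Lipschitz f0_Lipschitz)
  then have c: "continuous_on {0..T} (\<lambda>r. f0 (Y r))" by (rule continuous_on_compose2[OF _ Y]) simp
  have cs: "continuous_on {s..t} (\<lambda>r. f0 (Y r))" by (rule continuous_on_subset[OF c]) (use st in auto)
  have c0: "continuous_on {0..t} (\<lambda>r. f0 (Y r))" by (rule continuous_on_subset[OF c]) (use st in auto)
  have c1: "integral {0..s} (\<lambda>r. f0 (Y r)) + integral {s..t} (\<lambda>r. f0 (Y r)) = integral {0..t} (\<lambda>r. f0 (Y r))"
    using st by (intro Henstock_Kurzweil_Integration.integral_combine integrable_continuous_real c0) auto
  have c2: "integral {s..t} (\<lambda>r. f0 (Y r) - f0 (Y s)) = integral {s..t} (\<lambda>r. f0 (Y r)) - (t - s) *\<^sub>R f0 (Y s)"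
    using st Henstock_Kurzweil_Integration.integral_diff[OF integrable_continuous_real[OF cs] integrable_const_ivl[of "f0 (Y s)" s t]]
    by simp
  have eq: "integral {0..t} (\<lambda>r. f0 (Y r)) - integral {0..s} (\<lambda>r. f0 (Y r)) - (t - s) *\<^sub>R f0 (Y s) = integral {s..t} (\<lambda>r. f0 (Y r) - f0 (Y s))"
    unfolding c2 c1[symmetric] by simp
  have "norm (integral {s..t} (\<lambda>r. f0 (Y r) - f0 (Y s))) \<le> K * (L * (t - s) powr \<alpha>) * (t - s)"
  proof (rule integral_bound)
    fix r assume r: "r \<in> {s..t}"
    have "norm (Y r - Y s) \<le> L * \<bar>r - s\<bar> powr \<alpha>" using r st by (intro H) auto
    also have "\<dots> \<le> L * (t - s) powr \<alpha>" using r \<alpha> L by (intro mult_left_mono powr_mono2) auto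
    finally have "K * norm (Y r - Y s) \<le> K * (L * (t - s) powr \<alpha>)" using K0 by (rule mult_left_mono)
    then show "norm (f0 (Y r) - f0 (Y s)) \<le> K * (L * (t - s) powr \<alpha>)" using f0_Lipschitz[of "Y r" "Y s"] by linarith
  qed (use st cs in \<open>auto intro!: continuous_intros\<close>)
  also have "\<dots> = K * L * ((t - s) * (t - s) powr \<alpha>)" by simp
  also have "(t - s) * (t - s) powr \<alpha> = (t - s) powr (1 + \<alpha>)" using st by (simp add: powr_mult_base)
  also have "K * L * (t - s) powr (1 + \<alpha>) \<le> K * L * (T powr (1 + \<alpha> - 3 * \<alpha>) * (t - s) powr (3 * \<alpha>))"
    using st \<alpha> K0 L by (intro mult_left_mono powr_le_powr_times) auto
  finally show ?thesis unfolding eq by (simp add: mult.assoc)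
qed

text \<open>
  The sewing lemma for the rough integral: compensated Riemann sums over an interval stay
  close to the single term of the trivial partition.
\<close>

lemma compensated_sum_bound:
  assumes C: "0 \<le> C" and ctrl: "\<And>s t. 0 \<le> s \<Longrightarrow> s \<le> t \<Longrightarrow> t \<le> T \<Longrightarrow>
      norm (Y t - Y s - blinfun_apply (f (Y s)) (X t - X s)) \<le> C * (t - s) powr (2 * \<alpha>)"
    and st: "0 \<le> s" "s < t" "t \<le> T" "t - s \<le> 1" and N: "0 < N" and h: "h = (t - s) / real N"
  shows "norm ((\<Sum>k<N. rough_step (Y (s + real k * h)) (s + real k * h) (s + real (Suc k) * h)) - rough_step (Y s) s t)
    \<le> (2 * K\<^sup>2 * C + 2 * K ^ 6) * sewing_const (3 * \<alpha>) * (t - s) powr (3 * \<alpha>)"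
proof -
  have K0: "0 \<le> K" using K by simp
  let ?t = "\<lambda>k. s + real k * h" and ?c = "(2/3) powr (3 * \<alpha> - 1)"
  define R where "R i j = (\<Sum>k=i..<j. rough_step (Y (?t k)) (?t k) (?t (Suc k))) - rough_step (Y (?t i)) (?t i) (?t j)" for i j
  define B where "B = 2 * K\<^sup>2 * C + 2 * K ^ 6"
  have B0: "0 \<le> B" using C K0 by (simp add: B_def)
  have h0: "0 < h" "real N * h = t - s" using st N h by auto
  have tk: "?t k \<in> {0..T}" if "k \<le> N" for k
  proof -
    have "real k * h \<le> real N * h" using that h0 by (intro mult_right_mono) auto
    moreover have "0 \<le> real k * h" using h0 by simp
    ultimately show ?thesis using h0 st unfolding atLeastAtMost_iff by linarith
  qed
  have c1: "?c < 1" using \<alpha> by (intro two_thirds_powr_less_1) auto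
  have "norm (R 0 N) \<le> (0 + 2 * B / (1 - ?c)) * (real (N - 0) * h) powr (3 * \<alpha>)"
  proof (rule discrete_sewing[where R = R and p = 0 and q = N and b = 0 and c = ?c, OF _ h0(1) B0 _ _ refl])
    show "1 < 3 * \<alpha>" using \<alpha> by simp
    show "(1 + 0) * ?c \<le> (1 + ?c) / 2" using c1 by simp
    show "norm (R i (Suc i)) \<le> 0 * h powr (3 * \<alpha>)" for i by (simp add: R_def)
    fix i j k assume ijk: "0 \<le> i" "i < j" "j < k" "k \<le> N"
    let ?w = "real (k - i) * h"
    have m: "?t i \<in> {0..T}" "?t j \<in> {0..T}" "?t k \<in> {0..T}" using ijk by (intro tk; simp)+
    have w: "0 < ?w" "\<bar>?t j - ?t i\<bar> \<le> ?w" "\<bar>?t k - ?t j\<bar> \<le> ?w" "?t j - ?t i \<le> ?w" "?t i \<le> ?t j"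
      using h0 ijk by (auto simp: of_nat_diff simp flip: left_diff_distrib)
    have "?w \<le> real N * h" using ijk h0 by (intro mult_right_mono) auto
    then have w1: "?w \<le> 1" using h0 st by linarith
    define b where "b = ?w powr \<alpha>"
    note win = window_powers[OF w(1) w1 b_def]
    note b = win(1,2) and b2 = win(3,4) and X1 = win(6) and XX1 = win(7)
    have "norm (offset (Y (?t i)) (Y (?t j)) (X (?t j) - X (?t i))) \<le> C * (?t j - ?t i) powr (2 * \<alpha>)"
      unfolding offset_def using m w by (intro ctrl) auto
    also have "\<dots> \<le> C * ?w powr (2 * \<alpha>)" using w \<alpha> C by (intro mult_left_mono powr_mono2) auto
    finally have off: "norm (offset (Y (?t i)) (Y (?t j)) (X (?t j) - X (?t i))) \<le> C * b\<^sup>2" by (simp add: b2)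
    have eqR: "R i k - R i j - R j k = rough_step (Y (?t i)) (?t i) (?t j) + rough_step (Y (?t j)) (?t j) (?t k) - rough_step (Y (?t i)) (?t i) (?t k)"
      using sum.atLeastLessThan_concat[of i j k "\<lambda>k. rough_step (Y (?t k)) (?t k) (?t (Suc k))"] ijk
      by (simp add: R_def algebra_simps)
    have "norm (R i k - R i j - R j k) \<le> 2 * K\<^sup>2 * b * norm (offset (Y (?t i)) (Y (?t j)) (X (?t j) - X (?t i))) + 2 * K ^ 6 * b ^ 3"
      unfolding eqR by (intro rough_step_defect_bound m b X1 XX1 w)
    also have "\<dots> \<le> 2 * K\<^sup>2 * b * (C * b\<^sup>2) + 2 * K ^ 6 * b ^ 3"
      using b by (intro add_right_mono mult_left_mono off) auto
    also have "\<dots> = B * b ^ 3" by (simp add: B_def algebra_simps eval_nat_numeral)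
    finally show "norm (R i k - R i j - R j k) \<le> B * ?w powr (3 * \<alpha>) + 0 * norm (R i j)" by (simp add: b2)
  qed (use N in auto)
  moreover have "R 0 N = (\<Sum>k<N. rough_step (Y (?t k)) (?t k) (?t (Suc k))) - rough_step (Y s) s t"
    using h0 by (simp add: R_def atLeast0LessThan)
  ultimately show ?thesis using h0 by (simp add: B_def sewing_const_def mult.assoc)
qed

end

locale rough_rde = completed_tensor_product tensor + rough_equation \<alpha> T K X XX f0 f f1 F
  for tensor :: "'v::banach \<Rightarrow> 'v \<Rightarrow> 't::banach" and \<alpha> T K :: real and X :: "real \<Rightarrow> 'v" and XX :: "real \<Rightarrow> real \<Rightarrow> 't"
    and f0 :: "'w::banach \<Rightarrow> 'w" and f :: "'w \<Rightarrow> 'v \<Rightarrow>\<^sub>L 'w" and f1 :: "'w \<Rightarrow> 'w \<Rightarrow>\<^sub>L 'v \<Rightarrow>\<^sub>L 'w" and F :: "'w \<Rightarrow> 't \<Rightarrow>\<^sub>L 'w" +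
  assumes F_lift: "\<And>y. F y = tensor_lift tensor (f1 y o\<^sub>L f y)"
begin

lemma Frechet_D_f: "Frechet_D f y = f1 y"
  by (rule Frechet_D_eq[OF f_derivative])

lemma has_rough_integral_iff:
  assumes Y': "\<And>u. u \<in> {0..T} \<Longrightarrow> Y' u = f (Y u)" and t: "t \<in> {0..T}"
  shows "has_rough_integral tensor X XX (\<lambda>s. f (Y s)) (\<lambda>s. Frechet_D f (Y s) o\<^sub>L Y' s) t I \<longleftrightarrow>
    (\<forall>\<epsilon>>0. \<exists>\<delta>>0. \<forall>n p. fine_partition p n t \<delta> \<longrightarrow> norm ((\<Sum>i<n. rough_step (Y (p i)) (p i) (p (Suc i))) - I) < \<epsilon>)"
proof -
  have "(\<Sum>i<n. blinfun_apply (f (Y (p i))) (X (p (Suc i)) - X (p i)) + blinfun_apply (tensor_lift tensor (Frechet_D f (Y (p i)) o\<^sub>L Y' (p i))) (XX (p i) (p (Suc i))))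
      = (\<Sum>i<n. rough_step (Y (p i)) (p i) (p (Suc i)))" if "fine_partition p n t \<delta>" for n p \<delta>
  proof (rule sum.cong)
    fix i assume "i \<in> {..<n}"
    then have "p i \<in> {0..T}" using fine_partition_bounds[OF that, of i] t by auto
    then show "blinfun_apply (f (Y (p i))) (X (p (Suc i)) - X (p i)) + blinfun_apply (tensor_lift tensor (Frechet_D f (Y (p i)) o\<^sub>L Y' (p i))) (XX (p i) (p (Suc i)))
      = rough_step (Y (p i)) (p i) (p (Suc i))"
      by (simp add: Y' rough_step_def F_lift Frechet_D_f)
  qed simp
  then have "(\<forall>n p. fine_partition p n t \<delta> \<longrightarrow> norm ((\<Sum>i<n. blinfun_apply (f (Y (p i))) (X (p (Suc i)) - X (p i)) + blinfun_apply (tensor_lift tensor (Frechet_D f (Y (p i)) o\<^sub>L Y' (p i))) (XX (p i) (p (Suc i)))) - I) < \<epsilon>)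
      \<longleftrightarrow> (\<forall>n p. fine_partition p n t \<delta> \<longrightarrow> norm ((\<Sum>i<n. rough_step (Y (p i)) (p i) (p (Suc i))) - I) < \<epsilon>)" for \<delta> \<epsilon>
    by (intro all_cong1 imp_cong refl) simp
  then show ?thesis
    unfolding has_rough_integral_def fine_partition_def[symmetric] by (simp only:)
qed

lemma davie_solution_controlled:
  assumes dav: "davie_solution Y"
  shows "\<exists>c\<ge>0. \<forall>s t. 0 \<le> s \<longrightarrow> s \<le> t \<longrightarrow> t \<le> T \<longrightarrow>
    norm (Y t - Y s - blinfun_apply (f (Y s)) (X t - X s)) \<le> c * \<bar>t - s\<bar> powr (2 * \<alpha>)"
proof -
  have K0: "0 \<le> K" using K by simp
  obtain L where L: "0 \<le> L" and f0L: "\<And>t. t \<in> {0..T} \<Longrightarrow> norm (f0 (Y t)) \<le> L"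
    by (rule davie_solution_bounds[OF dav]) blast
  obtain C where C: "0 \<le> C" and rem: "\<And>s t. 0 \<le> s \<Longrightarrow> s \<le> t \<Longrightarrow> t \<le> T \<Longrightarrow> norm (davie_rem Y s t) \<le> C * (t - s) powr (3 * \<alpha>)"
    using dav unfolding davie_solution_def by blast
  define c where "c = K * K + T powr (1 - 2 * \<alpha>) * L + C * T powr (3 * \<alpha> - 2 * \<alpha>)"
  have fwd: "norm (Y t - Y s - blinfun_apply (f (Y s)) (X t - X s)) \<le> c * \<bar>t - s\<bar> powr (2 * \<alpha>)" if st: "0 \<le> s" "s \<le> t" "t \<le> T" for s t
  proof -
    have m: "s \<in> {0..T}" "t \<in> {0..T}" using st by auto
    have p: "(t - s) powr b \<le> T powr (b - 2 * \<alpha>) * (t - s) powr (2 * \<alpha>)" if "2 * \<alpha> \<le> b" for b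
      using st that by (intro powr_le_powr_times) auto
    have eq: "Y t - Y s - blinfun_apply (f (Y s)) (X t - X s) = blinfun_apply (F (Y s)) (XX s t) + (t - s) *\<^sub>R f0 (Y s) + davie_rem Y s t"
      by (simp add: davie_rem_def rough_step_def)
    have "norm (Y t - Y s - blinfun_apply (f (Y s)) (X t - X s)) \<le> K * (K * \<bar>t - s\<bar> powr (2 * \<alpha>)) + (t - s) powr 1 * L + C * (t - s) powr (3 * \<alpha>)"
      unfolding eq using st f0L[OF m(1)]
      by (intro norm_triangle_mono mult_norm_le C11D(2)[OF C11_F] XX_Holder m rem) (auto intro!: mult_left_mono)
    also have "\<dots> \<le> K * (K * \<bar>t - s\<bar> powr (2 * \<alpha>)) + (T powr (1 - 2 * \<alpha>) * (t - s) powr (2 * \<alpha>)) * L + C * (T powr (3 * \<alpha> - 2 * \<alpha>) * (t - s) powr (2 * \<alpha>))"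
      using \<alpha> L C by (intro add_mono order_refl mult_left_mono mult_right_mono p) auto
    finally show ?thesis using st by (simp add: c_def algebra_simps)
  qed
  have "0 \<le> c" using K0 L C by (simp add: c_def)
  then show ?thesis using fwd by blast
qed

text \<open>
  The increments of \<open>Y t - \<integral>f0(Y)\<close> agree with the terms of the compensated sum up to order \<open>3 * \<alpha> > 1\<close>, so that
  the errors over a partition sum up to a power of the mesh: the rough integral exists, and it has the value that the equation
  demands.
\<close>

theorem rde_solution_if_davie_solution:
  assumes dav: "davie_solution Y" and Y0: "Y 0 = \<xi>"
  shows "rde_solution tensor \<alpha> T X XX f0 f \<xi> Y (\<lambda>t. f (Y t))"
proof -
  have K0: "0 \<le> K" using K by simp
  obtain L where L: "0 \<le> L" and H: "\<And>s t. s \<in> {0..T} \<Longrightarrow> t \<in> {0..T} \<Longrightarrow> norm (Y t - Y s) \<le> L * \<bar>t - s\<bar> powr \<alpha>"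
    and f0L: "\<And>t. t \<in> {0..T} \<Longrightarrow> norm (f0 (Y t)) \<le> L"
    by (rule davie_solution_bounds[OF dav]) blast
  obtain C where C: "0 \<le> C" and rem: "\<And>s t. 0 \<le> s \<Longrightarrow> s \<le> t \<Longrightarrow> t \<le> T \<Longrightarrow> norm (davie_rem Y s t) \<le> C * (t - s) powr (3 * \<alpha>)"
    using dav unfolding davie_solution_def by blast
  have div: "x / \<bar>t - s\<bar> powr b \<le> c" if "x \<le> c * \<bar>t - s\<bar> powr b" "s \<noteq> t" for x s t b c :: real
    using that by (simp add: pos_divide_le_eq)
  have "holder_path \<alpha> T Y" unfolding holder_path_def using H by (intro exI[of _ L] ballI impI div) auto
  moreover have "holder_path \<alpha> T (\<lambda>t. f (Y t))"
    unfolding holder_path_def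
  proof (intro exI[of _ "K * L"] ballI impI div)
    fix s t assume m: "s \<in> {0..T}" "t \<in> {0..T}"
    show "norm (f (Y t) - f (Y s)) \<le> K * L * \<bar>t - s\<bar> powr \<alpha>"
      using C11D(3)[OF C11_f, of "Y t" "Y s"] mult_left_mono[OF H[OF m] K0] by (simp add: mult.assoc)
  qed
  moreover have "\<exists>C. \<forall>s\<in>{0..T}. \<forall>t\<in>{0..T}. s \<noteq> t \<longrightarrow> norm (Y t - Y s - blinfun_apply (f (Y s)) (X t - X s)) / \<bar>t - s\<bar> powr (2 * \<alpha>) \<le> C"
  proof -
    obtain c where c0: "0 \<le> c" and fwd: "\<And>s t. 0 \<le> s \<Longrightarrow> s \<le> t \<Longrightarrow> t \<le> T \<Longrightarrow>
        norm (Y t - Y s - blinfun_apply (f (Y s)) (X t - X s)) \<le> c * \<bar>t - s\<bar> powr (2 * \<alpha>)"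
      using davie_solution_controlled[OF dav] by blast
    show ?thesis
    proof (intro exI[of _ "c + K * L * K"] ballI impI div)
      fix s t assume m: "s \<in> {0..T}" "t \<in> {0..T}"
      let ?w = "\<bar>t - s\<bar> powr (2 * \<alpha>)"
      show "norm (Y t - Y s - blinfun_apply (f (Y s)) (X t - X s)) \<le> (c + K * L * K) * ?w"
      proof (cases "s \<le> t")
        case True
        have "norm (Y t - Y s - blinfun_apply (f (Y s)) (X t - X s)) \<le> c * ?w" using m True by (intro fwd) auto
        also have "\<dots> \<le> (c + K * L * K) * ?w" using K0 L by (intro mult_right_mono) auto
        finally show ?thesis .
      next
        case False
        have 1: "norm (- (Y s - Y t - blinfun_apply (f (Y t)) (X s - X t))) \<le> c * ?w"
          unfolding norm_minus_cancel using fwd[of t s] m False by (simp add: abs_minus_commute)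
        have "norm (f (Y t) - f (Y s)) \<le> K * (L * \<bar>t - s\<bar> powr \<alpha>)"
          using C11D(3)[OF C11_f, of "Y t" "Y s"] mult_left_mono[OF H[OF m] K0] by linarith
        then have 2: "norm (blinfun_apply (f (Y t) - f (Y s)) (X t - X s)) \<le> K * (L * \<bar>t - s\<bar> powr \<alpha>) * (K * \<bar>t - s\<bar> powr \<alpha>)"
          by (intro mult_norm_le X_Holder m)
        have w: "?w = \<bar>t - s\<bar> powr \<alpha> * \<bar>t - s\<bar> powr \<alpha>" by (simp flip: powr_add)
        have eq: "Y t - Y s - blinfun_apply (f (Y s)) (X t - X s) = - (Y s - Y t - blinfun_apply (f (Y t)) (X s - X t)) + blinfun_apply (f (Y t) - f (Y s)) (X t - X s)"
          by (simp add: blinfun.diff_left blinfun.diff_right)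
        show ?thesis unfolding eq using norm_triangle_mono[OF 1 2] unfolding w by (simp add: algebra_simps)
      qed
    qed auto
  qed
  ultimately have "controlled_path \<alpha> T X Y (\<lambda>t. f (Y t))" unfolding controlled_path_def by blast
  moreover have "\<exists>I. has_rough_integral tensor X XX (\<lambda>s. f (Y s)) (\<lambda>s. Frechet_D f (Y s) o\<^sub>L f (Y s)) t I \<and>
      Y t = \<xi> + integral {0..t} (\<lambda>s. f0 (Y s)) + I" if t: "t \<in> {0..T}" for t
  proof -
    define I where "I t = Y t - integral {0..t} (\<lambda>r. f0 (Y r))" for t
    define c where "c = C + K * L * T powr (1 + \<alpha> - 3 * \<alpha>)"
    have c0: "0 \<le> c" using C K0 L by (simp add: c_def)
    have loc: "norm (rough_step (Y s) s t - (I t - I s)) \<le> c * (t - s) powr (3 * \<alpha>)" if st: "0 \<le> s" "s \<le> t" "t \<le> T" for s t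
    proof -
      have eq: "rough_step (Y s) s t - (I t - I s) = (integral {0..t} (\<lambda>r. f0 (Y r)) - integral {0..s} (\<lambda>r. f0 (Y r)) - (t - s) *\<^sub>R f0 (Y s)) - davie_rem Y s t"
        by (simp add: I_def davie_rem_def)
      show ?thesis
        unfolding eq c_def using norm_triangle_le_diff[OF add_mono[OF drift_increment[OF L H st] rem[OF st]]] by (simp add: algebra_simps)
    qed
    have "\<exists>\<delta>>0. \<forall>n p. fine_partition p n t \<delta> \<longrightarrow> norm ((\<Sum>i<n. rough_step (Y (p i)) (p i) (p (Suc i))) - (I t - I 0)) < \<epsilon>" if \<epsilon>: "0 < \<epsilon>" for \<epsilon>
    proof -
      have "eventually (\<lambda>\<delta>. c * T * \<delta> powr (3 * \<alpha> - 1) \<le> \<epsilon> / 2) (at_right 0)" using \<alpha> \<epsilon> by (intro eventually_powr_small) auto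
      moreover have "eventually (\<lambda>\<delta>::real. 0 < \<delta>) (at_right 0)" by (simp add: eventually_at_right_less)
      ultimately have "eventually (\<lambda>\<delta>. 0 < \<delta> \<and> c * T * \<delta> powr (3 * \<alpha> - 1) \<le> \<epsilon> / 2) (at_right 0)" by eventually_elim simp
      then obtain \<delta> where \<delta>: "0 < \<delta>" "c * T * \<delta> powr (3 * \<alpha> - 1) \<le> \<epsilon> / 2"
        using eventually_happens'[OF trivial_limit_at_right_real] by blast
      have "norm ((\<Sum>i<n. rough_step (Y (p i)) (p i) (p (Suc i))) - (I t - I 0)) < \<epsilon>" if p: "fine_partition p n t \<delta>" for n p
      proof -
        have "I t - I 0 = (\<Sum>i<n. I (p (Suc i)) - I (p i))"
          using sum_lessThan_telescope[of "\<lambda>i. I (p i)" n] p by (simp add: fine_partition_def)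
        then have "norm ((\<Sum>i<n. rough_step (Y (p i)) (p i) (p (Suc i))) - (I t - I 0)) = norm (\<Sum>i<n. rough_step (Y (p i)) (p i) (p (Suc i)) - (I (p (Suc i)) - I (p i)))"
          by (simp add: sum_subtractf)
        also have "\<dots> \<le> (\<Sum>i<n. c * \<delta> powr (3 * \<alpha> - 1) * (p (Suc i) - p i))"
        proof (intro order_trans[OF norm_sum] sum_mono)
          fix i assume i: "i \<in> {..<n}"
          let ?w = "p (Suc i) - p i"
          have w: "0 < ?w" "?w \<le> \<delta>" using p i by (auto simp: fine_partition_def less_imp_le)
          have "norm (rough_step (Y (p i)) (p i) (p (Suc i)) - (I (p (Suc i)) - I (p i))) \<le> c * ?w powr (3 * \<alpha>)"
            using fine_partition_bounds[OF p, of i] fine_partition_bounds[OF p, of "Suc i"] i w t by (intro loc) auto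
          also have "\<dots> \<le> c * (\<delta> powr (3 * \<alpha> - 1) * ?w powr 1)"
            using w \<alpha> c0 by (intro mult_left_mono powr_le_powr_times) auto
          finally show "norm (rough_step (Y (p i)) (p i) (p (Suc i)) - (I (p (Suc i)) - I (p i))) \<le> c * \<delta> powr (3 * \<alpha> - 1) * ?w" using w by simp
        qed
        also have "\<dots> = c * \<delta> powr (3 * \<alpha> - 1) * t"
          unfolding sum_distrib_left[symmetric] sum_lessThan_telescope using p by (simp add: fine_partition_def)
        also have "\<dots> \<le> c * \<delta> powr (3 * \<alpha> - 1) * T" using t c0 by (intro mult_left_mono) auto
        also have "\<dots> \<le> \<epsilon> / 2" using \<delta> by (simp add: mult_ac)
        also have "\<dots> < \<epsilon>" using \<epsilon> by simp
        finally show ?thesis .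
      qed
      then show ?thesis using \<delta> by blast
    qed
    then have "has_rough_integral tensor X XX (\<lambda>s. f (Y s)) (\<lambda>s. Frechet_D f (Y s) o\<^sub>L f (Y s)) t (I t - I 0)"
      using has_rough_integral_iff[of "\<lambda>t. f (Y t)" Y t] t by blast
    moreover have "Y t = \<xi> + integral {0..t} (\<lambda>s. f0 (Y s)) + (I t - I 0)" by (simp add: I_def Y0)
    ultimately show ?thesis by blast
  qed
  ultimately show ?thesis unfolding rde_solution_def by blast
qed

text \<open>
  The integrals over \<open>[0,s]\<close> and \<open>[0,t]\<close> are compared along a partition of \<open>[0,s]\<close> followed by a uniform one of
  \<open>[s,t]\<close>; what remains is the compensated sum over \<open>[s,t]\<close>.
\<close>

theorem davie_solution_if_rde_solution:
  assumes rde: "rde_solution tensor \<alpha> T X XX f0 f \<xi> Y Y'"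
  shows "davie_solution Y" "Y 0 = \<xi>"
proof -
  have K0: "0 \<le> K" using K by simp
  have Y': "\<And>u. u \<in> {0..T} \<Longrightarrow> Y' u = f (Y u)" using rde by (simp add: rde_solution_def)
  obtain I where I: "\<And>t. t \<in> {0..T} \<Longrightarrow> has_rough_integral tensor X XX (\<lambda>s. f (Y s)) (\<lambda>s. Frechet_D f (Y s) o\<^sub>L Y' s) t (I t)"
    and Yt: "\<And>t. t \<in> {0..T} \<Longrightarrow> Y t = \<xi> + integral {0..t} (\<lambda>s. f0 (Y s)) + I t"
    using rde unfolding rde_solution_def by metis
  have I': "\<exists>\<delta>>0. \<forall>n p. fine_partition p n t \<delta> \<longrightarrow> norm ((\<Sum>i<n. rough_step (Y (p i)) (p i) (p (Suc i))) - I t) < \<epsilon>"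
    if "t \<in> {0..T}" "0 < \<epsilon>" for t \<epsilon>
    using has_rough_integral_iff[OF Y' that(1), THEN iffD1, OF _ I[OF that(1)]] that(2) by simp
  obtain L0 where L0: "\<And>s t. s \<in> {0..T} \<Longrightarrow> t \<in> {0..T} \<Longrightarrow> s \<noteq> t \<Longrightarrow> norm (Y t - Y s) / \<bar>t - s\<bar> powr \<alpha> \<le> L0"
    using rde unfolding rde_solution_def controlled_path_def holder_path_def by blast
  obtain C0 where C0: "\<And>s t. s \<in> {0..T} \<Longrightarrow> t \<in> {0..T} \<Longrightarrow> s \<noteq> t \<Longrightarrow> norm (Y t - Y s - blinfun_apply (Y' s) (X t - X s)) / \<bar>t - s\<bar> powr (2 * \<alpha>) \<le> C0"
    using rde unfolding rde_solution_def controlled_path_def by blast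
  define L C where "L = max 0 L0" and "C = max 0 C0"
  have L: "0 \<le> L" and C: "0 \<le> C" by (simp_all add: L_def C_def)
  have H: "norm (Y t - Y s) \<le> L * \<bar>t - s\<bar> powr \<alpha>" if m: "s \<in> {0..T}" "t \<in> {0..T}" for s t
  proof (cases "s = t")
    case False
    have "norm (Y t - Y s) \<le> L0 * \<bar>t - s\<bar> powr \<alpha>" using L0[OF m False] False by (simp add: pos_divide_le_eq)
    also have "\<dots> \<le> L * \<bar>t - s\<bar> powr \<alpha>" by (intro mult_right_mono) (auto simp: L_def)
    finally show ?thesis .
  qed simp
  have ctrl: "norm (Y t - Y s - blinfun_apply (f (Y s)) (X t - X s)) \<le> C * (t - s) powr (2 * \<alpha>)" if st: "0 \<le> s" "s \<le> t" "t \<le> T" for s t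
  proof (cases "s = t")
    case False
    have m: "s \<in> {0..T}" "t \<in> {0..T}" using st by auto
    have "norm (Y t - Y s - blinfun_apply (f (Y s)) (X t - X s)) \<le> C0 * (t - s) powr (2 * \<alpha>)"
      using C0[OF m False] False st by (simp add: pos_divide_le_eq Y'[OF m(1)])
    also have "\<dots> \<le> C * (t - s) powr (2 * \<alpha>)" by (intro mult_right_mono) (auto simp: C_def)
    finally show ?thesis .
  qed (simp add: blinfun.zero_right)
  define c where "c = (2 * K\<^sup>2 * C + 2 * K ^ 6) * sewing_const (3 * \<alpha>)"
  have c0: "0 \<le> c" using C K0 sewing_const_pos[of "3 * \<alpha>"] \<alpha> by (simp add: c_def)
  have int: "norm (I t - I s - rough_step (Y s) s t) \<le> c * (t - s) powr (3 * \<alpha>)" if st: "0 \<le> s" "s < t" "t \<le> T" "t - s \<le> 1" for s t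
  proof (rule field_le_epsilon)
    fix e :: real assume e: "0 < e"
    have m: "s \<in> {0..T}" "t \<in> {0..T}" using st by auto
    obtain \<delta>1 where \<delta>1: "0 < \<delta>1" "\<And>n p. fine_partition p n s \<delta>1 \<Longrightarrow> norm ((\<Sum>i<n. rough_step (Y (p i)) (p i) (p (Suc i))) - I s) < e / 2"
      using I'[OF m(1) half_gt_zero[OF e]] by blast
    obtain \<delta>2 where \<delta>2: "0 < \<delta>2" "\<And>n p. fine_partition p n t \<delta>2 \<Longrightarrow> norm ((\<Sum>i<n. rough_step (Y (p i)) (p i) (p (Suc i))) - I t) < e / 2"
      using I'[OF m(2) half_gt_zero[OF e]] by blast
    define \<delta> where "\<delta> = min \<delta>1 \<delta>2"
    have \<delta>: "0 < \<delta>" using \<delta>1 \<delta>2 by (simp add: \<delta>_def)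
    obtain p n where p: "fine_partition p n s \<delta>" using fine_partition_exists[OF st(1) \<delta>] by blast
    obtain N :: nat where N: "(t - s) / \<delta> < real N" using reals_Archimedean2 by blast
    have "0 \<le> (t - s) / \<delta>" using st \<delta> by simp
    then have N0: "0 < real N" using N by linarith
    then have N1: "0 < N" "(t - s) / real N < \<delta>" using N \<delta> by (auto simp: field_simps)
    define h where "h = (t - s) / real N"
    define q where "q i = (if i \<le> n then p i else s + real (i - n) * ((t - s) / real N))" for i
    have q: "fine_partition q (n + N) t \<delta>" unfolding q_def using p st(2) N1 by (rule fine_partition_concat)
    have finer: "fine_partition p n s \<delta>1" "fine_partition q (n + N) t \<delta>2"
      using p q by (auto simp: fine_partition_def \<delta>_def)
    let ?S = "\<Sum>k<N. rough_step (Y (s + real k * h)) (s + real k * h) (s + real (Suc k) * h)"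
    have "q n = s" using p by (simp add: q_def fine_partition_def)
    then have qn: "q (n + k) = s + real k * h" for k by (cases "k = 0") (auto simp: q_def h_def)
    have "(\<Sum>i<n + N. rough_step (Y (q i)) (q i) (q (Suc i))) = (\<Sum>i<n. rough_step (Y (p i)) (p i) (p (Suc i))) + ?S"
    proof -
      have "(\<Sum>i<n. rough_step (Y (q i)) (q i) (q (Suc i))) = (\<Sum>i<n. rough_step (Y (p i)) (p i) (p (Suc i)))"
        by (intro sum.cong) (auto simp: q_def)
      moreover have "(\<Sum>k<N. rough_step (Y (q (n + k))) (q (n + k)) (q (Suc (n + k)))) = ?S"
        using qn qn[of "Suc _"] by simp
      ultimately show ?thesis unfolding sum_lessThan_add by simp
    qed
    then have eq: "I t - I s - rough_step (Y s) s t = (?S - rough_step (Y s) s t)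
        + (((\<Sum>i<n. rough_step (Y (p i)) (p i) (p (Suc i))) - I s) - ((\<Sum>i<n + N. rough_step (Y (q i)) (q i) (q (Suc i))) - I t))"
      by simp
    have "norm (?S - rough_step (Y s) s t) \<le> c * (t - s) powr (3 * \<alpha>)"
      unfolding c_def by (rule compensated_sum_bound[OF C ctrl st N1(1) h_def])
    then show "norm (I t - I s - rough_step (Y s) s t) \<le> c * (t - s) powr (3 * \<alpha>) + e"
      unfolding eq
    proof (rule norm_triangle_mono)
      show "norm (((\<Sum>i<n. rough_step (Y (p i)) (p i) (p (Suc i))) - I s) - ((\<Sum>i<n + N. rough_step (Y (q i)) (q i) (q (Suc i))) - I t)) \<le> e"
        using norm_triangle_ineq4[of "(\<Sum>i<n. rough_step (Y (p i)) (p i) (p (Suc i))) - I s" "(\<Sum>i<n + N. rough_step (Y (q i)) (q i) (q (Suc i))) - I t"]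
          \<delta>1(2)[OF finer(1)] \<delta>2(2)[OF finer(2)] by linarith
    qed
  qed
  define c' where "c' = c + K * L * T powr (1 + \<alpha> - 3 * \<alpha>)"
  have c'0: "0 \<le> c'" using c0 K0 L by (simp add: c'_def)
  show "davie_solution Y"
  proof (rule davie_solution_if_local[OF _ zero_less_one c'0])
    show "continuous_on {0..T} Y" using H by (intro continuous_on_if_Holder[of _ 1 _ L]) auto
    fix s t assume st: "0 \<le> s" "s \<le> t" "t \<le> T" "t - s \<le> 1"
    show "norm (davie_rem Y s t) \<le> c' * (t - s) powr (3 * \<alpha>)"
    proof (cases "s = t")
      case True
      have "t \<in> {0..T}" using st True by simp
      then show ?thesis using rough_step_bound[of t t "Y t"] True by (simp add: davie_rem_def)
    next
      case False
      have m: "s \<in> {0..T}" "t \<in> {0..T}" using st by auto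
      have eq: "davie_rem Y s t = (I t - I s - rough_step (Y s) s t) + (integral {0..t} (\<lambda>r. f0 (Y r)) - integral {0..s} (\<lambda>r. f0 (Y r)) - (t - s) *\<^sub>R f0 (Y s))"
        unfolding davie_rem_def using Yt[OF m(1)] Yt[OF m(2)] by (simp add: algebra_simps)
      show ?thesis
        unfolding eq c'_def distrib_right
        using st False by (intro norm_triangle_mono int drift_increment[OF L H]) auto
    qed
  qed
  have m0: "0 \<in> {0..T}" using T by simp
  have "norm (I 0) \<le> 0"
  proof (rule field_le_epsilon)
    fix e :: real assume e: "0 < e"
    obtain \<delta> where "0 < \<delta>" "\<And>n p. fine_partition p n 0 \<delta> \<Longrightarrow> norm ((\<Sum>i<n. rough_step (Y (p i)) (p i) (p (Suc i))) - I 0) < e"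
      using I'[OF m0 e] by blast
    from this(2)[of "\<lambda>_. 0" 0] show "norm (I 0) \<le> 0 + e" by (simp add: fine_partition_def)
  qed
  then show "Y 0 = \<xi>" using Yt[OF m0] by simp
qed

end

section \<open>Charts of a submanifold\<close>

lemma twice_differentiable_on_smaller_ball:
  assumes "twice_differentiable_on_ball z0 r K \<phi> \<phi>1 \<phi>2" "0 < r'" "r' \<le> r"
  shows "twice_differentiable_on_ball z0 r' K \<phi> \<phi>1 \<phi>2"
proof -
  interpret twice_differentiable_on_ball z0 r K \<phi> \<phi>1 \<phi>2 by fact
  have "z \<in> ball z0 r" if "z \<in> ball z0 r'" for z using that assms(3) by auto
  then show ?thesis
    using assms(2) D1 D2 bound1 bound2 Lip2 by unfold_locales auto
qed

lemma injective_blinfun_bounded_below: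
  fixes D :: "'e::euclidean_space \<Rightarrow>\<^sub>L 'w::real_normed_vector"
  assumes "inj (blinfun_apply D)"
  obtains c where "0 < c" "\<And>q. c * norm q \<le> norm (blinfun_apply D q)"
proof -
  have "compact (sphere (0::'e) 1)" "sphere (0::'e) 1 \<noteq> {}" by simp_all
  moreover have "continuous_on (sphere 0 1) (\<lambda>q. norm (blinfun_apply D q))" by (intro continuous_intros)
  ultimately obtain p where p: "p \<in> sphere 0 1" "\<And>q. q \<in> sphere 0 1 \<Longrightarrow> norm (blinfun_apply D p) \<le> norm (blinfun_apply D q)"
    using continuous_attains_inf[of "sphere (0::'e) 1" "\<lambda>q. norm (blinfun_apply D q)"] by blast
  have "p \<noteq> 0" using p by auto
  then have "blinfun_apply D p \<noteq> blinfun_apply D 0" using assms by (metis injD)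
  then have pos: "0 < norm (blinfun_apply D p)" by (simp add: blinfun.zero_right)
  have "norm (blinfun_apply D p) * norm q \<le> norm (blinfun_apply D q)" for q
  proof (cases "q = 0")
    case False
    then have "norm (blinfun_apply D p) \<le> norm (blinfun_apply D ((1 / norm q) *\<^sub>R q))" by (intro p) simp
    then show ?thesis using False by (simp add: blinfun.scaleR_right field_simps)
  qed simp
  then show ?thesis using that pos by blast
qed

text \<open>
  A parametrised piece of \<open>M\<close> around \<open>\<phi> z0\<close>. The lower bounds with the constant \<open>c\<close> make parameters comparable
  to points of \<open>M\<close>; together with \<open>U\<close> they hold the information that \<open>\<phi>\<close> is a homeomorphism onto an open part of \<open>M\<close>.
\<close>

locale submanifold_chart = twice_differentiable_on_ball z0 r K \<phi> \<phi>1 \<phi>2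
  for z0 :: "'e::euclidean_space" and r K :: real and \<phi> :: "'e \<Rightarrow> 'w::banach"
    and \<phi>1 :: "'e \<Rightarrow> 'e \<Rightarrow>\<^sub>L 'w" and \<phi>2 :: "'e \<Rightarrow> 'e \<Rightarrow>\<^sub>L 'e \<Rightarrow>\<^sub>L 'w" +
  fixes c :: real and M U :: "'w set"
  assumes c: "0 < c"
    and below1: "\<And>z q. z \<in> ball z0 r \<Longrightarrow> c * norm q \<le> norm (blinfun_apply (\<phi>1 z) q)"
    and below: "\<And>z w. z \<in> ball z0 r \<Longrightarrow> w \<in> ball z0 r \<Longrightarrow> c * norm (z - w) \<le> norm (\<phi> z - \<phi> w)"
    and into: "\<And>z. z \<in> ball z0 r \<Longrightarrow> \<phi> z \<in> M"
    and openU: "open U" and centreU: "\<phi> z0 \<in> U" and onto: "\<And>w. w \<in> U \<Longrightarrow> w \<in> M \<Longrightarrow> w \<in> \<phi> ` ball z0 r"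
begin

text \<open>
  The left inverses at different points are chosen independently of each other; what they share is a bound on
  their norms.
\<close>

definition linv :: "'e \<Rightarrow> 'w \<Rightarrow>\<^sub>L 'e" where
  "linv z = (SOME P. (\<forall>q. blinfun_apply P (blinfun_apply (\<phi>1 z) q) = q) \<and> norm P \<le> real DIM('e) / c)"

lemma linv:
  assumes "z \<in> ball z0 r"
  shows "blinfun_apply (linv z) (blinfun_apply (\<phi>1 z) q) = q" "norm (linv z) \<le> real DIM('e) / c"
proof -
  obtain P :: "'w \<Rightarrow>\<^sub>L 'e" where "\<And>q. blinfun_apply P (blinfun_apply (\<phi>1 z) q) = q" "norm P \<le> real DIM('e) / c"
    using bounded_left_inverse[OF bounded_linear.linear[OF blinfun.bounded_linear_right] c below1[OF assms]] by blast
  then have "(\<forall>q. blinfun_apply (linv z) (blinfun_apply (\<phi>1 z) q) = q) \<and> norm (linv z) \<le> real DIM('e) / c"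
    unfolding linv_def by (intro someI[where P = "\<lambda>P. (\<forall>q. blinfun_apply P (blinfun_apply (\<phi>1 z) q) = q) \<and> norm P \<le> real DIM('e) / c"]) auto
  then show "blinfun_apply (linv z) (blinfun_apply (\<phi>1 z) q) = q" "norm (linv z) \<le> real DIM('e) / c" by auto
qed

text \<open>
  A projection along the tangent space at \<open>\<phi> z\<close>.
\<close>

definition normal_part :: "'e \<Rightarrow> 'w \<Rightarrow>\<^sub>L 'w" where "normal_part z = id_blinfun - (\<phi>1 z o\<^sub>L linv z)"

lemma normal_part_apply: "blinfun_apply (normal_part z) w = w - blinfun_apply (\<phi>1 z) (blinfun_apply (linv z) w)"
  by (simp add: normal_part_def blinfun.diff_left)

lemma normal_part_tangent: "z \<in> ball z0 r \<Longrightarrow> blinfun_apply (normal_part z) (blinfun_apply (\<phi>1 z) q) = 0"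
  by (simp add: normal_part_apply linv)

lemma normal_part_zero_iff: "z \<in> ball z0 r \<Longrightarrow> blinfun_apply (normal_part z) w = 0 \<longleftrightarrow> w \<in> range (blinfun_apply (\<phi>1 z))"
  using normal_part_tangent by (auto simp: normal_part_apply)

text \<open>
  A common bound for the derivatives of \<open>\<phi>\<close>, the left inverses, the normal parts, and the passage
  from points of \<open>M\<close> to parameters.
\<close>

definition B :: real where "B = 1 + K + K * (real DIM('e) / c) + real DIM('e) / c + 1 / c"

lemma B: "1 \<le> B" "K \<le> B" "1 / c \<le> B"
  "z \<in> ball z0 r \<Longrightarrow> norm (linv z) \<le> B" "z \<in> ball z0 r \<Longrightarrow> norm (normal_part z) \<le> B"
proof -
  have n: "0 \<le> K * (real DIM('e) / c)" "0 \<le> real DIM('e) / c" "0 \<le> 1 / c" using c K0 by simp_all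
  show 1: "1 \<le> B" "K \<le> B" "1 / c \<le> B" using n K0 unfolding B_def by linarith+
  assume z: "z \<in> ball z0 r"
  show "norm (linv z) \<le> B" using linv(2)[OF z] n K0 unfolding B_def by linarith
  have "norm (\<phi>1 z o\<^sub>L linv z) \<le> norm (\<phi>1 z) * norm (linv z)" by (rule norm_blinfun_compose)
  also have "\<dots> \<le> K * (real DIM('e) / c)" using z K0 by (intro mult_mono bound1 linv) auto
  finally have "norm (normal_part z) \<le> 1 + K * (real DIM('e) / c)"
    unfolding normal_part_def using norm_blinfun_id_le[where 'a = 'w]
    by (intro norm_triangle_le_diff add_mono)
  then show "norm (normal_part z) \<le> B" using n K0 unfolding B_def by linarith
qed

lemma parameter:
  assumes "w \<in> U" "w \<in> M"
  obtains q where "z0 + q \<in> ball z0 r" "w = \<phi> (z0 + q)" "norm q \<le> B * norm (w - \<phi> z0)"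
proof -
  obtain z where z: "z \<in> ball z0 r" "w = \<phi> z" using onto[OF assms] by blast
  have z0: "z0 \<in> ball z0 r" using r by simp
  have "norm (z - z0) \<le> 1 / c * norm (w - \<phi> z0)" using below[OF z(1) z0] c z(2) by (simp add: field_simps)
  also have "\<dots> \<le> B * norm (w - \<phi> z0)" by (intro mult_right_mono B) simp
  finally show ?thesis using z by (intro that[of "z - z0"]) auto
qed

text \<open>
  In the parameter increment \<open>q\<close>, the first order part of \<open>w - \<phi> z0\<close> is tangential and the rest quadratic, and \<open>q\<close>
  is bounded by the increment itself.
\<close>

lemma normal_increment_quadratic:
  assumes "w \<in> U" "w \<in> M"
  shows "norm (blinfun_apply (normal_part z0) (w - \<phi> z0)) \<le> B ^ 4 * norm (w - \<phi> z0) ^ 2"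
proof -
  have z0: "z0 \<in> ball z0 r" using r by simp
  have B0: "0 \<le> B" using B(1) by simp
  obtain q where q: "z0 + q \<in> ball z0 r" "w = \<phi> (z0 + q)" "norm q \<le> B * norm (w - \<phi> z0)" by (rule parameter[OF assms])
  have "norm (w - \<phi> z0 - blinfun_apply (\<phi>1 z0) q) \<le> K * norm q ^ 2" unfolding q(2) by (rule taylor1[OF z0 q(1)])
  also have "\<dots> \<le> B * (B * norm (w - \<phi> z0)) ^ 2" using q(3) B K0 B0 by (intro mult_mono power_mono) auto
  finally have t: "norm (w - \<phi> z0 - blinfun_apply (\<phi>1 z0) q) \<le> B * (B * norm (w - \<phi> z0)) ^ 2" .
  have "blinfun_apply (normal_part z0) (w - \<phi> z0) = blinfun_apply (normal_part z0) (w - \<phi> z0 - blinfun_apply (\<phi>1 z0) q)"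
    by (simp add: blinfun.diff_right normal_part_tangent[OF z0])
  also have "norm \<dots> \<le> norm (normal_part z0) * norm (w - \<phi> z0 - blinfun_apply (\<phi>1 z0) q)" by (rule norm_blinfun)
  also have "\<dots> \<le> B * (B * (B * norm (w - \<phi> z0)) ^ 2)" using t B(5)[OF z0] B0 by (intro mult_mono) auto
  finally show ?thesis by (simp add: power_mult_distrib eval_nat_numeral mult_ac)
qed

text \<open>
  Normal increments are quadratic, so they vanish to first order.
\<close>

lemma curve_tangent:
  assumes d: "(g has_vector_derivative v) (at_right 0)" and g0: "g 0 = \<phi> z0"
    and M: "eventually (\<lambda>e. g e \<in> M) (at_right (0::real))"
  shows "v \<in> range (blinfun_apply (\<phi>1 z0))"
proof -
  have z0: "z0 \<in> ball z0 r" using r by simp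
  have "continuous (at_right 0) g" using d has_vector_derivative_continuous by blast
  then have lim: "(g \<longlongrightarrow> \<phi> z0) (at_right 0)" by (simp add: continuous_within g0)
  have quot: "((\<lambda>e. (1 / e) *\<^sub>R (g e - \<phi> z0)) \<longlongrightarrow> v) (at_right 0)"
  proof -
    have "((\<lambda>e. (1 / norm (e - 0)) *\<^sub>R (g e - (g 0 + (e - 0) *\<^sub>R v))) \<longlongrightarrow> 0) (at_right 0)"
      using d unfolding has_vector_derivative_def has_derivative_within by blast
    then have "((\<lambda>e. (1 / norm (e - 0)) *\<^sub>R (g e - (g 0 + (e - 0) *\<^sub>R v)) + v) \<longlongrightarrow> 0 + v) (at_right 0)"
      by (intro tendsto_add tendsto_const)
    moreover have "eventually (\<lambda>e. (1 / norm (e - 0)) *\<^sub>R (g e - (g 0 + (e - 0) *\<^sub>R v)) + v = (1 / e) *\<^sub>R (g e - \<phi> z0)) (at_right 0)"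
      using eventually_at_right_less[of 0] by eventually_elim (simp add: g0 algebra_simps)
    ultimately show ?thesis by (auto elim: Lim_transform_eventually)
  qed
  have "((\<lambda>e. blinfun_apply (normal_part z0) ((1 / e) *\<^sub>R (g e - \<phi> z0))) \<longlongrightarrow> blinfun_apply (normal_part z0) v) (at_right 0)"
    by (intro blinfun.tendsto tendsto_const quot)
  moreover have "((\<lambda>e. blinfun_apply (normal_part z0) ((1 / e) *\<^sub>R (g e - \<phi> z0))) \<longlongrightarrow> 0) (at_right 0)"
  proof (rule Lim_null_comparison)
    have "((\<lambda>e. B ^ 4 * (norm ((1 / e) *\<^sub>R (g e - \<phi> z0)) * norm (g e - \<phi> z0))) \<longlongrightarrow> B ^ 4 * (norm v * norm (\<phi> z0 - \<phi> z0))) (at_right 0)"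
      by (intro tendsto_mult_left tendsto_mult tendsto_norm quot tendsto_diff lim tendsto_const)
    then show "((\<lambda>e. B ^ 4 * (norm ((1 / e) *\<^sub>R (g e - \<phi> z0)) * norm (g e - \<phi> z0))) \<longlongrightarrow> 0) (at_right 0)" by simp
    have "eventually (\<lambda>e. g e \<in> U) (at_right 0)" using lim openU centreU by (rule topological_tendstoD)
    with M have "eventually (\<lambda>e. g e \<in> M \<and> g e \<in> U \<and> 0 < e) (at_right 0)"
      using eventually_at_right_less[of 0] by eventually_elim simp
    then show "eventually (\<lambda>e. norm (blinfun_apply (normal_part z0) ((1 / e) *\<^sub>R (g e - \<phi> z0))) \<le> B ^ 4 * (norm ((1 / e) *\<^sub>R (g e - \<phi> z0)) * norm (g e - \<phi> z0))) (at_right 0)"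
    proof eventually_elim
      case (elim e)
      then have "norm (blinfun_apply (normal_part z0) (g e - \<phi> z0)) \<le> B ^ 4 * norm (g e - \<phi> z0) ^ 2"
        by (intro normal_increment_quadratic) auto
      then have "(1 / e) * norm (blinfun_apply (normal_part z0) (g e - \<phi> z0)) \<le> (1 / e) * (B ^ 4 * norm (g e - \<phi> z0) ^ 2)"
        using elim by (intro mult_left_mono) auto
      then show ?case using elim by (simp add: blinfun.scaleR_right power2_eq_square mult_ac)
    qed
  qed
  ultimately have "blinfun_apply (normal_part z0) v = 0" by (rule tendsto_unique[OF trivial_limit_at_right_real])
  then show ?thesis using normal_part_zero_iff[OF z0] by simp
qed

end

lemma local_parametrization_recentre:
  assumes lp: "local_parametrization M y U S \<phi>" and z: "z \<in> S"
  shows "local_parametrization M (\<phi> z) U S \<phi>"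
proof -
  obtain \<psi> where "homeomorphism S (U \<inter> M) \<phi> \<psi>" using lp by (auto simp: local_parametrization_def)
  then have "\<phi> z \<in> U" using z by (auto simp: homeomorphism_def)
  then show ?thesis using lp by (simp add: local_parametrization_def)
qed

text \<open>
  On a small ball the derivative of \<open>\<phi>\<close> is so close to the injective one at \<open>z0\<close> that half of the lower bound
  survives. The neighbourhood comes from the continuity of the inverse of \<open>\<phi>\<close>.
\<close>

lemma chart_at_parameter:
  fixes \<phi> :: "real ^ 'm::finite \<Rightarrow> 'w::banach"
  assumes lp: "local_parametrization M y U S \<phi>" and z0: "z0 \<in> S"
  shows "\<exists>r K \<phi>1 \<phi>2 c V. submanifold_chart z0 r K \<phi> \<phi>1 \<phi>2 c M V \<and> ball z0 r \<subseteq> S \<and>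
    (\<forall>z\<in>ball z0 r. frechet_derivative \<phi> (at z) = blinfun_apply (\<phi>1 z))"
proof -
  have S: "open S" "C3_on S \<phi>" and U: "open U" and inj: "inj (frechet_derivative \<phi> (at z0))"
    using lp z0 by (auto simp: local_parametrization_def)
  obtain \<psi> where hom: "homeomorphism S (U \<inter> M) \<phi> \<psi>" using lp by (auto simp: local_parametrization_def)
  obtain r0 K \<phi>1 \<phi>2 where r0: "ball z0 r0 \<subseteq> S" and td0: "twice_differentiable_on_ball z0 r0 K \<phi> \<phi>1 \<phi>2"
    using C3_on_imp_twice_differentiable_on_ball[OF S(2,1) z0] by blast
  interpret t0: twice_differentiable_on_ball z0 r0 K \<phi> \<phi>1 \<phi>2 by (rule td0)
  have fd: "frechet_derivative \<phi> (at z) = blinfun_apply (\<phi>1 z)" if "z \<in> ball z0 r0" for z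
    using frechet_derivative_at[OF t0.D1[OF that]] by simp
  have z0r: "z0 \<in> ball z0 r0" using t0.r by simp
  obtain c2 where c2: "0 < c2" "\<And>q. c2 * norm q \<le> norm (blinfun_apply (\<phi>1 z0) q)"
    using injective_blinfun_bounded_below[of "\<phi>1 z0"] inj fd[OF z0r] by auto
  define c where "c = c2 / 2"
  have c: "0 < c" using c2 by (simp add: c_def)
  define r where "r = min r0 (c / (K + 1))"
  have K1: "0 < K + 1" using t0.K0 by linarith
  have r: "0 < r" "r \<le> r0" using t0.r c K1 by (auto simp: r_def)
  have "r \<le> c / (K + 1)" by (simp add: r_def)
  then have "r * (K + 1) \<le> c" using K1 by (simp add: pos_le_divide_eq)
  then have Kr: "K * r \<le> c" using r by (simp add: algebra_simps)
  have sub: "ball z0 r \<subseteq> ball z0 r0" using r by auto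
  have near: "norm (\<phi>1 z - \<phi>1 z0) \<le> c" if z: "z \<in> ball z0 r" for z
  proof -
    have "norm (\<phi>1 z - \<phi>1 z0) \<le> K * norm (z - z0)" using z sub z0r by (intro t0.Lip1) auto
    also have "\<dots> \<le> K * r" using z t0.K0 by (intro mult_left_mono) (auto simp: dist_norm norm_minus_commute)
    finally show ?thesis using Kr by linarith
  qed
  have low: "c * norm q \<le> norm x" if "norm (x - blinfun_apply (\<phi>1 z0) q) \<le> c * norm q" for x q
  proof -
    have "2 * c * norm q \<le> norm (blinfun_apply (\<phi>1 z0) q)" using c2 by (simp add: c_def)
    then show ?thesis using that norm_triangle_ineq2[of "blinfun_apply (\<phi>1 z0) q" x] norm_minus_commute[of x "blinfun_apply (\<phi>1 z0) q"] by linarith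
  qed
  have below1: "c * norm q \<le> norm (blinfun_apply (\<phi>1 z) q)" if z: "z \<in> ball z0 r" for z q
  proof (rule low)
    have "norm (blinfun_apply (\<phi>1 z - \<phi>1 z0) q) \<le> norm (\<phi>1 z - \<phi>1 z0) * norm q" by (rule norm_blinfun)
    also have "\<dots> \<le> c * norm q" by (intro mult_right_mono near z) simp
    finally show "norm (blinfun_apply (\<phi>1 z) q - blinfun_apply (\<phi>1 z0) q) \<le> c * norm q" by (simp add: blinfun.diff_left)
  qed
  have below: "c * norm (z - w) \<le> norm (\<phi> z - \<phi> w)" if zw: "z \<in> ball z0 r" "w \<in> ball z0 r" for z w
  proof (rule low)
    have "norm (\<phi> z - \<phi> w - blinfun_apply (\<phi>1 z0) (z - w)) \<le> norm (z - w) * c"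
    proof (rule differentiable_bound_linearization[where f = \<phi> and a = w and b = z and ?x0.0 = z0 and B = c and S = "ball z0 r" and f' = "\<lambda>z. blinfun_apply (\<phi>1 z)"])
      show "w + t *\<^sub>R (z - w) \<in> ball z0 r" if "t \<in> {0..1}" for t
        using convexD_alt[OF convex_ball, of w z0 r z t] zw that by (simp add: algebra_simps)
      show "(\<phi> has_derivative blinfun_apply (\<phi>1 x)) (at x within ball z0 r)" if "x \<in> ball z0 r" for x
        by (rule has_derivative_at_withinI[OF t0.D1]) (use that sub in blast)
      show "onorm (blinfun_apply (\<phi>1 x) - blinfun_apply (\<phi>1 z0)) \<le> c" if "x \<in> ball z0 r" for x
      proof -
        have eq: "blinfun_apply (\<phi>1 x) - blinfun_apply (\<phi>1 z0) = blinfun_apply (\<phi>1 x - \<phi>1 z0)"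
          by (rule ext) (simp add: blinfun.diff_left)
        show ?thesis using near[OF that] unfolding eq norm_blinfun.rep_eq .
      qed
    qed (use r in simp)
    then show "norm (\<phi> z - \<phi> w - blinfun_apply (\<phi>1 z0) (z - w)) \<le> c * norm (z - w)" by (simp only: mult.commute[of c])
  qed
  have \<psi>: "continuous_on (U \<inter> M) \<psi>" "\<And>z. z \<in> S \<Longrightarrow> \<psi> (\<phi> z) = z" "\<And>w. w \<in> U \<inter> M \<Longrightarrow> \<phi> (\<psi> w) = w" "\<And>z. z \<in> S \<Longrightarrow> \<phi> z \<in> U \<inter> M"
    using hom by (auto simp: homeomorphism_def)
  obtain V where V: "open V" "V \<inter> (U \<inter> M) = \<psi> -` ball z0 r \<inter> (U \<inter> M)"
    using \<psi>(1) open_ball[of z0 r] unfolding continuous_on_open_invariant by blast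
  have "submanifold_chart z0 r K \<phi> \<phi>1 \<phi>2 c M (U \<inter> V)"
  proof (intro submanifold_chart.intro submanifold_chart_axioms.intro)
    show "twice_differentiable_on_ball z0 r K \<phi> \<phi>1 \<phi>2" by (rule twice_differentiable_on_smaller_ball[OF td0 r])
    show "\<phi> z \<in> M" if "z \<in> ball z0 r" for z using \<psi>(4)[of z] that sub r0 by blast
    show "open (U \<inter> V)" using U V by auto
    show "\<phi> z0 \<in> U \<inter> V"
    proof -
      have "\<phi> z0 \<in> \<psi> -` ball z0 r \<inter> (U \<inter> M)" using \<psi>(2,4)[OF z0] r by simp
      then show ?thesis using V(2) by blast
    qed
    show "w \<in> \<phi> ` ball z0 r" if "w \<in> U \<inter> V" "w \<in> M" for w
    proof -
      have "w \<in> V \<inter> (U \<inter> M)" using that by blast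
      then have "\<psi> w \<in> ball z0 r" unfolding V(2) by simp
      moreover have "\<phi> (\<psi> w) = w" using that by (intro \<psi>(3)) auto
      ultimately show ?thesis by (metis imageI)
    qed
  qed (use c below1 below in auto)
  moreover have "ball z0 r \<subseteq> S" "\<forall>z\<in>ball z0 r. frechet_derivative \<phi> (at z) = blinfun_apply (\<phi>1 z)"
    using sub r0 fd by auto
  ultimately show ?thesis by blast
qed

text \<open>
  A tangent vector of any other parametrisation is the velocity of a curve in \<open>M\<close>.
\<close>

theorem tangent_space_eq_range:
  fixes \<phi> :: "real ^ 'm::finite \<Rightarrow> 'w::banach"
  assumes lp: "local_parametrization M y U S \<phi>" and z0: "z0 \<in> S"
  shows "tangent_space TYPE('m) M (\<phi> z0) = range (frechet_derivative \<phi> (at z0))"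
proof
  have "local_parametrization M (\<phi> z0) U S \<phi>" using lp z0 by (rule local_parametrization_recentre)
  then show "range (frechet_derivative \<phi> (at z0)) \<subseteq> tangent_space TYPE('m) M (\<phi> z0)"
    unfolding tangent_space_def using z0 by blast
  show "tangent_space TYPE('m) M (\<phi> z0) \<subseteq> range (frechet_derivative \<phi> (at z0))"
  proof
    fix v assume "v \<in> tangent_space TYPE('m) M (\<phi> z0)"
    then obtain U' S' and \<phi>' :: "real ^ 'm \<Rightarrow> 'w" and z' h where v: "v = frechet_derivative \<phi>' (at z') h"
      and lp': "local_parametrization M (\<phi> z0) U' S' \<phi>'" and z': "z' \<in> S'" "\<phi>' z' = \<phi> z0"
      unfolding tangent_space_def by blast
    obtain r K \<phi>1 \<phi>2 c V where "submanifold_chart z0 r K \<phi> \<phi>1 \<phi>2 c M V"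
      and fd: "\<And>z. z \<in> ball z0 r \<Longrightarrow> frechet_derivative \<phi> (at z) = blinfun_apply (\<phi>1 z)"
      using chart_at_parameter[OF lp z0] by blast
    then interpret submanifold_chart z0 r K \<phi> \<phi>1 \<phi>2 c M V by blast
    obtain r' K' \<phi>1' \<phi>2' c' V' where "submanifold_chart z' r' K' \<phi>' \<phi>1' \<phi>2' c' M V'"
      and fd': "\<And>z. z \<in> ball z' r' \<Longrightarrow> frechet_derivative \<phi>' (at z) = blinfun_apply (\<phi>1' z)"
      using chart_at_parameter[OF lp' z'(1)] by blast
    then interpret c': submanifold_chart z' r' K' \<phi>' \<phi>1' \<phi>2' c' M V' by blast
    have "v \<in> range (blinfun_apply (\<phi>1 z0))"
    proof (rule curve_tangent[where g = "\<lambda>e. \<phi>' (z' + e *\<^sub>R h)"])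
      show "((\<lambda>e. \<phi>' (z' + e *\<^sub>R h)) has_vector_derivative v) (at_right 0)"
        using has_vector_derivative_along_segment[of \<phi>' \<phi>1' z' 0 h "{0<..}"] c'.D1[of z'] c'.r fd'[of z'] v by simp
      show "\<phi>' (z' + 0 *\<^sub>R h) = \<phi> z0" using z' by simp
      have "((\<lambda>e. z' + e *\<^sub>R h) \<longlongrightarrow> z' + 0 *\<^sub>R h) (at_right 0)" by (intro tendsto_intros)
      then have "eventually (\<lambda>e. z' + e *\<^sub>R h \<in> ball z' r') (at_right 0)"
        using c'.r by (intro topological_tendstoD) auto
      then show "eventually (\<lambda>e. \<phi>' (z' + e *\<^sub>R h) \<in> M) (at_right 0)"
        by eventually_elim (rule c'.into)
    qed
    then show "v \<in> range (frechet_derivative \<phi> (at z0))" using fd[of z0] r by simp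
  qed
qed

section \<open>The equation in a chart\<close>

locale rde_on_chart =
  rough_rde tensor \<alpha> T K X XX f0 f f1 F + submanifold_chart z0 r \<kappa> \<phi> \<phi>1 \<phi>2 c M U
  for tensor :: "'v::banach \<Rightarrow> 'v \<Rightarrow> 't::banach" and \<alpha> T K :: real and X :: "real \<Rightarrow> 'v" and XX :: "real \<Rightarrow> real \<Rightarrow> 't"
    and f0 :: "'w::banach \<Rightarrow> 'w" and f :: "'w \<Rightarrow> 'v \<Rightarrow>\<^sub>L 'w" and f1 :: "'w \<Rightarrow> 'w \<Rightarrow>\<^sub>L 'v \<Rightarrow>\<^sub>L 'w" and F :: "'w \<Rightarrow> 't \<Rightarrow>\<^sub>L 'w"
    and z0 :: "'e::euclidean_space" and r \<kappa> :: real and \<phi> :: "'e \<Rightarrow> 'w"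
    and \<phi>1 :: "'e \<Rightarrow> 'e \<Rightarrow>\<^sub>L 'w" and \<phi>2 :: "'e \<Rightarrow> 'e \<Rightarrow>\<^sub>L 'e \<Rightarrow>\<^sub>L 'w" and c :: real and M U :: "'w set" +
  fixes x :: 't
  assumes inj: "has_canonical_injection tensor TYPE('w)"
    and bracket: "\<And>s t. 0 \<le> s \<Longrightarrow> s \<le> t \<Longrightarrow> t \<le> T \<Longrightarrow>
      XX s t + tensor_flip tensor (XX s t) = tensor (X t - X s) (X t - X s) - (t - s) *\<^sub>R x"
begin

lemma centre: "z0 \<in> ball z0 r"
  using r by simp

lemma K_nonneg: "0 \<le> K" and B_nonneg: "0 \<le> B"
  using K B(1) by simp_all

lemma F_tensor: "blinfun_apply (F y) (tensor v w) = blinfun_apply (blinfun_apply (f1 y) (blinfun_apply (f y) v)) w"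
  by (simp add: F_lift tensor_lift[OF inj])

text \<open>
  If \<open>f v\<close> had a normal component, a functional detecting it, composed with the normal part and \<open>f\<close>,
  would be a nonzero functional on the driver space that is of order \<open>(t - s) powr (2 * \<alpha>)\<close> along the
  increments of \<open>X\<close>.
\<close>

theorem tangent_at_truly_rough_time:
  assumes Y: "davie_solution Y" and s: "0 \<le> s" "s < \<tau>" "\<tau> \<le> T" and Ys: "Y s = \<phi> z0"
    and M: "\<And>t. s \<le> t \<Longrightarrow> t \<le> \<tau> \<Longrightarrow> Y t \<in> M"
    and rough: "\<And>v :: 'v \<Rightarrow>\<^sub>L real. v \<noteq> 0 \<Longrightarrow>
      Limsup (at_right s) (\<lambda>t. ereal (\<bar>blinfun_apply v (X t - X s)\<bar> / \<bar>t - s\<bar> powr (2 * \<alpha>))) = \<infinity>"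
  shows "blinfun_apply (f (\<phi> z0)) v \<in> range (blinfun_apply (\<phi>1 z0))"
proof (rule ccontr)
  assume "\<not> ?thesis"
  then have "blinfun_apply (normal_part z0) (blinfun_apply (f (\<phi> z0)) v) \<noteq> 0" using normal_part_zero_iff[OF centre] by simp
  then obtain l :: "'w \<Rightarrow>\<^sub>L real" where l: "blinfun_apply l (blinfun_apply (normal_part z0) (blinfun_apply (f (\<phi> z0)) v)) \<noteq> 0"
    by (rule functional_separating_from_zero)
  define g where "g = (l o\<^sub>L normal_part z0) o\<^sub>L f (\<phi> z0)"
  have "blinfun_apply g v \<noteq> 0" using l by (simp add: g_def)
  then have g0: "g \<noteq> 0" by auto
  obtain L where L: "0 \<le> L" and H: "\<And>s t. s \<in> {0..T} \<Longrightarrow> t \<in> {0..T} \<Longrightarrow> norm (Y t - Y s) \<le> L * \<bar>t - s\<bar> powr \<alpha>"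
    by (rule davie_solution_bounds[OF Y]) blast
  obtain C where C: "0 \<le> C" and ctrl: "\<And>s t. 0 \<le> s \<Longrightarrow> s \<le> t \<Longrightarrow> t \<le> T \<Longrightarrow>
      norm (Y t - Y s - blinfun_apply (f (Y s)) (X t - X s)) \<le> C * \<bar>t - s\<bar> powr (2 * \<alpha>)"
    using davie_solution_controlled[OF Y] by blast
  have "continuous_on {0..T} Y" using H by (intro continuous_on_if_Holder[of _ 1 _ L]) auto
  then have "continuous_on {s..\<tau>} Y" by (rule continuous_on_subset) (use s in auto)
  then have "(Y \<longlongrightarrow> Y s) (at s within {s..\<tau>})" using s by (simp add: continuous_on_def)
  then have lim: "(Y \<longlongrightarrow> Y s) (at_right s)" using s by (simp add: at_within_Icc_at_right)
  have "eventually (\<lambda>t. Y t \<in> U) (at_right s)" using lim openU centreU Ys by (intro topological_tendstoD) auto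
  moreover have "eventually (\<lambda>t. s < t \<and> t < \<tau>) (at_right s)" using s by (intro eventually_at_rightI[of s \<tau>]) auto
  ultimately have "eventually (\<lambda>t. ereal (\<bar>blinfun_apply g (X t - X s)\<bar> / \<bar>t - s\<bar> powr (2 * \<alpha>)) \<le> ereal (norm l * (B ^ 4 * L\<^sup>2 + B * C))) (at_right s)"
  proof eventually_elim
    case (elim t)
    then have t: "s \<in> {0..T}" "t \<in> {0..T}" "s < t" "t \<le> \<tau>" using s by auto
    let ?w = "\<bar>t - s\<bar> powr (2 * \<alpha>)"
    have "norm (blinfun_apply (normal_part z0) (Y t - Y s)) \<le> B ^ 4 * norm (Y t - Y s) ^ 2"
      unfolding Ys using elim t by (intro normal_increment_quadratic M) auto
    also have "\<dots> \<le> B ^ 4 * (L * \<bar>t - s\<bar> powr \<alpha>) ^ 2" using H[OF t(1,2)] B_nonneg by (intro mult_left_mono power_mono) auto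
    also have "\<dots> = B ^ 4 * L\<^sup>2 * ?w" using t powr_multiples(1)[of "\<bar>t - s\<bar>"] by (simp add: power_mult_distrib)
    finally have 1: "norm (blinfun_apply (normal_part z0) (Y t - Y s)) \<le> B ^ 4 * L\<^sup>2 * ?w" .
    have 2: "norm (blinfun_apply (normal_part z0) (Y t - Y s - blinfun_apply (f (Y s)) (X t - X s))) \<le> B * (C * ?w)"
      using t by (intro mult_norm_le B(5)[OF centre] ctrl) auto
    have "norm (blinfun_apply (normal_part z0) (blinfun_apply (f (\<phi> z0)) (X t - X s))) \<le> B ^ 4 * L\<^sup>2 * ?w + B * (C * ?w)"
      using norm_triangle_le_diff[OF add_mono[OF 1 2]] by (simp add: blinfun.diff_right Ys)
    then have "norm (blinfun_apply l (blinfun_apply (normal_part z0) (blinfun_apply (f (\<phi> z0)) (X t - X s)))) \<le> norm l * (B ^ 4 * L\<^sup>2 * ?w + B * (C * ?w))"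
      by (intro mult_norm_le) auto
    then have "\<bar>blinfun_apply g (X t - X s)\<bar> \<le> norm l * (B ^ 4 * L\<^sup>2 + B * C) * ?w" by (simp add: g_def algebra_simps)
    then show ?case using t by (simp add: pos_divide_le_eq)
  qed
  then have "Limsup (at_right s) (\<lambda>t. ereal (\<bar>blinfun_apply g (X t - X s)\<bar> / \<bar>t - s\<bar> powr (2 * \<alpha>))) \<le> ereal (norm l * (B ^ 4 * L\<^sup>2 + B * C))"
    by (rule Limsup_bounded)
  then show False using rough[OF g0] by simp
qed

text \<open>
  The preimages of \<open>f (\<phi> z) v\<close> under the injective derivatives are bounded, because the derivatives are bounded below
  uniformly.
\<close>

lemma tangency_closed:
  assumes near: "\<And>\<delta>. 0 < \<delta> \<Longrightarrow> \<exists>z\<in>ball z0 r. norm (z - z0) < \<delta> \<and> blinfun_apply (f (\<phi> z)) v \<in> range (blinfun_apply (\<phi>1 z))"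
  shows "blinfun_apply (f (\<phi> z0)) v \<in> range (blinfun_apply (\<phi>1 z0))"
proof -
  note [simp] = K_nonneg B_nonneg
  define C where "C = B * (K * \<kappa> * norm v) + B * (\<kappa> * (K * norm v / c)) + 1"
  have C: "0 < C" unfolding C_def using K0 c by (intro add_nonneg_pos add_nonneg_nonneg mult_nonneg_nonneg divide_nonneg_pos) auto
  have "norm (blinfun_apply (normal_part z0) (blinfun_apply (f (\<phi> z0)) v)) \<le> 0"
  proof (rule field_le_epsilon)
    fix e :: real assume e: "0 < e"
    then obtain z h where z: "z \<in> ball z0 r" "norm (z - z0) < e / C" and h: "blinfun_apply (f (\<phi> z)) v = blinfun_apply (\<phi>1 z) h"
      using near[of "e / C"] C by auto
    have "c * norm h \<le> norm (blinfun_apply (f (\<phi> z)) v)" unfolding h by (rule below1[OF z(1)])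
    also have "\<dots> \<le> K * norm v" by (intro mult_norm_le C11D(2)[OF C11_f]) simp
    finally have hn: "norm h \<le> K * norm v / c" using c by (simp add: field_simps)
    have \<phi>n: "norm (\<phi> z0 - \<phi> z) \<le> \<kappa> * norm (z - z0)" using Lip0[OF centre z(1)] by (simp add: norm_minus_commute)
    have "norm (f (\<phi> z0) - f (\<phi> z)) \<le> K * (\<kappa> * norm (z - z0))"
      using C11D(3)[OF C11_f, of "\<phi> z0" "\<phi> z"] mult_left_mono[OF \<phi>n K_nonneg] by linarith
    then have 1: "norm (blinfun_apply (normal_part z0) (blinfun_apply (f (\<phi> z0) - f (\<phi> z)) v)) \<le> B * (K * (\<kappa> * norm (z - z0)) * norm v)"
      by (intro mult_norm_le B centre) auto
    have 2: "norm (blinfun_apply (normal_part z0) (blinfun_apply (\<phi>1 z - \<phi>1 z0) h)) \<le> B * (\<kappa> * norm (z - z0) * (K * norm v / c))"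
      by (intro mult_norm_le B centre Lip1 z hn)
    have eq: "blinfun_apply (normal_part z0) (blinfun_apply (f (\<phi> z0)) v) = blinfun_apply (normal_part z0) (blinfun_apply (f (\<phi> z0) - f (\<phi> z)) v) + blinfun_apply (normal_part z0) (blinfun_apply (\<phi>1 z - \<phi>1 z0) h)"
      by (simp add: blinfun.diff_left blinfun.diff_right h normal_part_tangent[OF centre])
    have "norm (blinfun_apply (normal_part z0) (blinfun_apply (f (\<phi> z0)) v)) \<le> B * (K * (\<kappa> * norm (z - z0)) * norm v) + B * (\<kappa> * norm (z - z0) * (K * norm v / c))"
      unfolding eq by (rule norm_triangle_mono[OF 1 2])
    also have "\<dots> \<le> C * norm (z - z0)" by (simp add: C_def algebra_simps)
    also have "\<dots> \<le> C * (e / C)" using z C by (intro mult_left_mono) auto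
    finally show "norm (blinfun_apply (normal_part z0) (blinfun_apply (f (\<phi> z0)) v)) \<le> 0 + e" using C by simp
  qed
  then show ?thesis using normal_part_zero_iff[OF centre] by simp
qed

text \<open>
  The vector field \<open>f\<close> pulled back to the parameter domain.
\<close>

definition chart_field :: "'e \<Rightarrow> 'v \<Rightarrow> 'e" where "chart_field z v = blinfun_apply (linv z) (blinfun_apply (f (\<phi> z)) v)"

definition tangential :: bool where
  "tangential \<longleftrightarrow> (\<forall>z\<in>ball z0 r. \<forall>v. blinfun_apply (f (\<phi> z)) v \<in> range (blinfun_apply (\<phi>1 z)))"

lemma chart_field:
  assumes "tangential" "z \<in> ball z0 r"
  shows "blinfun_apply (\<phi>1 z) (chart_field z v) = blinfun_apply (f (\<phi> z)) v"
proof -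
  obtain q where "blinfun_apply (f (\<phi> z)) v = blinfun_apply (\<phi>1 z) q" using assms unfolding tangential_def by blast
  then show ?thesis by (simp add: chart_field_def linv(1)[OF assms(2)])
qed

lemma chart_field_bound:
  assumes "z \<in> ball z0 r"
  shows "norm (chart_field z v) \<le> B * (K * norm v)"
  unfolding chart_field_def by (intro mult_norm_le B assms C11D(2)[OF C11_f]) simp

text \<open>
  Apply the normal part at the fixed point \<open>z\<close> to both sides of the tangency relation at the moving point \<open>z + e p\<close>,
  divide by \<open>e\<close> and let \<open>e\<close> tend to zero. The normal part annihilates the derivative of \<open>\<phi>\<close> at \<open>z\<close>, so
  the derivative falls on \<open>\<phi>1\<close>, and the pulled back field enters through its limit alone.
\<close>

theorem second_order_tangency:
  assumes tan: "tangential" and z: "z \<in> ball z0 r"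
  shows "blinfun_apply (normal_part z) (blinfun_apply (blinfun_apply (f1 (\<phi> z)) (blinfun_apply (\<phi>1 z) p)) v)
    = blinfun_apply (normal_part z) (blinfun_apply (blinfun_apply (\<phi>2 z) p) (chart_field z v))"
proof -
  define ze where "ze e = z + e *\<^sub>R p" for e :: real
  have zlim: "(ze \<longlongrightarrow> z) (at_right 0)"
  proof -
    have "((\<lambda>e. z + e *\<^sub>R p) \<longlongrightarrow> z + 0 *\<^sub>R p) (at_right 0)" by (intro tendsto_intros)
    then show ?thesis by (simp add: ze_def[abs_def])
  qed
  have ev: "eventually (\<lambda>e. ze e \<in> ball z0 r \<and> 0 < e) (at_right 0)"
    using topological_tendstoD[OF zlim open_ball z] eventually_at_right_less[of 0] by eventually_elim simp
  have \<phi>1lim: "((\<lambda>e. \<phi>1 (ze e)) \<longlongrightarrow> \<phi>1 z) (at_right 0)"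
    using has_derivative_continuous[OF D2[OF z]] zlim by (rule isCont_tendsto_compose)
  have "isCont \<phi> z" using D1[OF z] has_derivative_continuous by blast
  then have "((\<lambda>e. \<phi> (ze e)) \<longlongrightarrow> \<phi> z) (at_right 0)" using zlim by (rule isCont_tendsto_compose)
  with has_derivative_continuous[OF f_derivative] have flim: "((\<lambda>e. f (\<phi> (ze e))) \<longlongrightarrow> f (\<phi> z)) (at_right 0)"
    by (rule isCont_tendsto_compose)
  have alim: "((\<lambda>e. chart_field (ze e) v) \<longlongrightarrow> chart_field z v) (at_right 0)"
  proof (rule LIM_zero_cancel, rule Lim_null_comparison)
    show "eventually (\<lambda>e. norm (chart_field (ze e) v - chart_field z v) \<le>
        (1 / c) * (norm (f (\<phi> (ze e)) - f (\<phi> z)) * norm v + norm (\<phi>1 (ze e) - \<phi>1 z) * (B * (K * norm v)))) (at_right 0)"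
      using ev
    proof eventually_elim
      case (elim e)
      have eq: "blinfun_apply (\<phi>1 z) (chart_field (ze e) v - chart_field z v)
          = blinfun_apply (f (\<phi> (ze e)) - f (\<phi> z)) v - blinfun_apply (\<phi>1 (ze e) - \<phi>1 z) (chart_field (ze e) v)"
        using elim z by (simp add: blinfun.diff_right blinfun.diff_left chart_field[OF tan])
      have "c * norm (chart_field (ze e) v - chart_field z v) \<le> norm (blinfun_apply (\<phi>1 z) (chart_field (ze e) v - chart_field z v))" by (rule below1[OF z])
      also have "\<dots> \<le> norm (f (\<phi> (ze e)) - f (\<phi> z)) * norm v + norm (\<phi>1 (ze e) - \<phi>1 z) * (B * (K * norm v))"
        unfolding eq using elim by (intro norm_triangle_le_diff add_mono mult_norm_le chart_field_bound order_refl) auto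
      finally show ?case using c by (simp add: field_simps)
    qed
    have "((\<lambda>e. (1 / c) * (norm (f (\<phi> (ze e)) - f (\<phi> z)) * norm v + norm (\<phi>1 (ze e) - \<phi>1 z) * (B * (K * norm v))))
        \<longlongrightarrow> (1 / c) * (norm (f (\<phi> z) - f (\<phi> z)) * norm v + norm (\<phi>1 z - \<phi>1 z) * (B * (K * norm v)))) (at_right 0)"
      by (intro tendsto_intros flim \<phi>1lim)
    then show "((\<lambda>e. (1 / c) * (norm (f (\<phi> (ze e)) - f (\<phi> z)) * norm v + norm (\<phi>1 (ze e) - \<phi>1 z) * (B * (K * norm v)))) \<longlongrightarrow> 0) (at_right 0)"
      by simp
  qed
  have quotient: "((\<lambda>e. (1 / e) *\<^sub>R (g (ze e) - g z)) \<longlongrightarrow> blinfun_apply D p) (at_right 0)"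
    if "(g has_derivative blinfun_apply D) (at z)" for g :: "'e \<Rightarrow> 'b::real_normed_vector" and D
  proof -
    have "((\<lambda>e. g (z + e *\<^sub>R p)) has_vector_derivative blinfun_apply D p) (at_right 0)"
      using has_vector_derivative_along_segment[of g "\<lambda>_. D" z 0 p] that by simp
    then have "((\<lambda>e. (1 / norm (e - 0)) *\<^sub>R (g (ze e) - (g (ze 0) + (e - 0) *\<^sub>R blinfun_apply D p))) \<longlongrightarrow> 0) (at_right 0)"
      unfolding has_vector_derivative_def has_derivative_within ze_def by blast
    then have "((\<lambda>e. (1 / norm (e - 0)) *\<^sub>R (g (ze e) - (g (ze 0) + (e - 0) *\<^sub>R blinfun_apply D p)) + blinfun_apply D p) \<longlongrightarrow> 0 + blinfun_apply D p) (at_right 0)"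
      by (intro tendsto_add tendsto_const)
    moreover have "eventually (\<lambda>e. (1 / norm (e - 0)) *\<^sub>R (g (ze e) - (g (ze 0) + (e - 0) *\<^sub>R blinfun_apply D p)) + blinfun_apply D p
        = (1 / e) *\<^sub>R (g (ze e) - g z)) (at_right 0)"
      using eventually_at_right_less[of 0] by eventually_elim (simp add: ze_def algebra_simps)
    ultimately show ?thesis by (auto elim: Lim_transform_eventually)
  qed
  have "((\<lambda>z. f (\<phi> z)) has_derivative blinfun_apply (f1 (\<phi> z) o\<^sub>L \<phi>1 z)) (at z)"
    using has_derivative_compose[OF D1[OF z] f_derivative] by (simp add: o_def blinfun_compose.rep_eq)
  from quotient[OF this]
  have lim1: "((\<lambda>e. blinfun_apply (normal_part z) (blinfun_apply ((1 / e) *\<^sub>R (f (\<phi> (ze e)) - f (\<phi> z))) v))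
      \<longlongrightarrow> blinfun_apply (normal_part z) (blinfun_apply (blinfun_apply (f1 (\<phi> z) o\<^sub>L \<phi>1 z) p) v)) (at_right 0)"
    by (intro blinfun.tendsto tendsto_const)
  have lim2: "((\<lambda>e. blinfun_apply (normal_part z) (blinfun_apply ((1 / e) *\<^sub>R (\<phi>1 (ze e) - \<phi>1 z)) (chart_field (ze e) v)))
      \<longlongrightarrow> blinfun_apply (normal_part z) (blinfun_apply (blinfun_apply (\<phi>2 z) p) (chart_field z v))) (at_right 0)"
    by (intro blinfun.tendsto tendsto_const quotient D2 z alim)
  have eq: "eventually (\<lambda>e. blinfun_apply (normal_part z) (blinfun_apply ((1 / e) *\<^sub>R (\<phi>1 (ze e) - \<phi>1 z)) (chart_field (ze e) v))
      = blinfun_apply (normal_part z) (blinfun_apply ((1 / e) *\<^sub>R (f (\<phi> (ze e)) - f (\<phi> z))) v)) (at_right 0)"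
    using ev
  proof eventually_elim
    case (elim e)
    have "blinfun_apply (normal_part z) (blinfun_apply (f (\<phi> z)) v) = 0"
      unfolding chart_field[OF tan z, symmetric] by (rule normal_part_tangent[OF z])
    then show ?case
      using elim by (simp add: blinfun.scaleR_left blinfun.scaleR_right blinfun.diff_left blinfun.diff_right chart_field[OF tan] normal_part_tangent[OF z])
  qed
  show ?thesis
    using tendsto_unique[OF trivial_limit_at_right_real lim1 Lim_transform_eventually[OF lim2 eq]]
    by (simp add: blinfun_compose.rep_eq)
qed

lemma normal_tensor:
  assumes tan: "tangential" and z: "z \<in> ball z0 r"
  shows "blinfun_apply (normal_part z) (blinfun_apply (F (\<phi> z)) (tensor u v)) = blinfun_apply (normal_part z) (blinfun_apply (blinfun_apply (\<phi>2 z) (chart_field z u)) (chart_field z v))"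
  unfolding F_tensor chart_field[OF tan z, of u, symmetric] by (rule second_order_tangency[OF tan z])

text \<open>
  By the symmetry of the second derivative, the normal part of \<open>F\<close> is invariant under the flip and therefore sees
  only the symmetric part of the second level, which the bracket determines.
\<close>

lemma normal_level_two:
  assumes tan: "tangential" and z: "z \<in> ball z0 r" and st: "0 \<le> s" "s \<le> t" "t \<le> T"
  defines "a \<equiv> chart_field z (X t - X s)"
  shows "blinfun_apply (normal_part z) (blinfun_apply (F (\<phi> z)) (XX s t))
    = (1/2) *\<^sub>R (blinfun_apply (normal_part z) (blinfun_apply (blinfun_apply (\<phi>2 z) a) a) - (t - s) *\<^sub>R blinfun_apply (normal_part z) (blinfun_apply (F (\<phi> z)) x))"
proof -
  define Q where "Q = normal_part z o\<^sub>L F (\<phi> z)"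
  have "(\<lambda>y. blinfun_apply Q (tensor_flip tensor y)) = blinfun_apply Q"
  proof (rule bounded_linear_eq_on_tensors)
    show "bounded_linear (\<lambda>y. blinfun_apply Q (tensor_flip tensor y))"
      by (rule bounded_linear_compose[OF blinfun.bounded_linear_right tensor_flip(1)])
    show "bounded_linear (blinfun_apply Q)" by (rule blinfun.bounded_linear_right)
    show "blinfun_apply Q (tensor_flip tensor (tensor v w)) = blinfun_apply Q (tensor v w)" for v w
      by (simp add: Q_def tensor_flip(2) normal_tensor[OF tan z] second_derivative_symmetric[OF z, of "chart_field z v"])
  qed
  then have "blinfun_apply Q (XX s t) + blinfun_apply Q (XX s t) = blinfun_apply Q (XX s t + tensor_flip tensor (XX s t))"
    by (metis blinfun.add_right)
  also have "\<dots> = blinfun_apply Q (tensor (X t - X s) (X t - X s)) - (t - s) *\<^sub>R blinfun_apply Q x"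
    unfolding bracket[OF st] by (simp add: blinfun.diff_right blinfun.scaleR_right)
  finally have "2 *\<^sub>R blinfun_apply Q (XX s t) = blinfun_apply Q (tensor (X t - X s) (X t - X s)) - (t - s) *\<^sub>R blinfun_apply Q x"
    by (simp add: scaleR_2)
  then have "blinfun_apply Q (XX s t) = (1/2) *\<^sub>R (blinfun_apply Q (tensor (X t - X s) (X t - X s)) - (t - s) *\<^sub>R blinfun_apply Q x)"
    by (metis (no_types, lifting) divide_self_if mult.commute scaleR_one scaleR_scaleR times_divide_eq_right zero_neq_numeral mult_1)
  then show ?thesis by (simp add: Q_def normal_tensor[OF tan z] a_def)
qed

definition corrected_drift :: "'w \<Rightarrow> 'w" where
  "corrected_drift y = f0 y - (1/2) *\<^sub>R blinfun_apply (F y) x"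

definition euler_increment :: "'w \<Rightarrow> real \<Rightarrow> real \<Rightarrow> 'w" where
  "euler_increment y s t = rough_step y s t + (t - s) *\<^sub>R f0 y"

lemma normal_euler_increment:
  assumes tan: "tangential" and z: "z \<in> ball z0 r" and st: "0 \<le> s" "s \<le> t" "t \<le> T"
  defines "a \<equiv> chart_field z (X t - X s)"
  shows "blinfun_apply (normal_part z) (euler_increment (\<phi> z) s t)
    = (1/2) *\<^sub>R blinfun_apply (normal_part z) (blinfun_apply (blinfun_apply (\<phi>2 z) a) a) + (t - s) *\<^sub>R blinfun_apply (normal_part z) (corrected_drift (\<phi> z))"
proof -
  have "blinfun_apply (normal_part z) (blinfun_apply (f (\<phi> z)) (X t - X s)) = 0"
    unfolding chart_field[OF tan z, symmetric] by (rule normal_part_tangent[OF z])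
  then show ?thesis
    unfolding euler_increment_def rough_step_def corrected_drift_def
    by (simp add: blinfun.add_right blinfun.diff_right blinfun.scaleR_right normal_level_two[OF tan z st] a_def scaleR_diff_right)
qed

lemma second_derivative_difference:
  assumes "z \<in> ball z0 r"
  shows "norm (blinfun_apply (blinfun_apply (\<phi>2 z) q) q - blinfun_apply (blinfun_apply (\<phi>2 z) p) p) \<le> B * ((norm q + norm p) * norm (q - p))"
proof -
  have b: "norm (\<phi>2 z) \<le> B" using bound2[OF assms] B(2) by linarith
  have eq: "blinfun_apply (blinfun_apply (\<phi>2 z) q) q - blinfun_apply (blinfun_apply (\<phi>2 z) p) p
      = blinfun_apply (blinfun_apply (\<phi>2 z) (q - p)) q + blinfun_apply (blinfun_apply (\<phi>2 z) p) (q - p)"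
    by (simp add: blinfun.diff_right blinfun.diff_left)
  have "norm (blinfun_apply (blinfun_apply (\<phi>2 z) q) q - blinfun_apply (blinfun_apply (\<phi>2 z) p) p) \<le> B * norm (q - p) * norm q + B * norm p * norm (q - p)"
    unfolding eq by (intro norm_triangle_mono mult_norm_le b order_refl)
  then show ?thesis by (simp add: algebra_simps)
qed

text \<open>
  A bound for the drift on the chart, where \<open>\<phi>\<close> is bounded.
\<close>

definition drift_sup :: real where "drift_sup = norm (f0 (\<phi> z0)) + K * (\<kappa> * r)"

lemma drift_sup:
  assumes "z \<in> ball z0 r"
  shows "norm (f0 (\<phi> z)) \<le> drift_sup" "0 \<le> drift_sup"
proof -
  have "norm (\<phi> z - \<phi> z0) \<le> \<kappa> * norm (z - z0)" by (rule Lip0[OF assms centre])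
  also have "\<dots> \<le> \<kappa> * r" using assms K0 by (intro mult_left_mono) (auto simp: dist_norm norm_minus_commute)
  finally have "K * norm (\<phi> z - \<phi> z0) \<le> K * (\<kappa> * r)" using K_nonneg by (rule mult_left_mono)
  then show 1: "norm (f0 (\<phi> z)) \<le> drift_sup"
    using f0_Lipschitz[of "\<phi> z" "\<phi> z0"] norm_triangle_ineq2[of "f0 (\<phi> z)" "f0 (\<phi> z0)"] by (simp add: drift_sup_def)
  then show "0 \<le> drift_sup" using norm_ge_zero order_trans by blast
qed

text \<open>
  The constant in the bound of the second order part of an Euler increment.
\<close>

definition E :: real where "E = K\<^sup>2 + drift_sup"

lemma E_nonneg: "0 \<le> E"
  using drift_sup(2)[OF centre] by (simp add: E_def)

lemma chart_increment_bounds: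
  assumes z: "z \<in> ball z0 r" and st: "0 \<le> s" "s < t" "t \<le> T" "t - s \<le> 1" and b: "b = (t - s) powr \<alpha>"
  shows "norm (chart_field z (X t - X s)) \<le> B * K\<^sup>2 * b"
    and "norm (blinfun_apply (linv z) (euler_increment (\<phi> z) s t) - chart_field z (X t - X s)) \<le> B * E * b\<^sup>2"
proof -
  have m: "s \<in> {0..T}" "t \<in> {0..T}" using st by auto
  have w: "0 < t - s" "\<bar>t - s\<bar> = t - s" using st by auto
  note win = window_powers[OF w(1) st(4) b]
  note b2 = win(3) and wb = win(5)
  have "norm (chart_field z (X t - X s)) \<le> B * (K * (K * b))"
    using chart_field_bound[OF z, of "X t - X s"] X_Holder[OF m] B_nonneg K_nonneg w b
    by (elim order_trans) (intro mult_left_mono, auto)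
  then show "norm (chart_field z (X t - X s)) \<le> B * K\<^sup>2 * b" by (simp add: power2_eq_square mult.assoc)
  have eq: "blinfun_apply (linv z) (euler_increment (\<phi> z) s t) - chart_field z (X t - X s)
      = blinfun_apply (linv z) (blinfun_apply (F (\<phi> z)) (XX s t) + (t - s) *\<^sub>R f0 (\<phi> z))"
    by (simp add: euler_increment_def rough_step_def chart_field_def blinfun.add_right)
  have "norm ((t - s) *\<^sub>R f0 (\<phi> z)) \<le> b\<^sup>2 * drift_sup"
    using w wb drift_sup[OF z] by (auto intro!: mult_mono)
  moreover have "norm (XX s t) \<le> K * b\<^sup>2" using XX_Holder[OF m] w b2 by simp
  ultimately have "norm (blinfun_apply (linv z) (euler_increment (\<phi> z) s t) - chart_field z (X t - X s)) \<le> B * (K * (K * b\<^sup>2) + b\<^sup>2 * drift_sup)"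
    unfolding eq by (intro mult_norm_le norm_triangle_mono B z C11D(2)[OF C11_F])
  then show "norm (blinfun_apply (linv z) (euler_increment (\<phi> z) s t) - chart_field z (X t - X s)) \<le> B * E * b\<^sup>2"
    by (simp add: E_def algebra_simps power2_eq_square)
qed

text \<open>
  Compare the normal part of \<open>Y t - Y 0\<close> computed from the Euler increment with the one computed from the
  expansion of \<open>\<phi>\<close>. The quadratic terms agree up to order \<open>3 * \<alpha>\<close>, since the parameter increment of \<open>Y\<close> is
  the pulled back increment of \<open>X\<close> up to order \<open>2 * \<alpha>\<close>. What is left is \<open>t\<close> times the normal part of the drift.
\<close>

theorem corrected_drift_tangent_if_invariant:
  assumes tan: "tangential" and Y: "davie_solution Y" and Y0: "Y 0 = \<phi> z0"
    and \<tau>: "0 < \<tau>" "\<tau> \<le> T" and M: "\<And>t. 0 \<le> t \<Longrightarrow> t \<le> \<tau> \<Longrightarrow> Y t \<in> M"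
  shows "corrected_drift (\<phi> z0) \<in> range (blinfun_apply (\<phi>1 z0))"
proof -
  note [simp] = K_nonneg B_nonneg E_nonneg
  obtain L where L: "0 \<le> L" and H: "\<And>s t. s \<in> {0..T} \<Longrightarrow> t \<in> {0..T} \<Longrightarrow> norm (Y t - Y s) \<le> L * \<bar>t - s\<bar> powr \<alpha>"
    by (rule davie_solution_bounds[OF Y]) blast
  obtain C where C: "0 \<le> C" and rem: "\<And>s t. 0 \<le> s \<Longrightarrow> s \<le> t \<Longrightarrow> t \<le> T \<Longrightarrow> norm (davie_rem Y s t) \<le> C * (t - s) powr (3 * \<alpha>)"
    using Y unfolding davie_solution_def by blast
  define Q where "Q = B * L"
  define D where "D = B * E + B * C + B * (B * Q\<^sup>2)"
  define A where "A = (1/2) * (B * (B * ((Q + B * K\<^sup>2) * D))) + B * (B * Q ^ 3) + B * C"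
  have "continuous_on {0..T} Y" using H by (intro continuous_on_if_Holder[of _ 1 _ L]) auto
  then have "(Y \<longlongrightarrow> Y 0) (at 0 within {0..T})" using T by (auto simp: continuous_on_def)
  then have "(Y \<longlongrightarrow> Y 0) (at_right 0)" using T by (simp add: at_within_Icc_at_right)
  then have "eventually (\<lambda>t. Y t \<in> U) (at_right 0)" using openU centreU Y0 by (intro topological_tendstoD) auto
  moreover have "eventually (\<lambda>t. 0 < t \<and> t < min \<tau> 1) (at_right 0)" using \<tau> by (intro eventually_at_rightI[of 0 "min \<tau> 1"]) auto
  ultimately have ev: "eventually (\<lambda>t. norm (blinfun_apply (normal_part z0) (corrected_drift (\<phi> z0))) \<le> A * t powr (3 * \<alpha> - 1)) (at_right 0)"
  proof eventually_elim
    case (elim t)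
    then have t: "0 < t" "t \<le> 1" "t \<le> \<tau>" "t \<le> T" using \<tau> by auto
    define b where "b = t powr \<alpha>"
    have b: "0 \<le> b" "b \<le> 1" using t \<alpha> powr_mono2[of \<alpha> t 1] by (auto simp: b_def)
    have b2: "t powr (2 * \<alpha>) = b\<^sup>2" "t powr (3 * \<alpha>) = b ^ 3" using powr_multiples[OF t(1)] by (simp_all add: b_def)
    have m: "0 \<in> {0..T}" "t \<in> {0..T}" using t T by auto
    let ?a = "chart_field z0 (X t - X 0)" and ?d = "euler_increment (\<phi> z0) 0 t" and ?\<rho> = "davie_rem Y 0 t"
    have YM: "Y t \<in> U" "Y t \<in> M" using elim t by (auto intro: M)
    obtain q where q: "z0 + q \<in> ball z0 r" "Y t = \<phi> (z0 + q)" "norm q \<le> B * norm (Y t - \<phi> z0)"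
      by (rule parameter[OF YM])
    have "B * norm (Y t - \<phi> z0) \<le> B * (L * b)" using H[OF m] t by (intro mult_left_mono) (auto simp: Y0 b_def)
    then have qb: "norm q \<le> Q * b" using q(3) by (simp add: Q_def mult.assoc)
    have Q0: "0 \<le> Q" using L by (simp add: Q_def)
    have \<rho>: "norm ?\<rho> \<le> C * b ^ 3" using rem[of 0 t] t by (simp add: b2)
    have d\<rho>: "Y t - \<phi> z0 = ?d + ?\<rho>" by (simp add: euler_increment_def davie_rem_def Y0)
    define \<sigma> where "\<sigma> = Y t - \<phi> z0 - blinfun_apply (\<phi>1 z0) q"
    have "norm \<sigma> \<le> \<kappa> * norm q ^ 2" unfolding \<sigma>_def q(2) by (rule taylor1[OF centre q(1)])
    also have "\<dots> \<le> B * (Q * b) ^ 2" using qb B(2) K0 by (intro mult_mono power_mono) auto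
    finally have \<sigma>: "norm \<sigma> \<le> B * (Q * b) ^ 2" .
    define \<xi> where "\<xi> = Y t - \<phi> z0 - blinfun_apply (\<phi>1 z0) q - (1/2) *\<^sub>R blinfun_apply (blinfun_apply (\<phi>2 z0) q) q"
    have "norm \<xi> \<le> \<kappa> * norm q ^ 3" unfolding \<xi>_def q(2) by (rule taylor2[OF centre q(1)])
    also have "\<dots> \<le> B * (Q * b) ^ 3" using qb B(2) K0 by (intro mult_mono power_mono) auto
    finally have \<xi>: "norm \<xi> \<le> B * (Q * b) ^ 3" .
    have incr: "norm ?a \<le> B * K\<^sup>2 * b" "norm (blinfun_apply (linv z0) ?d - ?a) \<le> B * E * b\<^sup>2"
      using chart_increment_bounds[OF centre, of 0 t b] t by (simp_all add: b_def)
    have "blinfun_apply (\<phi>1 z0) q = ?d + ?\<rho> - \<sigma>" unfolding d\<rho>[symmetric] by (simp add: \<sigma>_def)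
    then have "q = blinfun_apply (linv z0) (?d + ?\<rho> - \<sigma>)" using linv(1)[OF centre, of q] by simp
    then have eqq: "q - ?a = (blinfun_apply (linv z0) ?d - ?a) + blinfun_apply (linv z0) ?\<rho> - blinfun_apply (linv z0) \<sigma>"
      by (simp add: blinfun.add_right blinfun.diff_right)
    have "norm (q - ?a) \<le> B * E * b\<^sup>2 + B * (C * b ^ 3) + B * (B * (Q * b) ^ 2)"
      unfolding eqq by (intro norm_triangle_le_diff norm_triangle_mono add_mono mult_norm_le incr B centre \<rho> \<sigma>)
    also have "\<dots> \<le> B * E * b\<^sup>2 + B * (C * b ^ 2) + B * (B * (Q * b) ^ 2)"
      using b C by (intro add_mono order_refl mult_left_mono power_decreasing) auto
    also have "\<dots> = D * b\<^sup>2" by (simp add: D_def algebra_simps power_mult_distrib)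
    finally have qa: "norm (q - ?a) \<le> D * b\<^sup>2" .
    let ?qq = "blinfun_apply (blinfun_apply (\<phi>2 z0) q) q" and ?aa = "blinfun_apply (blinfun_apply (\<phi>2 z0) ?a) ?a"
    have "norm (?qq - ?aa) \<le> B * ((norm q + norm ?a) * norm (q - ?a))" by (rule second_derivative_difference[OF centre])
    also have "\<dots> \<le> B * ((Q * b + B * K\<^sup>2 * b) * (D * b\<^sup>2))"
      using b Q0 by (intro mult_left_mono mult_mono add_mono qb qa incr) auto
    finally have diff: "norm (?qq - ?aa) \<le> B * ((Q * b + B * K\<^sup>2 * b) * (D * b\<^sup>2))" .
    have "blinfun_apply (normal_part z0) (?d + ?\<rho>) = (1/2) *\<^sub>R blinfun_apply (normal_part z0) ?qq + blinfun_apply (normal_part z0) \<xi>"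
      unfolding d\<rho>[symmetric] \<xi>_def by (simp add: blinfun.diff_right blinfun.scaleR_right normal_part_tangent[OF centre])
    then have eqG: "t *\<^sub>R blinfun_apply (normal_part z0) (corrected_drift (\<phi> z0))
        = (1/2) *\<^sub>R blinfun_apply (normal_part z0) (?qq - ?aa) + blinfun_apply (normal_part z0) \<xi> - blinfun_apply (normal_part z0) ?\<rho>"
      using normal_euler_increment[OF tan centre, of 0 t] t
      by (simp add: blinfun.add_right blinfun.diff_right scaleR_diff_right algebra_simps)
    have "norm (t *\<^sub>R blinfun_apply (normal_part z0) (corrected_drift (\<phi> z0)))
        \<le> (1/2) * (B * (B * ((Q * b + B * K\<^sup>2 * b) * (D * b\<^sup>2)))) + B * (B * (Q * b) ^ 3) + B * (C * b ^ 3)"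
      unfolding eqG
    proof (intro norm_triangle_le_diff norm_triangle_mono add_mono mult_norm_le B centre \<xi> \<rho>)
      have "norm (blinfun_apply (normal_part z0) (?qq - ?aa)) \<le> B * (B * ((Q * b + B * K\<^sup>2 * b) * (D * b\<^sup>2)))"
        by (intro mult_norm_le B centre diff)
      then show "norm ((1/2) *\<^sub>R blinfun_apply (normal_part z0) (?qq - ?aa)) \<le> (1/2) * (B * (B * ((Q * b + B * K\<^sup>2 * b) * (D * b\<^sup>2))))"
        by simp
    qed
    also have "\<dots> = A * b ^ 3" by (simp add: A_def algebra_simps eval_nat_numeral)
    also have "\<dots> = A * (t * t powr (3 * \<alpha> - 1))" unfolding b2(2)[symmetric] using t powr_mult_base[of t "3 * \<alpha> - 1"] by simp
    finally have "t * norm (blinfun_apply (normal_part z0) (corrected_drift (\<phi> z0))) \<le> t * (A * t powr (3 * \<alpha> - 1))"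
      using t by (simp add: mult_ac)
    then show ?case using t by simp
  qed
  have "norm (blinfun_apply (normal_part z0) (corrected_drift (\<phi> z0))) \<le> 0"
  proof (rule field_le_epsilon)
    fix e :: real assume "0 < e"
    then have "eventually (\<lambda>t. A * t powr (3 * \<alpha> - 1) \<le> e) (at_right 0)" using \<alpha> by (intro eventually_powr_small) auto
    with ev have "eventually (\<lambda>t. norm (blinfun_apply (normal_part z0) (corrected_drift (\<phi> z0))) \<le> 0 + e) (at_right (0::real))"
      by eventually_elim simp
    then show "norm (blinfun_apply (normal_part z0) (corrected_drift (\<phi> z0))) \<le> 0 + e"
      using eventually_happens'[OF trivial_limit_at_right_real] by blast
  qed
  then show ?thesis using normal_part_zero_iff[OF centre] by simp
qed

text \<open>
  The parameter increment whose image under \<open>\<phi>\<close> reproduces the Euler increment: its tangential component,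
  corrected by the tangential component of the quadratic term of \<open>\<phi>\<close>.
\<close>

definition chart_step :: "'e \<Rightarrow> real \<Rightarrow> real \<Rightarrow> 'e" where
  "chart_step z s t = (let p = blinfun_apply (linv z) (euler_increment (\<phi> z) s t)
     in p - (1/2) *\<^sub>R blinfun_apply (linv z) (blinfun_apply (blinfun_apply (\<phi>2 z) p) p))"

text \<open>
  The tangential components match by construction. The normal component of the image is that of the quadratic
  term of \<open>\<phi>\<close>, and this is also the normal component of the Euler increment once the drift is tangential.
\<close>

lemma chart_step_consistent:
  assumes tan: "tangential" and drift: "\<And>z. z \<in> ball z0 r \<Longrightarrow> corrected_drift (\<phi> z) \<in> range (blinfun_apply (\<phi>1 z))"
  shows "\<exists>Q\<ge>0. \<exists>C\<ge>0. \<forall>z\<in>ball z0 r. \<forall>s t. 0 \<le> s \<longrightarrow> s < t \<longrightarrow> t \<le> T \<longrightarrow> t - s \<le> 1 \<longrightarrow>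
    norm (chart_step z s t) \<le> Q * (t - s) powr \<alpha> \<and>
    (z + chart_step z s t \<in> ball z0 r \<longrightarrow>
       norm (\<phi> (z + chart_step z s t) - \<phi> z - euler_increment (\<phi> z) s t) \<le> C * (t - s) powr (3 * \<alpha>))"
proof -
  note [simp] = K_nonneg B_nonneg E_nonneg
  define P where "P = B * E + B * K\<^sup>2"
  define D where "D = (1/2) * (B * (B * P * P))"
  define Q where "Q = P + D"
  define C where "C = B * Q ^ 3 + (1/2) * (B * (B * ((P + B * K\<^sup>2) * (B * E)))) + (1/2) * (B * ((Q + P) * D))"
  have P0: "0 \<le> P" by (simp add: P_def)
  have D0: "0 \<le> D" using P0 by (simp add: D_def)
  have Q0: "0 \<le> Q" using P0 D0 by (simp add: Q_def)
  have main: "norm (chart_step z s t) \<le> Q * b \<and> (z + chart_step z s t \<in> ball z0 r \<longrightarrow>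
      norm (\<phi> (z + chart_step z s t) - \<phi> z - euler_increment (\<phi> z) s t) \<le> C * b ^ 3)"
    if z: "z \<in> ball z0 r" and st: "0 \<le> s" "s < t" "t \<le> T" "t - s \<le> 1" and b: "b = (t - s) powr \<alpha>" for z s t b
  proof -
    have b1: "0 \<le> b" "b \<le> 1" using st \<alpha> powr_mono2[of \<alpha> "t - s" 1] by (auto simp: b)
    then have bb: "b\<^sup>2 \<le> b" by (simp add: power2_eq_square mult_left_le)
    let ?d = "euler_increment (\<phi> z) s t" and ?a = "chart_field z (X t - X s)" and ?p = "blinfun_apply (linv z) (euler_increment (\<phi> z) s t)"
    let ?q = "chart_step z s t"
    let ?pp = "blinfun_apply (blinfun_apply (\<phi>2 z) ?p) ?p" and ?aa = "blinfun_apply (blinfun_apply (\<phi>2 z) ?a) ?a" and ?qq = "blinfun_apply (blinfun_apply (\<phi>2 z) ?q) ?q"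
    have q: "?q = ?p - (1/2) *\<^sub>R blinfun_apply (linv z) ?pp" by (simp add: chart_step_def Let_def)
    have a: "norm ?a \<le> B * K\<^sup>2 * b" "norm (?p - ?a) \<le> B * E * b\<^sup>2" by (rule chart_increment_bounds[OF z st b])+
    have "norm ((?p - ?a) + ?a) \<le> B * E * b\<^sup>2 + B * K\<^sup>2 * b" by (intro norm_triangle_mono a)
    also have "\<dots> \<le> B * E * b + B * K\<^sup>2 * b" using bb by (intro add_right_mono mult_left_mono) auto
    finally have p: "norm ?p \<le> P * b" by (simp add: P_def algebra_simps)
    have b2: "norm (\<phi>2 z) \<le> B" using bound2[OF z] B(2) by linarith
    have "norm ?pp \<le> B * (P * b) * (P * b)" by (intro mult_norm_le b2 p)
    then have "norm (blinfun_apply (linv z) ?pp) \<le> B * (B * (P * b) * (P * b))" by (rule mult_norm_le[OF B(4)[OF z]])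
    then have qp: "norm (?q - ?p) \<le> D * b\<^sup>2" by (simp add: q D_def power2_eq_square algebra_simps)
    have "norm (?p + (?q - ?p)) \<le> P * b + D * b\<^sup>2" by (intro norm_triangle_mono p qp)
    also have "\<dots> \<le> P * b + D * b" using bb D0 by (intro add_left_mono mult_left_mono)
    finally have qb: "norm ?q \<le> Q * b" by (simp add: Q_def algebra_simps)
    have "norm (\<phi> (z + ?q) - \<phi> z - ?d) \<le> C * b ^ 3" if zq: "z + ?q \<in> ball z0 r"
    proof -
      define \<xi> where "\<xi> = \<phi> (z + ?q) - \<phi> z - blinfun_apply (\<phi>1 z) ?q - (1/2) *\<^sub>R ?qq"
      have "norm \<xi> \<le> \<kappa> * norm ?q ^ 3" unfolding \<xi>_def by (rule taylor2[OF z zq])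
      also have "\<dots> \<le> B * (Q * b) ^ 3" using qb B(2) K0 by (intro mult_mono power_mono) auto
      finally have \<xi>: "norm \<xi> \<le> B * (Q * b) ^ 3" .
      have "norm (?pp - ?aa) \<le> B * ((norm ?p + norm ?a) * norm (?p - ?a))" by (rule second_derivative_difference[OF z])
      also have "\<dots> \<le> B * ((P * b + B * K\<^sup>2 * b) * (B * E * b\<^sup>2))"
        using b1 P0 by (intro mult_left_mono mult_mono add_mono p a) auto
      finally have pa: "norm (blinfun_apply (normal_part z) (?pp - ?aa)) \<le> B * (B * ((P * b + B * K\<^sup>2 * b) * (B * E * b\<^sup>2)))"
        by (rule mult_norm_le[OF B(5)[OF z]])
      have "norm (?qq - ?pp) \<le> B * ((norm ?q + norm ?p) * norm (?q - ?p))" by (rule second_derivative_difference[OF z])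
      also have "\<dots> \<le> B * ((Q * b + P * b) * (D * b\<^sup>2))"
        using b1 P0 Q0 by (intro mult_left_mono mult_mono add_mono p qb qp) auto
      finally have qqpp: "norm (?qq - ?pp) \<le> B * ((Q * b + P * b) * (D * b\<^sup>2))" .
      have "blinfun_apply (normal_part z) (corrected_drift (\<phi> z)) = 0" using drift[OF z] normal_part_zero_iff[OF z] by blast
      then have nd: "blinfun_apply (normal_part z) ?d = (1/2) *\<^sub>R blinfun_apply (normal_part z) ?aa"
        using normal_euler_increment[OF tan z st(1) less_imp_le[OF st(2)] st(3)] by simp
      have "blinfun_apply (\<phi>1 z) ?q = (?d - blinfun_apply (normal_part z) ?d) - (1/2) *\<^sub>R (?pp - blinfun_apply (normal_part z) ?pp)"
        unfolding q by (simp add: normal_part_apply blinfun.diff_right blinfun.scaleR_right)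
      then have eq: "\<phi> (z + ?q) - \<phi> z - ?d = \<xi> + (1/2) *\<^sub>R blinfun_apply (normal_part z) (?pp - ?aa) + (1/2) *\<^sub>R (?qq - ?pp)"
        unfolding \<xi>_def nd by (simp add: blinfun.diff_right scaleR_diff_right)
      have "norm (\<phi> (z + ?q) - \<phi> z - ?d) \<le> B * (Q * b) ^ 3 + (1/2) * (B * (B * ((P * b + B * K\<^sup>2 * b) * (B * E * b\<^sup>2)))) + (1/2) * (B * ((Q * b + P * b) * (D * b\<^sup>2)))"
        unfolding eq by (intro norm_triangle_mono \<xi>) (use pa qqpp in simp_all)
      also have "\<dots> = C * b ^ 3" by (simp add: C_def algebra_simps eval_nat_numeral)
      finally show ?thesis .
    qed
    then show ?thesis using qb by blast
  qed
  show ?thesis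
  proof (rule exI[of _ Q], rule conjI[OF Q0], rule exI[of _ C], intro conjI ballI allI impI)
    show "0 \<le> C" using P0 Q0 D0 by (simp add: C_def)
    fix z s t assume z: "z \<in> ball z0 r" and st: "0 \<le> s" "s < t" "t \<le> T" "t - s \<le> 1"
    show "norm (chart_step z s t) \<le> Q * (t - s) powr \<alpha>" using main[OF z st refl] by blast
    assume "z + chart_step z s t \<in> ball z0 r"
    then show "norm (\<phi> (z + chart_step z s t) - \<phi> z - euler_increment (\<phi> z) s t) \<le> C * (t - s) powr (3 * \<alpha>)"
      using main[OF z st refl] powr_multiples(2)[of "t - s"] st by simp
  qed
qed

primrec chart_scheme :: "real \<Rightarrow> real \<Rightarrow> nat \<Rightarrow> 'e" where
  "chart_scheme a h 0 = z0"
| "chart_scheme a h (Suc k) = chart_scheme a h k + chart_step (chart_scheme a h k) (a + real k * h) (a + real (Suc k) * h)"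

text \<open>
  The scheme and the solution are both grid paths. By induction, as long as the scheme remains in the half ball, stability keeps
  it near the solution, and the solution is near its starting point for a short time; so the scheme remains in the half
  ball, uniformly in the mesh. The image of the closed half ball is compact and contains the limit.
\<close>

theorem local_invariance_in_chart:
  assumes tan: "tangential" and drift: "\<And>z. z \<in> ball z0 r \<Longrightarrow> corrected_drift (\<phi> z) \<in> range (blinfun_apply (\<phi>1 z))"
    and Y: "davie_solution Y" and a: "0 \<le> a" and Ya: "Y a = \<phi> z0"
  shows "\<exists>\<epsilon>>0. \<forall>t. a \<le> t \<longrightarrow> t \<le> a + \<epsilon> \<longrightarrow> t \<le> T \<longrightarrow> Y t \<in> M"
proof -
  obtain Q Cs where Q: "0 \<le> Q" and Cs: "0 \<le> Cs"
    and QC: "\<And>z s t. z \<in> ball z0 r \<Longrightarrow> 0 \<le> s \<Longrightarrow> s < t \<Longrightarrow> t \<le> T \<Longrightarrow> t - s \<le> 1 \<Longrightarrow>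
      norm (chart_step z s t) \<le> Q * (t - s) powr \<alpha> \<and>
      (z + chart_step z s t \<in> ball z0 r \<longrightarrow> norm (\<phi> (z + chart_step z s t) - \<phi> z - euler_increment (\<phi> z) s t) \<le> Cs * (t - s) powr (3 * \<alpha>))"
    using chart_step_consistent[OF tan drift] by blast
  note Qb = QC[THEN conjunct1] and cons = QC[THEN conjunct2, rule_format]
  obtain L where L: "0 \<le> L" and H: "\<And>s t. s \<in> {0..T} \<Longrightarrow> t \<in> {0..T} \<Longrightarrow> norm (Y t - Y s) \<le> L * \<bar>t - s\<bar> powr \<alpha>"
    by (rule davie_solution_bounds[OF Y]) blast
  obtain C1 where C1: "0 \<le> C1" "\<And>a h N. 0 \<le> a \<Longrightarrow> 0 < h \<Longrightarrow> a + real N * h \<le> T \<Longrightarrow> grid_path C1 a h N (\<lambda>k. Y (a + real k * h))"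
    using davie_solution_grid_path[OF Y] by blast
  define C0 where "C0 = max C1 Cs"
  have C0: "0 \<le> C0" using Cs by (simp add: C0_def)
  obtain Ms h0 where stab: "stability_bound C0 (norm (f0 (Y a))) Ms h0"
    using grid_path_stability[OF C0 norm_ge_zero] by blast
  note h0 = stability_boundD(2)[OF stab]
  have cr: "0 < c * r / 8" using c r by simp
  have "eventually (\<lambda>\<epsilon>. L * \<epsilon> powr \<alpha> \<le> c * r / 8) (at_right 0)" using \<alpha> cr by (intro eventually_powr_small) auto
  with eventually_at_right_less[of 0] have "eventually (\<lambda>\<epsilon>. 0 < \<epsilon> \<and> L * \<epsilon> powr \<alpha> \<le> c * r / 8) (at_right 0)" by eventually_elim simp
  then obtain \<epsilon> where \<epsilon>: "0 < \<epsilon>" "L * \<epsilon> powr \<alpha> \<le> c * r / 8" using eventually_happens'[OF trivial_limit_at_right_real] by blast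
  have "eventually (\<lambda>h. Q * h powr \<alpha> \<le> r / 4) (at_right 0)" using \<alpha> r by (intro eventually_powr_small) auto
  moreover have "eventually (\<lambda>h. Ms * h powr \<gamma> \<le> c * r / 8) (at_right 0)" using \<theta>'_\<gamma>(3) cr by (intro eventually_powr_small) auto
  moreover have "eventually (\<lambda>h. 0 < h \<and> h < min 1 h0) (at_right (0::real))" using h0 by (intro eventually_at_rightI[of 0 "min 1 h0"]) auto
  ultimately have ev: "eventually (\<lambda>h. Q * h powr \<alpha> \<le> r / 4 \<and> Ms * h powr \<gamma> \<le> c * r / 8 \<and> h \<le> 1 \<and> h \<le> h0) (at_right 0)"
    by eventually_elim simp
  have "Y t \<in> M" if t: "a < t" "t \<le> a + \<epsilon>" "t \<le> T" for t
  proof -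
    \<comment> \<open>The grids are chosen such that t is their last point.\<close>
    define h where "h N = (t - a) / real (Suc N)" for N
    have hN: "0 < h N" "real (Suc N) * h N = t - a" for N using t by (auto simp: h_def simp del: of_nat_Suc)
    have hlim: "h \<longlonglongrightarrow> 0"
      unfolding h_def[abs_def] using LIMSEQ_Suc[OF lim_const_over_n[of "t - a"]] by simp
    moreover have "h N \<noteq> 0" for N using hN(1)[of N] by simp
    ultimately have "filterlim h (at_right 0) sequentially"
      using hN(1) by (simp add: filterlim_at)
    then have evN: "eventually (\<lambda>N. Q * h N powr \<alpha> \<le> r / 4 \<and> Ms * h N powr \<gamma> \<le> c * r / 8 \<and> h N \<le> 1 \<and> h N \<le> h0) sequentially"
      using ev by (rule eventually_compose_filterlim[rotated])
    define z where "z N = chart_scheme a (h N)" for N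
    have main: "z N (Suc N) \<in> cball z0 (r / 2) \<and> norm (\<phi> (z N (Suc N)) - Y t) \<le> Ms * h N powr \<gamma>"
      if N: "Q * h N powr \<alpha> \<le> r / 4 \<and> Ms * h N powr \<gamma> \<le> c * r / 8 \<and> h N \<le> 1 \<and> h N \<le> h0" for N
    proof -
      let ?t = "\<lambda>k. a + real k * h N"
      have tk: "0 \<le> ?t k" "?t k \<le> t" if "k \<le> Suc N" for k
      proof -
        have "real k * h N \<le> real (Suc N) * h N" using that hN by (intro mult_right_mono) (auto simp: less_imp_le)
        then show "?t k \<le> t" using hN(2)[of N] by linarith
        show "0 \<le> ?t k" using a hN(1)[of N] by simp
      qed
      have step: "?t k < ?t (Suc k)" "?t (Suc k) - ?t k = h N" for k using hN(1)[of N] by (simp_all add: algebra_simps)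
      have inner: "ball z0 (r / 2) \<subseteq> ball z0 r" using r by auto
      have moved: "z N (Suc k) \<in> ball z0 r" if "z N k \<in> ball z0 (r / 2)" "k < Suc N" for k
      proof -
        have "norm (chart_step (z N k) (?t k) (?t (Suc k))) \<le> Q * (?t (Suc k) - ?t k) powr \<alpha>"
          using that tk[of k] tk[of "Suc k"] t step N inner by (intro Qb) auto
        then have "norm (z N (Suc k) - z N k) \<le> r / 4" using N unfolding step(2) by (simp add: z_def)
        then have "dist (z N k) (z N (Suc k)) \<le> r / 4" by (simp add: dist_norm norm_minus_commute)
        moreover have "dist z0 (z N k) < r / 2" using that by simp
        ultimately show ?thesis using dist_triangle[of z0 "z N (Suc k)" "z N k"] r by simp
      qed
      have close: "norm (\<phi> (z N n) - Y (?t n)) \<le> Ms * h N powr \<gamma>"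
        if inn: "\<And>k. k < n \<Longrightarrow> z N k \<in> ball z0 (r / 2)" and n: "n \<le> Suc N" for n
      proof -
        have tn: "a + real n * h N \<le> T" using tk[OF n] t by linarith
        have "grid_path Cs a (h N) n (\<lambda>k. \<phi> (z N k))"
          unfolding grid_path_def
        proof (intro conjI allI impI a hN tn)
          fix k assume k: "k < n"
          have zk: "z N (Suc k) = z N k + chart_step (z N k) (?t k) (?t (Suc k))" by (simp add: z_def)
          have "norm (\<phi> (z N k + chart_step (z N k) (?t k) (?t (Suc k))) - \<phi> (z N k) - euler_increment (\<phi> (z N k)) (?t k) (?t (Suc k))) \<le> Cs * (?t (Suc k) - ?t k) powr (3 * \<alpha>)"
            using inn[OF k] k n tk[of k] tk[of "Suc k"] t step N inner moved[OF inn[OF k]] unfolding zk by (intro cons) auto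
          then show "norm (\<phi> (z N (Suc k)) - \<phi> (z N k) - rough_step (\<phi> (z N k)) (?t k) (?t (Suc k)) - h N *\<^sub>R f0 (\<phi> (z N k))) \<le> Cs * h N powr (3 * \<alpha>)"
            unfolding zk euler_increment_def step(2) by (simp only: diff_diff_eq add.assoc)
        qed
        then have "grid_path C0 a (h N) n (\<lambda>k. \<phi> (z N k))" by (rule grid_path_mono_const) (simp add: C0_def)
        moreover have "grid_path C0 a (h N) n (\<lambda>k. Y (?t k))"
          by (rule grid_path_mono_const[OF C1(2)[OF a hN(1) tn]]) (simp add: C0_def)
        ultimately have "norm (Y (?t n) - \<phi> (z N n)) \<le> Ms * (norm (Y (?t 0) - \<phi> (z N 0)) + h N powr \<gamma>)"
          using N by (intro stability_boundD(3)[OF stab, where y = "\<lambda>k. Y (?t k)" and z = "\<lambda>k. \<phi> (z N k)"]) auto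
        then show ?thesis using Ya by (simp add: z_def norm_minus_commute)
      qed
      have inn: "z N n \<in> ball z0 (r / 2)" if "n \<le> Suc N" for n
        using that
      proof (induction n rule: less_induct)
        case (less n)
        show ?case
        proof (cases n)
          case 0
          then show ?thesis using r by (simp add: z_def)
        next
          case (Suc m)
          have zn: "z N n \<in> ball z0 r" unfolding Suc using Suc less by (intro moved) auto
          have m: "a \<in> {0..T}" "?t n \<in> {0..T}" using a t tk[OF less.prems] by auto
          have "0 \<le> real n * h N" using hN(1)[of N] by simp
          then have "\<bar>?t n - a\<bar> \<le> \<epsilon>" using t tk[OF less.prems] by simp
          then have "L * \<bar>?t n - a\<bar> powr \<alpha> \<le> L * \<epsilon> powr \<alpha>" using L \<alpha> by (intro mult_left_mono powr_mono2) auto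
          then have "norm (Y (?t n) - \<phi> z0) \<le> c * r / 8" using H[OF m] \<epsilon> Ya by simp
          moreover have "norm (\<phi> (z N n) - Y (?t n)) \<le> Ms * h N powr \<gamma>"
            by (rule close[OF less.IH less.prems]) (use less.prems in auto)
          then have "norm (\<phi> (z N n) - Y (?t n)) \<le> c * r / 8" using N by linarith
          ultimately have "norm (\<phi> (z N n) - \<phi> z0) \<le> c * r / 4"
            using \<open>norm (\<phi> (z N n) - Y (?t n)) \<le> c * r / 8\<close> norm_triangle_ineq[of "\<phi> (z N n) - Y (?t n)" "Y (?t n) - \<phi> z0"] by simp
          then have "c * norm (z N n - z0) \<le> c * (r / 4)" using below[OF zn centre] by simp
          then have "norm (z N n - z0) \<le> r / 4" using c by simp
          then show ?thesis using r by (simp add: dist_norm norm_minus_commute)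
        qed
      qed
      have tN: "?t (Suc N) = t" using hN(2)[of N] by simp
      have "norm (\<phi> (z N (Suc N)) - Y (?t (Suc N))) \<le> Ms * h N powr \<gamma>"
        by (rule close[OF inn order_refl]) simp
      moreover have "dist z0 (z N (Suc N)) < r / 2" using inn[OF order_refl] by simp
      ultimately show ?thesis unfolding tN mem_cball by simp
    qed
    have "(\<lambda>N. \<phi> (z N (Suc N)) - Y t) \<longlonglongrightarrow> 0"
    proof (rule Lim_null_comparison)
      show "eventually (\<lambda>N. norm (\<phi> (z N (Suc N)) - Y t) \<le> Ms * h N powr \<gamma>) sequentially"
        using evN by eventually_elim (rule main[THEN conjunct2])
      have "(\<lambda>N. h N powr \<gamma>) \<longlonglongrightarrow> 0 powr \<gamma>"
        using \<theta>'_\<gamma>(3) less_imp_le[OF hN(1)] by (intro tendsto_powr'[OF hlim tendsto_const] disjI2 conjI always_eventually) auto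
      then have "(\<lambda>N. h N powr \<gamma>) \<longlonglongrightarrow> 0" by simp
      then have "(\<lambda>N. Ms * h N powr \<gamma>) \<longlonglongrightarrow> Ms * 0" by (rule tendsto_mult_left)
      then show "(\<lambda>N. Ms * h N powr \<gamma>) \<longlonglongrightarrow> 0" by simp
    qed
    then have lim: "(\<lambda>N. \<phi> (z N (Suc N))) \<longlonglongrightarrow> Y t" by (simp add: LIM_zero_iff)
    have sub: "cball z0 (r / 2) \<subseteq> ball z0 r" using r by auto
    have "continuous_on (cball z0 (r / 2)) \<phi>"
      by (intro continuous_at_imp_continuous_on ballI has_derivative_continuous[OF D1[OF subsetD[OF sub]]])
    then have "closed (\<phi> ` cball z0 (r / 2))"
      by (intro compact_imp_closed compact_continuous_image compact_cball)
    moreover have "eventually (\<lambda>N. \<phi> (z N (Suc N)) \<in> \<phi> ` cball z0 (r / 2)) sequentially"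
      using evN by eventually_elim (rule imageI[OF main[THEN conjunct1]])
    ultimately have "Y t \<in> \<phi> ` cball z0 (r / 2)" by (rule Lim_in_closed_set[OF _ _ sequentially_bot lim])
    then obtain q where q: "q \<in> cball z0 (r / 2)" "Y t = \<phi> q" by (rule imageE)
    show ?thesis unfolding q(2) by (rule into[OF subsetD[OF sub q(1)]])
  qed
  moreover have "Y a \<in> M" unfolding Ya by (rule into[OF centre])
  ultimately have "Y t \<in> M" if "a \<le> t" "t \<le> a + \<epsilon>" "t \<le> T" for t
    using that by (cases "a = t") auto
  then show ?thesis using \<epsilon>(1) by (intro exI[of _ \<epsilon>] conjI allI impI)
qed

end

section \<open>Invariance of submanifolds\<close>

lemma (in completed_tensor_product) symmetric_part_from_bracket:
  assumes rp: "rough_path tensor \<alpha> T X XX" and br: "\<forall>t\<in>{0..T}. rough_bracket tensor X XX 0 t = t *\<^sub>R x"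
    and st: "0 \<le> s" "s \<le> t" "t \<le> T"
  shows "XX s t + tensor_flip tensor (XX s t) = tensor (X t - X s) (X t - X s) - (t - s) *\<^sub>R x"
proof -
  define A where "A = X s - X 0"
  define D where "D = X t - X s"
  have AD: "X t - X 0 = A + D" by (simp add: A_def D_def)
  have "XX 0 t - XX 0 s - XX s t = tensor A D" using rp st by (simp add: rough_path_def A_def D_def)
  then have chen: "XX 0 t = XX 0 s + XX s t + tensor A D" by (simp add: algebra_simps)
  note flip_add = linear_add[OF bounded_linear.linear[OF tensor_flip(1)]]
  have "rough_bracket tensor X XX 0 u = u *\<^sub>R x" if "0 \<le> u" "u \<le> T" for u using br that by simp
  then have b: "tensor (X u - X 0) (X u - X 0) - (XX 0 u + tensor_flip tensor (XX 0 u)) = u *\<^sub>R x" if "0 \<le> u" "u \<le> T" for u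
    using that by (simp add: rough_bracket_def tensor_Sym_def)
  have 1: "tensor A A - (XX 0 s + tensor_flip tensor (XX 0 s)) = s *\<^sub>R x" using b[of s] st by (simp add: A_def)
  have "tensor (A + D) (A + D) - (XX 0 t + tensor_flip tensor (XX 0 t)) = t *\<^sub>R x" using b[of t] st by (simp add: AD)
  then have 2: "tensor A A + tensor D D - (XX 0 s + tensor_flip tensor (XX 0 s)) - (XX s t + tensor_flip tensor (XX s t)) = t *\<^sub>R x"
    unfolding chen by (simp add: flip_add tensor_flip(2) bilinear_ladd[OF bilin] bilinear_radd[OF bilin] algebra_simps)
  have "XX s t + tensor_flip tensor (XX s t)
    = tensor D D + (tensor A A - (XX 0 s + tensor_flip tensor (XX 0 s))) - (tensor A A + tensor D D - (XX 0 s + tensor_flip tensor (XX 0 s)) - (XX s t + tensor_flip tensor (XX s t)))"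
    by simp
  also have "\<dots> = tensor D D - (t - s) *\<^sub>R x" unfolding 1 2 by (simp add: scaleR_diff_left)
  finally show ?thesis by (simp add: D_def)
qed

lemma (in completed_tensor_product) level_two_continuous:
  assumes \<alpha>: "0 < \<alpha>" and X: "\<And>s t. s \<in> {0..T} \<Longrightarrow> t \<in> {0..T} \<Longrightarrow> norm (X t - X s) \<le> C * \<bar>t - s\<bar> powr \<alpha>"
    and XX: "\<And>s t. s \<in> {0..T} \<Longrightarrow> t \<in> {0..T} \<Longrightarrow> norm (XX s t) \<le> C * \<bar>t - s\<bar> powr (2 * \<alpha>)"
    and Chen: "\<And>s u t. s \<in> {0..T} \<Longrightarrow> u \<in> {0..T} \<Longrightarrow> t \<in> {0..T} \<Longrightarrow> XX s t - XX s u - XX u t = tensor (X u - X s) (X t - X u)"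
  shows "continuous_on ({0..T} \<times> {0..T}) (\<lambda>(s, t). XX s t)"
  unfolding continuous_on_def
proof
  fix p assume "p \<in> {0..T} \<times> {0..T}"
  then obtain a b where p: "p = (a, b)" and ab: "a \<in> {0..T}" "b \<in> {0..T}" by (rule SigmaE)
  let ?F = "at p within {0..T} \<times> {0..T}"
  have bound: "norm ((case q of (s, t) \<Rightarrow> XX s t) - XX a b) \<le> C * \<bar>a - fst q\<bar> powr (2 * \<alpha>) + C * \<bar>snd q - b\<bar> powr (2 * \<alpha>)
      + (C * \<bar>a - fst q\<bar> powr \<alpha>) * norm (X (snd q) - X a) + norm (X b - X a) * (C * \<bar>snd q - b\<bar> powr \<alpha>)" if "q \<in> {0..T} \<times> {0..T}" for q
  proof -
    define s t where "s = fst q" and "t = snd q"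
    have q: "q = (s, t)" and st: "s \<in> {0..T}" "t \<in> {0..T}" using that by (auto simp: s_def t_def mem_Times_iff)
    have "XX s t - XX a b = XX s a + XX b t + tensor (X a - X s) (X t - X a) + tensor (X b - X a) (X t - X b)"
      using Chen[OF st(1) ab(1) st(2)] Chen[OF ab(1,2) st(2)] by (simp add: algebra_simps)
    moreover have "norm (tensor (X a - X s) (X t - X a)) \<le> (C * \<bar>a - s\<bar> powr \<alpha>) * norm (X t - X a)"
      unfolding cross_norm by (intro mult_right_mono X st ab) simp
    moreover have "norm (tensor (X b - X a) (X t - X b)) \<le> norm (X b - X a) * (C * \<bar>t - b\<bar> powr \<alpha>)"
      unfolding cross_norm by (intro mult_left_mono X st ab) simp
    ultimately show ?thesis
      using XX[OF st(1) ab(1)] XX[OF ab(2) st(2)] by (simp add: q) (intro norm_triangle_mono; simp)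
  qed
  have pw: "((\<lambda>q. g q powr e) \<longlongrightarrow> 0) ?F" if "(g \<longlongrightarrow> 0) ?F" "0 < e" "\<And>q. 0 \<le> g q" for g :: "real \<times> real \<Rightarrow> real" and e
  proof -
    have "((\<lambda>q. g q powr e) \<longlongrightarrow> 0 powr e) ?F"
      using that by (intro tendsto_powr'[OF that(1) tendsto_const] disjI2 conjI always_eventually allI) auto
    then show ?thesis by simp
  qed
  have f: "((\<lambda>q. \<bar>a - fst q\<bar>) \<longlongrightarrow> 0) ?F" and s: "((\<lambda>q. \<bar>snd q - b\<bar>) \<longlongrightarrow> 0) ?F"
    by (auto intro!: tendsto_eq_intros simp: p)
  note lims = pw[OF f] pw[OF s]
  have Xb: "((\<lambda>q. X (snd q)) \<longlongrightarrow> X b) ?F"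
  proof (rule LIM_zero_cancel, rule Lim_null_comparison)
    show "eventually (\<lambda>q. norm (X (snd q) - X b) \<le> C * \<bar>snd q - b\<bar> powr \<alpha>) ?F"
      unfolding eventually_at_filter by (intro always_eventually allI impI X ab) auto
    show "((\<lambda>q. C * \<bar>snd q - b\<bar> powr \<alpha>) \<longlongrightarrow> 0) ?F"
      using tendsto_mult_left[OF lims(2)[OF \<alpha>], of C] by simp
  qed
  have "((\<lambda>q. (case q of (s, t) \<Rightarrow> XX s t)) \<longlongrightarrow> XX a b) ?F"
  proof (rule LIM_zero_cancel, rule Lim_null_comparison)
    show "eventually (\<lambda>q. norm ((case q of (s, t) \<Rightarrow> XX s t) - XX a b) \<le> C * \<bar>a - fst q\<bar> powr (2 * \<alpha>) + C * \<bar>snd q - b\<bar> powr (2 * \<alpha>)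
      + (C * \<bar>a - fst q\<bar> powr \<alpha>) * norm (X (snd q) - X a) + norm (X b - X a) * (C * \<bar>snd q - b\<bar> powr \<alpha>)) ?F"
      unfolding eventually_at_filter by (intro always_eventually allI impI bound)
    have "((\<lambda>q. C * \<bar>a - fst q\<bar> powr (2 * \<alpha>) + C * \<bar>snd q - b\<bar> powr (2 * \<alpha>)
      + (C * \<bar>a - fst q\<bar> powr \<alpha>) * norm (X (snd q) - X a) + norm (X b - X a) * (C * \<bar>snd q - b\<bar> powr \<alpha>))
      \<longlongrightarrow> C * 0 + C * 0 + (C * 0) * norm (X b - X a) + norm (X b - X a) * (C * 0)) ?F"
      using \<alpha> by (intro tendsto_add tendsto_mult tendsto_const tendsto_norm tendsto_diff Xb lims) auto
    then show "((\<lambda>q. C * \<bar>a - fst q\<bar> powr (2 * \<alpha>) + C * \<bar>snd q - b\<bar> powr (2 * \<alpha>)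
      + (C * \<bar>a - fst q\<bar> powr \<alpha>) * norm (X (snd q) - X a) + norm (X b - X a) * (C * \<bar>snd q - b\<bar> powr \<alpha>)) \<longlongrightarrow> 0) ?F" by simp
  qed
  then show "((\<lambda>(s, t). XX s t) \<longlongrightarrow> (case p of (s, t) \<Rightarrow> XX s t)) ?F" by (simp add: p)
qed

text \<open>
  The lift of \<open>Df(y) f(y)\<close> has the regularity of a product of \<open>Df\<close> and \<open>f\<close>, since the lifting is bounded.
\<close>

theorem rough_rde_if_rough_path:
  fixes tensor :: "'v::banach \<Rightarrow> 'v \<Rightarrow> 't::banach" and f0 :: "'w::banach \<Rightarrow> 'w" and f :: "'w \<Rightarrow> 'v \<Rightarrow>\<^sub>L 'w"
  assumes tp: "completed_tensor_product tensor" and inj: "has_canonical_injection tensor TYPE('w)"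
    and T: "0 < T" and \<alpha>: "\<alpha> \<in> {1/3<..1/2}" and rp: "rough_path tensor \<alpha> T X XX"
    and f0: "\<exists>L. L-lipschitz_on UNIV f0" and f: "Cb3 f"
  shows "\<exists>K f1. rough_rde tensor \<alpha> T K X XX f0 f f1 (\<lambda>y. tensor_lift tensor (f1 y o\<^sub>L f y))"
proof -
  interpret completed_tensor_product tensor by (rule tp)
  obtain f1 K1 where d: "\<And>y. (f has_derivative blinfun_apply (f1 y)) (at y)" and c1: "C11 K1 f" "C11 K1 f1"
    using Cb3_imp_C11[OF f] by blast
  let ?F = "\<lambda>y. tensor_lift tensor (f1 y o\<^sub>L f y) :: 't \<Rightarrow>\<^sub>L 'w"
  obtain K2 where "C11 K2 (\<lambda>y. f1 y o\<^sub>L f y)" using C11_bounded_bilinear[OF bounded_bilinear_blinfun_compose c1(2,1)] by blast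
  then obtain K3 where c3: "C11 K3 ?F" using C11_bounded_linear[OF bounded_linear_tensor_lift[OF inj]] by blast
  obtain L where L: "L-lipschitz_on UNIV f0" using f0 by blast
  obtain CX where CX: "\<And>s t. s \<in> {0..T} \<Longrightarrow> t \<in> {0..T} \<Longrightarrow> s \<noteq> t \<Longrightarrow> norm (X t - X s) / \<bar>t - s\<bar> powr \<alpha> \<le> CX"
    using rp unfolding rough_path_def holder_path_def by blast
  obtain CXX where CXX: "\<And>s t. s \<in> {0..T} \<Longrightarrow> t \<in> {0..T} \<Longrightarrow> s \<noteq> t \<Longrightarrow> norm (XX s t) / \<bar>t - s\<bar> powr (2 * \<alpha>) \<le> CXX"
    using rp unfolding rough_path_def by blast
  have Chen: "XX s t - XX s u - XX u t = tensor (X u - X s) (X t - X u)" if "s \<in> {0..T}" "u \<in> {0..T}" "t \<in> {0..T}" for s u t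
    using rp that unfolding rough_path_def by blast
  define K where "K = Max {1, K1, K3, L, CX, CXX}"
  have K: "1 \<le> K" "K1 \<le> K" "K3 \<le> K" "L \<le> K" "CX \<le> K" "CXX \<le> K" by (simp_all add: K_def)
  have X: "norm (X t - X s) \<le> K * \<bar>t - s\<bar> powr \<alpha>" if "s \<in> {0..T}" "t \<in> {0..T}" for s t
  proof (cases "s = t")
    case False
    then have "norm (X t - X s) / \<bar>t - s\<bar> powr \<alpha> \<le> K" using CX[OF that False] K by linarith
    then show ?thesis using False by (simp add: pos_divide_le_eq)
  qed simp
  have XX: "norm (XX s t) \<le> K * \<bar>t - s\<bar> powr (2 * \<alpha>)" if "s \<in> {0..T}" "t \<in> {0..T}" for s t
  proof (cases "s = t")
    case True
    have "XX t t - XX t t - XX t t = tensor (X t - X t) (X t - X t)" using that by (intro Chen) auto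
    then have "norm (XX t t) = norm (tensor 0 0)" by (simp add: norm_minus_commute) (metis diff_0 norm_minus_cancel)
    then show ?thesis using True by (simp add: cross_norm)
  next
    case False
    then have "norm (XX s t) / \<bar>t - s\<bar> powr (2 * \<alpha>) \<le> K" using CXX[OF that False] K by linarith
    then show ?thesis using False by (simp add: pos_divide_le_eq)
  qed
  have "rough_rde tensor \<alpha> T K X XX f0 f f1 ?F"
  proof (intro rough_rde.intro tp rough_equation.intro rough_rde_axioms.intro refl)
    show "continuous_on ({0..T} \<times> {0..T}) (\<lambda>(s, t). XX s t)"
      using \<alpha> by (intro level_two_continuous[OF _ X XX Chen]) auto
    show "blinfun_apply (?F y) (XX s t - XX s u - XX u t) = blinfun_apply (blinfun_apply (f1 y) (blinfun_apply (f y) (X u - X s))) (X t - X u)"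
      if "s \<in> {0..T}" "u \<in> {0..T}" "t \<in> {0..T}" for y s u t
      unfolding Chen[OF that] by (simp add: tensor_lift[OF inj])
    show "norm (f0 y - f0 z) \<le> K * norm (y - z)" for y z
    proof -
      have "norm (f0 y - f0 z) \<le> L * norm (y - z)" using lipschitz_onD[OF L, of y z] by (simp add: dist_norm)
      also have "\<dots> \<le> K * norm (y - z)" using K by (intro mult_right_mono) auto
      finally show ?thesis .
    qed
  qed (use T \<alpha> K X XX d c1 c3 C11_mono in auto)
  then show ?thesis by blast
qed

lemma submanifold_chart_at:
  assumes M: "C3_submanifold TYPE('m::finite) M" and y: "y \<in> M"
  shows "\<exists>(z0 :: real ^ 'm) r \<kappa> \<phi> \<phi>1 \<phi>2 c U. submanifold_chart z0 r \<kappa> \<phi> \<phi>1 \<phi>2 c M U \<and> \<phi> z0 = y \<and>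
    (\<forall>z\<in>ball z0 r. tangent_space TYPE('m) M (\<phi> z) = range (blinfun_apply (\<phi>1 z)))"
proof -
  obtain U S and \<phi> :: "real ^ 'm \<Rightarrow> 'a" where lp: "local_parametrization M y U S \<phi>"
    using M y unfolding C3_submanifold_def by blast
  obtain \<psi> where hom: "homeomorphism S (U \<inter> M) \<phi> \<psi>" and yU: "y \<in> U" using lp unfolding local_parametrization_def by blast
  have "y \<in> \<phi> ` S" using homeomorphism_image1[OF hom] yU y by blast
  then obtain z0 where z0: "z0 \<in> S" "y = \<phi> z0" by (rule imageE)
  obtain r \<kappa> \<phi>1 \<phi>2 c V where ch: "submanifold_chart z0 r \<kappa> \<phi> \<phi>1 \<phi>2 c M V" "ball z0 r \<subseteq> S"
    "\<forall>z\<in>ball z0 r. frechet_derivative \<phi> (at z) = blinfun_apply (\<phi>1 z)"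
    using chart_at_parameter[OF lp z0(1)] by blast
  have "tangent_space TYPE('m) M (\<phi> z) = range (blinfun_apply (\<phi>1 z))" if "z \<in> ball z0 r" for z
    using tangent_space_eq_range[OF lp subsetD[OF ch(2) that]] ch(3) that by simp
  then show ?thesis using ch(1) z0(2) by blast
qed

context rough_rde
begin

lemma rde_chart_at:
  assumes inj: "has_canonical_injection tensor TYPE('w)"
    and bracket: "\<forall>s t. 0 \<le> s \<longrightarrow> s \<le> t \<longrightarrow> t \<le> T \<longrightarrow> XX s t + tensor_flip tensor (XX s t) = tensor (X t - X s) (X t - X s) - (t - s) *\<^sub>R x"
    and M: "C3_submanifold TYPE('m::finite) M" and y: "y \<in> M"
  shows "\<exists>(z0 :: real ^ 'm) r \<kappa> \<phi> \<phi>1 \<phi>2 c U. rde_on_chart tensor \<alpha> T K X XX f0 f f1 F z0 r \<kappa> \<phi> \<phi>1 \<phi>2 c M U x \<and> \<phi> z0 = y \<and>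
    (\<forall>z\<in>ball z0 r. tangent_space TYPE('m) M (\<phi> z) = range (blinfun_apply (\<phi>1 z)))"
proof -
  obtain z0 :: "real ^ 'm" and r \<kappa> \<phi> \<phi>1 \<phi>2 c U where ch: "submanifold_chart z0 r \<kappa> \<phi> \<phi>1 \<phi>2 c M U" and rest: "\<phi> z0 = y"
    "\<forall>z\<in>ball z0 r. tangent_space TYPE('m) M (\<phi> z) = range (blinfun_apply (\<phi>1 z))"
    using submanifold_chart_at[OF M y] by blast
  have "rde_on_chart tensor \<alpha> T K X XX f0 f f1 F z0 r \<kappa> \<phi> \<phi>1 \<phi>2 c M U x"
    by (intro rde_on_chart.intro rough_rde_axioms ch rde_on_chart_axioms.intro inj bracket[rule_format])
  then show ?thesis using rest by blast
qed

definition invariant_near_start :: "'w set \<Rightarrow> bool" where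
  "invariant_near_start M \<longleftrightarrow> (\<forall>\<xi>\<in>M. \<exists>\<tau>\<in>{0<..T}. \<exists>Y. davie_solution Y \<and> Y 0 = \<xi> \<and> (\<forall>t\<in>{0..\<tau>}. Y t \<in> M))"

context
  fixes x :: 't and M :: "'w set" and m :: "'m::finite itself"
  assumes inj: "has_canonical_injection tensor TYPE('w)"
    and bracket: "\<forall>s t. 0 \<le> s \<longrightarrow> s \<le> t \<longrightarrow> t \<le> T \<longrightarrow> XX s t + tensor_flip tensor (XX s t) = tensor (X t - X s) (X t - X s) - (t - s) *\<^sub>R x"
    and M: "C3_submanifold TYPE('m) M"
begin

text \<open>
  Each time in the dense set provides tangency at the point of \<open>M\<close> visited then, with respect to a chart
  centred at that point. These points converge to the starting point.
\<close>

theorem field_tangent_if_invariant: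
  assumes inv: "invariant_near_start M" and rough: "truly_rough \<alpha> T X" and \<xi>: "\<xi> \<in> M"
  shows "blinfun_apply (f \<xi>) v \<in> tangent_space TYPE('m) M \<xi>"
proof -
  obtain D where dense: "D \<subseteq> {0..<T} \<and> {0..<T} \<subseteq> closure D \<and> (\<forall>s\<in>D. \<forall>v. v \<noteq> 0 \<longrightarrow>
      Limsup (at_right s) (\<lambda>t. ereal (\<bar>blinfun_apply v (X t - X s)\<bar> / \<bar>t - s\<bar> powr (2 * \<alpha>))) = \<infinity>)"
    using rough unfolding truly_rough_def by (elim conjE exE) (rule that, intro conjI)
  note D = dense[THEN conjunct2, THEN conjunct1] and Dr = dense[THEN conjunct2, THEN conjunct2, rule_format]
  obtain \<tau> Y where \<tau>: "0 < \<tau>" "\<tau> \<le> T" and Y: "davie_solution Y" "Y 0 = \<xi>" and YM: "\<And>t. t \<in> {0..\<tau>} \<Longrightarrow> Y t \<in> M"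
    using inv[unfolded invariant_near_start_def, rule_format, OF \<xi>] by auto
  obtain z0 :: "real ^ 'm" and r \<kappa> \<phi> \<phi>1 \<phi>2 c U where chart: "rde_on_chart tensor \<alpha> T K X XX f0 f f1 F z0 r \<kappa> \<phi> \<phi>1 \<phi>2 c M U x \<and> \<phi> z0 = \<xi> \<and>
      (\<forall>z\<in>ball z0 r. tangent_space TYPE('m) M (\<phi> z) = range (blinfun_apply (\<phi>1 z)))"
    using rde_chart_at[OF inj bracket M \<xi>] by (elim exE) (rule that)
  note ch = chart[THEN conjunct1] and z0 = chart[THEN conjunct2, THEN conjunct1]
    and tg = chart[THEN conjunct2, THEN conjunct2, rule_format]
  interpret C: rde_on_chart tensor \<alpha> T K X XX f0 f f1 F z0 r \<kappa> \<phi> \<phi>1 \<phi>2 c M U x by (rule ch)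
  have at_D: "blinfun_apply (f (Y s)) v \<in> tangent_space TYPE('m) M (Y s)" if s: "s \<in> D" "0 < s" "s < \<tau>" for s
  proof -
    have YsM: "Y s \<in> M" using s by (intro YM) auto
    obtain z0' :: "real ^ 'm" and r' \<kappa>' \<phi>' \<phi>1' \<phi>2' c' U' where chart': "rde_on_chart tensor \<alpha> T K X XX f0 f f1 F z0' r' \<kappa>' \<phi>' \<phi>1' \<phi>2' c' M U' x \<and> \<phi>' z0' = Y s \<and>
        (\<forall>z\<in>ball z0' r'. tangent_space TYPE('m) M (\<phi>' z) = range (blinfun_apply (\<phi>1' z)))"
      using rde_chart_at[OF inj bracket M YsM] by (elim exE) (rule that)
    note ch' = chart'[THEN conjunct1] and z0' = chart'[THEN conjunct2, THEN conjunct1]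
      and tg' = chart'[THEN conjunct2, THEN conjunct2, rule_format]
    interpret C': rde_on_chart tensor \<alpha> T K X XX f0 f f1 F z0' r' \<kappa>' \<phi>' \<phi>1' \<phi>2' c' M U' x by (rule ch')
    have "blinfun_apply (f (\<phi>' z0')) v \<in> range (blinfun_apply (\<phi>1' z0'))"
    proof (rule C'.tangent_at_truly_rough_time[OF Y(1) less_imp_le[OF s(2)] s(3) \<tau>(2) z0'[symmetric] _ Dr[OF s(1)]])
      show "Y t \<in> M" if "s \<le> t" "t \<le> \<tau>" for t using s that by (intro YM) auto
    qed
    then show ?thesis using tg'[OF C'.centre] by (simp add: z0')
  qed
  obtain L where L: "0 \<le> L" and H: "\<And>s t. s \<in> {0..T} \<Longrightarrow> t \<in> {0..T} \<Longrightarrow> norm (Y t - Y s) \<le> L * \<bar>t - s\<bar> powr \<alpha>"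
    by (rule davie_solution_bounds[OF Y(1)]) blast
  have "continuous_on {0..T} Y" using H by (intro continuous_on_if_Holder[of _ 1 _ L]) auto
  then have "(Y \<longlongrightarrow> Y 0) (at 0 within {0..T})" using T by (simp add: continuous_on_def)
  then have lim: "(Y \<longlongrightarrow> \<phi> z0) (at_right 0)" using T Y(2) z0 by (simp add: at_within_Icc_at_right)
  have "blinfun_apply (f (\<phi> z0)) v \<in> range (blinfun_apply (\<phi>1 z0))"
  proof (rule C.tangency_closed)
    fix \<delta> :: real assume \<delta>: "0 < \<delta>"
    have "eventually (\<lambda>t. Y t \<in> U) (at_right 0)" by (rule topological_tendstoD[OF lim C.openU C.centreU])
    moreover have "((\<lambda>t. C.B * norm (Y t - \<phi> z0)) \<longlongrightarrow> C.B * norm (\<phi> z0 - \<phi> z0)) (at_right 0)"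
      by (intro tendsto_intros lim)
    then have "eventually (\<lambda>t. C.B * norm (Y t - \<phi> z0) < \<delta>) (at_right 0)" using \<delta> by (intro order_tendstoD(2)) auto
    ultimately have "eventually (\<lambda>t. Y t \<in> U \<and> C.B * norm (Y t - \<phi> z0) < \<delta>) (at_right 0)" by eventually_elim simp
    then obtain e where e: "0 < e" "\<And>t. 0 < t \<Longrightarrow> t < e \<Longrightarrow> Y t \<in> U \<and> C.B * norm (Y t - \<phi> z0) < \<delta>"
      unfolding eventually_at_right_field by blast
    define \<rho> where "\<rho> = min e \<tau>"
    have \<rho>: "0 < \<rho>" "\<rho> \<le> e" "\<rho> \<le> \<tau>" using e \<tau> by (auto simp: \<rho>_def)
    \<comment> \<open>A point of D at distance less than \<open>\<rho> / 2\<close> from \<open>\<rho> / 2\<close> lies strictly between 0 and \<open>\<rho>\<close>.\<close>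
    then have "\<rho> / 2 \<in> closure D" using D \<tau> by auto
    then obtain s where s: "s \<in> D" "dist s (\<rho> / 2) < \<rho> / 2" using \<rho>(1) closure_approachable half_gt_zero by metis
    then have s0: "0 < s" "s < \<rho>" by (auto simp: dist_real_def abs_if split: if_splits)
    have Ys: "Y s \<in> U" "Y s \<in> M" "C.B * norm (Y s - \<phi> z0) < \<delta>" using e(2)[of s] s0 \<rho> by (auto intro: YM)
    obtain q where q: "z0 + q \<in> ball z0 r" "Y s = \<phi> (z0 + q)" "norm q \<le> C.B * norm (Y s - \<phi> z0)"
      by (rule C.parameter[OF Ys(1,2)])
    have "blinfun_apply (f (\<phi> (z0 + q))) v \<in> range (blinfun_apply (\<phi>1 (z0 + q)))"
      using at_D[OF s(1)] s0 \<rho> tg[OF q(1)] by (simp add: q(2))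
    then show "\<exists>z\<in>ball z0 r. norm (z - z0) < \<delta> \<and> blinfun_apply (f (\<phi> z)) v \<in> range (blinfun_apply (\<phi>1 z))"
      using q Ys(3) by (intro bexI[of _ "z0 + q"]) auto
  qed
  then show ?thesis using tg[OF C.centre] by (simp add: z0)
qed

theorem drift_tangent_if_invariant:
  assumes inv: "invariant_near_start M" and tan: "\<forall>y\<in>M. \<forall>v. blinfun_apply (f y) v \<in> tangent_space TYPE('m) M y" and \<xi>: "\<xi> \<in> M"
  shows "f0 \<xi> - (1/2) *\<^sub>R blinfun_apply (F \<xi>) x \<in> tangent_space TYPE('m) M \<xi>"
proof -
  obtain \<tau> Y where \<tau>: "0 < \<tau>" "\<tau> \<le> T" and Y: "davie_solution Y" "Y 0 = \<xi>" and YM: "\<And>t. t \<in> {0..\<tau>} \<Longrightarrow> Y t \<in> M"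
    using inv[unfolded invariant_near_start_def, rule_format, OF \<xi>] by auto
  obtain z0 :: "real ^ 'm" and r \<kappa> \<phi> \<phi>1 \<phi>2 c U where chart: "rde_on_chart tensor \<alpha> T K X XX f0 f f1 F z0 r \<kappa> \<phi> \<phi>1 \<phi>2 c M U x \<and> \<phi> z0 = \<xi> \<and>
      (\<forall>z\<in>ball z0 r. tangent_space TYPE('m) M (\<phi> z) = range (blinfun_apply (\<phi>1 z)))"
    using rde_chart_at[OF inj bracket M \<xi>] by (elim exE) (rule that)
  note ch = chart[THEN conjunct1] and z0 = chart[THEN conjunct2, THEN conjunct1]
    and tg = chart[THEN conjunct2, THEN conjunct2, rule_format]
  interpret C: rde_on_chart tensor \<alpha> T K X XX f0 f f1 F z0 r \<kappa> \<phi> \<phi>1 \<phi>2 c M U x by (rule ch)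
  have "C.tangential" unfolding C.tangential_def
  proof (intro ballI allI)
    fix z v assume z: "z \<in> ball z0 r"
    show "blinfun_apply (f (\<phi> z)) v \<in> range (blinfun_apply (\<phi>1 z))" using bspec[OF tan C.into[OF z]] tg[OF z] by simp
  qed
  then have "C.corrected_drift (\<phi> z0) \<in> range (blinfun_apply (\<phi>1 z0))"
    using Y z0 \<tau> YM by (intro C.corrected_drift_tangent_if_invariant[of Y \<tau>]) auto
  then show ?thesis using tg[OF C.centre] by (simp add: z0 C.corrected_drift_def)
qed

theorem stays_for_a_while:
  assumes tan: "\<forall>y\<in>M. \<forall>v. blinfun_apply (f y) v \<in> tangent_space TYPE('m) M y"
    and drift: "\<forall>y\<in>M. f0 y - (1/2) *\<^sub>R blinfun_apply (F y) x \<in> tangent_space TYPE('m) M y"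
    and Y: "davie_solution Y" and a: "0 \<le> a" and Ya: "Y a \<in> M"
  shows "\<exists>\<epsilon>>0. \<forall>t. a \<le> t \<longrightarrow> t \<le> a + \<epsilon> \<longrightarrow> t \<le> T \<longrightarrow> Y t \<in> M"
proof -
  obtain z0 :: "real ^ 'm" and r \<kappa> \<phi> \<phi>1 \<phi>2 c U where chart: "rde_on_chart tensor \<alpha> T K X XX f0 f f1 F z0 r \<kappa> \<phi> \<phi>1 \<phi>2 c M U x \<and> \<phi> z0 = Y a \<and>
      (\<forall>z\<in>ball z0 r. tangent_space TYPE('m) M (\<phi> z) = range (blinfun_apply (\<phi>1 z)))"
    using rde_chart_at[OF inj bracket M Ya] by (elim exE) (rule that)
  note ch = chart[THEN conjunct1] and z0 = chart[THEN conjunct2, THEN conjunct1]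
    and tg = chart[THEN conjunct2, THEN conjunct2, rule_format]
  interpret C: rde_on_chart tensor \<alpha> T K X XX f0 f f1 F z0 r \<kappa> \<phi> \<phi>1 \<phi>2 c M U x by (rule ch)
  have t: "C.tangential" unfolding C.tangential_def
  proof (intro ballI allI)
    fix z v assume z: "z \<in> ball z0 r"
    show "blinfun_apply (f (\<phi> z)) v \<in> range (blinfun_apply (\<phi>1 z))" using bspec[OF tan C.into[OF z]] tg[OF z] by simp
  qed
  have d: "C.corrected_drift (\<phi> z) \<in> range (blinfun_apply (\<phi>1 z))" if z: "z \<in> ball z0 r" for z
    using bspec[OF drift C.into[OF z]] tg[OF z] by (simp add: C.corrected_drift_def)
  show ?thesis by (rule C.local_invariance_in_chart[OF t d Y a z0[symmetric]])
qed

text \<open>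
  At the infimum of the times outside \<open>M\<close> the solution is still in \<open>M\<close>, since \<open>M\<close> is closed, and from there it stays
  in \<open>M\<close> for a positive time.
\<close>

theorem stays_forever_if_closed:
  assumes tan: "\<forall>y\<in>M. \<forall>v. blinfun_apply (f y) v \<in> tangent_space TYPE('m) M y"
    and drift: "\<forall>y\<in>M. f0 y - (1/2) *\<^sub>R blinfun_apply (F y) x \<in> tangent_space TYPE('m) M y"
    and Y: "davie_solution Y" and Y0: "Y 0 \<in> M" and closed: "closed M" and t: "t \<in> {0..T}"
  shows "Y t \<in> M"
proof (rule ccontr)
  assume tM: "Y t \<notin> M"
  obtain L where L: "0 \<le> L" and H: "\<And>s t. s \<in> {0..T} \<Longrightarrow> t \<in> {0..T} \<Longrightarrow> norm (Y t - Y s) \<le> L * \<bar>t - s\<bar> powr \<alpha>"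
    by (rule davie_solution_bounds[OF Y]) blast
  have cont: "continuous_on {0..T} Y" using H by (intro continuous_on_if_Holder[of _ 1 _ L]) auto
  define A where "A = {u \<in> {0..T}. Y u \<notin> M}"
  define \<sigma> where "\<sigma> = Inf A"
  have A: "t \<in> A" "bdd_below A" using t tM by (auto simp: A_def intro!: bdd_belowI[of _ 0])
  have \<sigma>: "0 \<le> \<sigma>" "\<sigma> \<le> t" unfolding \<sigma>_def using A by (auto intro!: cInf_greatest cInf_lower simp: A_def)
  have before: "Y u \<in> M" if "0 \<le> u" "u < \<sigma>" for u
  proof (rule ccontr)
    assume "Y u \<notin> M"
    then have "u \<in> A" using that \<sigma> t by (auto simp: A_def)
    then have "\<sigma> \<le> u" unfolding \<sigma>_def by (rule cInf_lower[OF _ A(2)])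
    then show False using that(2) by simp
  qed
  have \<sigma>M: "Y \<sigma> \<in> M"
  proof (cases "\<sigma> = 0")
    case False
    then have "0 < \<sigma>" using \<sigma> by simp
    then have "\<sigma> \<in> closure {0..<\<sigma>}" by simp
    moreover have "continuous_on (closure {0..<\<sigma>}) Y" using \<open>0 < \<sigma>\<close> \<sigma> t by (intro continuous_on_subset[OF cont]) auto
    moreover have "Y ` {0..<\<sigma>} \<subseteq> M" using before by auto
    ultimately show ?thesis using image_closure_subset[of "{0..<\<sigma>}" Y M] closed by blast
  qed (use Y0 in simp)
  obtain \<epsilon> where \<epsilon>: "0 < \<epsilon>" "\<forall>u. \<sigma> \<le> u \<longrightarrow> u \<le> \<sigma> + \<epsilon> \<longrightarrow> u \<le> T \<longrightarrow> Y u \<in> M"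
    using stays_for_a_while[OF tan drift Y \<sigma>(1) \<sigma>M] by blast
  have "\<sigma> + \<epsilon> \<le> Inf A"
  proof (rule cInf_greatest)
    fix u assume u: "u \<in> A"
    then have "\<sigma> \<le> u" unfolding \<sigma>_def by (intro cInf_lower A)
    moreover have "u \<le> T" "Y u \<notin> M" using u by (auto simp: A_def)
    ultimately show "\<sigma> + \<epsilon> \<le> u" using \<epsilon>(2) by force
  qed (use A in auto)
  then show False using \<epsilon>(1) by (simp add: \<sigma>_def)
qed

end

end

theorem theorem2p3:
  fixes tensor :: "'v::banach \<Rightarrow> 'v \<Rightarrow> 't::banach"
    and T \<alpha> :: real
    and X :: "real \<Rightarrow> 'v" and XX :: "real \<Rightarrow> real \<Rightarrow> 't"
    and f0 :: "'w::banach \<Rightarrow> 'w" and f :: "'w \<Rightarrow> 'v \<Rightarrow>\<^sub>L 'w"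
    and M :: "'w set" and x :: 't
  assumes tensor_product: "completed_tensor_product tensor"
    and canonical_injection: "has_canonical_injection tensor TYPE('w)"
    and T: "0 < T"
    and \<alpha>: "\<alpha> \<in> {1/3<..1/2}"
    and rough: "rough_path tensor \<alpha> T X XX"
    and f0: "\<exists>L. L-lipschitz_on UNIV f0"
    and f: "Cb3 f"
    and M: "C3_submanifold TYPE('m::finite) M"
    and truly_rough: "truly_rough \<alpha> T X"
    and x: "symmetric_tensor tensor x"
    and bracket: "\<forall>t\<in>{0..T}. rough_bracket tensor X XX 0 t = t *\<^sub>R x"
  shows "(locally_invariant tensor \<alpha> T X XX f0 f M \<longleftrightarrow>
            (\<forall>y\<in>M.
               f0 y - (1/2) *\<^sub>R blinfun_apply (tensor_lift tensor (Frechet_D f y o\<^sub>L f y)) x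
                 \<in> tangent_space TYPE('m) M y \<and>
               (\<forall>v. blinfun_apply (f y) v \<in> tangent_space TYPE('m) M y))) \<and>
         (locally_invariant tensor \<alpha> T X XX f0 f M \<and> closed M \<longrightarrow>
            globally_invariant tensor \<alpha> T X XX f0 f M)"
proof -
  obtain K f1 where rde: "rough_rde tensor \<alpha> T K X XX f0 f f1 (\<lambda>y. tensor_lift tensor (f1 y o\<^sub>L f y))"
    using rough_rde_if_rough_path[OF tensor_product canonical_injection T \<alpha> rough f0 f] by blast
  interpret rough_rde tensor \<alpha> T K X XX f0 f f1 "\<lambda>y. tensor_lift tensor (f1 y o\<^sub>L f y)" by (rule rde)
  have sym: "\<forall>s t. 0 \<le> s \<longrightarrow> s \<le> t \<longrightarrow> t \<le> T \<longrightarrow>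
      XX s t + tensor_flip tensor (XX s t) = tensor (X t - X s) (X t - X s) - (t - s) *\<^sub>R x"
    by (intro allI impI symmetric_part_from_bracket[OF rough bracket])
  let ?drift = "\<lambda>y. f0 y - (1/2) *\<^sub>R blinfun_apply (tensor_lift tensor (f1 y o\<^sub>L f y)) x"
  let ?ii = "\<forall>y\<in>M. ?drift y \<in> tangent_space TYPE('m) M y \<and> (\<forall>v. blinfun_apply (f y) v \<in> tangent_space TYPE('m) M y)"
  note stay = stays_for_a_while[OF canonical_injection sym M] and forever = stays_forever_if_closed[OF canonical_injection sym M]
  have uniq: "Y t = Z t" if "rde_solution tensor \<alpha> T X XX f0 f \<xi> Y Y'" "davie_solution Z" "Z 0 = \<xi>" "t \<in> {0..T}" for \<xi> Y Y' Z t
    using davie_solution_unique[of Y Z 0 t] davie_solution_if_rde_solution[OF that(1)] that by simp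
  have necessary: "?ii" if loc: "locally_invariant tensor \<alpha> T X XX f0 f M"
  proof -
    have inv: "invariant_near_start M"
      unfolding invariant_near_start_def
    proof
      fix \<xi> assume "\<xi> \<in> M"
      then obtain \<tau> Y Y' where "\<tau> \<in> {0<..T}" "rde_solution tensor \<alpha> T X XX f0 f \<xi> Y Y'" "\<forall>t\<in>{0..\<tau>}. Y t \<in> M"
        using loc unfolding locally_invariant_def by blast
      then show "\<exists>\<tau>\<in>{0<..T}. \<exists>Y. davie_solution Y \<and> Y 0 = \<xi> \<and> (\<forall>t\<in>{0..\<tau>}. Y t \<in> M)"
        using davie_solution_if_rde_solution by blast
    qed
    have tan: "blinfun_apply (f y) v \<in> tangent_space TYPE('m) M y" if "y \<in> M" for y v
      by (rule field_tangent_if_invariant[OF canonical_injection sym M inv truly_rough that])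
    then show ?thesis using drift_tangent_if_invariant[OF canonical_injection sym M inv] by blast
  qed
  have sufficient: "locally_invariant tensor \<alpha> T X XX f0 f M" if ii: ?ii
    unfolding locally_invariant_def
  proof
    fix \<xi> assume \<xi>: "\<xi> \<in> M"
    obtain Z where Z: "Z 0 = \<xi>" "davie_solution Z" by (rule davie_solution_exists)
    obtain \<epsilon> where \<epsilon>: "0 < \<epsilon>" "\<And>t. 0 \<le> t \<Longrightarrow> t \<le> 0 + \<epsilon> \<Longrightarrow> t \<le> T \<Longrightarrow> Z t \<in> M"
      using stay[of Z 0] ii Z \<xi> by auto
    have "Y t \<in> M" if "rde_solution tensor \<alpha> T X XX f0 f \<xi> Y Y'" "t \<in> {0..min \<epsilon> T}" for Y Y' t
      using uniq[OF that(1) Z(2,1)] \<epsilon>(2)[of t] that(2) by simp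
    then show "\<exists>T0\<in>{0<..T}. (\<exists>Y Y'. rde_solution tensor \<alpha> T X XX f0 f \<xi> Y Y') \<and>
        (\<forall>Y Y'. rde_solution tensor \<alpha> T X XX f0 f \<xi> Y Y' \<longrightarrow> (\<forall>t\<in>{0..T0}. Y t \<in> M))"
      using rde_solution_if_davie_solution[OF Z(2,1)] \<epsilon>(1) T by (intro bexI[of _ "min \<epsilon> T"]) auto
  qed
  have global: "globally_invariant tensor \<alpha> T X XX f0 f M" if ii: ?ii and cl: "closed M"
    unfolding globally_invariant_def
  proof
    fix \<xi> assume \<xi>: "\<xi> \<in> M"
    obtain Z where Z: "Z 0 = \<xi>" "davie_solution Z" by (rule davie_solution_exists)
    have "Y t \<in> M" if "rde_solution tensor \<alpha> T X XX f0 f \<xi> Y Y'" "t \<in> {0..T}" for Y Y' t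
      using davie_solution_if_rde_solution[OF that(1)] ii \<xi> cl that(2) by (intro forever[of Y t]) auto
    then show "(\<exists>Y Y'. rde_solution tensor \<alpha> T X XX f0 f \<xi> Y Y') \<and>
        (\<forall>Y Y'. rde_solution tensor \<alpha> T X XX f0 f \<xi> Y Y' \<longrightarrow> (\<forall>t\<in>{0..T}. Y t \<in> M))"
      using rde_solution_if_davie_solution[OF Z(2,1)] by blast
  qed
  show ?thesis
    unfolding Frechet_D_f using necessary sufficient global by blast
qed

end
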